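(* Let $m,n,q\in\mathbb{N}$ be such that $q$ is a prime power and $m\geq 3$. Let $\mathrm{Rad}(q^m-1)=kPL$, where $k$ is the product of the smallest prime divisors of $q^m-1$, $L=l_1l_2\cdots l_t$ is the product of the large prime divisors $l_1,\dots,l_t$ of $q^m-1$, and the remaining prime divisors $p_1,\dots,p_r$ of $q^m-1$ are those of $P$. Let $\mathrm{Rad}(x^m-1)=gGH$ in $\mathbb{F}_q[x]$, where $g$ is the product of the irreducible factors of $x^m-1$ of least degree, $h_1,\dots,h_u$ are the irreducible factors of $H$, being irreducible factors of $x^m-1$ of large degree, and the remaining irreducible factors $g_1,\dots,g_s$ of $x^m-1$ are those of $G$. Put $$\delta=1-2\sum_{i=1}^r\frac{1}{p_i}-\sum_{i=1}^s\frac{1}{q^{\deg(g_i)}},\qquad \epsilon_1=\sum_{i=1}^t\frac{1}{l_i},\qquad \epsilon_2=\sum_{i=1}^u\frac{1}{q^{\deg(h_i)}},$$ and suppose that $\delta\,\theta(k)^2\,\Theta(g)-(2\epsilon_1+\epsilon_2)>0$. If $$q^{\frac{m}{2}-1}>\frac{(n+2)\Big[\theta(k)^2\Theta(g)W(k)^2W(g)(2r+s-1+2\delta)+(t-\epsilon_1)+\frac{2}{n+2}(u-\epsilon_2)+\frac{n}{n+2}\cdot\frac{1}{q^{m/2}}(t+u-\epsilon_1-\epsilon_2)\Big]}{\delta\,\theta(k)^2\,\Theta(g)-(2\epsilon_1+\epsilon_2)},$$ then $(q,m)\in T_n$.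
   Context: $\mathbb{F}_q$ is the finite field of order $q$ and $\mathbb{F}_{q^m}$ its extension of degree $m$. An element of $\mathbb{F}_{q^m}$ is primitive if it generates the cyclic group $\mathbb{F}_{q^m}^*$. For a rational function $f\in\mathbb{F}_{q^m}(x)$ and $\alpha\in\mathbb{F}_{q^m}$, $(\alpha,f(\alpha))$ is a primitive pair in $\mathbb{F}_{q^m}$ if both $\alpha$ and $f(\alpha)$ are primitive elements of $\mathbb{F}_{q^m}$. An element $\alpha\in\mathbb{F}_{q^m}$ is normal over $\mathbb{F}_q$ if $\{\alpha,\alpha^q,\dots,\alpha^{q^{m-1}}\}$ is a basis of $\mathbb{F}_{q^m}$ over $\mathbb{F}_q$. $\mathrm{Tr}_{\mathbb{F}_{q^m}/\mathbb{F}_q}(\alpha)=\alpha+\alpha^q+\cdots+\alpha^{q^{m-1}}$. Rational functions are written $f=f_1/f_2$ with $f_1,f_2\in\mathbb{F}_{q^m}[x]$ coprime nonzero polynomials and $f_2$ monic. A rational function $f\in\mathbb{F}_{q^m}(x)$ is exceptional if $f=cx^ig^d$ for some $c\in\mathbb{F}_{q^m}$, $i\in\mathbb{Z}$, $g\in\mathbb{F}_{q^m}(x)$ and some integer $d>1$ dividing $q^m-1$, or if $f(x)=x^i$ for some $i\in\mathbb{Z}$ with $\gcd(q^m-1,i)\neq 1$. For non-negative integers $n_1,n_2$, $S_{q,m}(n_1,n_2)$ is the set of non-exceptional rational functions $f=f_1/f_2\in\mathbb{F}_{q^m}(x)$ with $\deg f_1\leq n_1$ and $\deg f_2\leq n_2$.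 $T_{n_1,n_2}$ is the set of pairs $(q,m)\in\mathbb{N}\times\mathbb{N}$ ($q$ a prime power) such that for every $f\in S_{q,m}(n_1,n_2)$ and every $a\in\mathbb{F}_q$ there is an element $\alpha\in\mathbb{F}_{q^m}$, normal over $\mathbb{F}_q$, such that $(\alpha,f(\alpha))$ is a primitive pair in $\mathbb{F}_{q^m}$ and $\mathrm{Tr}_{\mathbb{F}_{q^m}/\mathbb{F}_q}(\alpha^{-1})=a$. $T_n=\bigcap_{n_1+n_2=n}T_{n_1,n_2}$. $\mathrm{Rad}$ of a positive integer is the product of its distinct prime divisors; $\mathrm{Rad}$ of a polynomial in $\mathbb{F}_q[x]$ is the product of its distinct monic irreducible factors. Each of $k,P,L,g,G,H$ may be $1$ (an empty product). For a positive integer $k$, $W(k)=2^{\omega(k)}$ is the number of square-free divisors of $k$, where $\omega(k)$ is the number of distinct prime divisors of $k$, and $\theta(k)=\phi(k)/k$ with $\phi$ the Euler function. For a nonzero polynomial $g\in\mathbb{F}_q[x]$, $W(g)=2^{\Omega_q(g)}$ is the number of monic square-free divisors of $g$, where $\Omega_q(g)$ is the number of distinct monic irreducible divisors of $g$ over $\mathbb{F}_q$, and $\Theta(g)=\Phi_q(g)/q^{\deg g}$, where $\Phi_q(g)=|(\mathbb{F}_q[x]/(g))^*|$ is the analogue of Euler's function on $\mathbb{F}_q[x]$. *)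

theory Defs
  imports
    "HOL-Library.Cardinality"
    "HOL-Computational_Algebra.Computational_Algebra"
    "HOL-Number_Theory.Totient"
    "HOL-Number_Theory.Prime_Powers"
begin

text \<open>
  The extension field of order \<open>q ^ m\<close> is a type \<open>'k :: finite_field\<close> with \<open>CARD('k) = q ^ m\<close>.
  Inside it, the field of order \<open>q\<close> is its unique subfield with \<open>q\<close> elements, the set of
  roots of \<open>x ^ q - x\<close>. The rational functions over \<open>'k\<close> are the elements of
  \<open>'k poly fract\<close>.
\<close>

definition base_field :: "nat \<Rightarrow> 'k::finite_field set" where
  "base_field q = {x. x ^ q = x}"

definition primitive_element :: "'k::finite_field \<Rightarrow> bool" where
  "primitive_element \<alpha> \<longleftrightarrow> \<alpha> \<noteq> 0 \<and> (\<forall>x. x \<noteq> 0 \<longrightarrow> (\<exists>i::int. x = \<alpha> powi i))"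

text \<open>
  The family of conjugates is a basis over \<open>base_field q\<close>: linearly independent and spanning.
\<close>

definition normal_element :: "nat \<Rightarrow> nat \<Rightarrow> 'k::finite_field \<Rightarrow> bool" where
  "normal_element q m \<alpha> \<longleftrightarrow>
     (\<forall>c. (\<forall>i<m. c i \<in> base_field q) \<and> (\<Sum>i<m. c i * \<alpha> ^ (q ^ i)) = 0 \<longrightarrow> (\<forall>i<m. c i = 0)) \<and>
     (\<forall>x. \<exists>c. (\<forall>i<m. c i \<in> base_field q) \<and> x = (\<Sum>i<m. c i * \<alpha> ^ (q ^ i)))"

definition field_trace :: "nat \<Rightarrow> nat \<Rightarrow> 'k::finite_field \<Rightarrow> 'k" where
  "field_trace q m \<alpha> = (\<Sum>i<m. \<alpha> ^ (q ^ i))"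

definition reduced_form :: "'k::field poly fract \<Rightarrow> 'k poly \<Rightarrow> 'k poly \<Rightarrow> bool" where
  "reduced_form f f1 f2 \<longleftrightarrow>
     f = Fract f1 f2 \<and> coprime f1 f2 \<and> f1 \<noteq> 0 \<and> f2 \<noteq> 0 \<and> lead_coeff f2 = 1"

text \<open>In particular \<open>f\<close> is required to be defined at \<open>\<alpha>\<close>, i.e. \<open>\<alpha>\<close> is not a pole of \<open>f\<close>.\<close>

definition primitive_pair :: "'k::finite_field \<Rightarrow> 'k poly fract \<Rightarrow> bool" where
  "primitive_pair \<alpha> f \<longleftrightarrow> primitive_element \<alpha> \<and>
     (\<exists>f1 f2. reduced_form f f1 f2 \<and> poly f2 \<alpha> \<noteq> 0 \<and> primitive_element (poly f1 \<alpha> / poly f2 \<alpha>))"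

abbreviation ratfun_const :: "'k::field \<Rightarrow> 'k poly fract" where
  "ratfun_const c \<equiv> to_fract [:c:]"

abbreviation ratfun_x :: "'k::field poly fract" where
  "ratfun_x \<equiv> to_fract [:0, 1:]"

definition exceptional :: "'k::finite_field poly fract \<Rightarrow> bool" where
  "exceptional f \<longleftrightarrow>
     (\<exists>(c::'k) (i::int) (g::'k poly fract) (d::nat).
        d > 1 \<and> d dvd CARD('k) - 1 \<and> f = ratfun_const c * ratfun_x powi i * g ^ d) \<or>
     (\<exists>i::int. gcd (int (CARD('k) - 1)) i \<noteq> 1 \<and> f = ratfun_x powi i)"

definition S_set :: "nat \<Rightarrow> nat \<Rightarrow> 'k::finite_field poly fract set" where
  "S_set n1 n2 = {f. \<not> exceptional f \<and>
     (\<exists>f1 f2. reduced_form f f1 f2 \<and> degree f1 \<le> n1 \<and> degree f2 \<le> n2)}"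

text \<open>
  A set cannot quantify over types, so the field of order \<open>q ^ m\<close> is passed as a type argument:
  \<open>T_pair TYPE('k) n1 n2\<close> is the set of those \<open>(q, m)\<close> with \<open>CARD('k) = q ^ m\<close> which have the
  required property. The property depends on the field only up to isomorphism, hence
  only on \<open>(q, m)\<close>.
\<close>

definition T_pair :: "'k::finite_field itself \<Rightarrow> nat \<Rightarrow> nat \<Rightarrow> (nat \<times> nat) set" where
  "T_pair _ n1 n2 = {(q, m). primepow q \<and> CARD('k) = q ^ m \<and>
     (\<forall>f \<in> (S_set n1 n2 :: 'k poly fract set). \<forall>a \<in> (base_field q :: 'k set).
        \<exists>\<alpha>::'k. normal_element q m \<alpha> \<and> primitive_pair \<alpha> f \<and> field_trace q m (inverse \<alpha>) = a)}"

definition T_total :: "'k::finite_field itself \<Rightarrow> nat \<Rightarrow> (nat \<times> nat) set" where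
  "T_total K n = (\<Inter>(n1, n2) \<in> {(n1, n2). n1 + n2 = n}. T_pair K n1 n2)"

definition nat_rad :: "nat \<Rightarrow> nat" where
  "nat_rad N = \<Prod>(prime_factors N)"

definition W_nat :: "nat \<Rightarrow> nat" where
  "W_nat k = 2 ^ card (prime_factors k)"

definition theta_nat :: "nat \<Rightarrow> real" where
  "theta_nat k = real (totient k) / real k"

definition monic_irreducible_factors :: "'f::field poly \<Rightarrow> 'f poly set" where
  "monic_irreducible_factors p = {h. irreducible h \<and> lead_coeff h = 1 \<and> h dvd p}"

definition poly_rad :: "'f::field poly \<Rightarrow> 'f poly" where
  "poly_rad p = \<Prod>(monic_irreducible_factors p)"

definition W_poly :: "'f::field poly \<Rightarrow> nat" where
  "W_poly p = 2 ^ card (monic_irreducible_factors p)"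

text \<open>
  The elements of the residue ring modulo \<open>p\<close> are represented by the reduced
  polynomials \<open>a mod p\<close>. For \<open>p = 1\<close> this is the zero ring, whose single element is a unit.
\<close>

definition Phi_poly :: "'f::finite_field poly \<Rightarrow> nat" where
  "Phi_poly p = card {a. a mod p = a \<and> (\<exists>b. (a * b) mod p = 1 mod p)}"

definition Theta_poly :: "'f::finite_field poly \<Rightarrow> real" where
  "Theta_poly p = real (Phi_poly p) / real (CARD('f) ^ degree p)"

end

theory Submission
  imports
    "HOL-Algebra.Algebraic_Closure_Type"
    "HOL-Algebra.Multiplicative_Group"
    Defs
begin

text \<open>The indicator functions of "\<open>\<alpha>\<close> is not an \<open>l\<close>-th power" (\<open>l\<close> a prime divisor of \<open>q ^ m - 1\<close>), of the
  same condition for \<open>f(\<alpha>)\<close>, of "\<open>\<alpha>\<close> is not annihilated by \<open>(x ^ m - 1) / h\<close>" (\<open>h\<close> an irreducible factor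
  of \<open>x ^ m - 1\<close>) and of the trace condition are expanded into characters. Every nontrivial
  product of these characters gives a sum \<open>\<Sum> \<chi>(F(\<alpha>)) \<psi>(y \<alpha> + z / \<alpha>)\<close>, which the Weil bound controls
  because \<open>f\<close> is not exceptional. A Bonferroni type inequality treats the conditions from \<open>P\<close> and
  \<open>G\<close> one at a time on top of those from \<open>k\<close> and \<open>g\<close>, and those from \<open>L\<close> and \<open>H\<close> one at a time on
  top of the trace condition alone.

  The Weil bound is obtained by Stepanov's method. Let \<open>Y ^ d = F(x)\<close> and \<open>w ^ p - w = y x + z / x\<close>. A
  nonzero combination of the monomials \<open>Y ^ b w ^ c\<close> and of their \<open>Q\<close>-th powers, whose coefficients are
  polynomials of bounded degree, can be made to vanish to order \<open>Q\<close> (up to a constant) at every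
  point with prescribed character values; hence each value is taken about equally often on the
  field with \<open>Q ^ 2\<close> elements. So the reciprocal roots of the \<open>L\<close>-function, a polynomial, have absolute
  value at most the square root of the order of the field.\<close>

text \<open>Stepanov's argument gives only upper bounds, and only over fields of square order. Both
  defects are repaired formally: the classes of points with prescribed character values exhaust the
  field up to boundedly many points, so upper bounds for all classes yield a lower bound for each;
  and the even power sums alone already bound the reciprocal roots. What the method really needs is
  that the monomials \<open>Y ^ b * w ^ c\<close> are independent over the rational functions. A
  dependence, compared with its own Frobenius power, would give all multiplicities of
  \<open>F\<close> a common factor with \<open>d\<close>, or make \<open>y x + z / x\<close>
  cohomologous to zero for the Artin-Schreier map. Points are handled as power series, so that the
  generic point and the points over a finite field satisfy the same identities with the same
  coefficients. In the sieve, the conditions from \<open>L\<close> and \<open>H\<close> are never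
  combined with those from \<open>k\<close> and \<open>g\<close>. Their errors therefore carry no
  factor \<open>W\<close>, at the price that their main term
  \<open>2 * \<epsilon>\<^sub>1 + \<epsilon>\<^sub>2\<close> is not damped by the densities
  belonging to \<open>k\<close> and \<open>g\<close>.\<close>

lemma homogeneous_system_nontrivial_solution:
  fixes A :: "'e \<Rightarrow> 'u \<Rightarrow> 'a::field"
  assumes "finite E" "finite U" "card E < card U"
  shows "\<exists>x. (\<exists>u\<in>U. x u \<noteq> 0) \<and> (\<forall>e\<in>E. (\<Sum>u\<in>U. A e u * x u) = 0)"
  using assms
proof (induction E arbitrary: U A rule: finite_induct)
  case empty
  then obtain u where "u \<in> U" by (metis card_gt_0_iff card.empty ex_in_conv)
  then show ?case by (intro exI[of _ "\<lambda>_. 1"]) auto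
next
  case (insert e E)
  show ?case
  proof (cases "\<forall>u\<in>U. A e u = 0")
    case True
    from insert.IH[of U A] insert.prems insert.hyps obtain x
      where "\<exists>u\<in>U. x u \<noteq> 0" "\<forall>e\<in>E. (\<Sum>u\<in>U. A e u * x u) = 0" by auto
    with True show ?thesis by (intro exI[of _ x]) auto
  next
    case False
    then obtain v where v: "v \<in> U" "A e v \<noteq> 0" by blast
    define U' where "U' = U - {v}"
    \<comment> \<open>\<open>B\<close> is the system left after eliminating the unknown
      \<open>v\<close> by equation \<open>e\<close>; \<open>y\<close> recovers the value of
      \<open>v\<close> by back substitution.\<close>
    define B where "B = (\<lambda>e' u. A e' u - A e' v * A e u / A e v)"
    have "card E < card U'"
      using insert v by (simp add: U'_def)
    then obtain x where x: "\<exists>u\<in>U'. x u \<noteq> 0" "\<forall>e\<in>E. (\<Sum>u\<in>U'. B e u * x u) = 0"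
      using insert.IH[of U' B] insert.prems by (auto simp: U'_def)
    define y where "y = (\<lambda>u. if u = v then - (\<Sum>u\<in>U'. A e u * x u) / A e v else x u)"
    have yU: "(\<Sum>u\<in>U. A e' u * y u) = A e' v * y v + (\<Sum>u\<in>U'. A e' u * x u)" for e'
    proof -
      have "(\<Sum>u\<in>U. A e' u * y u) = A e' v * y v + (\<Sum>u\<in>U'. A e' u * y u)"
        using v insert.prems by (simp add: U'_def sum.remove)
      also have "(\<Sum>u\<in>U'. A e' u * y u) = (\<Sum>u\<in>U'. A e' u * x u)"
        by (intro sum.cong) (auto simp: U'_def y_def)
      finally show ?thesis .
    qed
    have "(\<Sum>u\<in>U. A e' u * y u) = 0" if "e' \<in> insert e E" for e'
    proof (cases "e' = e")
      case True
      then show ?thesis using v by (simp add: yU) (simp add: y_def)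
    next
      case False
      with that have "(\<Sum>u\<in>U'. B e' u * x u) = 0" using x by auto
      also have "(\<Sum>u\<in>U'. B e' u * x u) = (\<Sum>u\<in>U'. A e' u * x u) - (\<Sum>u\<in>U'. A e' v / A e v * (A e u * x u))"
        by (simp add: B_def algebra_simps sum_subtractf)
      also have "(\<Sum>u\<in>U'. A e' v / A e v * (A e u * x u)) = - (A e' v * y v)"
        by (simp add: y_def sum_distrib_left sum_divide_distrib mult.assoc)
      finally show ?thesis unfolding yU by (simp add: algebra_simps)
    qed
    moreover have "\<exists>u\<in>U. y u \<noteq> 0" using x by (auto simp: U'_def y_def)
    ultimately show ?thesis by blast
  qed
qed

section \<open>Frobenius powers of formal power series\<close>

text \<open>In prime characteristic a power of Frobenius acts monomial by monomial on a finite sum.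
  The remaining part of the series has order above \<open>n\<close>, and so has its
  \<open>m\<close>-th power, so it does not reach the index \<open>n\<close>.\<close>

lemma fps_nth_power_char:
  fixes f :: "'a::{comm_ring_1} fps"
  assumes p: "prime CHAR('a)" and m: "m = CHAR('a) ^ s"
  shows "fps_nth (f ^ m) n = (if m dvd n then fps_nth f (n div m) ^ m else 0)"
proof -
  have mpos: "m > 0" using p m prime_gt_0_nat by simp
  have ch: "prime CHAR('a fps)" "m = CHAR('a fps) ^ s" using assms by simp_all
  define g where "g = (\<Sum>i\<le>n. fps_const (fps_nth f i) * fps_X ^ i)"
  have g_nth: "fps_nth g i = (if i \<le> n then fps_nth f i else 0)" for i
    by (simp add: g_def fps_sum_nth fps_X_power_nth if_distrib cong: if_cong)
  define h where "h = f - g"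
  have h0: "fps_nth h i = 0" if "i \<le> n" for i
    using that by (simp add: h_def g_nth)
  have fg: "f = g + h" by (simp add: h_def)
  have "f ^ m = g ^ m + h ^ m" unfolding fg by (rule freshmans_dream'[OF ch])
  moreover have "fps_nth (h ^ m) n = 0"
  proof (cases "h = 0")
    case True then show ?thesis using mpos by (simp add: zero_power)
  next
    case False
    then have "subdegree h > n" using h0 by (metis not_less nth_subdegree_nonzero)
    with mpos have "n < m * subdegree h"
      by (metis One_nat_def Suc_leI less_le_trans mult_le_mono1 nat_mult_1)
    then show ?thesis by (rule fps_pow_nth_below_subdegree)
  qed
  ultimately have "fps_nth (f ^ m) n = fps_nth (g ^ m) n" by simp
  also have "g ^ m = (\<Sum>i\<le>n. (fps_const (fps_nth f i) * fps_X ^ i) ^ m)"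
    unfolding g_def by (rule freshmans_dream_sum'[OF ch])
  also have "\<dots> = (\<Sum>i\<le>n. fps_const (fps_nth f i ^ m) * fps_X ^ (i * m))"
    by (simp add: power_mult_distrib power_mult fps_const_power)
  also have "fps_nth \<dots> n = (\<Sum>i\<le>n. if n = i * m then fps_nth f i ^ m else 0)"
    by (auto simp: fps_sum_nth fps_X_power_nth intro!: sum.cong)
  also have "\<dots> = (\<Sum>i\<in>(if m dvd n then {n div m} else {}). fps_nth f i ^ m)"
    using mpos by (intro sum.mono_neutral_cong_right) (auto split: if_splits)
  finally show ?thesis by (simp split: if_splits)
qed

text \<open>The equation is contracting for the Frobenius power: the \<open>n\<close>-th coefficient of \<open>y ^ m\<close>
  only involves the coefficient of \<open>y\<close> at \<open>n div m\<close>.\<close>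

lemma fps_frobenius_equation_solvable:
  fixes c b :: "'a::{comm_ring_1} fps"
  assumes p: "prime CHAR('a)" and m: "m = CHAR('a) ^ s" "s > 0"
    and y0: "y0 = fps_nth c 0 * y0 ^ m + fps_nth b 0"
  obtains y where "fps_nth y 0 = y0" "y = c * y ^ m + b"
proof -
  have m1: "m > 1" using p m by (metis one_less_power prime_gt_1_nat)
  \<comment> \<open>At index 0 the equation is not contracting; there the prescribed root
    \<open>y0\<close> is used, and the equation reduces to the hypothesis on
    \<open>y0\<close>.\<close>
  define h where "h = (\<lambda>u n. if n = 0 then y0 else
     (\<Sum>i\<le>n. fps_nth c (n - i) * (if m dvd i then u (i div m) ^ m else 0)) + fps_nth b n)"
  define H where "H = wfrec (measure id) h"
  have "adm_wf (measure id) h"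
    unfolding adm_wf_def
  proof (intro allI impI)
    fix f g :: "nat \<Rightarrow> 'a" and x :: nat
    assume *: "\<forall>z. (z, x) \<in> measure id \<longrightarrow> f z = g z"
    have "f (i div m) = g (i div m)" if "i \<le> x" "x > 0" for i
    proof -
      have "i div m < x" using that m1
        by (metis div_le_mono div_less_dividend le_trans linorder_not_less order_le_less)
      with * show ?thesis by simp
    qed
    then show "h f x = h g x" by (auto simp: h_def intro!: sum.cong)
  qed
  then have H: "H n = h H n" for n
    unfolding H_def using wfrec_fixpoint[OF wf_measure] by metis
  define y where "y = Abs_fps H"
  have y_nth: "H i = fps_nth y i" for i by (simp add: y_def)
  have y0': "fps_nth y 0 = y0" by (simp add: H[of 0] h_def flip: y_nth)
  have "fps_nth y n = fps_nth (c * y ^ m + b) n" for n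
  proof (cases "n = 0")
    case True
    then show ?thesis using y0' y0 by (simp add: fps_nth_power_0)
  next
    case False
    then have "fps_nth y n = (\<Sum>i\<le>n. fps_nth c (n - i) * fps_nth (y ^ m) i) + fps_nth b n"
      unfolding fps_nth_power_char[OF p m(1)] using H[of n] by (simp add: h_def y_nth cong: if_cong)
    also have "(\<Sum>i\<le>n. fps_nth c (n - i) * fps_nth (y ^ m) i) = fps_nth (c * y ^ m) n"
      unfolding mult.commute[of c] fps_mult_nth by (simp add: mult.commute atMost_atLeast0)
    finally show ?thesis by simp
  qed
  then have "y = c * y ^ m + b" by (rule fps_ext)
  with y0' show ?thesis by (rule that)
qed

text \<open>A linear factor occurring twice would also make the derivative vanish at its root; hence
  the multiset of roots is a set.\<close>

lemma card_roots_eq_degree: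
  fixes P :: "'a::alg_closed_field poly"
  assumes "P \<noteq> 0" and sep: "\<And>x. poly P x = 0 \<Longrightarrow> poly (pderiv P) x \<noteq> 0"
  shows "card {x. poly P x = 0} = degree P"
proof -
  obtain A where A: "size A = degree P" "P = smult (lead_coeff P) (\<Prod>x\<in>#A. [:-x, 1:])"
    using alg_closed_imp_factorization[OF assms(1)] by blast
  have roots: "{x. poly P x = 0} = set_mset A"
    using assms(1) by (subst A(2)) (auto simp: poly_prod_mset prod_mset_zero_iff)
  have "count A x \<le> 1" for x
  proof (rule ccontr)
    assume "\<not> count A x \<le> 1"
    then have "count A x \<ge> 2" by simp
    then have "{#x, x#} \<subseteq># A"
      by (simp add: subseteq_mset_def)
    then obtain B where B: "A = {#x, x#} + B" by (metis subset_mset.add_diff_inverse)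
    have "[:-x,1:]\<^sup>2 dvd P"
      by (subst A(2)) (simp add: B power2_eq_square dvd_smult mult.assoc [symmetric] del: mult_pCons_left mult_pCons_right)
    then obtain R where R: "P = [:-x,1:]\<^sup>2 * R" by (elim dvdE)
    have "P = [:-x,1:] * ([:-x,1:] * R)" unfolding R power2_eq_square mult.assoc ..
    then have "poly P x = 0" "poly (pderiv P) x = 0"
      by (simp_all add: pderiv_mult del: mult_pCons_left)
    with sep show False by blast
  qed
  then have "A = mset_set (set_mset A)"
    by (intro multiset_eqI) (metis count_greater_zero_iff count_mset_set(1) count_mset_set(3)
        finite_set_mset le_neq_implies_less less_one not_gr_zero)
  then have "size A = card (set_mset A)" by (metis size_mset_set)
  with A roots show ?thesis by simp
qed

section \<open>Ring homomorphisms and evaluation of polynomials at power series\<close>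

text \<open>Several maps are used side by side: constants into power series, a field into its
  algebraic closure, Frobenius, integers into a field, and the embedding of the small field into the
  large one. Each acts on coefficients compatibly with evaluation of polynomials.\<close>

locale comm_ring_morphism =
  fixes h :: "'a::comm_ring_1 \<Rightarrow> 'b::comm_ring_1"
  assumes hom_one: "h 1 = 1"
    and hom_add: "h (a + b) = h a + h b"
    and hom_mult: "h (a * b) = h a * h b"
begin

lemma hom_zero: "h 0 = 0"
  using hom_add[of 0 0] by simp

lemma hom_uminus: "h (- a) = - h a"
  using hom_add[of a "- a"] by (simp add: hom_zero eq_neg_iff_add_eq_0 add.commute)

lemma hom_diff: "h (a - b) = h a - h b"
  using hom_add[of a "- b"] by (simp add: hom_uminus)

lemmas hom_simps = hom_one hom_zero hom_add hom_mult hom_uminus hom_diff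

lemma hom_power: "h (a ^ n) = h a ^ n"
  by (induction n) (auto simp: hom_simps)

lemma hom_sum: "h (sum f A) = (\<Sum>x\<in>A. h (f x))"
  by (induction A rule: infinite_finite_induct) (auto simp: hom_simps)

lemma map_poly_hom_add: "map_poly h (p + q) = map_poly h p + map_poly h q"
  by (rule poly_eqI) (simp add: coeff_map_poly hom_simps)

lemma map_poly_hom_diff: "map_poly h (p - q) = map_poly h p - map_poly h q"
  by (rule poly_eqI) (simp add: coeff_map_poly hom_simps)

lemma map_poly_hom_mult: "map_poly h (p * q) = map_poly h p * map_poly h q"
  by (rule poly_eqI) (simp add: coeff_map_poly coeff_mult hom_simps hom_sum)

lemma map_poly_hom_power: "map_poly h (p ^ n) = map_poly h p ^ n"
  by (induction n) (auto simp: map_poly_hom_mult hom_simps)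

lemma map_poly_hom_prod: "map_poly h (prod f A) = (\<Prod>x\<in>A. map_poly h (f x))"
  by (induction A rule: infinite_finite_induct) (auto simp: map_poly_hom_mult hom_simps)

lemma poly_map_poly_hom: "poly (map_poly h p) (h x) = h (poly p x)"
  by (induction p) (auto simp: map_poly_pCons hom_simps)

end

interpretation fps_const_hom: comm_ring_morphism "fps_const :: 'a::comm_ring_1 \<Rightarrow> 'a fps"
  by standard auto

interpretation to_ac_hom: comm_ring_morphism "to_ac :: 'a::field \<Rightarrow> 'a alg_closure"
  by standard auto

text \<open>The argument is either a constant series, an ordinary point, or
  \<open>fps_const a + fps_X\<close>, a generic point near \<open>a\<close> at which no nonzero
  polynomial vanishes.\<close>

definition fps_eval :: "'a::comm_ring_1 poly \<Rightarrow> 'a fps \<Rightarrow> 'a fps" where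
  "fps_eval P x = poly (map_poly fps_const P) x"

lemma fps_eval_0 [simp]: "fps_eval 0 x = 0"
  and fps_eval_1 [simp]: "fps_eval 1 x = 1"
  and fps_eval_add [simp]: "fps_eval (P + R) x = fps_eval P x + fps_eval R x"
  and fps_eval_diff [simp]: "fps_eval (P - R) x = fps_eval P x - fps_eval R x"
  and fps_eval_mult [simp]: "fps_eval (P * R) x = fps_eval P x * fps_eval R x"
  and fps_eval_power [simp]: "fps_eval (P ^ n) x = fps_eval P x ^ n"
  and fps_eval_const [simp]: "fps_eval [:c:] x = fps_const c"
  and fps_eval_monom [simp]: "fps_eval (monom c n) x = fps_const c * x ^ n"
  and fps_eval_smult [simp]: "fps_eval (smult c P) x = fps_const c * fps_eval P x"
  and fps_eval_pCons: "fps_eval (pCons c P) x = fps_const c + x * fps_eval P x"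
  by (simp_all add: fps_eval_def fps_const_hom.map_poly_hom_add fps_const_hom.map_poly_hom_diff
      fps_const_hom.map_poly_hom_mult fps_const_hom.map_poly_hom_power map_poly_pCons map_poly_monom
      poly_monom map_poly_smult fps_const_mult)

lemma fps_eval_sum: "fps_eval (sum f A) x = (\<Sum>i\<in>A. fps_eval (f i) x)"
  by (induction A rule: infinite_finite_induct) auto

lemma fps_eval_fps_const [simp]: "fps_eval P (fps_const a) = fps_const (poly P a)"
  by (simp add: fps_eval_def fps_const_hom.poly_map_poly_hom)

lemma fps_eval_nth_0 [simp]: "fps_nth (fps_eval P x) 0 = poly P (fps_nth x 0)"
  by (induction P) (auto simp: fps_eval_pCons)

lemma fps_eval_shift_eq: "fps_eval P (fps_const a + fps_X) = fps_of_poly (pcompose P [:a, 1:])"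
  by (induction P)
     (auto simp: fps_eval_pCons pcompose_pCons fps_of_poly_add fps_of_poly_mult fps_of_poly_pCons
        algebra_simps)

lemma fps_eval_shift_eq_0_iff [simp]:
  fixes P :: "'a::idom poly"
  shows "fps_eval P (fps_const a + fps_X) = 0 \<longleftrightarrow> P = 0"
proof -
  have "pcompose P [:a, 1:] = 0 \<longleftrightarrow> P = 0"
    by (metis One_nat_def degree_pCons_eq_if one_neq_zero pCons_eq_0_iff pcompose_0 pcompose_eq_0 zero_less_one)
  then show ?thesis by (simp add: fps_eval_shift_eq)
qed

lemma subdegree_fps_eval_shift_le:
  fixes P :: "'a::idom poly"
  assumes "P \<noteq> 0"
  shows "subdegree (fps_eval P (fps_const a + fps_X)) \<le> degree P"
proof -
  have "pcompose P [:a, 1:] \<noteq> 0"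
    using assms fps_eval_shift_eq_0_iff[of P a] by (auto simp: fps_eval_shift_eq)
  moreover have "degree (pcompose P [:a, 1:]) = degree P"
    by (simp add: degree_pcompose)
  ultimately show ?thesis
    unfolding fps_eval_shift_eq by (intro subdegree_leI) (metis fps_of_poly_nth leading_coeff_neq_0)
qed

subsection \<open>Stepanov's method\<close>

text \<open>\<open>K\<close> stands for the rational functions. The \<open>N\<close>-th power of a
  relation is again one over \<open>K\<close> in the same monomials, because \<open>y ^ N\<close> is
  a \<open>K\<close>-multiple of \<open>y\<close> and \<open>w ^ N - w\<close> lies in
  \<open>K\<close>. Subtracting a multiple of the original relation kills a top coefficient;
  induction makes the two relations proportional, and comparing coefficients solves the excluded
  Kummer or Artin-Schreier equation in \<open>K\<close>. The bound on \<open>e\<close> keeps the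
  exponents of \<open>w\<close> invertible.\<close>

lemma kummer_artin_schreier_independent:
  fixes K :: "'a::field set" and y w \<gamma> A :: 'a and h :: "nat \<Rightarrow> nat \<Rightarrow> 'a"
  assumes char: "prime CHAR('a)" and N: "N = CHAR('a) ^ s"
    and K_one: "1 \<in> K" and K_add: "\<And>u v. u \<in> K \<Longrightarrow> v \<in> K \<Longrightarrow> u + v \<in> K"
    and K_uminus: "\<And>u. u \<in> K \<Longrightarrow> - u \<in> K"
    and K_mult: "\<And>u v. u \<in> K \<Longrightarrow> v \<in> K \<Longrightarrow> u * v \<in> K"
    and K_inverse: "\<And>u. u \<in> K \<Longrightarrow> inverse u \<in> K"
    and y: "y \<noteq> 0" "y ^ N = y * A" "A \<in> K"
    and w: "w ^ N = w + \<gamma>" "\<gamma> \<in> K"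
    and kummer: "\<And>b v. 0 < b \<Longrightarrow> b < d \<Longrightarrow> v \<in> K \<Longrightarrow> v \<noteq> 0 \<Longrightarrow> v ^ N * A ^ b \<noteq> v"
    and artin_schreier: "\<And>v. v \<in> K \<Longrightarrow> v ^ N - v \<noteq> \<gamma>"
    and e: "e \<le> CHAR('a)" and h: "\<And>b c. b < d \<Longrightarrow> c < e \<Longrightarrow> h b c \<in> K"
    and rel: "(\<Sum>b<d. \<Sum>c<e. h b c * y ^ b * w ^ c) = 0"
  shows "\<forall>b<d. \<forall>c<e. h b c = 0"
  using e h rel
proof (induction e arbitrary: h)
  case (Suc e)
  have K_zero: "0 \<in> K" using K_add[OF K_one K_uminus[OF K_one]] by simp
  have K_pow: "u ^ n \<in> K" if "u \<in> K" for u n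
    using that by (induction n) (auto intro: K_one K_mult)
  have K_of_nat: "of_nat n \<in> K" for n
    by (induction n) (auto intro: K_zero K_one K_add)
  have K_sum: "sum f Z \<in> K" if "\<And>x. x \<in> Z \<Longrightarrow> f x \<in> K" for f :: "nat \<Rightarrow> 'a" and Z
    using that by (induction Z rule: infinite_finite_induct) (auto intro: K_zero K_add)
  have A0: "A \<noteq> 0" using y by auto
  have Npos: "N > 0" using char N prime_gt_0_nat by simp
  note dream = freshmans_dream'[OF char N] freshmans_dream_sum'[OF char N]
  have inner: "\<forall>b<d. \<forall>c<Suc e. h b c = 0"
    if "\<And>b c. b < d \<Longrightarrow> c < Suc e \<Longrightarrow> h b c \<in> K"
      "(\<Sum>b<d. \<Sum>c<Suc e. h b c * y ^ b * w ^ c) = 0" for h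
    using that
  \<comment> \<open>The outer induction is on the degree in \<open>w\<close>; this inner one is on
    the number of nonzero coefficients belonging to the top power \<open>w ^ e\<close>.\<close>
  proof (induction "card {b. b < d \<and> h b e \<noteq> 0}" arbitrary: h rule: less_induct)
    case less
    note hK = less.prems(1) and rel = less.prems(2)
    define B where "B = {b. b < d \<and> h b e \<noteq> 0}"
    show ?case
    proof (cases "B = {}")
      case True
      then have top: "h b e = 0" if "b < d" for b using that by (auto simp: B_def)
      have "(\<Sum>b<d. \<Sum>c<e. h b c * y ^ b * w ^ c) = 0"
        using rel top by simp
      with Suc.IH[of h] Suc.prems(1) hK have "\<forall>b<d. \<forall>c<e. h b c = 0" by simp
      with top show ?thesis by (auto simp: less_Suc_eq)
    next
      case False
      then obtain b0 where b0: "b0 < d" "h b0 e \<noteq> 0" by (auto simp: B_def)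
      \<comment> \<open>The coefficients of the \<open>N\<close>-th power of the relation, after
        substituting \<open>y ^ N = y * A\<close> and expanding
        \<open>(w + \<gamma>) ^ c\<close>.\<close>
      define H where "H = (\<lambda>b j. A ^ b * (\<Sum>c\<in>{j..<Suc e}. h b c ^ N * of_nat (c choose j) * \<gamma> ^ (c - j)))"
      have relH: "(\<Sum>b<d. \<Sum>j<Suc e. H b j * y ^ b * w ^ j) = 0"
      proof -
        have "0 = (\<Sum>b<d. \<Sum>c<Suc e. h b c * y ^ b * w ^ c) ^ N"
          using rel Npos by (simp add: zero_power)
        also have "\<dots> = (\<Sum>b<d. \<Sum>c<Suc e. (h b c * y ^ b * w ^ c) ^ N)"
          by (simp only: dream)
        also have "\<dots> = (\<Sum>b<d. \<Sum>j<Suc e. H b j * y ^ b * w ^ j)"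
        proof (rule sum.cong[OF refl])
          fix b
          have "(\<Sum>c<Suc e. (h b c * y ^ b * w ^ c) ^ N)
                = (\<Sum>c<Suc e. h b c ^ N * (y ^ N) ^ b * (w ^ N) ^ c)"
            by (simp add: power_mult_distrib mult.commute flip: power_mult)
          also have "\<dots> = (\<Sum>c<Suc e. \<Sum>j\<le>c. h b c ^ N * (y * A) ^ b *
              (of_nat (c choose j) * w ^ j * \<gamma> ^ (c - j)))"
            unfolding y w by (simp only: binomial_ring sum_distrib_left)
          also have "\<dots> = (\<Sum>c\<in>{..<Suc e}. \<Sum>j\<in>{..<Suc e}. if j \<le> c then h b c ^ N * (y * A) ^ b *
              (of_nat (c choose j) * w ^ j * \<gamma> ^ (c - j)) else 0)"
            by (intro sum.cong refl sum.mono_neutral_cong_left) auto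
          also have "\<dots> = (\<Sum>j\<in>{..<Suc e}. \<Sum>c\<in>{..<Suc e}. if j \<le> c then h b c ^ N * (y * A) ^ b *
              (of_nat (c choose j) * w ^ j * \<gamma> ^ (c - j)) else 0)"
            by (rule sum.swap)
          also have "\<dots> = (\<Sum>j<Suc e. \<Sum>c\<in>{j..<Suc e}. h b c ^ N * (y * A) ^ b *
              (of_nat (c choose j) * w ^ j * \<gamma> ^ (c - j)))"
            by (intro sum.cong refl sum.mono_neutral_cong_right) auto
          also have "\<dots> = (\<Sum>j<Suc e. H b j * y ^ b * w ^ j)"
            unfolding H_def sum_distrib_left sum_distrib_right
            by (intro sum.cong refl) (simp add: power_mult_distrib mult_ac)
          finally show "(\<Sum>c<Suc e. (h b c * y ^ b * w ^ c) ^ N) = (\<Sum>j<Suc e. H b j * y ^ b * w ^ j)" .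
        qed
        finally show ?thesis by simp
      qed
      have H_top: "H b e = A ^ b * h b e ^ N" for b by (simp add: H_def)
      \<comment> \<open>This multiple removes the top coefficient at \<open>b0\<close>, and no new
        top coefficient appears because \<open>H b e\<close> is a multiple of a power of
        \<open>h b e\<close>.\<close>
      define \<mu> where "\<mu> = H b0 e / h b0 e"
      define g where "g = (\<lambda>b c. H b c - \<mu> * h b c)"
      have HK: "H b j \<in> K" if "b < d" for b j
        unfolding H_def using that hK
        by (intro K_mult K_pow K_sum K_of_nat y w) auto
      have "\<mu> \<in> K" using b0 HK hK by (auto simp: \<mu>_def divide_inverse intro!: K_mult K_inverse)
      then have gK: "g b c \<in> K" if "b < d" "c < Suc e" for b c
        using K_add[OF HK K_uminus[OF K_mult[OF _ hK]]] that by (simp add: g_def)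
      have relg: "(\<Sum>b<d. \<Sum>c<Suc e. g b c * y ^ b * w ^ c) = 0"
      proof -
        have "(\<Sum>b<d. \<Sum>c<Suc e. g b c * y ^ b * w ^ c) =
          (\<Sum>b<d. \<Sum>c<Suc e. H b c * y ^ b * w ^ c) - \<mu> * (\<Sum>b<d. \<Sum>c<Suc e. h b c * y ^ b * w ^ c)"
          unfolding sum_distrib_left sum_subtractf[symmetric] g_def
          by (intro sum.cong refl) (simp add: algebra_simps)
        with rel relH show ?thesis by simp
      qed
      have "{b. b < d \<and> g b e \<noteq> 0} \<subset> B"
      proof -
        have "g b0 e = 0" using b0 by (simp add: g_def \<mu>_def)
        moreover have "h b e \<noteq> 0" if "g b e \<noteq> 0" for b
          using that Npos unfolding g_def H_top by (metis diff_self mult_zero_right zero_power)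
        ultimately show ?thesis using b0 by (auto simp: B_def)
      qed
      then have "card {b. b < d \<and> g b e \<noteq> 0} < card B"
        by (intro psubset_card_mono) (auto simp: B_def)
      then have "\<forall>b<d. \<forall>c<Suc e. g b c = 0"
        unfolding B_def by (rule less.hyps[OF _ gK relg])
      then have g0: "g b c = 0" if "b < d" "c < Suc e" for b c
        using that by blast
      \<comment> \<open>All top coefficients are scaled by the same factor \<mu> when passing to the
        \<open>N\<close>-th power, so the quotient of two nonzero ones would solve the excluded
        Kummer equation. Only \<open>b0\<close> survives.\<close>
      have ratio: "A ^ b * h b e ^ N * h b0 e = A ^ b0 * h b0 e ^ N * h b e" if "b < d" for b
        using g0[OF that, of e] b0 by (simp add: g_def H_top \<mu>_def field_simps)
      have single: "h b e = 0" if "b < d" "b \<noteq> b0" for b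
      proof (rule ccontr)
        assume nz: "h b e \<noteq> 0"
        have *: False if lt: "i < j" "j < d" and nzi: "h i e \<noteq> 0" "h j e \<noteq> 0"
          and eq: "A ^ j * h j e ^ N * h i e = A ^ i * h i e ^ N * h j e" for i j
        proof -
          define v where "v = h j e / h i e"
          have "v \<in> K" using lt hK by (auto simp: v_def divide_inverse intro!: K_mult K_inverse)
          moreover have "v \<noteq> 0" using nzi by (simp add: v_def)
          moreover have "v ^ N * A ^ (j - i) = v"
          proof -
            have "A ^ j = A ^ i * A ^ (j - i)" using lt by (simp flip: power_add)
            with eq A0 nzi show ?thesis
              by (simp add: v_def power_divide field_simps)
          qed
          ultimately show False using kummer[of "j - i" v] lt by auto
        qed
        show False
        proof (cases "b < b0")
          case True
          then show ?thesis using *[of b b0] b0 nz ratio[OF that(1)] by (simp add: mult_ac)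
        next
          case False
          then show ?thesis using *[of b0 b] b0 nz that ratio[OF that(1)] by (simp add: mult_ac)
        qed
      qed
      have False
      proof (cases e)
        case 0
        have "(\<Sum>b<d. \<Sum>c<Suc e. h b c * y ^ b * w ^ c) = (\<Sum>b\<in>{b0}. h b 0 * y ^ b)"
        proof -
          have "(\<Sum>b<d. \<Sum>c<Suc e. h b c * y ^ b * w ^ c) = (\<Sum>b<d. h b 0 * y ^ b)"
            by (simp add: 0)
          also have "\<dots> = (\<Sum>b\<in>{b0}. h b 0 * y ^ b)"
            using single b0 0 by (intro sum.mono_neutral_right) auto
          finally show ?thesis .
        qed
        with rel b0 y 0 show False by auto
      next
        case e: (Suc e')
        have en0: "of_nat e \<noteq> (0 :: 'a)"
          unfolding of_nat_eq_0_iff_char_dvd using Suc.prems(1) e by (auto dest: dvd_imp_le)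
        have He': "H b0 e' = A ^ b0 * (h b0 e' ^ N + of_nat e * h b0 e ^ N * \<gamma>)"
          by (simp add: H_def e atLeastLessThanSuc)
        \<comment> \<open>With a single top coefficient left, comparing the coefficients of
          \<open>w ^ e'\<close> yields \<open>u ^ N + e * \<gamma> = u\<close>. Since
          \<open>e\<close> is an invertible element of the prime field and hence fixed by the
          \<open>N\<close>-th power, \<open>- u / e\<close> solves the excluded Artin-Schreier
          equation.\<close>
        define u where "u = h b0 e' / h b0 e"
        have "H b0 e' = \<mu> * h b0 e'" using g0[OF b0(1), of e'] e by (simp add: g_def)
        then have "A ^ b0 * (h b0 e' ^ N + of_nat e * h b0 e ^ N * \<gamma>) * h b0 e = A ^ b0 * h b0 e ^ N * h b0 e'"
          unfolding He' using b0 by (simp add: \<mu>_def H_top)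
        then have "A ^ b0 * ((h b0 e' ^ N + of_nat e * h b0 e ^ N * \<gamma>) * h b0 e) = A ^ b0 * (h b0 e ^ N * h b0 e')"
          by (simp only: mult.assoc)
        then have "(h b0 e' ^ N + of_nat e * h b0 e ^ N * \<gamma>) * h b0 e = h b0 e ^ N * h b0 e'"
          using A0 by simp
        then have u: "u ^ N + of_nat e * \<gamma> = u"
          using A0 b0 by (simp add: u_def power_divide field_simps)
        have uK: "u \<in> K" using hK b0 e by (auto simp: u_def divide_inverse intro!: K_mult K_inverse)
        define v where "v = - (u / of_nat e)"
        have "v \<in> K" using uK by (auto simp: v_def divide_inverse intro!: K_mult K_inverse K_of_nat K_uminus)
        moreover have "v ^ N - v = \<gamma>"
        proof -
          have eN: "of_nat e ^ N = (of_nat e :: 'a)"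
          proof -
            have "(of_nat n :: 'a) ^ N = of_nat n" for n
              by (induction n) (use Npos in \<open>auto simp: dream zero_power\<close>)
            then show ?thesis .
          qed
          have "(- x) ^ N = - (x ^ N)" for x :: 'a
            using dream(1)[of x "- x"] Npos by (simp add: zero_power eq_neg_iff_add_eq_0 add.commute)
          then have "v ^ N = - (u ^ N / of_nat e)" by (simp add: v_def power_divide eN)
          moreover have "u ^ N = u - of_nat e * \<gamma>" using u by (simp add: algebra_simps)
          ultimately show ?thesis using en0 by (simp add: v_def field_simps)
        qed
        ultimately show False using artin_schreier by blast
      qed
      then show ?thesis ..
    qed
  qed
  show ?case using inner[OF Suc.prems(2,3)] by blast
qed simp

lemma order_power:
  assumes "A \<noteq> (0 :: 'a::idom poly)"
  shows "order x (A ^ n) = n * order x A"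
  using assms by (induction n) (auto simp: order_mult)

section \<open>Nondegeneracy of the Kummer and Artin-Schreier equations over the rational
  functions\<close>

text \<open>An equality would say \<open>v ^ N * F ^ (e * b) = v\<close> for
  \<open>v = A / B\<close>. Orders at \<rho> give \<open>e * b * order \<rho> F\<close> as
  \<open>e * d\<close> times an integer, because \<open>N - 1 = e * d\<close>; so \<open>d\<close>
  divides every \<open>b * order \<rho> F\<close>, hence \<open>b\<close>.\<close>

lemma kummer_nondegenerate:
  fixes A B F :: "'a::field poly"
  assumes "A \<noteq> 0" "B \<noteq> 0" "F \<noteq> 0"
    and H: "\<And>b. (\<And>\<rho>. d dvd b * order \<rho> F) \<Longrightarrow> d dvd b"
    and N: "N = e * d + 1" "e > 0" and b: "0 < b" "b < d"
  shows "A ^ N * B * F ^ (e * b) \<noteq> A * B ^ N"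
proof
  assume eq: "A ^ N * B * F ^ (e * b) = A * B ^ N"
  have "d dvd b * order \<rho> F" for \<rho>
  proof -
    have "order \<rho> (A ^ N * B * F ^ (e * b)) = order \<rho> (A * B ^ N)" by (simp only: eq)
    then have "N * order \<rho> A + order \<rho> B + e * b * order \<rho> F = order \<rho> A + N * order \<rho> B"
      using assms(1-3) by (simp add: order_mult order_power)
    then have "int N * order \<rho> A + order \<rho> B + int e * b * order \<rho> F = order \<rho> A + int N * order \<rho> B"
      by (metis of_nat_add of_nat_mult)
    then have "int e * (int b * order \<rho> F) = int e * (int d * (int (order \<rho> B) - order \<rho> A))"
      using N by (simp add: algebra_simps)
    then have "int b * order \<rho> F = int d * (int (order \<rho> B) - order \<rho> A)"
      using N by simp
    then have "int d dvd int (b * order \<rho> F)" by simp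
    then show ?thesis by (simp only: int_dvd_int_iff)
  qed
  then have "d dvd b" by (rule H)
  with b show False by (auto dest: dvd_imp_le)
qed

text \<open>With \<open>v = A / B\<close> an equality would read
  \<open>v ^ N - v = \<Gamma> / x ^ M\<close>. The right side has a pole of order \<open>M\<close>
  at 0, whereas a pole of \<open>v ^ N - v\<close> has order divisible by \<open>N\<close>.\<close>

lemma artin_schreier_nondegenerate_zero:
  fixes A B \<Gamma> :: "'a::field poly"
  assumes B: "B \<noteq> 0" and M: "0 < M" "M < N" and \<Gamma>: "poly \<Gamma> 0 \<noteq> 0"
  shows "(A ^ N - A * B ^ (N - 1)) * monom 1 M \<noteq> \<Gamma> * B ^ N"
proof
  assume eq: "(A ^ N - A * B ^ (N - 1)) * monom 1 M = \<Gamma> * B ^ N"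
  let ?x = "[:- 0, 1 :: 'a:]"
  have x: "monom 1 M = ?x ^ M" by (simp add: monom_altdef)
  have \<Gamma>0: "\<Gamma> \<noteq> 0" using \<Gamma> by auto
  have A: "A \<noteq> 0" using eq M B \<Gamma>0 by (auto simp: zero_power)
  have D: "A ^ N - A * B ^ (N - 1) \<noteq> 0" using eq B \<Gamma>0 by auto
  have ord: "order 0 (A ^ N - A * B ^ (N - 1)) + M = N * order 0 B"
  proof -
    have "order 0 ((A ^ N - A * B ^ (N - 1)) * ?x ^ M) = order 0 (\<Gamma> * B ^ N)"
      using eq x by simp
    moreover have "order 0 (?x ^ M) = M" by (rule order_power_n_n)
    moreover have "order 0 ?x = 1" using order_power_n_n[of "0::'a" 1] by simp
    moreover have "order 0 \<Gamma> = 0" using \<Gamma> by (simp add: order_0I)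
    ultimately show ?thesis using D B \<Gamma>0 by (simp add: order_mult order_power)
  qed
  have dvd: "?x ^ k dvd A" if "k \<le> order 0 A" for k
    using that order_divides by blast
  have dvdB: "?x ^ (k * j) dvd B ^ j" if "k \<le> order 0 B" for k j
    using that order_divides[of 0 k B] by (metis dvd_power_same power_mult)
  have dvdA: "?x ^ (k * j) dvd A ^ j" if "k \<le> order 0 A" for k j
    using that order_divides[of 0 k A] by (metis dvd_power_same power_mult)
  show False
  proof (cases "order 0 A \<ge> order 0 B")
    case True
    let ?b = "order 0 B"
    have "?x ^ (?b * N) dvd A ^ N" using True by (rule dvdA)
    moreover have "?x ^ (?b * N) dvd A * B ^ (N - 1)"
    proof -
      have "?x ^ (?b * 1) * ?x ^ (?b * (N - 1)) dvd A ^ 1 * B ^ (N - 1)"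
        using True by (intro mult_dvd_mono dvdA dvdB) auto
      moreover have "?b * 1 + ?b * (N - 1) = ?b * N"
        using M by (metis add.commute add_mult_distrib2 le_add_diff_inverse2 less_one linorder_not_less not_less_zero)
      ultimately show ?thesis by (simp flip: power_add)
    qed
    ultimately have "?x ^ (?b * N) dvd A ^ N - A * B ^ (N - 1)" by (rule dvd_diff)
    then have "?b * N \<le> order 0 (A ^ N - A * B ^ (N - 1))"
      using D order_divides by blast
    with ord M show False by (simp add: mult.commute)
  next
    case False
    define a b where "a = order 0 A" and "b = order 0 B"
    have lt: "a < b" using False by (simp add: a_def b_def)
    have bN: "N * a < a + b * (N - 1)"
    proof -
      have "N * a = a + a * (N - 1)" using M
        by (metis Suc_diff_1 gr0I mult.commute mult_Suc not_less_zero)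
      with lt M show ?thesis by simp
    qed
    have "?x ^ (a + b * (N - 1)) dvd A * B ^ (N - 1)"
      unfolding power_add using dvdB[of b] dvd[of a] by (auto simp: a_def b_def intro!: mult_dvd_mono)
    moreover have "?x ^ Suc (N * a) dvd ?x ^ (a + b * (N - 1))" using bN by (intro le_imp_power_dvd) simp
    ultimately have *: "?x ^ Suc (N * a) dvd A * B ^ (N - 1)" by (rule dvd_trans[rotated])
    have "order 0 (A ^ N - A * B ^ (N - 1)) = N * a"
    proof (rule antisym)
      show "N * a \<le> order 0 (A ^ N - A * B ^ (N - 1))"
      proof -
        have "?x ^ (a * N) dvd A ^ N" by (rule dvdA) (simp add: a_def)
        moreover have "?x ^ (N * a) dvd A * B ^ (N - 1)"
          using * by (metis dvd_trans le_imp_power_dvd lessI less_imp_le)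
        ultimately have "?x ^ (N * a) dvd A ^ N - A * B ^ (N - 1)" by (simp add: mult.commute)
        with D show ?thesis using order_divides by blast
      qed
      show "order 0 (A ^ N - A * B ^ (N - 1)) \<le> N * a"
      proof (rule ccontr)
        assume "\<not> ?thesis"
        then have "?x ^ Suc (N * a) dvd A ^ N - A * B ^ (N - 1)"
          by (metis order_divides Suc_leI not_less)
        then have "?x ^ Suc (N * a) dvd A ^ N" using * by (metis dvd_add diff_add_cancel)
        then have "Suc (N * a) \<le> order 0 (A ^ N)" using A order_divides by (metis power_not_zero)
        then show False using A by (simp add: order_power a_def)
      qed
    qed
    with ord have eqn: "N * a + M = N * b" by (simp add: b_def)
    then have "N dvd M" by (metis dvd_add_right_iff dvd_triv_left)
    with M show False by (auto dest: dvd_imp_le)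
  qed
qed

text \<open>The same argument at infinity, where \<open>\<Gamma> / x ^ M\<close> has a pole of order
  \<open>2 * M - M = M\<close>; degrees replace orders of vanishing.\<close>

lemma artin_schreier_nondegenerate_infinity:
  fixes A B \<Gamma> :: "'a::field poly"
  assumes B: "B \<noteq> 0" and M: "0 < M" "M < N" and \<Gamma>: "degree \<Gamma> = 2 * M"
  shows "(A ^ N - A * B ^ (N - 1)) * monom 1 M \<noteq> \<Gamma> * B ^ N"
proof
  assume eq: "(A ^ N - A * B ^ (N - 1)) * monom 1 M = \<Gamma> * B ^ N"
  have \<Gamma>0: "\<Gamma> \<noteq> 0" using \<Gamma> M by auto
  have A: "A \<noteq> 0" using eq M B \<Gamma>0 by (auto simp: zero_power)
  have D: "A ^ N - A * B ^ (N - 1) \<noteq> 0" using eq B \<Gamma>0 by auto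
  have deg: "degree (A ^ N - A * B ^ (N - 1)) + M = 2 * M + N * degree B"
    using arg_cong[OF eq, of degree] D B \<Gamma>0 \<Gamma>
    by (simp add: degree_mult_eq degree_power_eq degree_monom_eq)
  define a b where "a = degree A" and "b = degree B"
  have dA: "degree (A ^ N) = N * a" and dB: "degree (A * B ^ (N - 1)) = a + (N - 1) * b"
    using A B by (simp_all add: a_def b_def degree_mult_eq degree_power_eq)
  have Nsplit: "N * x = x + (N - 1) * x" for x
    using M by (metis Suc_diff_1 gr0I mult_Suc not_less_zero)
  show False
  proof (cases "a \<le> b")
    case True
    have "N * a \<le> N * b" using True by simp
    moreover have "a + (N - 1) * b \<le> N * b" using True Nsplit[of b] by linarith
    ultimately have "degree (A ^ N - A * B ^ (N - 1)) \<le> N * b"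
      using degree_diff_le_max[of "A ^ N" "A * B ^ (N - 1)"] dA dB by linarith
    with deg M show False by (simp add: b_def)
  next
    case False
    then have "a + (N - 1) * b < N * a" using M by (simp add: Nsplit[of a])
    then have "degree (A * B ^ (N - 1)) < degree (A ^ N)" using dA dB by simp
    then have "degree (A ^ N - A * B ^ (N - 1)) = N * a"
      using dA degree_add_eq_left[of "- (A * B ^ (N - 1))" "A ^ N"] by simp
    with deg have "N * a = M + N * b" by (simp add: b_def)
    then have "N dvd M" by (metis dvd_add_left_iff dvd_triv_left)
    with M show False by (auto dest: dvd_imp_le)
  qed
qed

text \<open>A nonzero coefficient at \<open>n > 0\<close> would force one at the smaller positive
  index \<open>n div m\<close>.\<close>

lemma fps_frobenius_fixed:
  fixes z :: "'a::comm_ring_1 fps"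
  assumes p: "prime CHAR('a)" and m: "m = CHAR('a) ^ s" "s > 0" and z: "z ^ m = z"
  shows "z = fps_const (fps_nth z 0)"
proof (rule fps_ext)
  have m1: "m > 1" using p m by (metis one_less_power prime_gt_1_nat)
  fix n show "fps_nth z n = fps_nth (fps_const (fps_nth z 0)) n"
  proof (induction n rule: less_induct)
    case (less n)
    have *: "fps_nth z n = (if m dvd n then fps_nth z (n div m) ^ m else 0)"
      using fps_nth_power_char[OF p m(1), of z n] z by simp
    show ?case
    proof (cases "n = 0")
      case False
      then have "n div m < n" "m dvd n \<Longrightarrow> n div m \<noteq> 0" using m1 by (auto elim: dvdE)
      with * less[of "n div m"] False m1 show ?thesis by (auto simp: zero_power)
    qed simp
  qed
qed

text \<open>The polynomial \<open>1 + x * P\<close> has positive degree and hence a root, at which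
  \<open>P\<close> cannot vanish. No appeal to infinitude of the field is needed.\<close>

lemma alg_closed_nonroot:
  fixes P :: "'a::alg_closed_field poly"
  assumes "P \<noteq> 0"
  obtains a where "poly P a \<noteq> 0"
proof -
  have "degree (1 + P * [:0, 1:]) = Suc (degree P)"
    using assms degree_add_eq_right[of 1 "P * [:0, 1:]"] by (simp add: degree_mult_eq del: mult_pCons_right)
  then obtain a where "poly (1 + P * [:0, 1:]) a = 0"
    using alg_closed_imp_poly_has_root by (metis zero_less_Suc)
  then have "poly P a \<noteq> 0" by auto
  then show ?thesis by (rule that)
qed

section \<open>Coordinates on the Kummer and Artin-Schreier cover, with bounds for the
  degrees\<close>

text \<open>\<open>H\<close> says that \<open>d\<close> and the multiplicities of the roots of
  \<open>F\<close> have no common factor; it makes \<open>Y ^ d = F\<close> geometrically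
  irreducible. The condition \<open>yz\<close> does the same for the additive equation. The exponent
  \<open>f\<close> is such that the \<open>d\<close>-th roots of unity lie in the field with
  \<open>CHAR('a) ^ f\<close> elements.\<close>

locale kummer_artin_schreier =
  fixes F :: "'a::alg_closed_field poly" and y0 z0 :: 'a and d f :: nat
  assumes char: "prime CHAR('a)" and F: "F \<noteq> 0"
    and d: "d dvd CHAR('a) ^ f - 1" and f: "f > 0"
    and H: "\<And>b. (\<And>\<rho>. d dvd b * order \<rho> F) \<Longrightarrow> d dvd b"
    and yz: "y0 \<noteq> 0 \<or> z0 \<noteq> 0"
begin

text \<open>This is \<open>x * (y0 * x + z0 / x)\<close>, the additive argument cleared of its
  denominator.\<close>

definition G :: "'a poly" where "G = [:z0, 0, y0:]"

text \<open>\<open>W\<close> stands for \<open>x w\<close>, so that no denominators occur.\<close>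

definition realization :: "'a fps \<Rightarrow> 'a fps \<Rightarrow> 'a fps \<Rightarrow> bool" where
  "realization \<xi> Y W \<longleftrightarrow> Y ^ d = fps_eval F \<xi> \<and>
     W ^ CHAR('a) = \<xi> ^ (CHAR('a) - 1) * (W + fps_eval G \<xi>)"

definition I :: "(nat \<times> nat) set" where "I = {..<d} \<times> {..<CHAR('a)}"

definition bas :: "nat \<times> nat \<Rightarrow> 'a fps \<Rightarrow> 'a fps \<Rightarrow> 'a fps" where
  "bas i Y W = Y ^ fst i * W ^ snd i"

definition val :: "(nat \<times> nat \<Rightarrow> 'a poly) \<Rightarrow> 'a fps \<Rightarrow> 'a fps \<Rightarrow> 'a fps \<Rightarrow> 'a fps" where
  "val T \<xi> Y W = (\<Sum>i\<in>I. fps_eval (T i) \<xi> * bas i Y W)"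

text \<open>A function of realizations is a combination of the monomials in \<open>I\<close> with
  polynomial coefficients of degree at most \<open>m\<close>, the same for all realizations. This
  uniformity lets coefficients found by linear algebra be used both at the generic point, for
  nonvanishing, and at points of the finite field, for vanishing.\<close>

definition rep :: "nat \<Rightarrow> ('a fps \<Rightarrow> 'a fps \<Rightarrow> 'a fps \<Rightarrow> 'a fps) \<Rightarrow> bool" where
  "rep m u \<longleftrightarrow> (\<exists>T. (\<forall>i. degree (T i) \<le> m) \<and> (\<forall>\<xi> Y W. realization \<xi> Y W \<longrightarrow> u \<xi> Y W = val T \<xi> Y W))"

lemma p_gt_1: "CHAR('a) > 1" using char by (rule prime_gt_1_nat)

lemma N_gt_1: "CHAR('a) ^ f > 1" using p_gt_1 f by (rule one_less_power)

lemma d_pos: "d > 0" using d N_gt_1 by (auto intro: Nat.gr0I)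

lemma finite_I [simp]: "finite I" and card_I: "card I = d * CHAR('a)"
  by (simp_all add: I_def)

lemma I_nonempty: "(0, 0) \<in> I" using d_pos p_gt_1 by (simp add: I_def)

lemma repI:
  assumes "\<And>i. degree (T i) \<le> m" "\<And>\<xi> Y W. realization \<xi> Y W \<Longrightarrow> u \<xi> Y W = val T \<xi> Y W"
  shows "rep m u"
  using assms unfolding rep_def by blast

lemma rep_mono: "rep m u \<Longrightarrow> m \<le> m' \<Longrightarrow> rep m' u"
  unfolding rep_def by (meson le_trans)

lemma rep_cong:
  assumes "rep m u" "\<And>\<xi> Y W. realization \<xi> Y W \<Longrightarrow> u \<xi> Y W = v \<xi> Y W"
  shows "rep m v"
  using assms unfolding rep_def by force

lemma rep_add:
  assumes "rep m u" "rep m v"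
  shows "rep m (\<lambda>\<xi> Y W. u \<xi> Y W + v \<xi> Y W)"
proof -
  obtain T where T: "\<And>i. degree (T i) \<le> m" "\<And>\<xi> Y W. realization \<xi> Y W \<Longrightarrow> u \<xi> Y W = val T \<xi> Y W"
    using assms(1) unfolding rep_def by blast
  obtain S where S: "\<And>i. degree (S i) \<le> m" "\<And>\<xi> Y W. realization \<xi> Y W \<Longrightarrow> v \<xi> Y W = val S \<xi> Y W"
    using assms(2) unfolding rep_def by blast
  show ?thesis
    by (rule repI[of "\<lambda>i. T i + S i"])
       (auto simp: T S val_def sum.distrib algebra_simps intro!: degree_add_le)
qed

lemma rep_zero: "rep m (\<lambda>\<xi> Y W. 0)"
  by (rule repI[of "\<lambda>i. 0"]) (auto simp: val_def)

lemma rep_sum: "(\<And>x. x \<in> S \<Longrightarrow> rep m (u x)) \<Longrightarrow> rep m (\<lambda>\<xi> Y W. \<Sum>x\<in>S. u x \<xi> Y W)"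
  by (induction S rule: infinite_finite_induct) (auto intro: rep_zero rep_add)

lemma rep_poly_mult:
  assumes "rep m u" "degree P \<le> k"
  shows "rep (k + m) (\<lambda>\<xi> Y W. fps_eval P \<xi> * u \<xi> Y W)"
proof -
  obtain T where T: "\<And>i. degree (T i) \<le> m" "\<And>\<xi> Y W. realization \<xi> Y W \<Longrightarrow> u \<xi> Y W = val T \<xi> Y W"
    using assms(1) unfolding rep_def by blast
  show ?thesis
    by (rule repI[of "\<lambda>i. P * T i"])
       (auto simp: T val_def sum_distrib_left mult.assoc
             intro!: order.trans[OF degree_mult_le] add_mono assms)
qed

lemma rep_bas_base: "i \<in> I \<Longrightarrow> rep 0 (\<lambda>\<xi> Y W. bas i Y W)"
  by (rule repI[of "\<lambda>j. if j = i then 1 else 0"])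
     (auto simp: val_def if_distrib if_distribR cong: if_cong)

text \<open>The extra degree caused by reducing a product of two basis monomials: at most one
  substitution \<open>Y ^ d = F\<close> and one of the equation for \<open>W\<close>.\<close>

definition \<kappa>\<^sub>0 :: nat where "\<kappa>\<^sub>0 = degree F + CHAR('a) + 1"

lemma degree_G: "degree G \<le> 2" by (simp add: G_def)

lemma rep_monomial_aux:
  assumes "c < CHAR('a)"
  shows "rep (b div d * degree F) (\<lambda>\<xi> Y W. Y ^ b * W ^ c)"
proof -
  have "(b mod d, c) \<in> I" using assms d_pos by (simp add: I_def)
  then have "rep (b div d * degree F + 0) (\<lambda>\<xi> Y W. fps_eval (F ^ (b div d)) \<xi> * bas (b mod d, c) Y W)"
    using degree_power_le[of F "b div d"]
    by (intro rep_poly_mult rep_bas_base) (simp_all add: mult.commute)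
  then show ?thesis
  proof (rule rep_cong[OF rep_mono])
    fix \<xi> Y W assume "realization \<xi> Y W"
    then have "fps_eval F \<xi> = Y ^ d" by (simp add: realization_def)
    then have "fps_eval (F ^ (b div d)) \<xi> * Y ^ (b mod d) = Y ^ b"
      by (metis fps_eval_power mult_div_mod_eq power_add power_mult)
    then show "fps_eval (F ^ (b div d)) \<xi> * bas (b mod d, c) Y W = Y ^ b * W ^ c"
      by (simp add: bas_def flip: mult.assoc)
  qed simp
qed

text \<open>The exponent of \<open>W\<close> in a product of two basis monomials is at most
  \<open>2 * CHAR('a) - 2\<close>, so a single use of the equation for \<open>W ^ CHAR('a)\<close>
  brings it below the characteristic. Its coefficients have degree at most
  \<open>CHAR('a) + 1\<close>.\<close>

lemma rep_monomial:
  assumes "c \<le> 2 * CHAR('a) - 2"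
  shows "rep (b div d * degree F + CHAR('a) + 1) (\<lambda>\<xi> Y W. Y ^ b * W ^ c)"
proof (cases "c < CHAR('a)")
  case True
  then show ?thesis by (rule rep_mono[OF rep_monomial_aux]) simp
next
  case False
  let ?p = "CHAR('a)"
  have "rep (?p - 1 + b div d * degree F) (\<lambda>\<xi> Y W. fps_eval (monom 1 (?p - 1)) \<xi> * (Y ^ b * W ^ (c - ?p + 1)))"
    using assms False p_gt_1 by (intro rep_poly_mult rep_monomial_aux) (auto simp: degree_monom_eq)
  moreover have "rep (?p + 1 + b div d * degree F) (\<lambda>\<xi> Y W. fps_eval (monom 1 (?p - 1) * G) \<xi> * (Y ^ b * W ^ (c - ?p)))"
    using assms False p_gt_1 degree_mult_le[of "monom 1 (?p - 1)" G] degree_G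
    by (intro rep_poly_mult rep_monomial_aux) (auto simp: degree_monom_eq)
  ultimately have "rep (?p + 1 + b div d * degree F)
     (\<lambda>\<xi> Y W. fps_eval (monom 1 (?p - 1)) \<xi> * (Y ^ b * W ^ (c - ?p + 1)) +
        fps_eval (monom 1 (?p - 1) * G) \<xi> * (Y ^ b * W ^ (c - ?p)))"
    by (intro rep_add) (auto elim: rep_mono)
  then show ?thesis
  proof (rule rep_cong[OF rep_mono])
    fix \<xi> Y W assume "realization \<xi> Y W"
    then have *: "W ^ ?p = \<xi> ^ (?p - 1) * (W + fps_eval G \<xi>)" by (simp add: realization_def)
    have "W ^ c = W ^ ?p * W ^ (c - ?p)" using False by (simp flip: power_add)
    then show "fps_eval (monom 1 (?p - 1)) \<xi> * (Y ^ b * W ^ (c - ?p + 1)) +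
        fps_eval (monom 1 (?p - 1) * G) \<xi> * (Y ^ b * W ^ (c - ?p)) = Y ^ b * W ^ c"
      unfolding * by (simp add: algebra_simps)
  qed simp
qed

lemma rep_mult:
  assumes "rep m u" "rep m' v"
  shows "rep (m + m' + \<kappa>\<^sub>0) (\<lambda>\<xi> Y W. u \<xi> Y W * v \<xi> Y W)"
proof -
  obtain T where T: "\<And>i. degree (T i) \<le> m" "\<And>\<xi> Y W. realization \<xi> Y W \<Longrightarrow> u \<xi> Y W = val T \<xi> Y W"
    using assms(1) unfolding rep_def by blast
  obtain S where S: "\<And>i. degree (S i) \<le> m'" "\<And>\<xi> Y W. realization \<xi> Y W \<Longrightarrow> v \<xi> Y W = val S \<xi> Y W"
    using assms(2) unfolding rep_def by blast
  have "rep (m + m' + \<kappa>\<^sub>0) (\<lambda>\<xi> Y W. \<Sum>i\<in>I. \<Sum>j\<in>I. fps_eval (T i * S j) \<xi> * (Y ^ (fst i + fst j) * W ^ (snd i + snd j)))"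
  proof (intro rep_sum)
    fix i j assume ij: "i \<in> I" "j \<in> I"
    then have "fst i + fst j < 2 * d" by (auto simp: I_def)
    then have "(fst i + fst j) div d < 2" using d_pos by (simp add: div_less_iff_less_mult mult.commute)
    then have "rep \<kappa>\<^sub>0 (\<lambda>\<xi> Y W. Y ^ (fst i + fst j) * W ^ (snd i + snd j))"
      using ij by (intro rep_mono[OF rep_monomial]) (auto simp: I_def \<kappa>\<^sub>0_def less_2_cases_iff)
    moreover have "degree (T i * S j) \<le> m + m'"
      by (intro order.trans[OF degree_mult_le] add_mono T S)
    ultimately show "rep (m + m' + \<kappa>\<^sub>0) (\<lambda>\<xi> Y W. fps_eval (T i * S j) \<xi> * (Y ^ (fst i + fst j) * W ^ (snd i + snd j)))"
      by (rule rep_poly_mult)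
  qed
  then show ?thesis
  proof (rule rep_cong)
    fix \<xi> Y W assume r: "realization \<xi> Y W"
    show "(\<Sum>i\<in>I. \<Sum>j\<in>I. fps_eval (T i * S j) \<xi> * (Y ^ (fst i + fst j) * W ^ (snd i + snd j))) = u \<xi> Y W * v \<xi> Y W"
      unfolding T(2)[OF r] S(2)[OF r] val_def sum_product
      by (intro sum.cong refl) (simp add: bas_def power_add mult_ac)
  qed
qed

lemma rep_one: "rep 0 (\<lambda>\<xi> Y W. 1)"
  using rep_bas_base[OF I_nonempty] by (simp add: bas_def)

lemma rep_power:
  assumes "rep m u"
  shows "rep (n * (m + \<kappa>\<^sub>0)) (\<lambda>\<xi> Y W. u \<xi> Y W ^ n)"
proof (induction n)
  case (Suc n)
  have "rep (m + n * (m + \<kappa>\<^sub>0) + \<kappa>\<^sub>0) (\<lambda>\<xi> Y W. u \<xi> Y W * u \<xi> Y W ^ n)"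
    by (rule rep_mult[OF assms Suc])
  then show ?case by (simp add: algebra_simps)
qed (simp add: rep_one)

text \<open>The error term when \<open>W\<close> is raised to the power \<open>CHAR('a) ^ s\<close>:
  up to the factor \<open>x ^ (CHAR('a) ^ s)\<close> it is the partial trace, the sum over
  \<open>i < s\<close> of \<open>(y0 * x + z0 / x) ^ (CHAR('a) ^ i)\<close>.\<close>

primrec \<Gamma> :: "nat \<Rightarrow> 'a poly" where
  "\<Gamma> 0 = 0"
| "\<Gamma> (Suc s) = monom 1 (CHAR('a) ^ Suc s - 1) * G + \<Gamma> s ^ CHAR('a)"

lemma degree_\<Gamma>: "degree (\<Gamma> s) \<le> 2 * CHAR('a) ^ s"
proof (induction s)
  case (Suc s)
  have "degree (monom 1 (CHAR('a) ^ Suc s - 1) * G) \<le> CHAR('a) ^ Suc s - 1 + 2"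
    by (intro order.trans[OF degree_mult_le] add_mono degree_G degree_monom_le)
  also have "\<dots> \<le> 2 * CHAR('a) ^ Suc s" using p_gt_1 one_le_power[of "CHAR('a)" "Suc s"] by linarith
  finally have 1: "degree (monom 1 (CHAR('a) ^ Suc s - 1) * G) \<le> 2 * CHAR('a) ^ Suc s" .
  have "degree (\<Gamma> s ^ CHAR('a)) \<le> degree (\<Gamma> s) * CHAR('a)" by (rule degree_power_le)
  also have "\<dots> \<le> 2 * CHAR('a) ^ s * CHAR('a)" using Suc by simp
  finally have 2: "degree (\<Gamma> s ^ CHAR('a)) \<le> 2 * CHAR('a) ^ Suc s" by (simp add: mult_ac)
  show ?case using 1 2 by (simp add: degree_add_le)
qed simp

lemma realization_power_W:
  assumes "realization \<xi> Y W"
  shows "W ^ (CHAR('a) ^ s) = \<xi> ^ (CHAR('a) ^ s - 1) * W + fps_eval (\<Gamma> s) \<xi>"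
proof (induction s)
  case (Suc s)
  let ?p = "CHAR('a)"
  have dream: "(a + b) ^ ?p = a ^ ?p + b ^ ?p" for a b :: "'a fps"
    by (rule freshmans_dream) (use char in auto)
  have W: "W ^ ?p = \<xi> ^ (?p - 1) * (W + fps_eval G \<xi>)" using assms by (simp add: realization_def)
  have e: "(?p ^ s - 1) * ?p + (?p - 1) = ?p ^ Suc s - 1"
  proof -
    have "?p ^ s \<ge> 1" using p_gt_1 by simp
    then obtain x where x: "?p ^ s = Suc x" by (metis Suc_le_D One_nat_def)
    with p_gt_1 show ?thesis by (simp add: mult.commute)
  qed
  have "W ^ (?p ^ Suc s) = (W ^ (?p ^ s)) ^ ?p" by (simp add: mult.commute flip: power_mult)
  also have "\<dots> = (\<xi> ^ (?p ^ s - 1)) ^ ?p * W ^ ?p + fps_eval (\<Gamma> s) \<xi> ^ ?p"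
    unfolding Suc dream by (simp add: power_mult_distrib)
  also have "\<dots> = \<xi> ^ ((?p ^ s - 1) * ?p + (?p - 1)) * (W + fps_eval G \<xi>) + fps_eval (\<Gamma> s) \<xi> ^ ?p"
    unfolding W by (simp add: power_add power_mult mult.assoc)
  finally show ?case unfolding e by (simp add: algebra_simps)
qed simp

definition \<kappa>\<^sub>1 :: nat where "\<kappa>\<^sub>1 = d * degree F + CHAR('a) * (2 + \<kappa>\<^sub>0) + \<kappa>\<^sub>0"

text \<open>\<open>W\<close> raised to the power \<open>Q = CHAR('a) ^ s\<close> is linear in
  \<open>W\<close> with coefficients of degree at most \<open>2 * Q\<close>, and \<open>Y\<close> is
  reduced by powers of \<open>F\<close>. Hence the degrees grow only linearly in \<open>Q\<close>,
  with a constant depending on the curve.\<close>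

lemma rep_bas_power:
  assumes i: "i \<in> I"
  shows "rep (\<kappa>\<^sub>1 * CHAR('a) ^ s) (\<lambda>\<xi> Y W. bas i Y W ^ (CHAR('a) ^ s))"
proof -
  let ?Q = "CHAR('a) ^ s"
  obtain b c where bc: "i = (b, c)" "b < d" "c < CHAR('a)" using i by (auto simp: I_def)
  have Q1: "?Q \<ge> 1" using p_gt_1 by simp
  have "rep (2 * ?Q) (\<lambda>\<xi> Y W. fps_eval (monom 1 (?Q - 1)) \<xi> * (Y ^ 0 * W ^ 1) + fps_eval (\<Gamma> s) \<xi> * 1)"
  proof (rule rep_add)
    have "rep (?Q - 1 + 0 div d * degree F) (\<lambda>\<xi> Y W. fps_eval (monom 1 (?Q - 1)) \<xi> * (Y ^ 0 * W ^ 1))"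
      using p_gt_1 by (intro rep_poly_mult rep_monomial_aux) (auto simp: degree_monom_eq)
    then show "rep (2 * ?Q) (\<lambda>\<xi> Y W. fps_eval (monom 1 (?Q - 1)) \<xi> * (Y ^ 0 * W ^ 1))"
      by (rule rep_mono) simp
    show "rep (2 * ?Q) (\<lambda>\<xi> Y W. fps_eval (\<Gamma> s) \<xi> * 1)"
      using rep_poly_mult[OF rep_one degree_\<Gamma>] by simp
  qed
  then have "rep (2 * ?Q) (\<lambda>\<xi> Y W. W ^ ?Q)"
    by (rule rep_cong) (simp add: realization_power_W)
  then have "rep (c * (2 * ?Q + \<kappa>\<^sub>0)) (\<lambda>\<xi> Y W. (W ^ ?Q) ^ c)" by (rule rep_power)
  moreover have "rep (b * ?Q div d * degree F) (\<lambda>\<xi> Y W. Y ^ (b * ?Q) * W ^ 0)"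
    using p_gt_1 by (intro rep_monomial_aux) simp
  ultimately have "rep (b * ?Q div d * degree F + c * (2 * ?Q + \<kappa>\<^sub>0) + \<kappa>\<^sub>0) (\<lambda>\<xi> Y W. Y ^ (b * ?Q) * W ^ 0 * (W ^ ?Q) ^ c)"
    by (intro rep_mult)
  then have "rep (b * ?Q div d * degree F + c * (2 * ?Q + \<kappa>\<^sub>0) + \<kappa>\<^sub>0) (\<lambda>\<xi> Y W. bas i Y W ^ ?Q)"
    by (rule rep_cong) (simp add: bas_def bc power_mult_distrib mult.commute flip: power_mult)
  then show ?thesis
  proof (rule rep_mono)
    have "b * ?Q div d * degree F \<le> d * degree F * ?Q"
    proof -
      have "b * ?Q div d \<le> d * ?Q" using bc
        by (meson div_le_dividend le_trans less_imp_le mult_le_mono1)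
      then show ?thesis by (metis mult.assoc mult.commute mult_le_mono1)
    qed
    moreover have "c * (2 * ?Q + \<kappa>\<^sub>0) \<le> CHAR('a) * (2 + \<kappa>\<^sub>0) * ?Q"
    proof -
      have "2 * ?Q + \<kappa>\<^sub>0 \<le> (2 + \<kappa>\<^sub>0) * ?Q" using Q1 by (simp add: algebra_simps)
      with bc have "c * (2 * ?Q + \<kappa>\<^sub>0) \<le> CHAR('a) * ((2 + \<kappa>\<^sub>0) * ?Q)" by (intro mult_le_mono) auto
      then show ?thesis by (simp only: mult.assoc)
    qed
    moreover have "\<kappa>\<^sub>0 \<le> \<kappa>\<^sub>0 * ?Q" using Q1 by simp
    ultimately show "b * ?Q div d * degree F + c * (2 * ?Q + \<kappa>\<^sub>0) + \<kappa>\<^sub>0 \<le> \<kappa>\<^sub>1 * ?Q"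
      unfolding \<kappa>\<^sub>1_def add_mult_distrib by linarith
  qed
qed

definition \<kappa>\<^sub>2 :: nat where "\<kappa>\<^sub>2 = CHAR('a) * (1 + \<kappa>\<^sub>0) + \<kappa>\<^sub>0"

text \<open>At a point with character values given by \<epsilon> and \<eta>, the power
  \<open>Q\<^sup>2\<close> sends \<open>Y\<close> to \<open>\<epsilon> * Y\<close> and
  \<open>W\<close> to \<open>W + \<eta> * \<xi>\<close>. So the power \<open>Q\<^sup>2\<close> of a
  monomial agrees there with a function whose degree does not depend on \<open>Q\<close>, which is
  what makes the linear system below solvable.\<close>

lemma rep_twisted_bas:
  assumes i: "i \<in> I"
  shows "rep \<kappa>\<^sub>2 (\<lambda>\<xi> Y W. bas i (fps_const \<epsilon> * Y) (W + fps_const \<eta> * \<xi>))"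
proof -
  obtain b c where bc: "i = (b, c)" "b < d" "c < CHAR('a)" using i by (auto simp: I_def)
  have "rep 1 (\<lambda>\<xi> Y W. Y ^ 0 * W ^ 1 + fps_eval (monom \<eta> 1) \<xi> * 1)"
  proof (rule rep_add)
    have "rep (0 div d * degree F) (\<lambda>\<xi> Y W. Y ^ 0 * W ^ 1)"
      using p_gt_1 by (intro rep_monomial_aux) auto
    then show "rep 1 (\<lambda>\<xi> Y W. Y ^ 0 * W ^ 1)" by (rule rep_mono) simp
    show "rep 1 (\<lambda>\<xi> Y W. fps_eval (monom \<eta> 1) \<xi> * 1)"
      using rep_poly_mult[OF rep_one degree_monom_le[of \<eta> 1]] by simp
  qed
  then have "rep (c * (1 + \<kappa>\<^sub>0)) (\<lambda>\<xi> Y W. (Y ^ 0 * W ^ 1 + fps_eval (monom \<eta> 1) \<xi> * 1) ^ c)"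
    by (rule rep_power)
  moreover have "rep (0 + b div d * degree F) (\<lambda>\<xi> Y W. fps_eval [:\<epsilon> ^ b:] \<xi> * (Y ^ b * W ^ 0))"
    using p_gt_1 by (intro rep_poly_mult rep_monomial_aux) auto
  ultimately have "rep (0 + b div d * degree F + c * (1 + \<kappa>\<^sub>0) + \<kappa>\<^sub>0)
     (\<lambda>\<xi> Y W. fps_eval [:\<epsilon> ^ b:] \<xi> * (Y ^ b * W ^ 0) * (Y ^ 0 * W ^ 1 + fps_eval (monom \<eta> 1) \<xi> * 1) ^ c)"
    by (intro rep_mult)
  then have "rep \<kappa>\<^sub>2 (\<lambda>\<xi> Y W. fps_eval [:\<epsilon> ^ b:] \<xi> * (Y ^ b * W ^ 0) * (Y ^ 0 * W ^ 1 + fps_eval (monom \<eta> 1) \<xi> * 1) ^ c)"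
  proof (rule rep_mono)
    have "c * (1 + \<kappa>\<^sub>0) \<le> CHAR('a) * (1 + \<kappa>\<^sub>0)" using bc by (intro mult_le_mono1) simp
    then show "0 + b div d * degree F + c * (1 + \<kappa>\<^sub>0) + \<kappa>\<^sub>0 \<le> \<kappa>\<^sub>2"
      using bc by (simp add: \<kappa>\<^sub>2_def)
  qed
  then show ?thesis
    by (rule rep_cong) (simp add: bc bas_def power_mult_distrib fps_const_power)
qed

end

section \<open>Generic points and orders of vanishing\<close>

text \<open>After division by the least power of \<open>fps_X\<close>, each \<open>u r ^ Q\<close>
  is a constant modulo \<open>fps_X ^ Q\<close>, and not all these constants vanish. The sum is then
  congruent to a nontrivial constant combination of the \<open>v r\<close>, which has order below
  \<open>Q\<close>.\<close>

lemma frobenius_combination_nonzero: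
  fixes v u :: "'r \<Rightarrow> 'a::idom fps"
  assumes char: "prime CHAR('a)" and Q: "Q = CHAR('a) ^ s" and R: "finite R"
    and v: "\<And>\<alpha>. \<exists>r\<in>R. \<alpha> r \<noteq> 0 \<Longrightarrow> (\<Sum>r\<in>R. fps_const (\<alpha> r) * v r) \<noteq> 0 \<and>
              subdegree (\<Sum>r\<in>R. fps_const (\<alpha> r) * v r) < Q"
    and u: "\<exists>r\<in>R. u r \<noteq> 0"
  shows "(\<Sum>r\<in>R. v r * u r ^ Q) \<noteq> 0"
proof
  assume eq: "(\<Sum>r\<in>R. v r * u r ^ Q) = 0"
  have Qpos: "Q > 0" using char Q prime_gt_0_nat by simp
  define R' where "R' = {r \<in> R. u r \<noteq> 0}"
  define m where "m = Min ((\<lambda>r. subdegree (u r)) ` R')"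
  have R': "finite R'" "R' \<noteq> {}" using R u by (auto simp: R'_def)
  then have "m \<in> (\<lambda>r. subdegree (u r)) ` R'" unfolding m_def by (intro Min_in) auto
  then obtain r0 where r0: "r0 \<in> R" "u r0 \<noteq> 0" "subdegree (u r0) = m" by (auto simp: R'_def)
  have m_le: "m \<le> subdegree (u r)" if "r \<in> R" "u r \<noteq> 0" for r
    using R' that by (auto simp: m_def R'_def intro!: Min_le)
  define u' where "u' = (\<lambda>r. fps_shift m (u r))"
  have u_eq: "u r = fps_X ^ m * u' r" if "r \<in> R" for r
    using fps_conv_fps_X_power_mult_fps_shift[of "u r" m] m_le[of r] that by (cases "u r = 0") (auto simp: u'_def)
  have "0 = (\<Sum>r\<in>R. v r * (fps_X ^ m * u' r) ^ Q)"
    using eq u_eq by simp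
  also have "\<dots> = (fps_X ^ m) ^ Q * (\<Sum>r\<in>R. v r * u' r ^ Q)"
    by (simp add: power_mult_distrib sum_distrib_left mult_ac)
  finally have eq': "(\<Sum>r\<in>R. v r * u' r ^ Q) = 0" by simp
  define \<alpha> where "\<alpha> = (\<lambda>r. fps_nth (u' r) 0 ^ Q)"
  define t where "t = (\<lambda>r. fps_shift Q (u' r ^ Q))"
  have split: "u' r ^ Q = fps_const (\<alpha> r) + fps_X ^ Q * t r" for r
  proof (rule fps_ext)
    fix n show "fps_nth (u' r ^ Q) n = fps_nth (fps_const (\<alpha> r) + fps_X ^ Q * t r) n"
    proof (cases "n < Q")
      case True
      then have "Q dvd n \<longleftrightarrow> n = 0" by (auto dest: dvd_imp_le)
      with True show ?thesis
        unfolding fps_nth_power_char[OF char Q] by (auto simp: \<alpha>_def fps_X_power_mult_nth)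
    next
      case False
      then show ?thesis using Qpos by (auto simp: fps_X_power_mult_nth t_def)
    qed
  qed
  have "\<alpha> r0 \<noteq> 0" using r0 by (auto simp: \<alpha>_def u'_def)
  with r0 v[of \<alpha>] have *: "(\<Sum>r\<in>R. fps_const (\<alpha> r) * v r) \<noteq> 0"
      "subdegree (\<Sum>r\<in>R. fps_const (\<alpha> r) * v r) < Q" by blast+
  have "(\<Sum>r\<in>R. fps_const (\<alpha> r) * v r) = - (fps_X ^ Q * (\<Sum>r\<in>R. v r * t r))"
    using eq' unfolding split by (simp add: algebra_simps sum.distrib sum_distrib_left add_eq_0_iff)
  also have "\<dots> = fps_X ^ Q * (- (\<Sum>r\<in>R. v r * t r))" by simp
  finally have eq2: "(\<Sum>r\<in>R. fps_const (\<alpha> r) * v r) = fps_X ^ Q * (- (\<Sum>r\<in>R. v r * t r))" .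
  with * have nz: "- (\<Sum>r\<in>R. v r * t r) \<noteq> 0" by auto
  then have "subdegree (\<Sum>r\<in>R. fps_const (\<alpha> r) * v r) = Q + subdegree (- (\<Sum>r\<in>R. v r * t r))"
    unfolding eq2 by (metis add.commute fps_subdegree_mult_fps_X_power(1))
  with * show False by simp
qed

lemma power_sum_vanishing_coeffs:
  fixes t :: "nat \<Rightarrow> 'a::idom"
  assumes "finite S" "card S \<ge> n" and "\<And>y. y \<in> S \<Longrightarrow> (\<Sum>b<n. t b * y ^ b) = 0" and "b < n"
  shows "t b = 0"
proof -
  define P where "P = (\<Sum>b<n. monom (t b) b)"
  have "poly P y = 0" if "y \<in> S" for y
    using assms(3)[OF that] by (simp add: P_def poly_sum poly_monom)
  moreover have "degree P < n"
    unfolding P_def using assms(4) by (intro degree_sum_less) (auto intro: le_less_trans[OF degree_monom_le])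
  ultimately have "P = 0"
    using assms(1,2) card_poly_roots_bound[of P] card_mono[of "{x. poly P x = 0}" S]
    by (metis (mono_tags, lifting) le_trans linorder_not_less mem_Collect_eq poly_roots_finite subsetI)
  moreover have "coeff P b = t b"
    using assms(4) by (simp add: P_def coeff_sum)
  ultimately show ?thesis by simp
qed

context kummer_artin_schreier
begin

text \<open>At a point \<open>a\<close> where \<open>x * F\<close> does not vanish, \<open>Y\<close>
  and \<open>w\<close> are obtained as power series solutions of Frobenius equations. A root of
  \<open>F\<close> is found from \<open>Y = F ^ (- e) * Y ^ N\<close> with
  \<open>N = d * e + 1\<close>, which determines \<open>Y ^ d\<close> up to a Frobenius-fixed
  factor.\<close>

lemma ex_generic_realization:
  obtains a Y W where "a \<noteq> 0" "realization (fps_const a + fps_X) Y W" "Y \<noteq> 0"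
proof -
  let ?p = "CHAR('a)"
  obtain a where "poly (F * [:0, 1:]) a \<noteq> 0"
    using alg_closed_nonroot[of "F * [:0, 1:]"] F by auto
  then have a: "a \<noteq> 0" "poly F a \<noteq> 0" by auto
  define \<xi> where "\<xi> = fps_const a + fps_X"
  define Fx where "Fx = fps_eval F \<xi>"
  obtain e where e: "?p ^ f - 1 = d * e" using d by (elim dvdE)
  then have N: "?p ^ f = Suc (d * e)" using N_gt_1 by linarith
  have \<xi>0: "fps_nth \<xi> 0 = a" and Fx0: "fps_nth Fx 0 = poly F a"
    by (simp_all add: \<xi>_def Fx_def)
  have invF: "inverse Fx * Fx = 1" using a Fx0 by (intro inverse_mult_eq_1) simp
  have inv\<xi>: "inverse \<xi> * \<xi> = 1" using a \<xi>0 by (intro inverse_mult_eq_1) simp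
  obtain y where y: "y ^ d = poly F a" using nth_root_exists[OF d_pos] by blast
  have "y = fps_nth (inverse Fx ^ e) 0 * y ^ (?p ^ f) + fps_nth 0 0"
    using a by (simp add: Fx0 N power_mult y fps_nth_power_0 flip: power_mult_distrib)
  then obtain Y where Y: "fps_nth Y 0 = y" "Y = inverse Fx ^ e * Y ^ (?p ^ f) + 0"
    using fps_frobenius_equation_solvable[OF char refl f, of y "inverse Fx ^ e" 0] by blast
  have YN: "Y ^ (?p ^ f) = Y * Fx ^ e"
  proof -
    have "Y * Fx ^ e = (inverse Fx * Fx) ^ e * Y ^ (?p ^ f)"
      by (subst Y(2)) (simp add: power_mult_distrib mult_ac)
    then show ?thesis by (simp add: invF)
  qed
  \<comment> \<open>The factor relating \<open>Y ^ d\<close> to \<open>F\<close>; it is fixed by the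
    \<open>N\<close>-th power and hence constant, and the choice of \<open>y\<close> makes this
    constant 1.\<close>
  define z where "z = Y ^ d * inverse Fx"
  have "z ^ (?p ^ f) = (Y ^ (?p ^ f)) ^ d * inverse Fx ^ (?p ^ f)"
    by (simp add: z_def power_mult_distrib mult.commute flip: power_mult)
  also have "\<dots> = Y ^ d * inverse Fx * (inverse Fx * Fx) ^ (d * e)"
    unfolding YN by (simp add: N power_mult_distrib mult_ac flip: power_mult)
  finally have "z ^ (?p ^ f) = z" by (simp add: invF z_def)
  then have "z = fps_const (fps_nth z 0)" by (rule fps_frobenius_fixed[OF char refl f])
  also have "fps_nth z 0 = 1" using a Y(1) y by (simp add: z_def Fx0 fps_nth_power_0)
  finally have "z * Fx = Fx" by simp
  then have Yd: "Y ^ d = Fx" using invF by (simp add: z_def mult.assoc)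
  define g where "g = fps_eval G \<xi> * inverse \<xi>"
  define g0 where "g0 = fps_nth g 0"
  have "degree (monom 1 ?p - [:g0, 1:]) = ?p"
    using p_gt_1 by (simp add: degree_monom_eq diff_conv_add_uminus degree_add_eq_left del: add_uminus_conv_diff)
  then obtain w0 where "poly (monom 1 ?p - [:g0, 1:]) w0 = 0"
    using alg_closed_imp_poly_has_root p_gt_1 by (metis less_trans zero_less_one)
  then have "w0 = fps_nth 1 0 * w0 ^ ?p + fps_nth (- g) 0"
    by (simp add: poly_monom g0_def algebra_simps)
  moreover have "?p = ?p ^ 1" "(1::nat) > 0" by simp_all
  ultimately obtain w where w: "w = 1 * w ^ ?p + - g"
    using fps_frobenius_equation_solvable[OF char] by metis
  define W where "W = \<xi> * w"
  have "W ^ ?p = \<xi> ^ ?p * (w + g)" using w by (simp add: W_def power_mult_distrib algebra_simps)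
  also have "\<xi> ^ ?p = \<xi> ^ (?p - 1) * \<xi>" using p_gt_1 by (metis Suc_diff_1 mult.commute less_trans power_Suc zero_less_one)
  also have "\<dots> * (w + g) = \<xi> ^ (?p - 1) * (W + fps_eval G \<xi> * (inverse \<xi> * \<xi>))"
    by (simp add: W_def g_def algebra_simps)
  finally have "W ^ ?p = \<xi> ^ (?p - 1) * (W + fps_eval G \<xi>)" by (simp add: inv\<xi>)
  with Yd have "realization \<xi> Y W" by (simp add: realization_def Fx_def)
  moreover have "Y \<noteq> 0" using Yd Fx0 a d_pos by (auto simp: zero_power)
  ultimately show ?thesis using a that unfolding \<xi>_def by blast
qed

text \<open>\<Gamma> stripped of its common power of \<open>x\<close>. What remains has constant
  term a power of \<open>z0\<close> and, if \<open>y0\<close> is nonzero, degree twice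
  \<open>CHAR('a) ^ s\<close>, as needed to read off poles at 0 and infinity.\<close>

primrec \<Gamma>' :: "nat \<Rightarrow> 'a poly" where
  "\<Gamma>' 0 = G"
| "\<Gamma>' (Suc s) = monom 1 (CHAR('a) ^ Suc s - 1) * G + \<Gamma>' s ^ CHAR('a)"

lemma \<Gamma>_conv: "\<Gamma> (Suc s) = monom 1 (CHAR('a) ^ Suc s - CHAR('a) ^ s) * \<Gamma>' s"
proof (induction s)
  case (Suc s)
  let ?p = "CHAR('a)"
  have le: "?p ^ s \<le> ?p ^ Suc s" "?p ^ Suc s \<le> ?p ^ Suc (Suc s)" "1 \<le> ?p ^ Suc s"
    using p_gt_1 by (simp_all add: power_increasing del: power_Suc) 
  have "\<Gamma> (Suc (Suc s)) = monom 1 (?p ^ Suc (Suc s) - 1) * G + \<Gamma> (Suc s) ^ ?p"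
    by simp
  also have "\<Gamma> (Suc s) ^ ?p = monom 1 (?p ^ Suc (Suc s) - ?p ^ Suc s) * \<Gamma>' s ^ ?p"
    unfolding Suc by (simp add: power_mult_distrib monom_power diff_mult_distrib2 mult.commute)
  also have "?p ^ Suc (Suc s) - 1 = ?p ^ Suc (Suc s) - ?p ^ Suc s + (?p ^ Suc s - 1)"
    using le by linarith
  also have "monom 1 \<dots> = monom 1 (?p ^ Suc (Suc s) - ?p ^ Suc s) * (monom 1 (?p ^ Suc s - 1) :: 'a poly)"
    by (simp add: mult_monom del: power_Suc)
  finally show ?case by (simp add: distrib_left mult.assoc)
qed (use p_gt_1 in simp)

lemma degree_\<Gamma>': "y0 \<noteq> 0 \<Longrightarrow> degree (\<Gamma>' s) = 2 * CHAR('a) ^ s"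
proof (induction s)
  case (Suc s)
  let ?p = "CHAR('a)"
  have G2: "degree G = 2" "G \<noteq> 0" using Suc.prems by (auto simp: G_def)
  have "\<Gamma>' s \<noteq> 0" using Suc p_gt_1 by auto
  then have d1: "degree (\<Gamma>' s ^ ?p) = 2 * ?p ^ Suc s"
    using Suc by (simp add: degree_power_eq)
  have "degree (monom 1 (?p ^ Suc s - 1) * G) = ?p ^ Suc s - 1 + 2"
    using G2 by (simp add: degree_mult_eq degree_monom_eq)
  also have "\<dots> < 2 * ?p ^ Suc s"
    using one_less_power[OF p_gt_1, of "Suc s"] by linarith
  finally show ?case using d1 by (simp add: degree_add_eq_right)
qed (simp add: G_def)

lemma poly_\<Gamma>'_0: "poly (\<Gamma>' s) 0 = z0 ^ (CHAR('a) ^ s)"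
proof (induction s)
  case (Suc s)
  have "CHAR('a) ^ Suc s - 1 > 0" using one_less_power[OF p_gt_1, of "Suc s"] by linarith
  then have "poly (monom 1 (CHAR('a) ^ Suc s - 1)) (0::'a) = 0" by (simp only: poly_monom zero_power mult_zero_right)
  then show ?case by (simp add: Suc mult.commute flip: power_mult)
qed (simp add: G_def)

text \<open>The abstract independence statement is applied in the field of Laurent series, with
  \<open>Y ^ N = Y * F ^ e\<close> and \<open>w = W / \<xi>\<close>; unique representation at the
  generic point follows.\<close>

lemma generic_independent:
  assumes a: "a \<noteq> 0" and real: "realization (fps_const a + fps_X) Y W" and Y: "Y \<noteq> 0"
    and T: "val T (fps_const a + fps_X) Y W = 0" and i: "i \<in> I"
  shows "T i = 0"
proof -
  let ?p = "CHAR('a)"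
  define N where "N = ?p ^ f"
  define \<xi> where "\<xi> = fps_const a + fps_X"
  define E :: "'a fps \<Rightarrow> 'a fls" where "E = fps_to_fls"
  have E: "E 0 = 0" "E 1 = 1" "E (x + y) = E x + E y" "E (x * y) = E x * E y" "E (x - y) = E x - E y"
    "E (- x) = - E x" "E (x ^ n) = E x ^ n" "E x = E y \<longleftrightarrow> x = y" "E x = 0 \<longleftrightarrow> x = 0" for x y n
    by (simp_all add: E_def fls_times_fps_to_fls fps_to_fls_power)
  have E_sum: "E (sum h S) = (\<Sum>x\<in>S. E (h x))" for h and S :: "'z set"
    by (induction S rule: infinite_finite_induct) (auto simp: E)
  define ev where "ev = (\<lambda>P. E (fps_eval P \<xi>))"
  have ev: "ev 0 = 0" "ev 1 = 1" "ev (P + R) = ev P + ev R" "ev (P * R) = ev P * ev R"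
    "ev (P - R) = ev P - ev R" "ev (P ^ n) = ev P ^ n" "ev P = ev R \<longleftrightarrow> P = R" "ev P = 0 \<longleftrightarrow> P = 0" for P R n
  proof -
    show eq0: "ev P = 0 \<longleftrightarrow> P = 0" for P by (simp add: ev_def E \<xi>_def)
    show diff: "ev (P - R) = ev P - ev R" for P R by (simp add: ev_def E)
    show "ev P = ev R \<longleftrightarrow> P = R" using eq0[of "P - R"] by (simp add: diff)
  qed (simp_all add: ev_def E)
  have ev_x: "ev (monom 1 n) = E \<xi> ^ n" for n by (simp add: ev_def E)
  have \<xi>0: "\<xi> \<noteq> 0"
    using fps_eval_shift_eq_0_iff[of "[:0, 1:]" a] by (simp add: \<xi>_def fps_eval_pCons)
  \<comment> \<open>The copy of the rational function field inside the Laurent series.\<close>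
  define K where "K = {x. \<exists>A B. B \<noteq> 0 \<and> x = ev A / ev B}"
  have evK: "ev P \<in> K" for P
    unfolding K_def by (rule CollectI, rule exI[of _ P], rule exI[of _ 1]) (simp add: ev)
  obtain e where e: "N - 1 = d * e" using d by (auto simp: N_def elim: dvdE)
  have N1: "N > 1" using N_gt_1 by (simp add: N_def)
  then have N: "N = e * d + 1" "e > 0" using e by (auto simp: mult.commute intro: Nat.gr0I)
  define y where "y = E Y"
  define w where "w = E W / E \<xi>"
  define A where "A = ev F ^ e"
  define \<gamma> where "\<gamma> = ev (\<Gamma> f) / ev (monom 1 N)"
  have Yd: "Y ^ d = fps_eval F \<xi>" using real by (simp add: realization_def \<xi>_def)
  have mono0: "monom 1 n \<noteq> (0 :: 'a poly)" for n by (simp add: monom_eq_0_iff)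
  \<comment> \<open>The factor \<open>x ^ c\<close> converts coefficients with respect to
    \<open>W ^ c\<close> into coefficients with respect to \<open>w ^ c\<close>.\<close>
  define h where "h = (\<lambda>b c. ev (T (b, c) * monom 1 c))"
  have "\<forall>b<d. \<forall>c<?p. h b c = 0"
  proof (rule kummer_artin_schreier_independent[where K = K and y = y and w = w and \<gamma> = \<gamma> and A = A and s = f and N = N])
    show "prime CHAR('a fls)" using char by simp
    show "N = CHAR('a fls) ^ f" by (simp add: N_def)
    show "1 \<in> K" using evK[of 1] by (simp add: ev)
    show "u + v \<in> K" if uv: "u \<in> K" "v \<in> K" for u v
    proof -
      obtain A B A' B' where *: "B \<noteq> 0" "u = ev A / ev B" "B' \<noteq> 0" "v = ev A' / ev B'"
        using uv unfolding K_def by blast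
      have "u + v = ev (A * B' + A' * B) / ev (B * B')" using * by (simp add: ev field_simps)
      then show ?thesis using * unfolding K_def by (metis (mono_tags, lifting) CollectI mult_eq_0_iff)
    qed
    show "- u \<in> K" if u: "u \<in> K" for u
    proof -
      obtain A B where *: "B \<noteq> 0" "u = ev A / ev B" using u unfolding K_def by blast
      have "- u = ev (0 - A) / ev B" using * by (simp only: ev) simp
      then show ?thesis using * unfolding K_def by blast
    qed
    show "u * v \<in> K" if uv: "u \<in> K" "v \<in> K" for u v
    proof -
      obtain A B A' B' where *: "B \<noteq> 0" "u = ev A / ev B" "B' \<noteq> 0" "v = ev A' / ev B'"
        using uv unfolding K_def by blast
      have "u * v = ev (A * A') / ev (B * B')" using * by (simp add: ev)
      then show ?thesis using * unfolding K_def by (metis (mono_tags, lifting) CollectI mult_eq_0_iff)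
    qed
    show "inverse u \<in> K" if u: "u \<in> K" for u
    proof -
      obtain A B where *: "B \<noteq> 0" "u = ev A / ev B" using u unfolding K_def by blast
      show ?thesis
      proof (cases "A = 0")
        case True
        then show ?thesis using * evK[of 0] by (simp add: ev)
      next
        case False
        then show ?thesis using * unfolding K_def by force
      qed
    qed
    show "y \<noteq> 0" using Y by (simp add: y_def E)
    show "A \<in> K" unfolding A_def ev(6)[symmetric] by (rule evK)
    show "y ^ N = y * A"
      by (simp add: y_def N A_def ev_def power_mult mult.commute[of e] Yd flip: E)
    show "\<gamma> \<in> K" unfolding \<gamma>_def K_def using mono0 by blast
    show "w ^ N = w + \<gamma>"
    proof -
      have "E W ^ N = E \<xi> ^ (N - 1) * E W + ev (\<Gamma> f)"
        using realization_power_W[OF real, of f] by (simp add: N_def \<xi>_def ev_def flip: E)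
      moreover have "E \<xi> ^ N = E \<xi> ^ (N - 1) * E \<xi>" using N1 by (metis Suc_diff_1 less_trans mult.commute power_Suc zero_less_one)
      ultimately show ?thesis
        using \<xi>0 by (simp add: w_def power_divide add_divide_distrib \<gamma>_def ev_x E)
    qed
    show "v ^ N * A ^ b \<noteq> v" if b: "0 < b" "b < d" and v: "v \<in> K" "v \<noteq> 0" for b v
    proof
      assume eq: "v ^ N * A ^ b = v"
      obtain A' B' where *: "B' \<noteq> 0" "v = ev A' / ev B'" using v unfolding K_def by blast
      then have A': "A' \<noteq> 0" using v by (auto simp: ev)
      have "ev A' ^ N * ev B' * ev F ^ (e * b) = ev A' * ev B' ^ N"
      proof -
        have "ev F ^ (e * b) = A ^ b" by (simp add: A_def power_mult)
        then show ?thesis using eq * A' by (simp add: power_divide field_simps ev)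
      qed
      then have "A' ^ N * B' * F ^ (e * b) = A' * B' ^ N" by (simp flip: ev)
      with kummer_nondegenerate[OF A' *(1) F H N b] show False by blast
    qed
    show "v ^ N - v \<noteq> \<gamma>" if v: "v \<in> K" for v
    proof
      assume eq: "v ^ N - v = \<gamma>"
      obtain A' B' where *: "B' \<noteq> 0" "v = ev A' / ev B'" using v unfolding K_def by blast
      obtain s where s: "f = Suc s" using f by (cases f) auto
      \<comment> \<open>After cancellation \<gamma> equals \<open>\<Gamma>' s / x ^ M\<close> with
        \<open>M = N / CHAR('a)\<close>. It has a pole of order \<open>M < N\<close> at 0 or at
        infinity, according to which of \<open>z0\<close> and \<open>y0\<close> is nonzero.\<close>
      define M where "M = ?p ^ s"
      have M: "0 < M" "M < N" using p_gt_1 by (auto simp: M_def N_def s)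
      have \<Gamma>f: "\<Gamma> f = monom 1 (N - M) * \<Gamma>' s" by (simp only: s \<Gamma>_conv N_def M_def)
      have BN: "ev B' ^ N = ev B' * ev B' ^ (N - 1)" using N1 by (metis Suc_diff_1 less_trans power_Suc zero_less_one)
      have xN: "ev (monom 1 N) = ev (monom 1 (N - M)) * ev (monom 1 M)"
        using M by (simp add: mult_monom flip: ev)
      have "\<gamma> = ev (\<Gamma>' s) / ev (monom 1 M)"
        using mono0[of "N - M"] by (simp add: \<gamma>_def \<Gamma>f xN ev)
      with eq have "ev A' ^ N / ev B' ^ N - ev A' / ev B' = ev (\<Gamma>' s) / ev (monom 1 M)"
        by (simp add: * power_divide)
      moreover have "ev A' / ev B' = ev A' * ev B' ^ (N - 1) / ev B' ^ N" using * BN by (simp add: ev)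
      ultimately have "(ev A' ^ N - ev A' * ev B' ^ (N - 1)) / ev B' ^ N = ev (\<Gamma>' s) / ev (monom 1 M)"
        by (simp add: diff_divide_distrib)
      then have "(ev A' ^ N - ev A' * ev B' ^ (N - 1)) * ev (monom 1 M) = ev (\<Gamma>' s) * ev B' ^ N"
        using * mono0[of M] by (simp add: frac_eq_eq ev)
      then have "(A' ^ N - A' * B' ^ (N - 1)) * monom 1 M = \<Gamma>' s * B' ^ N"
        by (simp only: ev[symmetric])
      moreover have "(A' ^ N - A' * B' ^ (N - 1)) * monom 1 M \<noteq> \<Gamma>' s * B' ^ N"
      proof (cases "y0 = 0")
        case True
        with yz have "z0 \<noteq> 0" by simp
        then have "poly (\<Gamma>' s) 0 \<noteq> 0" unfolding poly_\<Gamma>'_0 by simp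
        with * M show ?thesis by (intro artin_schreier_nondegenerate_zero)
      next
        case False
        with * M show ?thesis by (intro artin_schreier_nondegenerate_infinity) (simp_all add: degree_\<Gamma>' M_def)
      qed
      ultimately show False by blast
    qed
    show "h b c \<in> K" for b c unfolding h_def by (rule evK)
    show "(\<Sum>b<d. \<Sum>c<?p. h b c * y ^ b * w ^ c) = 0"
    proof -
      have "0 = E (val T \<xi> Y W)" using T by (simp add: \<xi>_def E)
      also have "\<dots> = (\<Sum>i\<in>I. ev (T i) * (y ^ fst i * (E \<xi> * w) ^ snd i))"
        using \<xi>0 by (simp add: val_def bas_def E_sum E ev_def y_def w_def)
      also have "\<dots> = (\<Sum>i\<in>I. h (fst i) (snd i) * y ^ fst i * w ^ snd i)"
        by (simp add: h_def ev ev_x power_mult_distrib mult_ac)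
      also have "\<dots> = (\<Sum>b<d. \<Sum>c<?p. h b c * y ^ b * w ^ c)"
        by (simp add: I_def sum.cartesian_product case_prod_unfold)
      finally show ?thesis by simp
    qed
  qed simp_all
  then have "h (fst i) (snd i) = 0" using i by (auto simp: I_def)
  then show ?thesis by (simp add: h_def ev(8) mono0)
qed

lemma rep_val: "(\<And>i. degree (T i) \<le> m) \<Longrightarrow> rep m (\<lambda>\<xi> Y W. val T \<xi> Y W)"
  by (rule repI) auto

lemma val_poly_sum:
  "val (\<lambda>k. \<Sum>x\<in>S. P x * T x k) \<xi> Y W = (\<Sum>x\<in>S. fps_eval (P x) \<xi> * val (T x) \<xi> Y W)"
  unfolding val_def fps_eval_sum sum_distrib_left sum_distrib_right
  by (subst sum.swap) (simp add: mult.assoc)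

text \<open>A substitute for the norm: linear algebra finds a nonzero \<open>V\<close> such that
  \<open>val T * val V\<close> is a polynomial in \<xi> alone. The order of vanishing of that
  polynomial at \<open>a\<close> is at most its degree, and it bounds the order of
  \<open>val T\<close>.\<close>

lemma subdegree_val_le:
  assumes a: "a \<noteq> 0" and real: "realization (fps_const a + fps_X) Y W" and Y: "Y \<noteq> 0"
    and deg: "\<And>i. degree (T i) \<le> m" and T: "i \<in> I" "T i \<noteq> 0"
  shows "val T (fps_const a + fps_X) Y W \<noteq> 0"
    and "subdegree (val T (fps_const a + fps_X) Y W) \<le> card I * (m + \<kappa>\<^sub>0)"
proof -
  define \<xi> where "\<xi> = fps_const a + fps_X"
  note indep = generic_independent[OF a real Y, folded \<xi>_def]
  show *: "val T (fps_const a + fps_X) Y W \<noteq> 0" using generic_independent[OF a real Y _ T(1)] T(2) by blast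
  have "\<exists>S. (\<forall>k. degree (S k) \<le> m + \<kappa>\<^sub>0) \<and> (\<forall>\<xi> Y W. realization \<xi> Y W \<longrightarrow> val T \<xi> Y W * bas j Y W = val S \<xi> Y W)" if "j \<in> I" for j
    using rep_mult[OF rep_val[OF deg] rep_bas_base[OF that]] unfolding rep_def by simp
  then obtain S where S: "\<And>j k. j \<in> I \<Longrightarrow> degree (S j k) \<le> m + \<kappa>\<^sub>0"
    "\<And>j. j \<in> I \<Longrightarrow> val T \<xi> Y W * bas j Y W = val (S j) \<xi> Y W"
    using real unfolding \<xi>_def by metis
  define D where "D = card I"
  have D1: "D \<ge> 1" using I_nonempty finite_I by (auto simp: D_def Suc_le_eq card_gt_0_iff)
  \<comment> \<open>The smallest degree bound for \<open>V\<close> that works: with it the number of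
    unknown coefficients exceeds by exactly one the number of equations, which require all
    components other than \<open>(0, 0)\<close> of the product to vanish.\<close>
  define M where "M = (D - 1) * (m + \<kappa>\<^sub>0)"
  define U where "U = I \<times> {..M}"
  define E where "E = (I - {(0, 0)}) \<times> {..M + m + \<kappa>\<^sub>0}"
  have "card E < card U"
  proof -
    obtain D' where D': "D = Suc D'" using D1 by (cases D) auto
    have "card E = D' * (M + m + \<kappa>\<^sub>0 + 1)" "card U = Suc D' * (M + 1)"
      using I_nonempty D' by (simp_all add: E_def U_def card_cartesian_product D_def)
    then show ?thesis by (simp add: M_def D' algebra_simps)
  qed
  then obtain x where x: "\<exists>u\<in>U. x u \<noteq> 0"
    "\<forall>e\<in>E. (\<Sum>u\<in>U. coeff (monom 1 (snd u) * S (fst u) (fst e)) (snd e) * x u) = 0"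
    using homogeneous_system_nontrivial_solution[of E U "\<lambda>e u. coeff (monom 1 (snd u) * S (fst u) (fst e)) (snd e)"]
    by (auto simp: E_def U_def)
  define V where "V = (\<lambda>j. \<Sum>n\<le>M. monom (x (j, n)) n)"
  define R where "R = (\<lambda>k. \<Sum>u\<in>U. monom (x u) (snd u) * S (fst u) k)"
  have degR: "degree (R k) \<le> M + m + \<kappa>\<^sub>0" for k
    unfolding R_def
  proof (intro degree_sum_le)
    fix u assume "u \<in> U"
    then have "fst u \<in> I" "snd u \<le> M" by (auto simp: U_def)
    then have "degree (monom (x u) (snd u) * S (fst u) k) \<le> M + (m + \<kappa>\<^sub>0)"
      by (intro order.trans[OF degree_mult_le] add_mono S order.trans[OF degree_monom_le])
    then show "degree (monom (x u) (snd u) * S (fst u) k) \<le> M + m + \<kappa>\<^sub>0" by simp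
  qed (simp add: U_def)
  have R0: "R k = 0" if k: "k \<in> I - {(0, 0)}" for k
  proof (rule poly_eqI)
    fix n
    show "coeff (R k) n = coeff 0 n"
    proof (cases "n \<le> M + m + \<kappa>\<^sub>0")
      case True
      then have "(k, n) \<in> E" using k by (simp add: E_def)
      with x(2) have "(\<Sum>u\<in>U. coeff (monom 1 (snd u) * S (fst u) k) n * x u) = 0" by fastforce
      moreover have "monom (x u) (snd u) = smult (x u) (monom 1 (snd u))" for u by (simp add: smult_monom)
      ultimately show ?thesis by (simp add: R_def coeff_sum mult.commute)
    next
      case False
      then show ?thesis using degR[of k] by (simp add: coeff_eq_0)
    qed
  qed
  have "val T \<xi> Y W * val V \<xi> Y W = (\<Sum>u\<in>U. fps_eval (monom (x u) (snd u)) \<xi> * val (S (fst u)) \<xi> Y W)"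
  proof -
    have "val T \<xi> Y W * val V \<xi> Y W = (\<Sum>j\<in>I. \<Sum>n\<le>M. fps_eval (monom (x (j, n)) n) \<xi> * (val T \<xi> Y W * bas j Y W))"
      unfolding val_def[of V] unfolding V_def fps_eval_sum by (simp add: sum_distrib_left sum_distrib_right mult_ac)
    also have "\<dots> = (\<Sum>j\<in>I. \<Sum>n\<le>M. fps_eval (monom (x (j, n)) n) \<xi> * val (S j) \<xi> Y W)"
      by (intro sum.cong refl) (simp only: S)
    finally show ?thesis by (simp add: U_def sum.cartesian_product case_prod_unfold)
  qed
  also have "\<dots> = val R \<xi> Y W" unfolding R_def by (rule val_poly_sum[symmetric])
  also have "\<dots> = (\<Sum>k\<in>{(0, 0)}. fps_eval (R k) \<xi> * bas k Y W)"
    unfolding val_def using R0 I_nonempty by (intro sum.mono_neutral_right) auto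
  finally have prod: "val T \<xi> Y W * val V \<xi> Y W = fps_eval (R (0, 0)) \<xi>" by (simp add: bas_def)
  have "val V \<xi> Y W \<noteq> 0"
  proof
    assume 0: "val V \<xi> Y W = 0"
    obtain j n where jn: "j \<in> I" "n \<le> M" "x (j, n) \<noteq> 0" using x(1) by (auto simp: U_def)
    have "coeff (V j) n = x (j, n)" using jn by (simp add: V_def coeff_sum)
    with indep[OF 0 jn(1)] jn show False by simp
  qed
  with * prod have nz: "R (0, 0) \<noteq> 0" "val T \<xi> Y W * val V \<xi> Y W \<noteq> 0" by (auto simp: \<xi>_def)
  have "subdegree (val T \<xi> Y W) \<le> subdegree (val T \<xi> Y W * val V \<xi> Y W)"
    using nz(2) by (subst subdegree_mult) auto
  also have "\<dots> \<le> degree (R (0, 0))" unfolding prod unfolding \<xi>_def using nz(1) by (rule subdegree_fps_eval_shift_le)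
  also have "\<dots> \<le> M + m + \<kappa>\<^sub>0" by (rule degR)
  also have "\<dots> = card I * (m + \<kappa>\<^sub>0)"
    using D1 by (cases D) (simp_all add: M_def flip: D_def)
  finally show "subdegree (val T (fps_const a + fps_X) Y W) \<le> card I * (m + \<kappa>\<^sub>0)" by (simp add: \<xi>_def)
qed

lemma char_dvd_power_iff: "CHAR('a) ^ f = Suc n \<Longrightarrow> of_nat n = (- 1 :: 'a)"
proof -
  assume "CHAR('a) ^ f = Suc n"
  moreover have "of_nat (CHAR('a) ^ f) = (0 :: 'a)" using f by simp
  ultimately have "1 + of_nat n = (0 :: 'a)" by simp
  then show ?thesis by (simp add: eq_neg_iff_add_eq_0 add.commute)
qed

lemma card_fibre_Y:
  assumes "c \<noteq> 0"
  shows "card {y::'a. y ^ d = c} = d"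
proof -
  obtain e where e: "CHAR('a) ^ f - 1 = d * e" using d by (elim dvdE)
  then have "CHAR('a) ^ f = Suc (d * e)" using N_gt_1 by linarith
  then have "of_nat (d * e) = (- 1 :: 'a)" by (rule char_dvd_power_iff)
  then have d0: "of_nat d \<noteq> (0 :: 'a)" by auto
  let ?P = "monom 1 d - [:c:]"
  have deg: "degree ?P = d"
    using d_pos by (simp add: degree_monom_eq diff_conv_add_uminus degree_add_eq_left del: add_uminus_conv_diff)
  have "card {y. poly ?P y = 0} = degree ?P"
  proof (rule card_roots_eq_degree)
    show "?P \<noteq> 0" using deg d_pos by auto
    fix y assume "poly ?P y = 0"
    then have "y ^ d = c" by (simp add: poly_monom)
    with assms d_pos have "y \<noteq> 0" by (auto simp: zero_power)
    then show "poly (pderiv ?P) y \<noteq> 0"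
      using d0 by (simp add: pderiv_diff pderiv_monom poly_monom pderiv_pCons)
  qed
  then show ?thesis by (simp add: deg poly_monom)
qed

lemma card_fibre_W:
  assumes "x \<noteq> 0"
  shows "card {w::'a. w ^ CHAR('a) = x ^ (CHAR('a) - 1) * (w + c)} = CHAR('a)"
proof -
  let ?p = "CHAR('a)"
  define R where "R = [:x ^ (?p - 1) * c, x ^ (?p - 1):]"
  let ?P = "monom 1 ?p - R"
  have deg: "degree ?P = ?p"
  proof -
    have "degree R < degree (monom 1 ?p :: 'a poly)"
      using p_gt_1 by (simp add: degree_monom_eq R_def)
    then show ?thesis using degree_add_eq_left[of "- R" "monom 1 ?p"]
      by (simp add: degree_monom_eq)
  qed
  have "card {y. poly ?P y = 0} = degree ?P"
  proof (rule card_roots_eq_degree)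
    show "?P \<noteq> 0" using deg p_gt_1 by auto
    fix y show "poly (pderiv ?P) y \<noteq> 0"
      using assms by (simp add: pderiv_diff pderiv_monom pderiv_pCons R_def)
  qed
  also note deg
  finally show ?thesis by (simp add: poly_monom R_def algebra_simps)
qed

lemma val_at_point:
  "val T (fps_const x) (fps_const y) (fps_const w) =
     fps_const (\<Sum>b<d. \<Sum>c<CHAR('a). poly (T (b, c)) x * y ^ b * w ^ c)"
  by (simp add: val_def bas_def I_def sum.cartesian_product case_prod_unfold
      fps_const_hom.hom_sum fps_const_power fps_const_mult mult.assoc)

text \<open>The fibre over \<open>x\<close> is a full grid of \<open>d\<close> values of
  \<open>y\<close> and \<open>CHAR('a)\<close> values of \<open>w\<close>, so the polynomial in
  \<open>y\<close> and \<open>w\<close> vanishes identically by two applications of the bound for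
  the number of roots. Points of the curve are thereby traded for roots of one coefficient
  polynomial.\<close>

lemma vanishing_on_fibre:
  assumes x: "x \<noteq> 0" "poly F x \<noteq> 0"
    and van: "\<And>y w. realization (fps_const x) (fps_const y) (fps_const w) \<Longrightarrow>
       val T (fps_const x) (fps_const y) (fps_const w) = 0"
    and i: "i \<in> I"
  shows "poly (T i) x = 0"
proof -
  let ?p = "CHAR('a)"
  define YS where "YS = {y. y ^ d = poly F x}"
  define WS where "WS = {w. w ^ ?p = x ^ (?p - 1) * (w + poly G x)}"
  have Y: "card YS = d" "finite YS" and W: "card WS = ?p" "finite WS"
    using card_fibre_Y[OF x(2)] card_fibre_W[OF x(1), of "poly G x"] d_pos p_gt_1
    by (auto simp: YS_def WS_def intro: card_ge_0_finite)
  have "(\<Sum>b<d. (\<Sum>c<?p. poly (T (b, c)) x * w ^ c) * y ^ b) = 0" if "y \<in> YS" "w \<in> WS" for y w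
  proof -
    have "realization (fps_const x) (fps_const y) (fps_const w)"
      using that by (simp add: realization_def YS_def WS_def fps_const_power)
    from van[OF this] show ?thesis by (simp add: val_at_point sum_distrib_right sum_distrib_left mult_ac)
  qed
  then have "(\<Sum>c<?p. poly (T (b, c)) x * w ^ c) = 0" if "b < d" "w \<in> WS" for b w
    using power_sum_vanishing_coeffs[of YS d "\<lambda>b. \<Sum>c<?p. poly (T (b, c)) x * w ^ c" b] Y that by simp
  then have "poly (T (b, c)) x = 0" if "b < d" "c < ?p" for b c
    using power_sum_vanishing_coeffs[of WS ?p "\<lambda>c. poly (T (b, c)) x" c] W that by simp
  with i show ?thesis by (auto simp: I_def)
qed

section \<open>The auxiliary function and the point count\<close>

text \<open>The auxiliary function is a combination of terms
  \<open>\<xi> ^ (n + Q * n') * bas i * bas i' ^ Q\<close> with \<open>n \<le> m1\<close> and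
  \<open>n' \<le> m2\<close>. Over \<open>S\<close> its \<open>Q\<close>-th power simplifies to a
  function of degree about \<open>Q * m1 + m2\<close>, small enough to be annihilated by choice of
  the coefficients; \<open>m2\<close> guarantees enough of them. Hypothesis \<open>m1\<close> keeps
  the function itself nonzero. Its degree, about \<open>Q * m2\<close>, bounds
  \<open>card S\<close>.\<close>

lemma stepanov_aux:
  assumes Q: "Q = CHAR('a) ^ s" and d_dvd: "d dvd Q\<^sup>2 - 1"
    and m1: "card I * (m1 + \<kappa>\<^sub>0) < Q"
    and m2: "card I * (m1 + 1) * (m2 + 1) > Q * m1 + m2 + \<kappa>\<^sub>1 * Q + \<kappa>\<^sub>2 + \<kappa>\<^sub>0 + 1"
    and S: "\<And>x. x \<in> S \<Longrightarrow> x \<noteq> 0 \<and> poly F x \<noteq> 0 \<and> x ^ Q\<^sup>2 = x \<and>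
              poly F x ^ ((Q\<^sup>2 - 1) div d) = \<epsilon> \<and> poly (\<Gamma> (2 * s)) x = \<eta> * x"
  shows "card S \<le> m1 + Q * m2 + \<kappa>\<^sub>1 * Q + \<kappa>\<^sub>0"
proof -
  define \<kappa> where "\<kappa> = \<kappa>\<^sub>1 * Q + \<kappa>\<^sub>2 + \<kappa>\<^sub>0"
  have Q1: "Q \<ge> 1" using Q p_gt_1 by simp
  have QQ: "Q\<^sup>2 = CHAR('a) ^ (2 * s)" by (simp add: Q power_mult power2_eq_square flip: power_add mult_2)
  have dream: "(\<Sum>x\<in>X'. g x) ^ Q = (\<Sum>x\<in>X'. g x ^ Q)" for g :: "'z \<Rightarrow> 'a fps" and X'
    using freshmans_dream_sum'[where ?'a = "'a fps", of Q s g X'] char Q by simp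
  have "\<exists>T. (\<forall>k. degree (T k) \<le> \<kappa>) \<and> (\<forall>\<xi> Y W. realization \<xi> Y W \<longrightarrow>
      bas i' Y W ^ Q * bas i (fps_const \<epsilon> * Y) (W + fps_const \<eta> * \<xi>) = val T \<xi> Y W)"
    if "i' \<in> I" "i \<in> I" for i' i
    using rep_mult[OF rep_bas_power[OF that(1), of s] rep_twisted_bas[OF that(2), of \<epsilon> \<eta>]]
    unfolding rep_def by (simp add: \<kappa>_def Q)
  then obtain TT where TT: "\<And>i' i k. i' \<in> I \<Longrightarrow> i \<in> I \<Longrightarrow> degree (TT i' i k) \<le> \<kappa>"
    "\<And>i' i \<xi> Y W. i' \<in> I \<Longrightarrow> i \<in> I \<Longrightarrow> realization \<xi> Y W \<Longrightarrow>
      bas i' Y W ^ Q * bas i (fps_const \<epsilon> * Y) (W + fps_const \<eta> * \<xi>) = val (TT i' i) \<xi> Y W"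
    by metis
  define V where "V = I \<times> {..m1}"
  define V' where "V' = I \<times> {..m2}"
  define U where "U = V \<times> V'"
  define E where "E = I \<times> {..Q * m1 + m2 + \<kappa>}"
  define ex where "ex = (\<lambda>u::((nat \<times> nat) \<times> nat) \<times> ((nat \<times> nat) \<times> nat). Q * snd (fst u) + snd (snd u))"
  define P where "P = (\<lambda>u k. monom 1 (ex u) * TT (fst (fst u)) (fst (snd u)) k)"
  have fin: "finite V" "finite V'" "finite U" "finite E" by (simp_all add: V_def V'_def U_def E_def)
  have ex_le: "ex u \<le> Q * m1 + m2" if "u \<in> U" for u
    using that by (auto simp: U_def V_def V'_def ex_def intro!: add_mono)
  have degP: "degree (P u k) \<le> Q * m1 + m2 + \<kappa>" if "u \<in> U" for u k
    unfolding P_def using that ex_le[OF that]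
    by (intro order.trans[OF degree_mult_le] add_mono TT order.trans[OF degree_monom_le])
       (auto simp: U_def V_def V'_def)
  have "card E < card U"
  proof -
    have "card E = card I * (Q * m1 + m2 + \<kappa> + 1)" by (simp add: E_def card_cartesian_product)
    moreover have "card U = card I * (card I * (m1 + 1) * (m2 + 1))"
      by (simp add: U_def V_def V'_def card_cartesian_product algebra_simps)
    moreover have "card I > 0" using I_nonempty by (auto simp: card_gt_0_iff)
    moreover have "Q * m1 + m2 + \<kappa> + 1 < card I * (m1 + 1) * (m2 + 1)" using m2 by (simp add: \<kappa>_def)
    ultimately show ?thesis by (simp only: mult_less_mono2)
  qed
  then obtain C where C: "\<exists>u\<in>U. C u \<noteq> 0" "\<forall>e\<in>E. (\<Sum>u\<in>U. coeff (P u (fst e)) (snd e) * C u) = 0"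
    using homogeneous_system_nontrivial_solution[of E U "\<lambda>e u. coeff (P u (fst e)) (snd e)"] fin by auto
  have zero: "(\<Sum>u\<in>U. [:C u:] * P u k) = 0" if "k \<in> I" for k
  proof (rule poly_eqI)
    fix n show "coeff (\<Sum>u\<in>U. [:C u:] * P u k) n = coeff 0 n"
    proof (cases "n \<le> Q * m1 + m2 + \<kappa>")
      case True
      then have "(k, n) \<in> E" using that by (simp add: E_def)
      with C(2) show ?thesis by (force simp: coeff_sum mult.commute)
    next
      case False
      then have "coeff (P u k) n = 0" if "u \<in> U" for u
        using degP[OF that, of k] by (intro coeff_eq_0) simp
      then show ?thesis by (simp add: coeff_sum)
    qed
  qed
  have "\<forall>z::'a. \<exists>y. y ^ Q = z" using nth_root_exists Q1 by (metis less_le_trans zero_less_one)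
  \<comment> \<open>The linear system is solved for the coefficients \<open>C\<close> of the
    \<open>Q\<close>-th power; those of the auxiliary function itself are their \<open>Q\<close>-th
    roots.\<close>
  then obtain rt :: "'a \<Rightarrow> 'a" where rt: "\<And>z. rt z ^ Q = z" by metis
  have rt0: "rt z = 0 \<longleftrightarrow> z = 0" for z using rt[of z] Q1
    by (metis less_le_trans power_eq_0_iff zero_less_one zero_power)
  define c where "c = (\<lambda>u. rt (C u))"
  define term1 where "term1 = (\<lambda>u \<xi> Y W. fps_eval (monom (c u) (snd (fst u) + Q * snd (snd u))) \<xi> *
      (bas (fst (fst u)) Y W * bas (fst (snd u)) Y W ^ Q))"
  have "rep (m1 + Q * m2 + (\<kappa>\<^sub>1 * Q + \<kappa>\<^sub>0)) (\<lambda>\<xi> Y W. \<Sum>u\<in>U. term1 u \<xi> Y W)"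
    unfolding term1_def
  proof (intro rep_sum rep_poly_mult)
    fix u assume "u \<in> U"
    then have u: "fst (fst u) \<in> I" "snd (fst u) \<le> m1" "fst (snd u) \<in> I" "snd (snd u) \<le> m2"
      by (auto simp: U_def V_def V'_def)
    show "rep (\<kappa>\<^sub>1 * Q + \<kappa>\<^sub>0) (\<lambda>\<xi> Y W. bas (fst (fst u)) Y W * bas (fst (snd u)) Y W ^ Q)"
      using rep_mult[OF rep_bas_base[OF u(1)] rep_bas_power[OF u(3), of s]] by (simp add: Q)
    show "degree (monom (c u) (snd (fst u) + Q * snd (snd u))) \<le> m1 + Q * m2"
      using u by (intro order.trans[OF degree_monom_le] add_mono) auto
  qed
  then obtain R where R: "\<And>k. degree (R k) \<le> m1 + Q * m2 + (\<kappa>\<^sub>1 * Q + \<kappa>\<^sub>0)"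
    "\<And>\<xi> Y W. realization \<xi> Y W \<Longrightarrow> (\<Sum>u\<in>U. term1 u \<xi> Y W) = val R \<xi> Y W"
    unfolding rep_def by blast
  have "\<exists>k\<in>I. R k \<noteq> 0"
  proof (rule ccontr)
    assume "\<not> ?thesis"
    then have R0: "\<And>k. k \<in> I \<Longrightarrow> R k = 0" by blast
    obtain a Y W where gen: "a \<noteq> 0" "realization (fps_const a + fps_X) Y W" "Y \<noteq> 0"
      by (rule ex_generic_realization)
    define \<xi> where "\<xi> = fps_const a + fps_X"
    define v where "v = (\<lambda>r. \<xi> ^ snd r * bas (fst r) Y W)"
    \<comment> \<open>A second \<open>Q\<close>-th root of the coefficients writes the auxiliary
      function as a sum of \<open>v r * u r ^ Q\<close>, where constant combinations of the
      \<open>v r\<close> vanish to order below \<open>Q\<close> by hypothesis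
      \<open>m1\<close>.\<close>
    define u where "u = (\<lambda>r. \<Sum>r'\<in>V'. fps_const (rt (c (r, r'))) * (\<xi> ^ snd r' * bas (fst r') Y W))"
    have as_val: "(\<Sum>r\<in>I \<times> {..m}. fps_const (\<alpha> r) * (\<xi> ^ snd r * bas (fst r) Y W)) =
        val (\<lambda>i. \<Sum>n\<le>m. monom (\<alpha> (i, n)) n) \<xi> Y W" for \<alpha> m
      unfolding val_def fps_eval_sum sum_distrib_right sum.cartesian_product
      by (simp add: case_prod_unfold mult_ac)
    have coeff_val: "coeff (\<Sum>n\<le>m. monom (\<alpha> n) n) k = \<alpha> k" if "k \<le> m" for \<alpha> :: "nat \<Rightarrow> 'a" and m k
      using that by (simp add: coeff_sum)
    have "(\<Sum>r\<in>V. v r * u r ^ Q) \<noteq> 0"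
    proof (rule frobenius_combination_nonzero[OF char Q fin(1)])
      fix \<alpha> :: "(nat \<times> nat) \<times> nat \<Rightarrow> 'a" assume "\<exists>r\<in>V. \<alpha> r \<noteq> 0"
      then obtain i n where in': "i \<in> I" "n \<le> m1" "\<alpha> (i, n) \<noteq> 0" by (auto simp: V_def)
      define T where "T = (\<lambda>i. \<Sum>n\<le>m1. monom (\<alpha> (i, n)) n)"
      have "T i \<noteq> 0" using coeff_val[OF in'(2), of "\<lambda>n. \<alpha> (i, n)"] in'(3) by (auto simp: T_def)
      moreover have "degree (T i) \<le> m1" for i
        unfolding T_def by (intro degree_sum_le) (auto intro: order.trans[OF degree_monom_le])
      ultimately have "val T \<xi> Y W \<noteq> 0" "subdegree (val T \<xi> Y W) \<le> card I * (m1 + \<kappa>\<^sub>0)"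
        using subdegree_val_le[OF gen _ in'(1), of T m1] by (simp_all add: \<xi>_def)
      moreover have "(\<Sum>r\<in>V. fps_const (\<alpha> r) * v r) = val T \<xi> Y W"
        unfolding V_def v_def T_def by (rule as_val)
      ultimately show "(\<Sum>r\<in>V. fps_const (\<alpha> r) * v r) \<noteq> 0 \<and>
          subdegree (\<Sum>r\<in>V. fps_const (\<alpha> r) * v r) < Q" using m1 by simp
    next
      obtain r i n where rin: "r \<in> V" "i \<in> I" "n \<le> m2" "C (r, (i, n)) \<noteq> 0"
        using C(1) by (auto simp: U_def V'_def)
      have "u r \<noteq> 0"
      proof
        assume "u r = 0"
        then have "val (\<lambda>i. \<Sum>n\<le>m2. monom (rt (c (r, (i, n)))) n) \<xi> Y W = 0"
          unfolding u_def V'_def as_val .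
        from generic_independent[OF gen this[unfolded \<xi>_def] rin(2)]
        have "rt (c (r, (i, n))) = 0" using coeff_val[OF rin(3)] by (metis coeff_0)
        with rin show False by (simp add: rt0 c_def)
      qed
      with rin show "\<exists>r\<in>V. u r \<noteq> 0" by blast
    qed
    moreover have "(\<Sum>r\<in>V. v r * u r ^ Q) = (\<Sum>u\<in>U. term1 u \<xi> Y W)"
    proof -
      have "u r ^ Q = (\<Sum>r'\<in>V'. fps_const (c (r, r')) * (\<xi> ^ (Q * snd r') * bas (fst r') Y W ^ Q))" for r
        by (simp add: u_def dream power_mult_distrib fps_const_power rt mult.commute[of Q] power_mult)
      then show ?thesis
        by (simp add: U_def sum.cartesian_product case_prod_unfold term1_def v_def sum_distrib_left power_add mult_ac)
    qed
    moreover have "val R \<xi> Y W = 0" by (simp add: val_def R0)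
    ultimately show False using R(2)[OF gen(2)] by (simp add: \<xi>_def)
  qed
  then obtain k where k: "k \<in> I" "R k \<noteq> 0" by blast
  have "poly (R k) x = 0" if x: "x \<in> S" for x
  proof (rule vanishing_on_fibre[OF _ _ _ k(1)])
    note Sx = S[OF x]
    show "x \<noteq> 0" "poly F x \<noteq> 0" using Sx by auto
    fix y w assume real: "realization (fps_const x) (fps_const y) (fps_const w)"
    have y: "y ^ Q\<^sup>2 = \<epsilon> * y"
    proof -
      have "y ^ d = poly F x" using real by (simp add: realization_def fps_const_power)
      moreover have "Q\<^sup>2 = Suc (d * ((Q\<^sup>2 - 1) div d))"
        using d_dvd Q1 by simp
      ultimately have "y ^ Q\<^sup>2 = y * poly F x ^ ((Q\<^sup>2 - 1) div d)"
        by (metis power_Suc power_mult)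
      with Sx show ?thesis by (simp add: mult.commute)
    qed
    have xq: "x ^ (Q\<^sup>2 - 1) = 1"
    proof -
      have "x * x ^ (Q\<^sup>2 - 1) = x * 1" using Sx Q1 by (simp flip: power_Suc)
      with Sx show ?thesis by (metis mult_cancel_left)
    qed
    have w: "w ^ Q\<^sup>2 = w + \<eta> * x"
    proof -
      have "fps_const (w ^ Q\<^sup>2) = fps_const (x ^ (Q\<^sup>2 - 1) * w + poly (\<Gamma> (2 * s)) x)"
        using realization_power_W[OF real, of "2 * s"] by (simp add: QQ fps_const_power)
      then show ?thesis using Sx xq by simp
    qed
    let ?x = "fps_const x" and ?y = "fps_const y" and ?w = "fps_const w"
    have basQ: "(bas i ?y ?w ^ Q) ^ Q = bas i (fps_const \<epsilon> * ?y) (?w + fps_const \<eta> * ?x)" for i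
    proof -
      have "(bas i ?y ?w ^ Q) ^ Q = fps_const ((y ^ Q\<^sup>2) ^ fst i * (w ^ Q\<^sup>2) ^ snd i)"
        by (simp add: bas_def fps_const_power fps_const_mult power_mult_distrib power2_eq_square mult_ac flip: power_mult)
      then show ?thesis by (simp add: y w bas_def fps_const_power fps_const_mult)
    qed
    \<comment> \<open>Here \<open>x ^ Q\<^sup>2 = x\<close> and the prescribed character values
      enter: the second factors become twisted monomials of bounded degree, and
      \<open>x ^ (Q * Q * n')\<close> becomes \<open>x ^ n'\<close>.\<close>
    have "(\<Sum>u\<in>U. term1 u ?x ?y ?w) ^ Q = (\<Sum>u\<in>U. fps_eval [:C u:] ?x * (fps_eval (monom 1 (ex u)) ?x * val (TT (fst (fst u)) (fst (snd u))) ?x ?y ?w))"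
      unfolding dream
    proof (intro sum.cong refl)
      fix u assume "u \<in> U"
      then have u: "fst (fst u) \<in> I" "fst (snd u) \<in> I" by (auto simp: U_def V_def V'_def)
      have "x ^ ((snd (fst u) + Q * snd (snd u)) * Q) = x ^ (Q * snd (fst u)) * (x ^ Q\<^sup>2) ^ snd (snd u)"
        by (simp add: power_add power2_eq_square algebra_simps flip: power_mult)
      also have "\<dots> = x ^ ex u" using Sx by (simp add: ex_def power_add)
      finally have "?x ^ ((snd (fst u) + Q * snd (snd u)) * Q) = ?x ^ ex u" by (simp add: fps_const_power)
      then show "term1 u ?x ?y ?w ^ Q = fps_eval [:C u:] ?x * (fps_eval (monom 1 (ex u)) ?x * val (TT (fst (fst u)) (fst (snd u))) ?x ?y ?w)"
        unfolding TT(2)[OF u real, symmetric] basQ[symmetric]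
        by (simp add: term1_def power_mult_distrib c_def rt poly_monom fps_const_power mult_ac flip: power_mult)
    qed
    also have "\<dots> = val (\<lambda>k. \<Sum>u\<in>U. [:C u:] * P u k) ?x ?y ?w"
      unfolding P_def mult.assoc[symmetric] val_poly_sum by (simp add: mult.assoc)
    also have "\<dots> = 0" by (simp add: val_def zero del: mult_pCons_left)
    finally have "(\<Sum>u\<in>U. term1 u ?x ?y ?w) = 0" using Q1 by simp
    with R(2)[OF real] show "val R ?x ?y ?w = 0" by simp
  qed
  then have "S \<subseteq> {x. poly (R k) x = 0}" by blast
  then have "card S \<le> card {x. poly (R k) x = 0}" by (intro card_mono poly_roots_finite k)
  also have "\<dots> \<le> degree (R k)" by (rule card_poly_roots_bound[OF k(2)])
  also have "\<dots> \<le> m1 + Q * m2 + (\<kappa>\<^sub>1 * Q + \<kappa>\<^sub>0)" by (rule R)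
  finally show ?thesis by simp
qed

lemma poly_\<Gamma>:
  assumes "x \<noteq> 0"
  shows "poly (\<Gamma> s) x = x ^ (CHAR('a) ^ s) * (\<Sum>i<s. (y0 * x + z0 / x) ^ (CHAR('a) ^ i))"
proof (induction s)
  case (Suc s)
  let ?p = "CHAR('a)" and ?g = "y0 * x + z0 / x"
  have G: "poly G x = x * ?g" using assms by (simp add: G_def algebra_simps)
  have "x ^ (?p ^ Suc s) = x ^ (?p ^ Suc s - 1) * x"
    using one_less_power[OF p_gt_1, of "Suc s"] by (metis Suc_diff_1 less_trans mult.commute power_Suc zero_less_one zero_less_Suc)
  then have "poly (\<Gamma> (Suc s)) x = x ^ (?p ^ Suc s) * ?g + poly (\<Gamma> s) x ^ ?p"
    by (simp add: poly_monom G mult.assoc)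
  also have "poly (\<Gamma> s) x ^ ?p = x ^ (?p ^ Suc s) * (\<Sum>i<s. ?g ^ (?p ^ Suc i))"
    unfolding Suc power_mult_distrib freshmans_dream_sum[OF char refl]
    by (simp add: mult.commute flip: power_mult)
  finally show ?case
    unfolding sum.lessThan_Suc_shift by (simp add: distrib_left)
qed simp

text \<open>The curve has degree \<open>d * CHAR('a)\<close> over the line, so the main term is the
  expected share of one class. The field has \<open>Q\<^sup>2\<close> elements with
  \<open>Q = CHAR('a) ^ (f * k)\<close>, and the error is a multiple of \<open>Q\<close> uniformly
  in \<open>k\<close>, \<epsilon> and \<eta>.\<close>

theorem stepanov_bound:
  obtains C :: real and k0 :: nat where "\<And>k \<epsilon> \<eta>. k \<ge> k0 \<Longrightarrow>
    real (card {x. x \<noteq> 0 \<and> poly F x \<noteq> 0 \<and> x ^ (CHAR('a) ^ (f * (2 * k))) = x \<and>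
       poly F x ^ ((CHAR('a) ^ (f * (2 * k)) - 1) div d) = \<epsilon> \<and>
       (\<Sum>i<f * (2 * k). (y0 * x + z0 / x) ^ (CHAR('a) ^ i)) = \<eta>})
    \<le> real (CHAR('a) ^ (f * (2 * k))) / real (d * CHAR('a)) + C * real (CHAR('a) ^ (f * k))"
proof -
  let ?p = "CHAR('a)"
  define D where "D = d * ?p"
  have D: "D = card I" "D > 0" using d_pos p_gt_1 by (simp_all add: D_def card_I)
  \<comment> \<open>\<open>B\<close> bounds the loss \<open>Q - D * (m1 + 1)\<close> caused by
    rounding and by \<open>\<kappa>\<^sub>0\<close>; for \<open>Q \<ge> 2 * B\<close> the constant
    \<open>c\<close> leaves enough room in \<open>m2\<close> to compensate for this loss and for the
    degree constants.\<close>
  define B where "B = D * (\<kappa>\<^sub>0 + 1) + 1"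
  define c where "c = 2 * (B + \<kappa>\<^sub>1 + \<kappa>\<^sub>2 + \<kappa>\<^sub>0) + 1"
  define C :: real where "C = 1 + c + \<kappa>\<^sub>1 + \<kappa>\<^sub>0"
  have "real (card {x. x \<noteq> 0 \<and> poly F x \<noteq> 0 \<and> x ^ (?p ^ (f * (2 * k))) = x \<and>
       poly F x ^ ((?p ^ (f * (2 * k)) - 1) div d) = \<epsilon> \<and>
       (\<Sum>i<f * (2 * k). (y0 * x + z0 / x) ^ (?p ^ i)) = \<eta>})
    \<le> real (?p ^ (f * (2 * k))) / real (d * ?p) + C * real (?p ^ (f * k))" (is "real (card ?S) \<le> _")
    if k: "k \<ge> 2 * B" for k \<epsilon> \<eta>
  proof -
    define Q where "Q = ?p ^ (f * k)"
    have QQ: "?p ^ (f * (2 * k)) = Q\<^sup>2" by (simp add: Q_def power2_eq_square flip: power_add) (simp add: mult_2 distrib_left)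
    have "k \<le> f * k" using f by simp
    also have "f * k < ?p ^ (f * k)" using p_gt_1 by (intro power_gt_expt) simp
    finally have Qk: "2 * B \<le> Q" using k by (simp add: Q_def)
    have "B \<ge> D" by (simp add: B_def)
    \<comment> \<open>The largest value for which orders of vanishing stay below \<open>Q\<close>;
      \<open>m2\<close> then exceeds \<open>Q / D\<close> only by a constant, so that
      \<open>Q * m2\<close> is \<open>Q\<^sup>2 / D\<close> up to a multiple of
      \<open>Q\<close>.\<close>
    define m1 where "m1 = Q div D - \<kappa>\<^sub>0 - 1"
    define m2 where "m2 = Q div D + c - 1"
    have m1: "m1 + \<kappa>\<^sub>0 + 1 = Q div D"
    proof -
      have "D * (\<kappa>\<^sub>0 + 1) \<le> Q" using Qk by (simp add: B_def)
      then have "\<kappa>\<^sub>0 + 1 \<le> Q div D" using D by (simp add: less_eq_div_iff_mult_less_eq mult.commute)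
      then show ?thesis by (simp add: m1_def)
    qed
    have m2: "m2 + 1 = Q div D + c" by (simp add: m2_def c_def)
    have QD: "D * (Q div D) \<le> Q" "Q < D * (Q div D) + D"
      using mult_div_mod_eq[of D Q] mod_less_divisor[OF D(2), of Q] by linarith+
    have "card ?S \<le> m1 + Q * m2 + \<kappa>\<^sub>1 * Q + \<kappa>\<^sub>0"
    proof (rule stepanov_aux[where \<epsilon> = \<epsilon> and \<eta> = \<eta>])
      show "Q = ?p ^ (f * k)" by (simp add: Q_def)
      have "?p ^ f - 1 dvd (?p ^ f) ^ j - 1" for j
      proof (induction j)
        case (Suc j)
        have "(?p ^ f) ^ Suc j - 1 = ?p ^ f * ((?p ^ f) ^ j - 1) + (?p ^ f - 1)"
          using N_gt_1 by (simp add: algebra_simps)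
        with Suc show ?case by (metis dvd_add dvd_mult dvd_refl)
      qed simp
      from this[of "2 * k"] d show "d dvd Q\<^sup>2 - 1"
        unfolding QQ[symmetric] power_mult using dvd_trans by blast
      have "D * (m1 + \<kappa>\<^sub>0) < D * (Q div D)" using m1 D by simp
      with QD show "card I * (m1 + \<kappa>\<^sub>0) < Q" unfolding D(1)[symmetric] by linarith
      define A where "A = D * (m1 + 1)"
      have A: "Q \<le> A + B - 1" 
      proof -
        have "D * (Q div D) = A + D * \<kappa>\<^sub>0" by (simp add: A_def algebra_simps flip: m1)
        with QD show ?thesis by (simp add: B_def)
      qed
      have "B \<ge> 1" by (simp add: B_def)
      with A have "real Q \<le> real A - 1 + B" by linarith
      have "real Q * m1 + \<kappa>\<^sub>1 * Q + \<kappa>\<^sub>2 + \<kappa>\<^sub>0 < (real A - 1) * (m2 + 1)"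
      proof -
        have "real Q - B \<ge> Q / 2" using Qk by linarith
        have "real B * (Q div D) + \<kappa>\<^sub>1 * Q + \<kappa>\<^sub>2 + \<kappa>\<^sub>0 < c * (Q / 2)"
        proof -
          have "real (Q div D) \<le> Q" using D by simp
          then have "real B * (Q div D) \<le> real B * Q" by (intro mult_left_mono) auto
          moreover have "real \<kappa>\<^sub>2 \<le> \<kappa>\<^sub>2 * Q" "real \<kappa>\<^sub>0 \<le> \<kappa>\<^sub>0 * Q" "0 < real Q"
            using Qk by (simp_all add: B_def mult_le_cancel_left1)
          moreover have "c * (real Q / 2) = B * Q + \<kappa>\<^sub>1 * Q + \<kappa>\<^sub>2 * Q + \<kappa>\<^sub>0 * Q + Q / 2"
            by (simp add: c_def algebra_simps)
          ultimately show ?thesis unfolding of_nat_mult of_nat_add by linarith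
        qed
        also have "c * (real Q / 2) \<le> c * (real Q - B)"
          using \<open>real Q - B \<ge> Q / 2\<close> by (intro mult_left_mono) auto
        finally have "real B * (Q div D) + \<kappa>\<^sub>1 * Q + \<kappa>\<^sub>2 + \<kappa>\<^sub>0 < c * (real Q - B)" .
        moreover have "real Q * m1 \<le> real Q * (Q div D)" using m1 by (intro mult_left_mono) auto
        ultimately have "real Q * m1 + \<kappa>\<^sub>1 * Q + \<kappa>\<^sub>2 + \<kappa>\<^sub>0 < (real Q - B) * (real (Q div D) + c)"
          by (simp add: algebra_simps)
        also have "real (Q div D) + c = m2 + 1" using m2 by linarith
        also have "(real Q - B) * (m2 + 1) \<le> (real A - 1) * (m2 + 1)"
          using \<open>real Q \<le> real A - 1 + B\<close> by (intro mult_right_mono) auto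
        finally show ?thesis by simp
      qed
      then have "real (Q * m1 + m2 + \<kappa>\<^sub>1 * Q + \<kappa>\<^sub>2 + \<kappa>\<^sub>0 + 1) < real (A * (m2 + 1))"
        by (simp add: algebra_simps)
      then show "Q * m1 + m2 + \<kappa>\<^sub>1 * Q + \<kappa>\<^sub>2 + \<kappa>\<^sub>0 + 1 < card I * (m1 + 1) * (m2 + 1)"
        unfolding A_def D(1) of_nat_less_iff .
    next
      fix x assume x: "x \<in> ?S"
      then have "poly (\<Gamma> (2 * (f * k))) x = x ^ Q\<^sup>2 * \<eta>"
        using poly_\<Gamma>[of x "f * (2 * k)"] by (simp add: QQ mult.left_commute)
      with x show "x \<noteq> 0 \<and> poly F x \<noteq> 0 \<and> x ^ Q\<^sup>2 = x \<and> poly F x ^ ((Q\<^sup>2 - 1) div d) = \<epsilon> \<and>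
          poly (\<Gamma> (2 * (f * k))) x = \<eta> * x"
        unfolding QQ by (auto simp: mult.commute)
    qed
    then have "real (card ?S) \<le> real m1 + real Q * real m2 + real \<kappa>\<^sub>1 * real Q + real \<kappa>\<^sub>0"
      by (simp only: flip: of_nat_add of_nat_mult)
    also have "\<dots> \<le> real Q + real Q * (real Q / real D + real c) + real \<kappa>\<^sub>1 * real Q + real \<kappa>\<^sub>0 * real Q"
    proof (intro add_mono mult_left_mono)
      have "m1 \<le> Q div D" using m1 by linarith
      also have "\<dots> \<le> Q" by simp
      finally show "real m1 \<le> Q" by simp
      have "real m2 \<le> Q div D + c" using m2 by linarith
      also have "\<dots> \<le> Q / D + c" using of_nat_div_le_of_nat[of Q D, where ?'a = real] by simp
      finally show "real m2 \<le> Q / D + c" by simp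
      have "Q \<ge> 1" using Qk by (simp add: B_def)
      then show "real \<kappa>\<^sub>0 \<le> real \<kappa>\<^sub>0 * real Q" by (simp add: mult_le_cancel_left1)
    qed auto
    also have "\<dots> = real (Q\<^sup>2) / D + C * Q"
      by (simp add: C_def power2_eq_square algebra_simps)
    finally show ?thesis unfolding QQ unfolding D_def Q_def .
  qed
  then show ?thesis by (rule that)
qed

end

section \<open>From power sums to the size of reciprocal roots\<close>

text \<open>A fixed linear combination of consecutive power sums isolates the powers of one value,
  since a polynomial can be chosen to vanish at all the others. These powers stay bounded only if
  the value has norm at most 1.\<close>

lemma power_sums_bounded_imp_norm_le_1:
  fixes A :: "'i multiset" and v :: "'i \<Rightarrow> complex"
  assumes bound: "\<And>k. k \<ge> k0 \<Longrightarrow> norm (\<Sum>w\<in>#A. v w ^ k) \<le> C" and w0: "w0 \<in># A"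
  shows "norm (v w0) \<le> 1"
proof (rule ccontr)
  assume "\<not> norm (v w0) \<le> 1"
  then have gt: "norm (v w0) > 1" by simp
  define V where "V = v ` set_mset A - {v w0}"
  define L where "L = (\<Prod>z\<in>V. [:- z, 1:])"
  have L0: "poly L (v w0) \<noteq> 0" by (auto simp: L_def poly_prod V_def)
  have L1: "poly L (v w) = 0" if "w \<in># A" "v w \<noteq> v w0" for w
    using that by (auto simp: L_def poly_prod V_def)
  define A' where "A' = filter_mset (\<lambda>w. v w = v w0) A"
  have key: "(\<Sum>l\<le>degree L. coeff L l * (\<Sum>w\<in>#A. v w ^ (k + l))) = of_nat (size A') * (v w0 ^ k * poly L (v w0))" for k
  proof -
    have "(\<Sum>l\<le>degree L. coeff L l * (\<Sum>w\<in>#A. v w ^ (k + l))) = (\<Sum>w\<in>#A. v w ^ k * poly L (v w))"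
      by (induction A) (simp_all add: poly_altdef sum_distrib_left distrib_left sum.distrib power_add mult_ac)
    also have "\<dots> = (\<Sum>w\<in>#A. if v w = v w0 then v w0 ^ k * poly L (v w0) else 0)"
      using L1 by (intro arg_cong[of _ _ sum_mset] image_mset_cong) auto
    also have "\<dots> = of_nat (size A') * (v w0 ^ k * poly L (v w0))"
      unfolding A'_def by (induction A) (auto simp: algebra_simps)
    finally show ?thesis .
  qed
  have A': "size A' > 0" 
  proof -
    have "w0 \<in># A'" using w0 by (simp add: A'_def)
    then show ?thesis by (metis empty_iff nonempty_has_size set_mset_empty)
  qed
  define C' where "C' = (\<Sum>l\<le>degree L. norm (coeff L l) * C) / norm (poly L (v w0))"
  have "norm (v w0) ^ k \<le> C'" if "k \<ge> k0" for k
  proof -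
    have "norm (v w0) ^ k * norm (poly L (v w0)) \<le> of_nat (size A') * (norm (v w0) ^ k * norm (poly L (v w0)))"
      using A' mult_right_mono[of 1 "real (size A')" "norm (v w0) ^ k * norm (poly L (v w0))"] by simp
    also have "\<dots> = norm (\<Sum>l\<le>degree L. coeff L l * (\<Sum>w\<in>#A. v w ^ (k + l)))"
      unfolding key by (simp add: norm_mult norm_power)
    also have "\<dots> \<le> (\<Sum>l\<le>degree L. norm (coeff L l) * C)"
      using bound that by (intro order.trans[OF norm_sum] sum_mono) (auto simp: norm_mult intro!: mult_left_mono)
    finally show ?thesis using L0 by (simp add: C'_def field_simps)
  qed
  moreover obtain n where n: "C' < norm (v w0) ^ n" using real_arch_pow[OF gt] by blast
  moreover have "norm (v w0) ^ n \<le> norm (v w0) ^ (n + k0)" using gt by (intro power_increasing) auto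
  ultimately show False by (metis le_add2 linorder_not_less order.strict_trans2)
qed

text \<open>The sequence \<open>S\<close> is minus the sequence of power sums of the reciprocal roots of
  \<open>\<Sum>j\<le>D. a j * T ^ j\<close>; a bound on every second power sum forces these to have absolute
  value at most \<open>sqrt N\<close>.\<close>

lemma first_power_sum_bound:
  fixes a S :: "nat \<Rightarrow> complex" and N C :: real
  assumes a0: "a 0 = 1" and aD: "\<And>j. j > D \<Longrightarrow> a j = 0"
    and newton: "\<And>j. of_nat j * a j = (\<Sum>i=1..j. S i * a (j - i))"
    and bound: "\<And>k. k \<ge> k0 \<Longrightarrow> norm (S (2 * k)) \<le> C * N ^ k" and N: "N > 0"
  shows "norm (S 1) \<le> real D * sqrt N"
proof -
  \<comment> \<open>The reversed polynomial: monic of degree exactly \<open>D\<close>, with the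
    reciprocal roots as roots. Zero is allowed among them in case \<open>a D = 0\<close>.\<close>
  define P where "P = (\<Sum>j\<le>D. monom (a j) (D - j))"
  have coeffP: "coeff P (D - j) = a j" if "j \<le> D" for j
  proof -
    have "coeff P (D - j) = (\<Sum>i\<le>D. if i = j then a i else 0)"
      unfolding P_def coeff_sum using that by (intro sum.cong) auto
    then show ?thesis using that by simp
  qed
  have degP: "degree P \<le> D" unfolding P_def by (intro degree_sum_le) (auto intro: order.trans[OF degree_monom_le])
  have "coeff P D = 1" using coeffP[of 0] a0 by simp
  then have deg: "degree P = D" "lead_coeff P = 1" using degP le_degree[of P D] by auto
  then have "P \<noteq> 0" by auto
  then obtain A where A: "size A = D" "P = (\<Prod>x\<in>#A. [:-x, 1:])"
    using alg_closed_imp_factorization[of P] deg by auto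
  define Af where "Af = Abs_fps a"
  have "fps_nth (fps_of_poly (reflect_poly P)) j = a j" for j
    using coeffP[of j] aD[of j] deg by (auto simp: coeff_reflect_poly)
  then have "Af = fps_of_poly (reflect_poly P)" unfolding Af_def by (intro fps_ext) simp
  also have "reflect_poly P = (\<Prod>x\<in>#A. [:1, -x:])"
  proof -
    have "reflect_poly (\<Prod>x\<in>#A. [:-x, 1:]) = (\<Prod>x\<in>#A. [:1, -x:])"
    proof (induction A)
      case (add x A)
      have "reflect_poly [:-x, 1:] = [:1, -x:]" by (cases "x = 0") (auto simp: reflect_poly_def)
      with add show ?case by (simp add: reflect_poly_mult del: mult_pCons_left mult_pCons_right)
    qed auto
    then show ?thesis by (simp only: A(2))
  qed
  finally have Af: "Af = fps_of_poly (\<Prod>x\<in>#A. [:1, -x:])" .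
  \<comment> \<open>The logarithmic derivative of \<open>1 - w T\<close>, multiplied by
    \<open>T\<close>.\<close>
  define G where "G = (\<lambda>w::complex. Abs_fps (\<lambda>i. if i = 0 then 0 else - (w ^ i)))"
  have G: "fps_X * fps_deriv (fps_of_poly [:1, -w:]) = G w * fps_of_poly [:1, -w:]" for w
  proof (rule fps_ext)
    fix n
    have lin: "fps_of_poly [:1, -w:] = 1 - fps_const w * fps_X"
      by (simp add: fps_of_poly_pCons)
    have "fps_nth (G w * fps_of_poly [:1, -w:]) n = fps_nth (G w) n - w * fps_nth (G w * fps_X) n"
      unfolding lin by (simp add: right_diff_distrib mult.left_commute)
    also have "\<dots> = (if n = 1 then - w else 0)"
      by (cases n) (auto simp: G_def fps_mult_fps_X_plus_1_nth)
    also have "\<dots> = fps_nth (fps_X * fps_deriv (fps_of_poly [:1, -w:])) n"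
      unfolding lin by (simp)
    finally show "fps_nth (fps_X * fps_deriv (fps_of_poly [:1, -w:])) n = fps_nth (G w * fps_of_poly [:1, -w:]) n" ..
  qed
  have logderiv: "fps_X * fps_deriv (fps_of_poly (\<Prod>x\<in>#A. [:1, -x:])) = (\<Sum>w\<in>#A. G w) * fps_of_poly (\<Prod>x\<in>#A. [:1, -x:])" for A
  proof (induction A)
    case (add w A)
    let ?u = "fps_of_poly [:1, -w:]" and ?v = "fps_of_poly (\<Prod>x\<in>#A. [:1, -x:])"
    have "fps_X * fps_deriv (fps_of_poly (\<Prod>x\<in>#add_mset w A. [:1, -x:])) = fps_X * fps_deriv (?u * ?v)"
      by (simp add: fps_of_poly_mult del: mult_pCons_left)
    also have "\<dots> = (fps_X * fps_deriv ?u) * ?v + ?u * (fps_X * fps_deriv ?v)"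
      by (simp add: algebra_simps)
    also have "\<dots> = (G w + (\<Sum>w\<in>#A. G w)) * (?u * ?v)" unfolding G add by (simp add: algebra_simps)
    finally show ?case by (simp add: fps_of_poly_mult del: mult_pCons_left)
  qed simp
  define Sf where "Sf = Abs_fps (\<lambda>i. if i = 0 then 0 else S i)"
  have "fps_X * fps_deriv Af = Sf * Af"
  proof (rule fps_ext)
    fix j
    have "fps_nth (Sf * Af) j = (\<Sum>i=0..j. fps_nth Sf i * a (j - i))" by (simp add: fps_mult_nth Af_def)
    also have "\<dots> = (\<Sum>i=1..j. S i * a (j - i))"
      by (intro sum.mono_neutral_cong_right) (auto simp: Sf_def)
    also have "\<dots> = fps_nth (fps_X * fps_deriv Af) j"
      unfolding newton[symmetric] by (cases j) (auto simp: Af_def)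
    finally show "fps_nth (fps_X * fps_deriv Af) j = fps_nth (Sf * Af) j" ..
  qed
  then have "Sf * Af = (\<Sum>w\<in>#A. G w) * Af" using logderiv[of A] unfolding Af by (rule trans[OF sym])
  moreover have "Af \<noteq> 0"
  proof
    assume "Af = 0"
    then have "fps_nth Af 0 = 0" by simp
    then show False by (simp add: Af_def a0)
  qed
  ultimately have "Sf = (\<Sum>w\<in>#A. G w)" by simp
  moreover have "fps_nth (\<Sum>w\<in>#A. G w) i = (\<Sum>w\<in>#A. fps_nth (G w) i)" for i
    by (induction A) auto
  ultimately have Sf_nth: "fps_nth Sf i = (\<Sum>w\<in>#A. fps_nth (G w) i)" for i by simp
  have S: "S i = - (\<Sum>w\<in>#A. w ^ i)" if "i > 0" for i
  proof -
    have "S i = (\<Sum>w\<in>#A. - (w ^ i))" using that Sf_nth[of i] by (simp add: Sf_def G_def)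
    also have "\<dots> = - (\<Sum>w\<in>#A. w ^ i)" by (induction A) auto
    finally show ?thesis .
  qed
  have w_le: "norm w \<le> sqrt N" if "w \<in># A" for w
  proof -
    \<comment> \<open>Only even power sums are controlled, so the squares of the reciprocal roots
      are the values to be bounded.\<close>
    have "norm (w\<^sup>2 / of_real N) \<le> 1"
    proof (rule power_sums_bounded_imp_norm_le_1[where v = "\<lambda>w. w\<^sup>2 / of_real N", OF _ that])
      fix k assume k: "k \<ge> max k0 1"
      have "(\<Sum>w\<in>#A. (w\<^sup>2 / of_real N) ^ k) = (\<Sum>w\<in>#A. w ^ (2 * k)) / of_real N ^ k"
        by (induction A) (simp_all add: power_divide power_mult add_divide_distrib)
      also have "\<dots> = - S (2 * k) / of_real N ^ k" using S[of "2 * k"] k by simp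
      finally have "norm (\<Sum>w\<in>#A. (w\<^sup>2 / of_real N) ^ k) = norm (S (2 * k)) / N ^ k"
        using N by (simp add: norm_divide norm_power)
      also have "\<dots> \<le> C" using bound[of k] k N by (simp add: field_simps)
      finally show "norm (\<Sum>w\<in>#A. (w\<^sup>2 / of_real N) ^ k) \<le> C" .
    qed
    then have "(norm w)\<^sup>2 \<le> N" using N by (simp add: norm_divide norm_power)
    then show ?thesis by (rule real_le_rsqrt)
  qed
  have "norm (S 1) = norm (\<Sum>w\<in>#A. w)" using S[of 1] by simp
  also have "\<dots> \<le> (\<Sum>w\<in>#A. norm w)" by (induction A) (auto intro: norm_triangle_le)
  also have "\<dots> \<le> (\<Sum>w\<in>#A. sqrt N)" using w_le by (intro sum_mset_mono) auto
  also have "\<dots> = real D * sqrt N" using A(1) by simp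
  finally show ?thesis .
qed

section \<open>Monic irreducible polynomials and Euler products\<close>

definition monic_irreducibles :: "'a::field poly set" where
  "monic_irreducibles = {Q. irreducible Q \<and> lead_coeff Q = 1}"

lemma monic_irreducible_factors_altdef:
  "monic_irreducible_factors P = {Q \<in> monic_irreducibles. Q dvd P}"
  by (auto simp: monic_irreducible_factors_def monic_irreducibles_def)

lemma monic_irreducible_prime: "Q \<in> monic_irreducibles \<Longrightarrow> prime_elem Q"
  by (rule field_poly_irreducible_imp_prime) (simp add: monic_irreducibles_def)

lemma monic_irreducible_degree_pos:
  assumes "Q \<in> monic_irreducibles"
  shows "degree Q > 0"
proof (rule ccontr)
  assume "\<not> degree Q > 0"
  then obtain c where "Q = [:c:]" by (auto elim: degree_eq_zeroE)
  with assms have "Q dvd 1" by (auto simp: monic_irreducibles_def one_pCons)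
  with assms show False by (auto simp: monic_irreducibles_def dest: irreducible_not_unit)
qed

lemma monic_irreducible_nonzero: "Q \<in> monic_irreducibles \<Longrightarrow> Q \<noteq> 0"
  by (auto simp: monic_irreducibles_def)

lemma monic_irreducible_dvd_imp_eq:
  assumes "P \<in> monic_irreducibles" "Q \<in> monic_irreducibles" "P dvd Q"
  shows "P = Q"
proof -
  obtain c where c: "Q = P * c" using assms(3) by (elim dvdE)
  have "\<not> P dvd 1" using assms by (auto simp: monic_irreducibles_def dest: irreducible_not_unit)
  then have "c dvd 1" using assms(2) c by (auto simp: monic_irreducibles_def dest: irreducibleD)
  then obtain b where b: "c = [:b:]" by (auto simp: is_unit_poly_iff)
  have "lead_coeff Q = lead_coeff P * b" by (simp add: c b lead_coeff_mult del: mult_pCons_right)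
  then have "b = 1" using assms by (auto simp: monic_irreducibles_def)
  then show ?thesis by (simp add: c b)
qed

lemma ex_monic_associate:
  fixes P :: "'a::field poly"
  assumes "P \<noteq> 0"
  obtains Q c where "c \<noteq> 0" "P = smult c Q" "lead_coeff Q = 1"
proof -
  define c where "c = lead_coeff P"
  have c: "c \<noteq> 0" using assms by (simp add: c_def)
  moreover have "P = smult c (smult (inverse c) P)" using c by simp
  moreover have "lead_coeff (smult (inverse c) P) = 1" using c by (simp add: lead_coeff_smult c_def[symmetric])
  ultimately show ?thesis by (rule that)
qed

lemma irreducible_smultD:
  fixes Q :: "'a::field poly"
  assumes "irreducible (smult c Q)" "c \<noteq> 0"
  shows "irreducible Q"
proof (rule irreducibleI)
  show "Q \<noteq> 0" using assms(1) by (auto simp: irreducible_def)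
  show "\<not> Q dvd 1" using irreducible_not_unit[OF assms(1)] assms(2) smult_dvd_iff[of c Q 1] by simp
  fix a b assume "Q = a * b"
  then have "smult c Q = smult c a * b" by simp
  then have "smult c a dvd 1 \<or> b dvd 1" by (rule irreducibleD[OF assms(1)])
  then show "a dvd 1 \<or> b dvd 1" using assms(2) smult_dvd_iff[of c a 1] by simp
qed

lemma ex_monic_irreducible_factor:
  fixes P :: "'a::field poly"
  assumes "degree P > 0"
  shows "\<exists>Q\<in>monic_irreducibles. Q dvd P"
  using assms
proof (induction "degree P" arbitrary: P rule: less_induct)
  case less
  have P0: "P \<noteq> 0" using less.prems by auto
  show ?case
  proof (cases "irreducible P")
    case True
    obtain Q c where Q: "c \<noteq> 0" "P = smult c Q" "lead_coeff Q = 1" by (rule ex_monic_associate[OF P0])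
    then have "irreducible Q" using True irreducible_smultD by metis
    with Q(3) have "Q \<in> monic_irreducibles" by (simp add: monic_irreducibles_def)
    moreover have "Q dvd P" unfolding Q(2) by (rule dvd_smult[OF dvd_refl])
    ultimately show ?thesis by (rule bexI[rotated])
  next
    case False
    moreover have "\<not> P dvd 1" using less.prems P0 by (simp add: is_unit_iff_degree)
    ultimately obtain a b where ab: "P = a * b" "\<not> a dvd 1" "\<not> b dvd 1"
      using P0 by (auto simp: irreducible_def)
    have ab0: "a \<noteq> 0" "b \<noteq> 0" using P0 ab by auto
    then have "degree a > 0" "degree b > 0" using ab by (auto simp: is_unit_iff_degree)
    then have "degree a < degree P" using ab ab0 by (simp add: degree_mult_eq)
    with less.hyps[of a] \<open>degree a > 0\<close> obtain Q where "Q \<in> monic_irreducibles" "Q dvd a" by blast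
    then show ?thesis using ab dvd_mult2 by blast
  qed
qed

lemma prime_power_dvd_mult_cancel:
  fixes Q :: "'a::idom"
  assumes "prime_elem Q" "\<not> Q dvd A" "Q ^ i dvd A * B"
  shows "Q ^ i dvd B"
  using assms(3)
proof (induction i)
  case (Suc i)
  have Q0: "Q \<noteq> 0" using assms by auto
  have "Q ^ i dvd A * B" using Suc.prems by (metis dvd_trans le_imp_power_dvd lessI less_imp_le)
  then obtain T where T: "B = Q ^ i * T" using Suc.IH unfolding dvd_def by blast
  have "Q ^ i * Q dvd Q ^ i * (A * T)" using Suc.prems by (simp add: T mult_ac)
  then have "Q dvd A * T" using Q0 by simp
  then have "Q dvd T" using assms by (simp add: prime_elem_dvd_mult_iff)
  then show ?case by (simp add: T mult_dvd_mono mult.commute)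
qed simp

lemma power_dvd_imp_le_degree:
  fixes Q :: "'a::idom poly"
  assumes "Q ^ i dvd P" "P \<noteq> 0"
  shows "i * degree Q \<le> degree P"
proof -
  have "Q ^ i \<noteq> 0" using assms by auto
  moreover have "degree (Q ^ i) = i * degree Q" if "Q \<noteq> 0" using that by (simp add: degree_power_eq)
  ultimately show ?thesis using dvd_imp_degree_le[OF assms] by (cases "Q = 0") auto
qed

text \<open>A factor \<open>Q\<close> of multiplicity \<open>v\<close> contributes the pairs
  \<open>(Q, 1)\<close> up to \<open>(Q, v)\<close>, so multiplicities are counted by divisibility
  alone, as in the identity expressing the logarithm as a divisor sum of the von Mangoldt
  function.\<close>

definition primary_divisors :: "'a::field poly \<Rightarrow> ('a poly \<times> nat) set" where
  "primary_divisors P = {(Q, i). Q \<in> monic_irreducibles \<and> 1 \<le> i \<and> Q ^ i dvd P}"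

lemma monic_mult_cancel:
  "lead_coeff (Q * R) = 1 \<Longrightarrow> lead_coeff Q = 1 \<Longrightarrow> lead_coeff (R :: 'a::idom poly) = 1"
  by (simp add: lead_coeff_mult)

text \<open>Multiplying \<open>R\<close> by an irreducible \<open>Q\<close> adds exactly one pair,
  \<open>(Q, Suc v)\<close> with \<open>v\<close> the multiplicity of \<open>Q\<close> in
  \<open>R\<close>.\<close>

lemma sum_degree_primary_divisors:
  fixes P :: "'a::field poly"
  assumes "lead_coeff P = 1"
  shows "finite (primary_divisors P) \<and> (\<Sum>x\<in>primary_divisors P. degree (fst x)) = degree P"
  using assms
proof (induction "degree P" arbitrary: P rule: less_induct)
  case less
  have P0: "P \<noteq> 0" using less.prems by auto
  show ?case
  proof (cases "degree P = 0")
    case True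
    then have "primary_divisors P = {}"
      using power_dvd_imp_le_degree[OF _ P0] monic_irreducible_degree_pos
      by (force simp: primary_divisors_def)
    with True show ?thesis by simp
  next
    case False
    then obtain Q where Q: "Q \<in> monic_irreducibles" "Q dvd P" using ex_monic_irreducible_factor by blast
    then obtain R where R: "P = Q * R" by (elim dvdE)
    have Q0: "Q \<noteq> 0" "degree Q > 0" "lead_coeff Q = 1"
      using Q monic_irreducible_nonzero monic_irreducible_degree_pos by (auto simp: monic_irreducibles_def)
    have lR: "lead_coeff R = 1" using less.prems Q0(3) unfolding R by (rule monic_mult_cancel)
    then have R0: "R \<noteq> 0" by auto
    have deg: "degree P = degree Q + degree R" using R Q0 R0 by (simp add: degree_mult_eq)
    with less.hyps[OF _ lR] Q0 have IH: "finite (primary_divisors R)"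
      "(\<Sum>x\<in>primary_divisors R. degree (fst x)) = degree R" by auto
    have bdd: "i \<le> degree R" if "Q ^ i dvd R" for i
      using power_dvd_imp_le_degree[OF that R0] Q0 by (metis le_trans mult_le_mono2 Suc_leI nat_mult_1_right One_nat_def)
    define v where "v = (GREATEST i. Q ^ i dvd R)"
    have v: "Q ^ v dvd R" "\<And>i. Q ^ i dvd R \<Longrightarrow> i \<le> v"
      unfolding v_def using GreatestI_nat[of "\<lambda>i. Q ^ i dvd R" 0 "degree R"]
        Greatest_le_nat[of "\<lambda>i. Q ^ i dvd R" _ "degree R"] bdd by auto
    have "primary_divisors P = insert (Q, Suc v) (primary_divisors R)"
    proof (intro Set.set_eqI iffI)
      fix x assume x: "x \<in> primary_divisors P"
      obtain Q' i where Q': "x = (Q', i)" "Q' \<in> monic_irreducibles" "1 \<le> i" "Q' ^ i dvd P"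
        using x by (auto simp: primary_divisors_def)
      show "x \<in> insert (Q, Suc v) (primary_divisors R)"
      proof (cases "Q' = Q")
        case True
        obtain j where j: "i = Suc j" using Q' by (cases i) auto
        have "Q * Q ^ j dvd Q * R" using Q' True j R by simp
        then have "Q ^ j dvd R" using Q0 by simp
        then have "j \<le> v" by (rule v(2))
        show ?thesis
        proof (cases "i = Suc v")
          case True
          then show ?thesis using Q'(1) \<open>Q' = Q\<close> by blast
        next
          case False
          then have "i \<le> v" using \<open>j \<le> v\<close> j by simp
          then have "Q ^ i dvd R" by (rule dvd_trans[OF le_imp_power_dvd v(1)])
          then show ?thesis using Q'(1-3) \<open>Q' = Q\<close> unfolding primary_divisors_def by blast
        qed
      next
        case False
        then have nd: "\<not> Q' dvd Q" using monic_irreducible_dvd_imp_eq[OF Q'(2) Q(1)] by metis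
        have "Q' ^ i dvd R"
          using Q'(4) unfolding R by (rule prime_power_dvd_mult_cancel[OF monic_irreducible_prime[OF Q'(2)] nd])
        with Q'(1-3) show ?thesis unfolding primary_divisors_def by blast
      qed
    next
      fix x assume "x \<in> insert (Q, Suc v) (primary_divisors R)"
      moreover have "Q ^ Suc v dvd P" unfolding R power_Suc by (rule mult_dvd_mono[OF dvd_refl v(1)])
      ultimately show "x \<in> primary_divisors P"
        unfolding primary_divisors_def R using Q(1) dvd_mult[where b = R] by fastforce
    qed
    moreover have "(Q, Suc v) \<notin> primary_divisors R" using v(2)[of "Suc v"] by (auto simp: primary_divisors_def)
    ultimately show ?thesis using IH deg by simp
  qed
qed

definition monics :: "nat \<Rightarrow> 'a::field poly set" where
  "monics j = {P. degree P = j \<and> lead_coeff P = 1}"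

lemma finite_polys_degree_le: "finite {P :: 'a::{finite,zero} poly. degree P \<le> n}"
proof (rule finite_subset)
  show "{P :: 'a poly. degree P \<le> n} \<subseteq> Poly ` {xs. set xs \<subseteq> UNIV \<and> length xs \<le> Suc n}"
  proof
    fix P :: "'a poly" assume "P \<in> {P. degree P \<le> n}"
    then have "length (coeffs P) \<le> Suc n" by (cases "P = 0") (auto simp: length_coeffs_degree)
    then show "P \<in> Poly ` {xs. set xs \<subseteq> UNIV \<and> length xs \<le> Suc n}"
      by (intro image_eqI[of _ _ "coeffs P"]) auto
  qed
  show "finite (Poly ` {xs :: 'a list. set xs \<subseteq> UNIV \<and> length xs \<le> Suc n})"
    by (intro finite_imageI finite_lists_length_le) simp
qed

lemma finite_monics: "finite (monics j :: 'a::finite_field poly set)"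
  by (rule finite_subset[OF _ finite_polys_degree_le[of j]]) (auto simp: monics_def)

lemma monics_0: "monics 0 = {1}"
proof -
  have "P = 1" if "degree P = 0" "lead_coeff P = 1" for P :: "'a poly"
  proof -
    obtain c where "P = [:c:]" using \<open>degree P = 0\<close> by (metis degree_eq_zeroE)
    with that show ?thesis by (simp add: one_pCons)
  qed
  then show ?thesis by (auto simp: monics_def)
qed

text \<open>The logarithmic derivative of the Euler product in finite form. Each
  \<open>degree P\<close> is written as the sum of \<open>degree Q\<close> over the prime powers
  \<open>Q ^ i\<close> dividing \<open>P\<close>, and the monic \<open>P\<close> are then collected
  by \<open>Q ^ i\<close>; multiplicativity gives the factor \<open>\<Lambda> Q ^ i\<close>.\<close>

lemma euler_product_newton:
  fixes \<Lambda> :: "'k::finite_field poly \<Rightarrow> complex"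
  assumes mult: "\<And>P R. lead_coeff P = 1 \<Longrightarrow> lead_coeff R = 1 \<Longrightarrow> \<Lambda> (P * R) = \<Lambda> P * \<Lambda> R"
    and one: "\<Lambda> 1 = 1"
  defines "a \<equiv> \<lambda>j. \<Sum>P\<in>monics j. \<Lambda> P"
  defines "S \<equiv> \<lambda>i. \<Sum>Q | Q \<in> monic_irreducibles \<and> degree Q dvd i \<and> degree Q \<le> i.
                  of_nat (degree Q) * \<Lambda> Q ^ (i div degree Q)"
  shows "of_nat j * a j = (\<Sum>i=1..j. S i * a (j - i))"
proof -
  have mult_pow: "\<Lambda> (P ^ n) = \<Lambda> P ^ n" if "lead_coeff P = 1" for P n
    using that by (induction n) (auto simp: one mult lead_coeff_power)
  define PI where "PI = {(Q :: 'k poly, i). Q \<in> monic_irreducibles \<and> 1 \<le> i \<and> i * degree Q \<le> j}"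
  have "PI \<subseteq> {P. degree P \<le> j} \<times> {..j}"
  proof
    fix x assume "x \<in> PI"
    then obtain Q i where x: "x = (Q, i)" "Q \<in> monic_irreducibles" "1 \<le> i" "i * degree Q \<le> j"
      by (auto simp: PI_def)
    then have "degree Q > 0" using monic_irreducible_degree_pos by blast
    with x have "degree Q \<le> i * degree Q" "i \<le> i * degree Q" by auto
    then have "degree Q \<le> j" "i \<le> j" using x(4) le_trans by blast+
    then show "x \<in> {P. degree P \<le> j} \<times> {..j}" using x by auto
  qed
  then have finPI: "finite PI" by (rule finite_subset) (intro finite_cartesian_product finite_polys_degree_le finite_atMost)
  have fibre: "(\<Sum>P\<in>{P \<in> monics j. Q ^ i dvd P}. \<Lambda> P) = \<Lambda> Q ^ i * a (j - i * degree Q)"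
    if Qi: "(Q, i) \<in> PI" for Q i
  proof -
    have Q: "Q \<in> monic_irreducibles" "1 \<le> i" "i * degree Q \<le> j" "Q \<noteq> 0" "lead_coeff Q = 1"
      using Qi monic_irreducible_nonzero by (auto simp: PI_def monic_irreducibles_def)
    have lQ: "lead_coeff (Q ^ i) = 1" using Q by (simp add: lead_coeff_power)
    have dQ: "degree (Q ^ i) = i * degree Q" using Q by (simp add: degree_power_eq)
    have "{P \<in> monics j. Q ^ i dvd P} = (\<lambda>R. Q ^ i * R) ` monics (j - i * degree Q)"
    proof (intro Set.set_eqI iffI)
      fix P assume "P \<in> {P \<in> monics j. Q ^ i dvd P}"
      then obtain R where R: "P = Q ^ i * R" "degree P = j" "lead_coeff P = 1" by (auto simp: monics_def)
      have "lead_coeff R = 1" using R lQ monic_mult_cancel by blast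
      moreover from this have "R \<noteq> 0" by auto
      ultimately show "P \<in> (\<lambda>R. Q ^ i * R) ` monics (j - i * degree Q)"
        using R Q dQ by (auto simp: monics_def degree_mult_eq)
    next
      fix P assume "P \<in> (\<lambda>R. Q ^ i * R) ` monics (j - i * degree Q)"
      then obtain R where R: "P = Q ^ i * R" "degree R = j - i * degree Q" "lead_coeff R = 1"
        unfolding monics_def by blast
      then have "R \<noteq> 0" by auto
      then have "degree P = j" "lead_coeff P = 1"
        using R Q dQ lQ lead_coeff_mult[of "Q ^ i" R] by (simp_all add: degree_mult_eq)
      then show "P \<in> {P \<in> monics j. Q ^ i dvd P}" using R by (auto simp: monics_def)
    qed
    moreover have "inj_on (\<lambda>R. Q ^ i * R) (monics (j - i * degree Q))" using Q by (auto intro!: inj_onI)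
    ultimately have "(\<Sum>P\<in>{P \<in> monics j. Q ^ i dvd P}. \<Lambda> P) = (\<Sum>R\<in>monics (j - i * degree Q). \<Lambda> (Q ^ i * R))"
      by (simp add: sum.reindex)
    also have "\<dots> = (\<Sum>R\<in>monics (j - i * degree Q). \<Lambda> Q ^ i * \<Lambda> R)"
      using lQ Q by (intro sum.cong) (auto simp: mult mult_pow monics_def)
    finally show ?thesis by (simp add: a_def sum_distrib_left)
  qed
  have "of_nat j * a j = (\<Sum>P\<in>monics j. of_nat (degree P) * \<Lambda> P)"
    by (simp add: a_def sum_distrib_left monics_def)
  also have "\<dots> = (\<Sum>P\<in>monics j. \<Sum>x\<in>PI. if fst x ^ snd x dvd P then of_nat (degree (fst x)) * \<Lambda> P else 0)"
  proof (rule sum.cong[OF refl])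
    fix P :: "'k poly" assume P: "P \<in> monics j"
    then have "P \<noteq> 0" by (auto simp: monics_def)
    then have sub: "primary_divisors P = {x \<in> PI. fst x ^ snd x dvd P}"
      using power_dvd_imp_le_degree[of _ _ P] P by (auto simp: primary_divisors_def PI_def monics_def)
    have "degree P = (\<Sum>x\<in>primary_divisors P. degree (fst x))"
    proof -
      have "lead_coeff P = 1" using P unfolding monics_def by blast
      then show ?thesis using sum_degree_primary_divisors by metis
    qed
    then have "of_nat (degree P) * \<Lambda> P = (\<Sum>x\<in>primary_divisors P. of_nat (degree (fst x)) * \<Lambda> P)"
      by (simp add: sum_distrib_right)
    also have "\<dots> = (\<Sum>x\<in>PI. if fst x ^ snd x dvd P then of_nat (degree (fst x)) * \<Lambda> P else 0)"
      unfolding sub using finPI by (simp add: sum.inter_filter)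
    finally show "of_nat (degree P) * \<Lambda> P = (\<Sum>x\<in>PI. if fst x ^ snd x dvd P then of_nat (degree (fst x)) * \<Lambda> P else 0)" .
  qed
  also have "\<dots> = (\<Sum>x\<in>PI. \<Sum>P\<in>monics j. if fst x ^ snd x dvd P then of_nat (degree (fst x)) * \<Lambda> P else 0)"
    by (rule sum.swap)
  also have "\<dots> = (\<Sum>x\<in>PI. of_nat (degree (fst x)) * (\<Sum>P\<in>{P \<in> monics j. fst x ^ snd x dvd P}. \<Lambda> P))"
    by (simp add: sum.inter_filter finite_monics sum_distrib_left if_distrib cong: if_cong)
  also have "\<dots> = (\<Sum>x\<in>PI. of_nat (degree (fst x)) * (\<Lambda> (fst x) ^ snd x * a (j - snd x * degree (fst x))))"
    by (intro sum.cong refl) (use fibre in \<open>auto\<close>)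
  also have "\<dots> = (\<Sum>(i, Q)\<in>(SIGMA i:{1..j}. {Q. Q \<in> monic_irreducibles \<and> degree Q dvd i \<and> degree Q \<le> i}).
      of_nat (degree Q) * \<Lambda> Q ^ (i div degree Q) * a (j - i))"
  proof (rule sum.reindex_bij_witness[of _ "\<lambda>(i, Q). (Q, i div degree Q)" "\<lambda>(Q, i). (i * degree Q, Q)"])
    fix x assume "x \<in> PI"
    then obtain Q i where x: "x = (Q, i)" "Q \<in> monic_irreducibles" "1 \<le> i" "i * degree Q \<le> j"
      by (auto simp: PI_def)
    then have dQ: "degree Q > 0" using monic_irreducible_degree_pos by blast
    then show "(case (case x of (Q, i) \<Rightarrow> (i * degree Q, Q)) of (i, Q) \<Rightarrow> (Q, i div degree Q)) = x"
      using x by simp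
    show "(case x of (Q, i) \<Rightarrow> (i * degree Q, Q)) \<in> (SIGMA i:{1..j}. {Q. Q \<in> monic_irreducibles \<and> degree Q dvd i \<and> degree Q \<le> i})"
      using x dQ by (auto simp: Suc_le_eq)
    show "(case case x of (Q, i) \<Rightarrow> (i * degree Q, Q) of (i, Q) \<Rightarrow>
         of_nat (degree Q) * \<Lambda> Q ^ (i div degree Q) * a (j - i)) =
         of_nat (degree (fst x)) * (\<Lambda> (fst x) ^ snd x * a (j - snd x * degree (fst x)))"
      using x dQ by simp
  next
    fix y assume "y \<in> (SIGMA i:{1..j}. {Q :: 'k poly. Q \<in> monic_irreducibles \<and> degree Q dvd i \<and> degree Q \<le> i})"
    then obtain i Q where y: "y = (i, Q)" "1 \<le> i" "i \<le> j" "Q \<in> monic_irreducibles" "degree Q dvd i" by auto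
    then have dQ: "degree Q > 0" using monic_irreducible_degree_pos by blast
    show "(case (case y of (i, Q) \<Rightarrow> (Q, i div degree Q)) of (Q, i) \<Rightarrow> (i * degree Q, Q)) = y"
      using y by simp
    have "1 \<le> i div degree Q" using y dQ by (metis One_nat_def Suc_leI div_greater_zero_iff dvd_imp_le less_le_trans zero_less_one)
    then show "(case y of (i, Q) \<Rightarrow> (Q, i div degree Q)) \<in> PI"
      using y by (auto simp: PI_def)
  qed
  also have "\<dots> = (\<Sum>i=1..j. \<Sum>Q | Q \<in> monic_irreducibles \<and> degree Q dvd i \<and> degree Q \<le> i.
      of_nat (degree Q) * \<Lambda> Q ^ (i div degree Q) * a (j - i))"
  proof (rule sum.Sigma[symmetric])
    show "\<forall>i\<in>{1..j}. finite {Q :: 'k poly. Q \<in> monic_irreducibles \<and> degree Q dvd i \<and> degree Q \<le> i}"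
      by (auto intro: finite_subset[OF _ finite_polys_degree_le])
  qed simp
  finally show ?thesis by (simp add: S_def sum_distrib_right)
qed

subsection \<open>Characters of finite fields\<close>

text \<open>Cyclicity of the multiplicative group is carried over from algebraic structures with
  explicit carriers to the type class.\<close>

lemma finite_field_ex_generator: "\<exists>\<gamma>::'k::finite_field. \<gamma> \<noteq> 0 \<and> (\<forall>x. x \<noteq> 0 \<longrightarrow> (\<exists>i. x = \<gamma> ^ i))"
proof -
  define R where "R = (ring_of_type_algebra :: 'k ring)"
  interpret R: Ring.field R unfolding R_def by rule
  have carrier: "carrier (Multiplicative_Group.mult_of R) = UNIV - {0}"
    by (auto simp: Multiplicative_Group.mult_of_def R_def ring_of_type_algebra_def)
  have pow: "x [^]\<^bsub>R\<^esub> (i::nat) = x ^ i" for x :: 'k and i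
  proof (induction i)
    case 0
    show ?case unfolding R.nat_pow_0 by (simp add: R_def ring_of_type_algebra_def)
  next
    case (Suc i)
    have "x [^]\<^bsub>R\<^esub> Suc i = x ^ i * x"
      unfolding R.nat_pow_Suc Suc by (simp add: R_def ring_of_type_algebra_def)
    then show ?case by (simp add: mult.commute)
  qed
  have "carrier R = UNIV" by (simp add: R_def ring_of_type_algebra_def)
  then have "finite (carrier R)" by (rule ssubst) (rule finite)
  then have "\<exists>a\<in>carrier (Multiplicative_Group.mult_of R). carrier (Multiplicative_Group.mult_of R) = {a [^]\<^bsub>R\<^esub> i |i::nat. i \<in> UNIV}"
    by (rule R.finite_field_mult_group_has_gen)
  then have "\<exists>a\<in>UNIV - {0::'k}. UNIV - {0} = {a ^ i |i::nat. i \<in> UNIV}"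
    unfolding carrier pow .
  then obtain a :: 'k where a: "a \<in> UNIV - {0}" "UNIV - {0} = {a ^ i |i::nat. i \<in> UNIV}"
    by (rule bexE)
  have "\<exists>i. x = a ^ i" if "x \<noteq> 0" for x
  proof -
    have "x \<in> {a ^ i |i::nat. i \<in> UNIV}" using that unfolding a(2)[symmetric] by simp
    then show ?thesis by blast
  qed
  with a(1) show ?thesis by blast
qed

definition gen :: "'k::finite_field" where
  "gen = (SOME \<gamma>. \<gamma> \<noteq> 0 \<and> (\<forall>x. x \<noteq> 0 \<longrightarrow> (\<exists>i. x = \<gamma> ^ i)))"

lemma gen_nonzero [simp]: "gen \<noteq> (0 :: 'k::finite_field)"
  and ex_power_gen: "x \<noteq> 0 \<Longrightarrow> \<exists>i. x = (gen :: 'k::finite_field) ^ i"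
  using someI_ex[OF finite_field_ex_generator, folded gen_def] by blast+

definition dlog :: "'k::finite_field \<Rightarrow> nat" where
  "dlog x = (LEAST i. x = gen ^ i)"

lemma gen_power_dlog [simp]: "x \<noteq> 0 \<Longrightarrow> gen ^ dlog x = x"
  using LeastI_ex[OF ex_power_gen, of x] by (simp add: dlog_def)

lemma card_field_gt_1: "CARD('k::finite_field) > 1"
proof -
  have "card {0, 1 :: 'k} \<le> CARD('k)" by (intro card_mono) auto
  then show ?thesis by simp
qed

lemma finite_field_power_card_units: "x \<noteq> (0 :: 'k::finite_field) \<Longrightarrow> x ^ (CARD('k) - 1) = 1"
proof -
  assume x: "x \<noteq> 0"
  have "x * x ^ (CARD('k) - 1) = x ^ CARD('k)"
    using card_field_gt_1[where ?'k = 'k] by (simp flip: power_Suc)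
  also have "\<dots> = x * 1" by (simp add: finite_field_power_card_eq_same)
  finally show ?thesis using x by (metis mult_cancel_left)
qed

lemma bij_betw_gen_power: "bij_betw (\<lambda>i. (gen :: 'k::finite_field) ^ i) {..<CARD('k) - 1} (UNIV - {0})"
proof -
  let ?n = "CARD('k) - 1"
  have n: "?n > 0" using card_field_gt_1[where ?'k = 'k] by simp
  have mod: "gen ^ i = (gen :: 'k) ^ (i mod ?n)" for i
  proof -
    have "(gen :: 'k) ^ i = gen ^ (?n * (i div ?n) + i mod ?n)" by (simp only: mult_div_mod_eq)
    also have "\<dots> = gen ^ (i mod ?n)"
      unfolding power_add power_mult finite_field_power_card_units[OF gen_nonzero] by simp
    finally show ?thesis .
  qed
  have "(\<lambda>i. gen ^ i) ` {..<?n} = UNIV - {0 :: 'k}"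
  proof
    show "UNIV - {0} \<subseteq> (\<lambda>i. (gen :: 'k) ^ i) ` {..<?n}"
    proof
      fix x :: 'k assume "x \<in> UNIV - {0}"
      then obtain i where "x = gen ^ i" using ex_power_gen by blast
      then have "x = gen ^ (i mod ?n)" using mod by simp
      then show "x \<in> (\<lambda>i. (gen :: 'k) ^ i) ` {..<?n}" using n by (intro image_eqI[of _ _ "i mod ?n"]) auto
    qed
  qed auto
  moreover have "card (UNIV - {0 :: 'k}) = card {..<?n}" by (simp add: card_Diff_subset)
  ultimately show ?thesis
    by (metis bij_betw_def eq_card_imp_inj_on finite_lessThan)
qed

lemma gen_power_eq_iff: "(gen :: 'k::finite_field) ^ i = gen ^ j \<longleftrightarrow> [i = j] (mod (CARD('k) - 1))"
proof -
  let ?n = "CARD('k) - 1"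
  have n: "?n > 0" using card_field_gt_1[where ?'k = 'k] by simp
  have mod: "gen ^ i = (gen :: 'k) ^ (i mod ?n)" for i
  proof -
    have "(gen :: 'k) ^ i = gen ^ (?n * (i div ?n) + i mod ?n)" by (simp only: mult_div_mod_eq)
    also have "\<dots> = gen ^ (i mod ?n)"
      unfolding power_add power_mult finite_field_power_card_units[OF gen_nonzero] by simp
    finally show ?thesis .
  qed
  have "inj_on (\<lambda>i. (gen :: 'k) ^ i) {..<?n}" using bij_betw_gen_power by (rule bij_betw_imp_inj_on)
  then have "gen ^ (i mod ?n) = (gen :: 'k) ^ (j mod ?n) \<longleftrightarrow> i mod ?n = j mod ?n"
    using n by (auto simp: inj_on_eq_iff)
  then show ?thesis using mod by (metis cong_def)
qed

text \<open>A character is given by its value \<omega> at the fixed generator, and is one as soon as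
  \<omega> is a root of unity of order dividing that of the group. Its value at 0 is 0 even for
  \<open>\<omega> = 1\<close>, so the trivial character is the indicator of the nonzero
  elements.\<close>

definition mult_char :: "complex \<Rightarrow> 'k::finite_field \<Rightarrow> complex" where
  "mult_char \<omega> x = (if x = 0 then 0 else \<omega> ^ dlog x)"

lemma power_cong_exponent:
  fixes \<omega> :: "'a::comm_ring_1"
  assumes "\<omega> ^ n = 1" "[i = j] (mod n)"
  shows "\<omega> ^ i = \<omega> ^ j"
proof -
  have "\<omega> ^ i = \<omega> ^ (i mod n)" for i
  proof -
    have "\<omega> ^ i = \<omega> ^ (n * (i div n) + i mod n)" by (simp only: mult_div_mod_eq)
    also have "\<dots> = \<omega> ^ (i mod n)" unfolding power_add power_mult assms(1) by simp
    finally show ?thesis .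
  qed
  then show ?thesis using assms(2) unfolding cong_def by metis
qed

lemma mult_char_gen_power:
  assumes "\<omega> ^ (CARD('k) - 1) = 1"
  shows "mult_char \<omega> ((gen :: 'k::finite_field) ^ i) = \<omega> ^ i"
proof -
  have "gen ^ dlog ((gen :: 'k) ^ i) = (gen :: 'k) ^ i" by simp
  then have "[dlog ((gen :: 'k) ^ i) = i] (mod (CARD('k) - 1))" by (simp only: gen_power_eq_iff)
  then show ?thesis using power_cong_exponent[OF assms] by (simp add: mult_char_def)
qed

lemma mult_char_0 [simp]: "mult_char \<omega> 0 = 0"
  by (simp add: mult_char_def)

lemma mult_char_mult:
  assumes "\<omega> ^ (CARD('k) - 1) = 1"
  shows "mult_char \<omega> (x * y) = mult_char \<omega> x * mult_char \<omega> (y :: 'k::finite_field)"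
proof (cases "x = 0 \<or> y = 0")
  case False
  then have "x * y = gen ^ (dlog x + dlog y)" by (simp add: power_add)
  then have "mult_char \<omega> (x * y) = \<omega> ^ (dlog x + dlog y)" using mult_char_gen_power[OF assms] by metis
  with False show ?thesis by (simp add: mult_char_def power_add)
qed auto

lemma mult_char_1:
  assumes "\<omega> ^ (CARD('k) - 1) = 1"
  shows "mult_char \<omega> (1 :: 'k::finite_field) = 1"
  using mult_char_gen_power[OF assms, of 0] by simp

lemma mult_char_power:
  assumes "\<omega> ^ (CARD('k) - 1) = 1"
  shows "mult_char \<omega> (x ^ n) = mult_char \<omega> (x :: 'k::finite_field) ^ n"
  by (induction n) (simp_all add: mult_char_1[OF assms] mult_char_mult[OF assms])

lemma norm_root_of_unity:
  assumes "\<omega> ^ n = (1 :: complex)" "n > 0"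
  shows "norm \<omega> = 1"
proof -
  have "norm \<omega> ^ n = 1 ^ n" using arg_cong[OF assms(1), of norm] by (simp add: norm_power)
  then show ?thesis using assms(2) power_eq_imp_eq_base[of "norm \<omega>" n 1] by simp
qed

lemma norm_mult_char_le:
  assumes "\<omega> ^ (CARD('k) - 1) = 1"
  shows "norm (mult_char \<omega> (x :: 'k::finite_field)) \<le> 1"
proof -
  have "CARD('k) - 1 > 0" using card_field_gt_1[where ?'k = 'k] by simp
  then have "norm \<omega> = 1" using norm_root_of_unity[OF assms] by blast
  then show ?thesis by (simp add: mult_char_def norm_power)
qed

text \<open>The images of the naturals below the characteristic are already as many roots as the
  degree of \<open>x ^ CHAR('a) - x\<close> permits.\<close>

lemma card_prime_field: "{x :: 'a::idom_prime_char. x ^ CHAR('a) = x} = of_nat ` {..<CHAR('a)}"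
proof -
  let ?p = "CHAR('a)"
  have p: "prime ?p" "?p > 1" using prime_gt_1_nat[OF CHAR_prime[where ?'a = 'a]] by simp_all
  have inj: "inj_on (of_nat :: nat \<Rightarrow> 'a) {..<?p}"
  proof (rule inj_onI)
    fix i j assume *: "i \<in> {..<?p}" "j \<in> {..<?p}" "(of_nat i :: 'a) = of_nat j"
    then have "[i = j] (mod ?p)" by (simp add: of_nat_eq_iff_cong_CHAR)
    with * show "i = j" by (simp add: cong_def)
  qed
  have dream: "(of_nat j :: 'a) ^ ?p = of_nat j" for j
    by (induction j) (use p in \<open>auto simp: freshmans_dream zero_power\<close>)
  let ?P = "monom 1 ?p - [:0, 1 :: 'a:]"
  have "coeff ?P ?p = 1" using p by (cases ?p; cases "?p - 1") auto
  then have P0: "?P \<noteq> 0" by (metis coeff_0 zero_neq_one)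
  have deg: "degree ?P \<le> ?p"
    using p by (intro degree_diff_le degree_monom_le) simp
  have roots: "{x. poly ?P x = 0} = {x :: 'a. x ^ ?p = x}" by (simp add: poly_monom)
  have "card {x :: 'a. x ^ ?p = x} \<le> card (of_nat ` {..<?p} :: 'a set)"
    using card_poly_roots_bound[OF P0] deg inj unfolding roots by (simp add: card_image)
  moreover have "finite {x :: 'a. x ^ ?p = x}" using poly_roots_finite[OF P0] unfolding roots .
  moreover have "of_nat ` {..<?p} \<subseteq> {x :: 'a. x ^ ?p = x}" using dream by auto
  ultimately show "{x :: 'a. x ^ ?p = x} = of_nat ` {..<?p}" by (metis card_seteq)
qed

definition abs_trace :: "nat \<Rightarrow> 'a::comm_ring_1 \<Rightarrow> 'a" where
  "abs_trace n x = (\<Sum>i<n. x ^ (CHAR('a) ^ i))"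

lemma abs_trace_add: "abs_trace n (x + y) = abs_trace n x + abs_trace n (y :: 'a::comm_ring_prime_char)"
  by (simp add: abs_trace_def freshmans_dream' sum.distrib)

lemma abs_trace_power_char:
  assumes "x ^ (CHAR('a) ^ n) = (x :: 'a::comm_ring_prime_char)"
  shows "abs_trace n x ^ CHAR('a) = abs_trace n x"
proof (cases n)
  case (Suc m)
  have "abs_trace n x ^ CHAR('a) = (\<Sum>i<n. x ^ (CHAR('a) ^ Suc i))"
    by (simp add: abs_trace_def freshmans_dream_sum mult.commute flip: power_mult)
  also have "\<dots> = (\<Sum>i<m. x ^ (CHAR('a) ^ Suc i)) + x ^ (CHAR('a) ^ 0)"
    using assms by (simp add: Suc)
  also have "\<dots> = abs_trace n x"
    unfolding abs_trace_def Suc sum.lessThan_Suc_shift by simp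
  finally show ?thesis .
qed (simp add: abs_trace_def zero_power)

definition char_root :: "'a::semiring_1 itself \<Rightarrow> complex" where
  "char_root _ = cis (2 * pi / real CHAR('a))"

lemma char_root_power: "char_root TYPE('a::semiring_prime_char) ^ CHAR('a) = 1"
  by (simp add: char_root_def DeMoivre)

lemma char_root_neq_1: "char_root TYPE('a::semiring_prime_char) \<noteq> 1"
proof
  assume "char_root TYPE('a) = 1"
  then have "cos (2 * pi / real CHAR('a)) = 1" by (metis char_root_def cis.sel(1) one_complex.sel(1))
  then obtain k :: int where k: "2 * pi / real CHAR('a) = of_int k * 2 * pi"
    using cos_one_2pi_int by auto
  have p: "real CHAR('a) > 1" using prime_gt_1_nat[OF CHAR_prime] by simp
  from k p have "1 = of_int k * real CHAR('a)" by (simp add: field_simps)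
  then have "(1::int) = k * int CHAR('a)" by (metis of_int_eq_1_iff of_int_mult of_int_of_nat_eq)
  then have "int CHAR('a) dvd 1" by (metis dvd_triv_right)
  with p show False by simp
qed

text \<open>The trace lies in the prime field when \<open>x\<close> lies in the field with
  \<open>CHAR('a) ^ n\<close> elements, and \<open>LEAST\<close> then selects a natural number
  representing it. Any other representative gives the same value, because the root of unity has
  order \<open>CHAR('a)\<close>.\<close>

definition add_char :: "nat \<Rightarrow> 'a::comm_ring_1 \<Rightarrow> complex" where
  "add_char n x = char_root TYPE('a) ^ (LEAST j. of_nat j = abs_trace n x)"

lemma add_char_eqI:
  fixes x :: "'a::comm_ring_prime_char"
  assumes "of_nat j = abs_trace n x"
  shows "add_char n x = char_root TYPE('a) ^ j"
proof -
  let ?l = "LEAST j. of_nat j = abs_trace n x"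
  have "of_nat ?l = abs_trace n x" using assms by (rule LeastI)
  then have "(of_nat ?l :: 'a) = of_nat j" using assms by (rule trans[OF _ sym])
  then have "[?l = j] (mod CHAR('a))" unfolding of_nat_eq_iff_cong_CHAR .
  then show ?thesis unfolding add_char_def by (rule power_cong_exponent[OF char_root_power])
qed

lemma add_char_add:
  fixes x y :: "'a::idom_prime_char"
  assumes "x ^ (CHAR('a) ^ n) = x" "y ^ (CHAR('a) ^ n) = y"
  shows "add_char n (x + y) = add_char n x * add_char n y"
proof -
  have "abs_trace n x \<in> of_nat ` {..<CHAR('a)}" "abs_trace n y \<in> of_nat ` {..<CHAR('a)}"
    using abs_trace_power_char[OF assms(1)] abs_trace_power_char[OF assms(2)] card_prime_field by blast+
  then obtain i j where ij: "of_nat i = abs_trace n x" "of_nat j = abs_trace n y" by (metis imageE)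
  then have "of_nat (i + j) = abs_trace n (x + y)" by (simp add: abs_trace_add)
  from add_char_eqI[OF this] show ?thesis
    unfolding add_char_eqI[OF ij(1)] add_char_eqI[OF ij(2)] by (simp add: power_add)
qed

lemma norm_add_char: "norm (add_char n x) = 1"
  by (simp add: add_char_def char_root_def norm_power)

lemma add_char_0 [simp]: "add_char n (0 :: 'a::comm_ring_prime_char) = 1"
  using add_char_eqI[of 0 n "0 :: 'a"] by (simp add: abs_trace_def zero_power)

section \<open>Frobenius orbits in the algebraic closure and minimal polynomials\<close>

locale finite_field_closure =
  fixes f N :: nat and type_k :: "'k::finite_field itself"
  assumes card_N: "CARD('k) = N" and card_eq: "N = CHAR('k) ^ f"
begin

abbreviation cl :: "'k poly \<Rightarrow> 'k alg_closure poly" where "cl \<equiv> map_poly to_ac"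

lemma N_gt_1: "N > 1"
  using card_field_gt_1[where ?'k = 'k] card_N by simp

lemma f_pos: "f > 0"
  using N_gt_1 card_eq by (cases f) auto

lemma N_pow: "N ^ i = CHAR('k alg_closure) ^ (f * i)"
  by (simp add: card_eq power_mult)

lemma char_prime: "prime CHAR('k alg_closure)"
  by simp

lemma frob_add: "(x + y :: 'k alg_closure) ^ (N ^ i) = x ^ (N ^ i) + y ^ (N ^ i)"
  by (rule freshmans_dream'[OF char_prime N_pow])

lemma frob_sum: "(\<Sum>a\<in>A. g a :: 'k alg_closure) ^ (N ^ i) = (\<Sum>a\<in>A. g a ^ (N ^ i))"
  by (rule freshmans_dream_sum'[OF char_prime N_pow])

lemma N_pow_pos: "N ^ i > 0"
  using N_gt_1 by simp

sublocale frob: comm_ring_morphism "\<lambda>x :: 'k alg_closure. x ^ N"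
  using frob_add[where i = 1] by unfold_locales (auto simp: power_mult_distrib)

lemma frob_to_ac [simp]: "to_ac x ^ N = to_ac (x :: 'k)"
  using finite_field_power_card_eq_same[of x] by (simp add: card_N flip: to_ac_power)

lemma frob_pow_to_ac [simp]: "to_ac x ^ (N ^ i) = to_ac (x :: 'k)"
  using finite_field_power_card_power_eq_same[of "N ^ i" i x] by (simp add: card_N flip: to_ac_power)

lemma card_frob_fixed:
  assumes "k > 0"
  shows "card {x :: 'k alg_closure. x ^ (N ^ k) = x} = N ^ k" and "finite {x :: 'k alg_closure. x ^ (N ^ k) = x}"
proof -
  let ?P = "monom 1 (N ^ k) - [:0, 1 :: 'k alg_closure:]"
  have gt: "N ^ k > 1" using N_gt_1 assms by (rule one_less_power)
  have deg: "degree ?P = N ^ k"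
    using gt by (simp add: degree_monom_eq diff_conv_add_uminus degree_add_eq_left del: add_uminus_conv_diff)
  have roots: "{x. poly ?P x = 0} = {x :: 'k alg_closure. x ^ (N ^ k) = x}" by (simp add: poly_monom)
  have P0: "?P \<noteq> 0"
  proof
    assume "?P = 0"
    then have "degree ?P = 0" by (simp only: degree_0)
    with deg gt show False by linarith
  qed
  have "of_nat (N ^ k) = (0 :: 'k alg_closure)"
    unfolding of_nat_eq_0_iff_char_dvd card_eq power_mult[symmetric] CHAR_alg_closure
    using assms f_pos by (intro dvd_power) simp
  then have "poly (pderiv ?P) x \<noteq> 0" for x
    using assms by (simp add: pderiv_diff pderiv_monom pderiv_pCons poly_monom zero_power)
  with card_roots_eq_degree[OF P0] show "card {x :: 'k alg_closure. x ^ (N ^ k) = x} = N ^ k"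
    unfolding roots deg by blast
  show "finite {x :: 'k alg_closure. x ^ (N ^ k) = x}" using poly_roots_finite[OF P0] unfolding roots .
qed

lemma range_to_ac: "range (to_ac :: 'k \<Rightarrow> _) = {x. x ^ N = x}"
proof (rule card_seteq)
  show "finite {x :: 'k alg_closure. x ^ N = x}" using card_frob_fixed(2)[of 1] by simp
  show "range (to_ac :: 'k \<Rightarrow> _) \<subseteq> {x. x ^ N = x}" by auto
  show "card {x :: 'k alg_closure. x ^ N = x} \<le> card (range (to_ac :: 'k \<Rightarrow> _))"
    using card_frob_fixed(1)[of 1] by (simp add: card_image inj_to_ac card_N)
qed

lemma to_ac_of_ac': "x ^ N = x \<Longrightarrow> to_ac (of_ac x :: 'k) = x"
  using range_to_ac by (intro to_ac_of_ac) blast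

lemma frob_fixed_poly:
  assumes "map_poly (\<lambda>x. x ^ N) P = P"
  obtains Q where "P = cl Q"
proof
  show "P = cl (map_poly of_ac P)"
  proof (rule poly_eqI)
    fix i
    have "coeff P i ^ N = coeff P i" using assms by (metis coeff_map_poly frob.hom_zero)
    then show "coeff P i = coeff (cl (map_poly of_ac P)) i"
      by (simp add: coeff_map_poly to_ac_of_ac')
  qed
qed

lemma frob_cl: "map_poly (\<lambda>x. x ^ N) (cl P) = cl P"
  by (rule poly_eqI) (simp add: coeff_map_poly frob.hom_zero)

lemma cl_inj: "cl P = cl Q \<longleftrightarrow> P = Q"
  by (metis coeff_map_poly poly_eqI to_ac_0 to_ac_eq_iff)

lemma cl_eq_0_iff [simp]: "cl P = 0 \<longleftrightarrow> P = 0"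
  using cl_inj[of P 0] by simp

lemma degree_cl [simp]: "degree (cl P) = degree P"
  by (rule degree_map_poly) simp

lemma poly_cl_frob: "poly (cl P) (x ^ (N ^ i)) = poly (cl P) x ^ (N ^ i)"
proof (induction i)
  case (Suc i)
  have *: "poly (cl P) (y ^ N) = poly (cl P) y ^ N" for y
    using frob.poly_map_poly_hom[of "cl P" y] by (simp add: frob_cl)
  have "poly (cl P) (x ^ (N ^ Suc i)) = poly (cl P) ((x ^ (N ^ i)) ^ N)"
    by (simp add: mult.commute flip: power_mult)
  also have "\<dots> = poly (cl P) x ^ (N ^ Suc i)"
    unfolding * Suc by (simp add: mult.commute flip: power_mult)
  finally show ?case .
qed simp

lemma frob_inj: "x ^ (N ^ i) = y ^ (N ^ i) \<Longrightarrow> x = (y :: 'k alg_closure)"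
proof -
  assume "x ^ (N ^ i) = y ^ (N ^ i)"
  then have "(x - y) ^ (N ^ i) = 0" using frob_add[of "x - y" y i] by simp
  then show "x = y" by simp
qed

text \<open>All conjugates are roots of one polynomial over the finite field, so two of them
  coincide; injectivity of Frobenius turns this into a return to \<open>x\<close> itself.\<close>

lemma ex_period: "\<exists>e>0. (x :: 'k alg_closure) ^ (N ^ e) = x"
proof -
  obtain P :: "'k poly" where P: "P \<noteq> 0" "poly (cl P) x = 0" by (rule alg_closure_algebraic)
  have "range (\<lambda>i. x ^ (N ^ i)) \<subseteq> {y. poly (cl P) y = 0}"
    using P N_pow_pos by (auto simp: poly_cl_frob zero_power)
  then have "finite (range (\<lambda>i. x ^ (N ^ i)))"
    using P(1) poly_roots_finite[of "cl P"] by (auto intro: finite_subset)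
  then have "\<not> inj (\<lambda>i. x ^ (N ^ i))" using finite_imageD infinite_UNIV_nat by blast
  then obtain i j where ij: "i < j" "x ^ (N ^ i) = x ^ (N ^ j)"
    by (metis injI linorder_neqE_nat)
  then have "x ^ (N ^ i) = (x ^ (N ^ (j - i))) ^ (N ^ i)" by (simp flip: power_mult power_add)
  then have "x = x ^ (N ^ (j - i))" by (rule frob_inj)
  with ij show ?thesis by (intro exI[of _ "j - i"]) simp
qed

definition period :: "'k alg_closure \<Rightarrow> nat" where
  "period x = (LEAST e. e > 0 \<and> x ^ (N ^ e) = x)"

lemma period_pos: "period x > 0" and period_fixed: "x ^ (N ^ period x) = x"
  using LeastI_ex[OF ex_period, of x] by (simp_all add: period_def)

lemma period_least: "e > 0 \<Longrightarrow> x ^ (N ^ e) = x \<Longrightarrow> period x \<le> e"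
  unfolding period_def by (rule Least_le) simp

lemma frob_period_mult: "x ^ (N ^ (period x * j)) = x"
proof (induction j)
  case (Suc j)
  have "x ^ (N ^ (period x * Suc j)) = (x ^ (N ^ (period x * j))) ^ (N ^ period x)"
    by (simp add: power_add mult.commute flip: power_mult)
  then show ?case by (simp add: Suc period_fixed)
qed simp

lemma frob_mod_period: "x ^ (N ^ i) = x ^ (N ^ (i mod period x))"
proof -
  have "x ^ (N ^ i) = (x ^ (N ^ (period x * (i div period x)))) ^ (N ^ (i mod period x))"
    by (simp flip: power_mult power_add)
  then show ?thesis by (simp add: frob_period_mult)
qed

lemma frob_fixed_iff: "x ^ (N ^ k) = x \<longleftrightarrow> period x dvd k"
proof
  assume "x ^ (N ^ k) = x"
  then have "x ^ (N ^ (k mod period x)) = x" using frob_mod_period by metis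
  then show "period x dvd k"
    using period_least[of "k mod period x" x] period_pos[of x] mod_less_divisor[OF period_pos, of k x]
    by (metis mod_eq_0_iff_dvd not_gr_zero not_le)
qed (auto elim!: dvdE simp: frob_period_mult)

lemma inj_on_conjugates: "inj_on (\<lambda>i. x ^ (N ^ i)) {..<period x}"
proof (rule linorder_inj_onI')
  fix i j assume ij: "i \<in> {..<period x}" "j \<in> {..<period x}" "i < j"
  show "x ^ (N ^ i) \<noteq> x ^ (N ^ j)"
  proof
    assume "x ^ (N ^ i) = x ^ (N ^ j)"
    then have "x ^ (N ^ i) = (x ^ (N ^ (j - i))) ^ (N ^ i)" using ij by (simp flip: power_mult power_add)
    then have "x ^ (N ^ (j - i)) = x" using frob_inj by metis
    then have "period x \<le> j - i" using ij by (intro period_least) auto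
    with ij show False by auto
  qed
qed

text \<open>Frobenius permutes the linear factors belonging to an orbit cyclically, so the
  coefficients of their product are fixed and descend to the base field.\<close>

lemma ex_minpoly: "\<exists>Q. cl Q = (\<Prod>i<period x. [:- (x ^ (N ^ i)), 1:])"
proof -
  let ?M = "\<Prod>i<period x. [:- (x ^ (N ^ i)), 1:]"
  have "map_poly (\<lambda>c. c ^ N) ?M = (\<Prod>i<period x. [:- (x ^ (N ^ Suc i)), 1:])"
    unfolding frob.map_poly_hom_prod
    by (intro prod.cong refl) (simp add: map_poly_pCons frob.hom_zero frob.hom_one frob.hom_uminus mult.commute flip: power_mult)
  also have "\<dots> = ?M"
  proof -
    obtain e where e: "period x = Suc e" using period_pos[of x] by (cases "period x") auto
    have "(\<Prod>i<Suc e. [:- (x ^ (N ^ Suc i)), 1:]) = (\<Prod>i<e. [:- (x ^ (N ^ Suc i)), 1:]) * [:- x, 1:]"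
      using period_fixed[of x] by (simp only: prod.lessThan_Suc e)
    also have "\<dots> = (\<Prod>i<Suc e. [:- (x ^ (N ^ i)), 1:])"
      unfolding prod.lessThan_Suc_shift by (simp add: mult.commute del: mult_pCons_left mult_pCons_right power_Suc)
    finally show ?thesis by (simp only: e)
  qed
  finally show ?thesis by (metis frob_fixed_poly)
qed

definition minpoly :: "'k alg_closure \<Rightarrow> 'k poly" where
  "minpoly x = (SOME Q. cl Q = (\<Prod>i<period x. [:- (x ^ (N ^ i)), 1:]))"

lemma cl_minpoly: "cl (minpoly x) = (\<Prod>i<period x. [:- (x ^ (N ^ i)), 1:])"
  unfolding minpoly_def by (rule someI_ex[OF ex_minpoly])

lemma degree_minpoly: "degree (minpoly x) = period x"
proof -
  have "degree (cl (minpoly x)) = period x"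
    unfolding cl_minpoly by (subst degree_prod_eq_sum_degree) auto
  then show ?thesis by simp
qed

lemma lead_coeff_cl: "lead_coeff (cl P) = to_ac (lead_coeff P)"
  by (simp add: coeff_map_poly)

lemma monic_minpoly: "lead_coeff (minpoly x) = 1"
proof -
  have "lead_coeff (cl (minpoly x)) = 1" unfolding cl_minpoly by (subst lead_coeff_prod) auto
  then show ?thesis unfolding lead_coeff_cl by simp
qed

lemma poly_minpoly: "poly (cl (minpoly x)) y = 0 \<longleftrightarrow> (\<exists>i<period x. y = x ^ (N ^ i))"
  unfolding cl_minpoly poly_prod by (auto simp: algebra_simps)

lemma poly_minpoly_self: "poly (cl (minpoly x)) x = 0"
  using poly_minpoly[of x x] period_pos[of x] by (metis power_0 power_one_right)

text \<open>The remainder modulo \<open>minpoly x\<close> vanishes at all conjugates of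
  \<open>x\<close>, which are more than its degree allows.\<close>

lemma minpoly_dvd_iff: "poly (cl R) x = 0 \<longleftrightarrow> minpoly x dvd R"
proof
  assume R: "poly (cl R) x = 0"
  define S where "S = R mod minpoly x"
  have "minpoly x \<noteq> 0" using monic_minpoly[of x] by auto
  have "R = R div minpoly x * minpoly x + S" using div_mult_mod_eq[of R "minpoly x"] by (simp add: S_def)
  then have "cl R = cl (R div minpoly x) * cl (minpoly x) + cl S"
    by (metis to_ac_hom.map_poly_hom_add to_ac_hom.map_poly_hom_mult)
  then have "poly (cl R) x = poly (cl (R div minpoly x)) x * poly (cl (minpoly x)) x + poly (cl S) x"
    by (metis poly_add poly_mult)
  with R have Sx: "poly (cl S) x = 0" by (simp add: poly_minpoly_self)
  have "S = 0"
  proof (rule ccontr)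
    assume "S \<noteq> 0"
    have "(\<lambda>i. x ^ (N ^ i)) ` {..<period x} \<subseteq> {y. poly (cl S) y = 0}"
      using Sx N_pow_pos by (auto simp: poly_cl_frob zero_power)
    then have "card ((\<lambda>i. x ^ (N ^ i)) ` {..<period x}) \<le> card {y. poly (cl S) y = 0}"
      using \<open>S \<noteq> 0\<close> by (intro card_mono poly_roots_finite) auto
    also have "\<dots> \<le> degree S" using card_poly_roots_bound[of "cl S"] \<open>S \<noteq> 0\<close> by simp
    finally have "period x \<le> degree S" by (simp add: card_image inj_on_conjugates)
    moreover have "degree S < degree (minpoly x)"
      using degree_mod_less[OF \<open>minpoly x \<noteq> 0\<close>, of R] \<open>S \<noteq> 0\<close> by (simp add: S_def)
    ultimately show False by (simp add: degree_minpoly)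
  qed
  then show "minpoly x dvd R" by (simp add: S_def dvd_eq_mod_eq_0)
next
  assume "minpoly x dvd R"
  then obtain T where "R = minpoly x * T" by (elim dvdE)
  then show "poly (cl R) x = 0" by (simp add: to_ac_hom.map_poly_hom_mult poly_minpoly_self)
qed

lemma irreducible_minpoly: "minpoly x \<in> monic_irreducibles"
proof -
  have "irreducible (minpoly x)"
  proof (rule irreducibleI)
    show "minpoly x \<noteq> 0" using monic_minpoly[of x] by auto
    show "\<not> minpoly x dvd 1" using minpoly_dvd_iff[of 1 x] by simp
    fix a b assume ab: "minpoly x = a * b"
    have unit: "v dvd 1" if uv: "minpoly x = u * v" "poly (cl u) x = 0" for u v
    proof -
      obtain c where "u = minpoly x * c" using uv(2) minpoly_dvd_iff by (metis dvdE)
      with uv(1) have "minpoly x * (c * v) = minpoly x * 1" by (simp add: mult_ac)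
      then have "c * v = 1" using monic_minpoly[of x] by (metis coeff_0 mult_cancel_left zero_neq_one)
      then show ?thesis by (metis dvd_triv_right)
    qed
    have "poly (cl a) x * poly (cl b) x = 0"
      using poly_minpoly_self[of x] by (simp add: ab to_ac_hom.map_poly_hom_mult)
    then have "poly (cl a) x = 0 \<or> poly (cl b) x = 0" by simp
    then show "a dvd 1 \<or> b dvd 1" using unit[OF ab] unit[of b a] ab by (auto simp: mult.commute)
  qed
  then show ?thesis by (simp add: monic_irreducibles_def monic_minpoly)
qed

lemma minpoly_eqI:
  assumes "Q \<in> monic_irreducibles" "poly (cl Q) x = 0"
  shows "minpoly x = Q"
  using monic_irreducible_dvd_imp_eq[OF irreducible_minpoly assms(1)] assms(2) minpoly_dvd_iff by blast

lemma roots_monic_irreducible: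
  assumes "Q \<in> monic_irreducibles"
  shows "{x. poly (cl Q) x = 0} = {x. minpoly x = Q}" and "card {x. minpoly x = Q} = degree Q"
    and "finite {x. minpoly x = Q}"
proof -
  show eq: "{x. poly (cl Q) x = 0} = {x. minpoly x = Q}"
    using minpoly_eqI[OF assms] poly_minpoly_self by auto
  have "degree (cl Q) > 0" using monic_irreducible_degree_pos[OF assms] by simp
  then obtain x where "poly (cl Q) x = 0" using alg_closed_imp_poly_has_root by blast
  then have Q: "Q = minpoly x" using minpoly_eqI[OF assms] by simp
  have "{y. poly (cl (minpoly x)) y = 0} = (\<lambda>i. x ^ (N ^ i)) ` {..<period x}"
    by (auto simp: poly_minpoly)
  then have "{x. minpoly x = Q} = (\<lambda>i. x ^ (N ^ i)) ` {..<period x}"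
    using eq Q by simp
  then show "card {x. minpoly x = Q} = degree Q" "finite {x. minpoly x = Q}"
    by (simp_all add: card_image inj_on_conjugates Q degree_minpoly)
qed

text \<open>The elements of the extension of degree \<open>k\<close> are partitioned by their
  minimal polynomials; a polynomial of degree \<open>e\<close> occurs if and only if
  \<open>e\<close> divides \<open>k\<close>, and then for \<open>e\<close> elements.\<close>

lemma sum_over_monic_irreducibles:
  fixes h :: "'k poly \<Rightarrow> complex"
  assumes k: "k > 0"
  shows "(\<Sum>Q | Q \<in> monic_irreducibles \<and> degree Q dvd k \<and> degree Q \<le> k. of_nat (degree Q) * h Q)
     = (\<Sum>x | x ^ (N ^ k) = x. h (minpoly x))"
proof -
  let ?I = "{Q :: 'k poly. Q \<in> monic_irreducibles \<and> degree Q dvd k \<and> degree Q \<le> k}"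
  have fin: "finite ?I" by (rule finite_subset[OF _ finite_polys_degree_le[of k]]) auto
  have "(\<Sum>Q\<in>?I. of_nat (degree Q) * h Q) = (\<Sum>Q\<in>?I. \<Sum>x\<in>{x. minpoly x = Q}. h (minpoly x))"
    by (intro sum.cong refl) (simp add: roots_monic_irreducible)
  also have "\<dots> = (\<Sum>x\<in>(\<Union>Q\<in>?I. {x. minpoly x = Q}). h (minpoly x))"
    using fin by (intro sum.UNION_disjoint[symmetric]) (auto simp: roots_monic_irreducible)
  also have "(\<Union>Q\<in>?I. {x. minpoly x = Q}) = {x. x ^ (N ^ k) = x}"
    using k irreducible_minpoly by (auto simp: frob_fixed_iff degree_minpoly intro: dvd_imp_le)
  finally show ?thesis .
qed

end

lemma alg_closed_monic_factorization:
  fixes P :: "'a::alg_closed_field poly"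
  assumes "lead_coeff P = 1"
  shows "P = (\<Prod>x\<in>#proots P. [:- x, 1:])"
proof -
  have "P \<noteq> 0" using assms by auto
  then obtain A where A: "P = smult (lead_coeff P) (\<Prod>x\<in>#A. [:- x, 1:])"
    using alg_closed_imp_factorization by blast
  then have A: "P = (\<Prod>x\<in>#A. [:- x, 1:])" unfolding assms by simp
  have "proots (\<Prod>x\<in>#A. [:- x, 1 :: 'a:]) = A"
  proof (induction A)
    case (add x A)
    have "(\<Prod>x\<in>#A. [:- x, 1 :: 'a:]) \<noteq> 0" by (auto simp: prod_mset_zero_iff)
    then show ?case using add by (simp add: proots_mult del: mult_pCons_left)
  qed simp
  with A show ?thesis by simp
qed

subsection \<open>The Weil bound\<close>

text \<open>For a monic polynomial with nonzero roots this is the sum of their inverses, while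
  \<open>log_deriv_inf\<close> is the sum of the roots. Both turn products into sums, so additive
  characters of them are multiplicative functions of the polynomial.\<close>

definition log_deriv_0 :: "'a::field poly \<Rightarrow> 'a" where
  "log_deriv_0 P = - coeff P 1 / coeff P 0"

definition log_deriv_inf :: "'a::field poly \<Rightarrow> 'a" where
  "log_deriv_inf P = - coeff (reflect_poly P) 1"

lemma coeff_mult_1: "coeff (P * Q) 1 = coeff P 0 * coeff Q 1 + coeff P 1 * coeff (Q :: 'a::comm_ring_1 poly) 0"
  by (simp add: coeff_mult)

lemma log_deriv_0_mult:
  "coeff P 0 \<noteq> 0 \<Longrightarrow> coeff Q 0 \<noteq> 0 \<Longrightarrow> log_deriv_0 (P * Q) = log_deriv_0 P + log_deriv_0 Q"
  unfolding log_deriv_0_def coeff_mult_1 by (simp add: coeff_mult_0 field_simps)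

lemma log_deriv_inf_mult:
  "lead_coeff P = 1 \<Longrightarrow> lead_coeff Q = 1 \<Longrightarrow> log_deriv_inf (P * Q) = log_deriv_inf P + log_deriv_inf Q"
  unfolding log_deriv_inf_def reflect_poly_mult coeff_mult_1 by simp

lemma log_deriv_inf_linear: "log_deriv_inf [:- a, 1:] = a"
  by (cases "a = 0") (simp_all add: log_deriv_inf_def reflect_poly_def)

lemma log_deriv_0_prod:
  fixes a :: "nat \<Rightarrow> 'a::field"
  assumes "\<And>i. i < n \<Longrightarrow> a i \<noteq> 0"
  shows "coeff (\<Prod>i<n. [:- a i, 1:]) 0 \<noteq> 0 \<and> log_deriv_0 (\<Prod>i<n. [:- a i, 1:]) = (\<Sum>i<n. inverse (a i))"
  using assms
proof (induction n)
  case (Suc n)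
  have "log_deriv_0 [:- a n, 1:] = inverse (a n)" by (simp add: log_deriv_0_def field_simps)
  then show ?case using Suc
    by (simp add: log_deriv_0_mult coeff_mult_0 del: mult_pCons_left mult_pCons_right)
qed (simp add: log_deriv_0_def)

lemma log_deriv_inf_prod:
  fixes a :: "nat \<Rightarrow> 'a::field"
  shows "lead_coeff (\<Prod>i<n. [:- a i, 1:]) = 1 \<and> log_deriv_inf (\<Prod>i<n. [:- a i, 1:]) = (\<Sum>i<n. a i)"
proof (induction n)
  case (Suc n)
  let ?P = "\<Prod>i<n. [:- a i, 1:]"
  have "lead_coeff (?P * [:- a n, 1:]) = 1"
    using Suc by (simp add: lead_coeff_mult del: mult_pCons_right)
  moreover have "log_deriv_inf (?P * [:- a n, 1:]) = (\<Sum>i<n. a i) + a n"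
    using Suc log_deriv_inf_mult[of ?P "[:- a n, 1:]"] by (simp add: log_deriv_inf_linear del: mult_pCons_right)
  ultimately show ?case by (simp only: prod.lessThan_Suc sum.lessThan_Suc)
qed (simp add: log_deriv_inf_def)

section \<open>The L-function of a mixed character sum\<close>

text \<open>\<open>E\<close> collects the points to be left out: 0 and the zeros of
  \<open>F\<close>. As in the geometric setting, \<open>H\<close> says that the multiplicities of
  \<open>F\<close> have no common factor with \<open>d\<close>. The additive and the multiplicative
  character are not both trivial.\<close>

locale weil_sum = finite_field_closure f N type_k
  for f N :: nat and type_k :: "'k::finite_field itself" +
  fixes F E :: "'k poly" and y z :: 'k and \<omega> :: complex and d :: nat
  assumes monic_F: "lead_coeff F = 1" and E_nz: "E \<noteq> 0" and E_0: "poly E 0 = 0"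
    and FE: "\<And>x. poly (cl F) x = 0 \<Longrightarrow> poly (cl E) x = 0"
    and d: "d dvd N - 1" and \<omega>: "\<omega> ^ d = 1"
    and H: "\<And>b. (\<And>\<rho>. d dvd b * order \<rho> (cl F)) \<Longrightarrow> d dvd b"
    and nontrivial: "\<omega> \<noteq> 1 \<or> y \<noteq> 0 \<or> z \<noteq> 0"
begin

lemma \<omega>_unit: "\<omega> ^ (CARD('k) - 1) = 1"
  using d \<omega> by (auto simp: card_N power_mult elim!: dvdE)

abbreviation \<chi> :: "'k \<Rightarrow> complex" where "\<chi> \<equiv> mult_char \<omega>"
abbreviation \<psi> :: "'k \<Rightarrow> complex" where "\<psi> \<equiv> add_char f"

lemma psi_add: "\<psi> (a + b) = \<psi> a * \<psi> b"
  by (rule add_char_add) (metis card_N card_eq finite_field_power_card_eq_same)+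

lemma psi_of_nat_mult: "\<psi> (of_nat n * a) = \<psi> a ^ n"
  by (induction n) (simp_all add: psi_add distrib_right)

lemma proots_frob: "image_mset (\<lambda>x. x ^ N) (proots (cl F)) = proots (cl F)"
proof -
  have l1: "lead_coeff (cl F) = 1" using monic_F by (simp add: coeff_map_poly)
  have "map_poly (\<lambda>c. c ^ N) (\<Prod>x\<in>#A. [:- x, 1:]) = (\<Prod>x\<in>#image_mset (\<lambda>x. x ^ N) A. [:- x, 1:])"
    for A :: "'k alg_closure multiset"
    by (induction A) (simp_all add: frob.map_poly_hom_mult map_poly_pCons frob.hom_simps del: mult_pCons_left mult_pCons_right)
  then have "(\<Prod>x\<in>#image_mset (\<lambda>x. x ^ N) (proots (cl F)). [:- x, 1:]) = cl F"
    using alg_closed_monic_factorization[OF l1] frob_cl by metis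
  moreover have "proots (\<Prod>x\<in>#A. [:- x, 1:]) = A" for A :: "'k alg_closure multiset"
  proof (induction A)
    case (add x A)
    have "(\<Prod>x\<in>#A. [:- x, 1 :: 'k alg_closure:]) \<noteq> 0" by (auto simp: prod_mset_zero_iff)
    then show ?case using add by (simp add: proots_mult del: mult_pCons_left)
  qed simp
  ultimately show ?thesis by metis
qed

text \<open>The resultant of \<open>P\<close> and \<open>F\<close> with its sign arranged so that
  for monic \<open>P\<close> it is the product of \<open>F\<close> over the roots of
  \<open>P\<close>. Writing it over the roots of \<open>F\<close> makes it multiplicative in
  \<open>P\<close> and shows its dependence on residues of \<open>P\<close>.\<close>

definition resF :: "'k poly \<Rightarrow> 'k" where
  "resF P = of_ac (\<Prod>\<rho>\<in>#proots (cl F). (- 1) ^ degree P * poly (cl P) \<rho>)"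

lemma to_ac_resF: "to_ac (resF P) = (\<Prod>\<rho>\<in>#proots (cl F). (- 1) ^ degree P * poly (cl P) \<rho>)"
  unfolding resF_def
proof (rule to_ac_of_ac')
  let ?g = "\<lambda>\<rho>. (- 1) ^ degree P * poly (cl P) \<rho>"
  have pow: "(\<Prod>\<rho>\<in>#A. ?g \<rho>) ^ N = (\<Prod>\<rho>\<in>#A. ?g \<rho> ^ N)" for A
    by (induction A) (simp_all add: power_mult_distrib)
  have "?g \<rho> ^ N = ?g (\<rho> ^ N)" for \<rho>
    using poly_cl_frob[of P \<rho> 1] frob_to_ac[of "(- 1) ^ degree P"] by (simp add: power_mult_distrib)
  then have "(\<Prod>\<rho>\<in>#proots (cl F). ?g \<rho>) ^ N = (\<Prod>\<rho>\<in>#proots (cl F). ?g (\<rho> ^ N))"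
    unfolding pow by simp
  also have "\<dots> = (\<Prod>\<rho>\<in>#image_mset (\<lambda>x. x ^ N) (proots (cl F)). ?g \<rho>)"
    by (simp add: image_mset.compositionality comp_def)
  finally show "(\<Prod>\<rho>\<in>#proots (cl F). ?g \<rho>) ^ N = (\<Prod>\<rho>\<in>#proots (cl F). ?g \<rho>)"
    unfolding proots_frob .
qed

lemma resF_mult:
  assumes "P \<noteq> 0" "Q \<noteq> 0"
  shows "resF (P * Q) = resF P * resF Q"
proof -
  have "to_ac (resF (P * Q)) = to_ac (resF P * resF Q)"
    unfolding to_ac_mult to_ac_resF prod_mset.distrib[symmetric]
    using assms by (simp add: degree_mult_eq to_ac_hom.map_poly_hom_mult power_add mult_ac)
  then show ?thesis by (simp only: to_ac_eq_iff)
qed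

lemma resF_minpoly: "to_ac (resF (minpoly x)) = (\<Prod>i<period x. poly (cl F) x ^ (N ^ i))"
proof -
  have l1: "lead_coeff (cl F) = 1" using monic_F by (simp add: coeff_map_poly)
  have FX: "poly (cl F) u = (\<Prod>\<rho>\<in>#proots (cl F). u - \<rho>)" for u
    by (subst alg_closed_monic_factorization[OF l1]) (simp add: poly_prod_mset image_mset.compositionality comp_def)
  have swap: "(\<Prod>\<rho>\<in>#A. \<Prod>i<n. g i \<rho>) = (\<Prod>i<n. \<Prod>\<rho>\<in>#A. g i \<rho>)" for A n and g :: "nat \<Rightarrow> _ \<Rightarrow> 'k alg_closure"
    by (induction A) (simp_all add: prod.distrib)
  have "(- 1) ^ degree (minpoly x) * poly (cl (minpoly x)) \<rho> = (\<Prod>i<period x. x ^ (N ^ i) - \<rho>)" for \<rho>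
  proof -
    have "(- 1) ^ degree (minpoly x) * poly (cl (minpoly x)) \<rho> = (\<Prod>i<period x. - 1) * (\<Prod>i<period x. \<rho> - x ^ (N ^ i))"
      by (simp add: degree_minpoly cl_minpoly poly_prod)
    also have "\<dots> = (\<Prod>i<period x. - 1 * (\<rho> - x ^ (N ^ i)))" by (rule prod.distrib[symmetric])
    finally show ?thesis by simp
  qed
  then have "to_ac (resF (minpoly x)) = (\<Prod>\<rho>\<in>#proots (cl F). \<Prod>i<period x. x ^ (N ^ i) - \<rho>)"
    by (simp add: to_ac_resF)
  also have "\<dots> = (\<Prod>i<period x. poly (cl F) (x ^ (N ^ i)))" unfolding swap FX ..
  finally show ?thesis by (simp add: poly_cl_frob)
qed

definition good :: "'k poly \<Rightarrow> bool" where
  "good P \<longleftrightarrow> (\<forall>x. poly (cl E) x = 0 \<longrightarrow> poly (cl P) x \<noteq> 0)"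

lemma good_coeff_0: "good P \<Longrightarrow> coeff P 0 \<noteq> 0"
proof -
  assume "good P"
  moreover have "poly (cl E) 0 = 0" using E_0 to_ac_hom.poly_map_poly_hom[of E 0] by simp
  ultimately have "poly (cl P) 0 \<noteq> 0" by (simp add: good_def)
  then show ?thesis using to_ac_hom.poly_map_poly_hom[of P 0] by (simp add: poly_0_coeff_0)
qed

lemma good_mult: "good (P * Q) \<longleftrightarrow> good P \<and> good Q"
  by (auto simp: good_def to_ac_hom.map_poly_hom_mult)

text \<open>The multiplicative function whose L-function encodes the sums. At \<open>x - a\<close>
  with \<open>poly E a \<noteq> 0\<close> it takes the value
  \<open>\<chi> (poly F a) * \<psi> (y * a + z / a)\<close>.\<close>

definition \<Lambda> :: "'k poly \<Rightarrow> complex" where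
  "\<Lambda> P = (if good P then \<chi> (resF P) * \<psi> (y * log_deriv_inf P + z * log_deriv_0 P) else 0)"

lemma \<Lambda>_mult:
  assumes "lead_coeff P = 1" "lead_coeff Q = 1"
  shows "\<Lambda> (P * Q) = \<Lambda> P * \<Lambda> Q"
proof (cases "good P \<and> good Q")
  case True
  moreover have "P \<noteq> 0" "Q \<noteq> 0" using assms by auto
  moreover have "y * log_deriv_inf (P * Q) + z * log_deriv_0 (P * Q) =
    (y * log_deriv_inf P + z * log_deriv_0 P) + (y * log_deriv_inf Q + z * log_deriv_0 Q)"
    using True assms by (simp add: log_deriv_inf_mult log_deriv_0_mult good_coeff_0 algebra_simps)
  ultimately show ?thesis
    by (simp add: \<Lambda>_def good_mult resF_mult psi_add mult_char_mult[OF \<omega>_unit])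
qed (auto simp: \<Lambda>_def good_mult)

lemma \<Lambda>_1: "\<Lambda> 1 = 1"
proof -
  have "to_ac (resF 1) = to_ac (1 :: 'k)" by (simp add: to_ac_resF)
  then have "resF 1 = 1" by simp
  then show ?thesis
    by (simp add: \<Lambda>_def good_def log_deriv_0_def log_deriv_inf_def mult_char_1[OF \<omega>_unit])
qed

lemma reflect_poly_cl: "reflect_poly (cl P) = cl (reflect_poly P)"
  by (rule poly_eqI) (simp add: coeff_reflect_poly coeff_map_poly)

lemma good_minpoly: "good (minpoly x) \<longleftrightarrow> poly (cl E) x \<noteq> 0"
proof
  assume "good (minpoly x)"
  then show "poly (cl E) x \<noteq> 0" using poly_minpoly_self[of x] by (auto simp: good_def)
next
  assume "poly (cl E) x \<noteq> 0"
  then show "good (minpoly x)" by (auto simp: good_def poly_minpoly poly_cl_frob)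
qed

lemma periodic_prod: "(\<Prod>i<period x * j. g (x ^ (N ^ i))) = (\<Prod>i<period x. g (x ^ (N ^ i)) :: 'b::comm_monoid_mult) ^ j"
proof (induction j)
  case (Suc j)
  have "(\<Prod>i<period x * Suc j. g (x ^ (N ^ i))) = (\<Prod>i<period x * j + period x. g (x ^ (N ^ i)))"
    by (simp add: algebra_simps)
  also have "\<dots> = (\<Prod>i<period x * j. g (x ^ (N ^ i))) * (\<Prod>i\<in>{period x * j..<period x * j + period x}. g (x ^ (N ^ i)))"
    by (subst prod.atLeastLessThan_concat[of 0, symmetric, simplified atLeast0LessThan]) (auto simp: atLeast0LessThan)
  also have "(\<Prod>i\<in>{period x * j..<period x * j + period x}. g (x ^ (N ^ i))) = (\<Prod>i<period x. g (x ^ (N ^ i)))"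
  proof (rule prod.reindex_bij_witness[of _ "\<lambda>i. i + period x * j" "\<lambda>i. i - period x * j"])
    fix i assume "i \<in> {period x * j..<period x * j + period x}"
    then obtain i' where i': "i = period x * j + i'" by (auto simp: le_iff_add)
    have "x ^ (N ^ i) = (x ^ (N ^ (period x * j))) ^ (N ^ i')" by (simp add: i' flip: power_mult power_add)
    then show "g (x ^ (N ^ (i - period x * j))) = g (x ^ (N ^ i))" by (simp add: i' frob_period_mult)
  qed auto
  finally show ?case unfolding Suc by (simp add: mult.commute)
qed simp

lemma periodic_sum: "(\<Sum>i<period x * j. g (x ^ (N ^ i))) = of_nat j * (\<Sum>i<period x. g (x ^ (N ^ i)) :: 'b::comm_semiring_1)"
proof (induction j)
  case (Suc j)
  have "(\<Sum>i<period x * Suc j. g (x ^ (N ^ i))) = (\<Sum>i<period x * j + period x. g (x ^ (N ^ i)))"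
    by (simp add: algebra_simps)
  also have "\<dots> = (\<Sum>i<period x * j. g (x ^ (N ^ i))) + (\<Sum>i\<in>{period x * j..<period x * j + period x}. g (x ^ (N ^ i)))"
    by (subst sum.atLeastLessThan_concat[of 0, symmetric, simplified atLeast0LessThan]) (auto simp: atLeast0LessThan)
  also have "(\<Sum>i\<in>{period x * j..<period x * j + period x}. g (x ^ (N ^ i))) = (\<Sum>i<period x. g (x ^ (N ^ i)))"
  proof (rule sum.reindex_bij_witness[of _ "\<lambda>i. i + period x * j" "\<lambda>i. i - period x * j"])
    fix i assume "i \<in> {period x * j..<period x * j + period x}"
    then obtain i' where i': "i = period x * j + i'" by (auto simp: le_iff_add)
    have "x ^ (N ^ i) = (x ^ (N ^ (period x * j))) ^ (N ^ i')" by (simp add: i' flip: power_mult power_add)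
    then show "g (x ^ (N ^ (i - period x * j))) = g (x ^ (N ^ i))" by (simp add: i' frob_period_mult)
  qed auto
  finally show ?case unfolding Suc by (simp add: algebra_simps)
qed simp

definition gx :: "'k alg_closure \<Rightarrow> 'k alg_closure" where
  "gx x = to_ac y * x + to_ac z / x"

definition ext_term :: "nat \<Rightarrow> 'k alg_closure \<Rightarrow> complex" where
  "ext_term k x = \<chi> (of_ac (\<Prod>i<k. poly (cl F) x ^ (N ^ i))) * \<psi> (of_ac (\<Sum>i<k. gx x ^ (N ^ i)))"

lemma gx_frob: "gx x ^ (N ^ i) = gx (x ^ (N ^ i))"
  by (simp add: gx_def frob_add power_mult_distrib power_divide)

text \<open>Norm and trace from the extension of degree \<open>k\<close> run through the orbit of
  \<open>x\<close> exactly \<open>k div period x\<close> times. Hence they give the corresponding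
  power and multiple of the invariants of \<open>minpoly x\<close>.\<close>

lemma \<Lambda>_minpoly_power:
  assumes x: "poly (cl E) x \<noteq> 0" "x ^ (N ^ k) = x"
  shows "\<Lambda> (minpoly x) ^ (k div period x) = ext_term k x"
proof -
  define j where "j = k div period x"
  have k: "k = period x * j" using x(2) by (simp add: j_def frob_fixed_iff)
  have x0: "x \<noteq> 0" using x(1) E_0 to_ac_hom.poly_map_poly_hom[of E 0] by auto
  define P where "P = minpoly x"
  have "(\<Prod>i<k. poly (cl F) x ^ (N ^ i)) = to_ac (resF P ^ j)"
    unfolding k poly_cl_frob[symmetric] periodic_prod
    by (simp add: P_def resF_minpoly poly_cl_frob)
  moreover have "(\<Sum>i<k. gx x ^ (N ^ i)) = to_ac (of_nat j * (y * log_deriv_inf P + z * log_deriv_0 P))"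
  proof -
    have "to_ac (log_deriv_0 P) = log_deriv_0 (cl P)" by (simp add: log_deriv_0_def coeff_map_poly)
    also have "\<dots> = (\<Sum>i<period x. inverse (x ^ (N ^ i)))"
      using log_deriv_0_prod[of "period x" "\<lambda>i. x ^ (N ^ i)"] x0 by (simp add: P_def cl_minpoly)
    finally have l0: "to_ac (log_deriv_0 P) = (\<Sum>i<period x. inverse (x ^ (N ^ i)))" .
    have "to_ac (log_deriv_inf P) = log_deriv_inf (cl P)"
      by (simp add: log_deriv_inf_def reflect_poly_cl coeff_map_poly)
    also have "\<dots> = (\<Sum>i<period x. x ^ (N ^ i))"
      using log_deriv_inf_prod[of "\<lambda>i. x ^ (N ^ i)" "period x"] by (simp add: P_def cl_minpoly)
    finally have linf: "to_ac (log_deriv_inf P) = (\<Sum>i<period x. x ^ (N ^ i))" .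
    have "(\<Sum>i<k. gx x ^ (N ^ i)) = of_nat j * (\<Sum>i<period x. gx (x ^ (N ^ i)))"
      unfolding gx_frob k by (rule periodic_sum)
    also have "(\<Sum>i<period x. gx (x ^ (N ^ i))) = to_ac y * to_ac (log_deriv_inf P) + to_ac z * to_ac (log_deriv_0 P)"
      unfolding l0 linf gx_def by (simp add: sum.distrib sum_distrib_left divide_inverse)
    finally show ?thesis by simp
  qed
  ultimately have "ext_term k x = \<chi> (resF P ^ j) * \<psi> (of_nat j * (y * log_deriv_inf P + z * log_deriv_0 P))"
    by (simp only: ext_term_def of_ac_to_ac)
  also have "\<dots> = \<Lambda> P ^ j"
    using x(1) by (simp add: mult_char_power[OF \<omega>_unit] psi_of_nat_mult \<Lambda>_def P_def good_minpoly power_mult_distrib)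
  finally show ?thesis by (simp add: P_def j_def)
qed

lemma prime_power_sums:
  assumes k: "k > 0"
  shows "(\<Sum>Q | Q \<in> monic_irreducibles \<and> degree Q dvd k \<and> degree Q \<le> k. of_nat (degree Q) * \<Lambda> Q ^ (k div degree Q))
     = (\<Sum>x | x ^ (N ^ k) = x \<and> poly (cl E) x \<noteq> 0. ext_term k x)"
proof -
  have "(\<Sum>Q | Q \<in> monic_irreducibles \<and> degree Q dvd k \<and> degree Q \<le> k. of_nat (degree Q) * \<Lambda> Q ^ (k div degree Q))
     = (\<Sum>x | x ^ (N ^ k) = x. \<Lambda> (minpoly x) ^ (k div period x))"
    using sum_over_monic_irreducibles[OF k, of "\<lambda>Q. \<Lambda> Q ^ (k div degree Q)"] by (simp add: degree_minpoly)
  also have "\<dots> = (\<Sum>x | x ^ (N ^ k) = x \<and> poly (cl E) x \<noteq> 0. ext_term k x)"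
  proof (rule sum.mono_neutral_cong_right)
    show "finite {x :: 'k alg_closure. x ^ (N ^ k) = x}" using k by (rule card_frob_fixed)
    show "\<forall>x\<in>{x. x ^ (N ^ k) = x} - {x. x ^ (N ^ k) = x \<and> poly (cl E) x \<noteq> 0}. \<Lambda> (minpoly x) ^ (k div period x) = 0"
    proof
      fix x assume x: "x \<in> {x. x ^ (N ^ k) = x} - {x. x ^ (N ^ k) = x \<and> poly (cl E) x \<noteq> 0}"
      then have "period x dvd k" by (simp add: frob_fixed_iff)
      with k have "k div period x > 0" using period_pos[of x] by (simp add: div_greater_zero_iff dvd_imp_le)
      then show "\<Lambda> (minpoly x) ^ (k div period x) = 0" using x by (simp add: \<Lambda>_def good_minpoly zero_power)
    qed
  qed (auto simp: \<Lambda>_minpoly_power)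
  finally show ?thesis .
qed

lemma finite_fixed: "k > 0 \<Longrightarrow> finite {x :: 'k alg_closure. x ^ (N ^ k) = x \<and> poly (cl E) x \<noteq> 0}"
  by (rule finite_subset[OF _ card_frob_fixed(2)]) auto

lemma card_fixed_ge:
  assumes "k > 0"
  shows "real (N ^ k) - real (degree E) \<le> real (card {x. x ^ (N ^ k) = x \<and> poly (cl E) x \<noteq> 0})"
proof -
  let ?A = "{x. x ^ (N ^ k) = x \<and> poly (cl E) x \<noteq> 0}" and ?Z = "{x. poly (cl E) x = 0}"
  have fin: "finite ?Z" using E_nz by (intro poly_roots_finite) simp
  have "N ^ k = card {x :: 'k alg_closure. x ^ (N ^ k) = x}" using card_frob_fixed(1)[OF assms] by simp
  also have "\<dots> \<le> card (?A \<union> ?Z)" using finite_fixed[OF assms] fin by (intro card_mono) auto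
  also have "\<dots> \<le> card ?A + card ?Z" by (rule card_Un_le)
  also have "card ?Z \<le> degree E" using card_poly_roots_bound[of "cl E"] E_nz by simp
  finally have "N ^ k \<le> card ?A + degree E" by simp
  then have "real (N ^ k) \<le> real (card ?A + degree E)" by (simp only: of_nat_le_iff)
  then show ?thesis by simp
qed

lemma frob_norm_fixed:
  assumes "u ^ (N ^ k) = (u :: 'k alg_closure)"
  shows "(\<Prod>i<k. u ^ (N ^ i)) ^ N = (\<Prod>i<k. u ^ (N ^ i))"
proof (cases k)
  case (Suc m)
  have "(\<Prod>i<k. u ^ (N ^ i)) ^ N = (\<Prod>i<k. u ^ (N ^ Suc i))"
    unfolding prod_power_distrib by (simp add: mult.commute flip: power_mult)
  also have "\<dots> = (\<Prod>i<m. u ^ (N ^ Suc i)) * u" using assms by (simp add: Suc)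
  also have "\<dots> = (\<Prod>i<k. u ^ (N ^ i))" unfolding Suc prod.lessThan_Suc_shift by (simp add: mult.commute)
  finally show ?thesis .
qed simp

lemma frob_trace_fixed:
  assumes "u ^ (N ^ k) = (u :: 'k alg_closure)"
  shows "(\<Sum>i<k. u ^ (N ^ i)) ^ N = (\<Sum>i<k. u ^ (N ^ i))"
proof (cases k)
  case (Suc m)
  have "(\<Sum>i<k. u ^ (N ^ i)) ^ N = (\<Sum>i<k. (u ^ (N ^ i)) ^ N)"
    using frob_sum[of "\<lambda>i. u ^ (N ^ i)" "{..<k}" 1] by simp
  also have "\<dots> = (\<Sum>i<k. u ^ (N ^ Suc i))"
    by (simp add: mult.commute flip: power_mult)
  also have "\<dots> = (\<Sum>i<m. u ^ (N ^ Suc i)) + u" using assms by (simp add: Suc)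
  also have "\<dots> = (\<Sum>i<k. u ^ (N ^ i))" unfolding Suc sum.lessThan_Suc_shift by (simp add: add.commute)
  finally show ?thesis .
qed (use N_gt_1 in \<open>simp add: zero_power\<close>)

text \<open>If the additive character is trivial, Stepanov's method still needs a nondegenerate
  Artin-Schreier equation. One is put in artificially, and \<tau>' is then set to 1, so that the
  added classes do not change the values of the sum.\<close>

definition y' :: 'k where "y' = (if y = 0 \<and> z = 0 then 1 else y)"

lemma yz': "y' \<noteq> 0 \<or> z \<noteq> 0" by (auto simp: y'_def)

definition \<tau>' :: complex where "\<tau>' = (if y = 0 \<and> z = 0 then 1 else char_root TYPE('k))"

definition gx' :: "'k alg_closure \<Rightarrow> 'k alg_closure" where "gx' x = to_ac y' * x + to_ac z / x"

lemma gx'_frob: "gx' x ^ (N ^ i) = gx' (x ^ (N ^ i))"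
  by (simp add: gx'_def frob_add power_mult_distrib power_divide)

definition \<zeta> :: 'k where "\<zeta> = gen ^ ((N - 1) div d)"

lemma d_pos: "d > 0" using d N_gt_1 by (auto intro: Nat.gr0I)

lemma \<zeta>_power_eq_iff: "\<zeta> ^ i = \<zeta> ^ j \<longleftrightarrow> [i = j] (mod d)"
proof -
  let ?e = "(N - 1) div d"
  have Ne: "N - 1 = ?e * d" using d by simp
  have e: "?e > 0" using Ne N_gt_1 by (metis diff_is_0_eq gr0I mult_0 not_less)
  have "\<zeta> ^ i = \<zeta> ^ j \<longleftrightarrow> [?e * i = ?e * j] (mod (?e * d))"
    using Ne by (simp add: \<zeta>_def gen_power_eq_iff card_N flip: power_mult)
  also have "\<dots> \<longleftrightarrow> [i = j] (mod d)"
    using e by (simp add: cong_def mult_mod_right[symmetric])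
  finally show ?thesis .
qed

text \<open>The power \<open>(N ^ k - 1) div d\<close> factors through the norm to the base field,
  and the long trace through the trace to it. So the two invariants of the point count determine the
  multiplicative and the additive character value of \<open>x\<close>.\<close>

lemma class_exists:
  assumes x: "x ^ (N ^ k) = x" "poly (cl E) x \<noteq> 0"
  obtains i j where "i < d" "j < CHAR('k)"
    "poly (cl F) x ^ ((N ^ k - 1) div d) = to_ac (\<zeta> ^ i)"
    "(\<Sum>l<f * k. gx' x ^ (CHAR('k) ^ l)) = of_nat j"
    "ext_term k x = \<omega> ^ i * \<tau>' ^ j"
proof -
  let ?p = "CHAR('k)" and ?e = "(N - 1) div d"
  have Ne: "N - 1 = ?e * d" using d by simp
  have Fx0: "poly (cl F) x \<noteq> 0" using x FE by blast
  define a where "a = (of_ac (\<Prod>i<k. poly (cl F) x ^ (N ^ i)) :: 'k)"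
  have a: "to_ac a = (\<Prod>i<k. poly (cl F) x ^ (N ^ i))"
    unfolding a_def
  proof (rule to_ac_of_ac')
    have "poly (cl F) x ^ (N ^ k) = poly (cl F) x" using poly_cl_frob[of F x k] x by simp
    from frob_norm_fixed[OF this]
    show "(\<Prod>i<k. poly (cl F) x ^ (N ^ i)) ^ N = (\<Prod>i<k. poly (cl F) x ^ (N ^ i))" .
  qed
  have "to_ac a \<noteq> 0" unfolding a using Fx0 by simp
  then have a0: "a \<noteq> 0" by simp
  define i where "i = dlog a mod d"
  have i: "i < d" "[dlog a = i] (mod d)" using d_pos by (simp_all add: i_def cong_def)
  have geom: "(\<Sum>i<k. N ^ i) * (N - 1) = N ^ k - 1"
  proof -
    have "(\<Sum>i<k. Suc n ^ i) * n + 1 = Suc n ^ k" for n by (induction k) (simp_all add: algebra_simps)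
    from this[of "N - 1"] show ?thesis using N_gt_1 by simp
  qed
  then have expo: "(N ^ k - 1) div d = (\<Sum>i<k. N ^ i) * ?e"
    unfolding Ne[symmetric] using d_pos by (metis Ne mult.assoc nonzero_mult_div_cancel_right not_gr_zero)
  have 1: "poly (cl F) x ^ ((N ^ k - 1) div d) = to_ac (\<zeta> ^ i)"
  proof -
    have "poly (cl F) x ^ ((N ^ k - 1) div d) = to_ac a ^ ?e"
      unfolding expo power_mult a power_sum ..
    also have "\<dots> = to_ac ((gen ^ dlog a) ^ ?e)" using a0 by simp
    also have "(gen ^ dlog a) ^ ?e = \<zeta> ^ dlog a" by (simp add: \<zeta>_def mult.commute flip: power_mult)
    also have "\<zeta> ^ dlog a = \<zeta> ^ i" using i \<zeta>_power_eq_iff by blast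
    finally show ?thesis .
  qed
  have chi: "\<chi> a = \<omega> ^ i"
    using a0 power_cong_exponent[OF \<omega> i(2)] by (simp add: mult_char_def)
  define b where "b = (of_ac (\<Sum>i<k. gx' x ^ (N ^ i)) :: 'k)"
  have b: "to_ac b = (\<Sum>i<k. gx' x ^ (N ^ i))"
    unfolding b_def by (rule to_ac_of_ac', rule frob_trace_fixed) (simp add: gx'_frob x)
  have bN: "b ^ (?p ^ f) = b" using finite_field_power_card_eq_same[of b] by (simp add: card_N card_eq)
  have "abs_trace f b \<in> of_nat ` {..<?p}"
    using abs_trace_power_char[OF bN] card_prime_field[where ?'a = 'k] by blast
  then obtain j where j: "j < ?p" "of_nat j = abs_trace f b" by auto
  have 2: "(\<Sum>l<f * k. gx' x ^ (?p ^ l)) = of_nat j"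
  proof -
    have dream: "(\<Sum>a\<in>A. h a :: 'k alg_closure) ^ (?p ^ r) = (\<Sum>a\<in>A. h a ^ (?p ^ r))" for A h r
      by (rule freshmans_dream_sum'[OF char_prime]) simp
    have "(\<Sum>l<f * k. gx' x ^ (?p ^ l)) = (\<Sum>i<k. \<Sum>l\<in>{i * f..<i * f + f}. gx' x ^ (?p ^ l))"
      by (simp add: sum.nat_group mult.commute)
    also have "\<dots> = (\<Sum>i<k. \<Sum>r<f. (gx' x ^ (N ^ i)) ^ (?p ^ r))"
    proof (rule sum.cong[OF refl])
      fix i
      show "(\<Sum>l\<in>{i * f..<i * f + f}. gx' x ^ (?p ^ l)) = (\<Sum>r<f. (gx' x ^ (N ^ i)) ^ (?p ^ r))"
        by (rule sum.reindex_bij_witness[of _ "\<lambda>r. r + i * f" "\<lambda>l. l - i * f"])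
           (auto simp: card_eq mult.commute simp flip: power_mult power_add)
    qed
    also have "\<dots> = (\<Sum>r<f. \<Sum>i<k. (gx' x ^ (N ^ i)) ^ (?p ^ r))" by (rule sum.swap)
    also have "\<dots> = (\<Sum>r<f. to_ac b ^ (?p ^ r))" unfolding b dream ..
    also have "\<dots> = to_ac (abs_trace f b)" by (simp add: abs_trace_def to_ac_sum)
    finally show ?thesis by (simp flip: j(2))
  qed
  have psi: "\<psi> (of_ac (\<Sum>i<k. gx x ^ (N ^ i))) = \<tau>' ^ j"
  proof (cases "y = 0 \<and> z = 0")
    case True
    have gx0: "gx x = 0" unfolding gx_def using True by simp
    have tau: "\<tau>' = 1" unfolding \<tau>'_def by (rule if_P[OF True])
    have "(\<Sum>i<k. gx x ^ (N ^ i)) = 0" unfolding gx0 using N_pow_pos by (simp add: zero_power)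
    then show ?thesis unfolding tau by simp
  next
    case False
    then have gxe: "gx x = gx' x" unfolding gx_def gx'_def y'_def by (simp only: if_False)
    have "\<tau>' = char_root TYPE('k)" unfolding \<tau>'_def by (rule if_not_P[OF False])
    moreover have "of_ac (\<Sum>i<k. gx x ^ (N ^ i)) = b" unfolding gxe b_def ..
    ultimately show ?thesis using add_char_eqI[OF j(2)] by simp
  qed
  have "ext_term k x = \<omega> ^ i * \<tau>' ^ j"
    unfolding ext_term_def psi using chi by (simp add: a_def)
  with i(1) j(1) 1 2 show ?thesis by (rule that)
qed

lemma sum_class_characters: "(\<Sum>i<d. \<Sum>j<CHAR('k). \<omega> ^ i * \<tau>' ^ j) = 0"
proof -
  have geom: "(\<Sum>i<n. w ^ i) = 0" if "w ^ n = 1" "w \<noteq> 1" for w :: complex and n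
    using that geometric_sum[of w n] by simp
  have "(\<Sum>i<d. \<Sum>j<CHAR('k). \<omega> ^ i * \<tau>' ^ j) = (\<Sum>i<d. \<omega> ^ i) * (\<Sum>j<CHAR('k). \<tau>' ^ j)"
    by (simp add: sum_product)
  moreover have "(\<Sum>i<d. \<omega> ^ i) = 0 \<or> (\<Sum>j<CHAR('k). \<tau>' ^ j) = 0"
  proof (cases "\<omega> = 1")
    case True
    then have "\<tau>' = char_root TYPE('k)" using nontrivial by (auto simp: \<tau>'_def)
    then show ?thesis using geom[OF char_root_power[where ?'a = 'k] char_root_neq_1] by simp
  qed (use geom[OF \<omega>] in blast)
  ultimately show ?thesis by auto
qed

text \<open>Only upper bounds for the classes are available, but the classes together contain all
  but at most \<open>degree E\<close> elements of the field, so subtracting the upper bounds of the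
  other classes bounds each one from below. All classes then have nearly equal size, and the common
  main term cancels in the character sum.\<close>

lemma even_power_sum_bound:
  obtains C :: real and k0 where "\<And>k. k \<ge> k0 \<Longrightarrow>
    norm (\<Sum>x | x ^ (N ^ (2 * k)) = x \<and> poly (cl E) x \<noteq> 0. ext_term (2 * k) x) \<le> C * real N ^ k"
proof -
  let ?p = "CHAR('k)"
  have charK: "CHAR('k alg_closure) = ?p" by simp
  interpret S: kummer_artin_schreier "cl F" "to_ac y'" "to_ac z" d f
  proof
    show "prime CHAR('k alg_closure)" by (rule char_prime)
    have "F \<noteq> 0" using monic_F by auto
    then show "cl F \<noteq> 0" by simp
    show "d dvd CHAR('k alg_closure) ^ f - 1" using d by (simp add: card_eq)
    show "f > 0" by (rule f_pos)
    show "d dvd b" if "\<And>\<rho>. d dvd b * order \<rho> (cl F)" for b using that by (rule H)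
    show "to_ac y' \<noteq> 0 \<or> to_ac z \<noteq> 0" using yz' by simp
  qed
  obtain C :: real and k0 where C: "\<And>k \<epsilon> \<eta>. k \<ge> k0 \<Longrightarrow>
    real (card {x. x \<noteq> 0 \<and> poly (cl F) x \<noteq> 0 \<and> x ^ (?p ^ (f * (2 * k))) = x \<and>
       poly (cl F) x ^ ((?p ^ (f * (2 * k)) - 1) div d) = \<epsilon> \<and>
       (\<Sum>i<f * (2 * k). (to_ac y' * x + to_ac z / x) ^ (?p ^ i)) = \<eta>})
    \<le> real (?p ^ (f * (2 * k))) / real (d * ?p) + C * real (?p ^ (f * k))"
  proof (rule S.stepanov_bound[unfolded charK], goal_cases)
    case (1 C k0)
    show ?case by (rule 1(1)[OF 1(2)])
  qed
  define D where "D = d * ?p"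
  have Dpos: "D > 0" using d_pos by (simp add: D_def)
  define C' where "C' = D * (D * \<bar>C\<bar> + degree E)"
  have "norm (\<Sum>x | x ^ (N ^ (2 * k)) = x \<and> poly (cl E) x \<noteq> 0. ext_term (2 * k) x) \<le> C' * real N ^ k"
    if k: "k \<ge> max k0 1" for k
  proof -
    define q where "q = N ^ (2 * k)"
    define Q where "Q = real N ^ k"
    have Q1: "Q \<ge> 1" using N_gt_1 by (simp add: Q_def)
    define A where "A = {x. x ^ q = x \<and> poly (cl E) x \<noteq> 0}"
    have finA: "finite A" unfolding A_def q_def using k by (intro finite_fixed) simp
    define Z where "Z = (\<lambda>(i, j). {x \<in> A. poly (cl F) x ^ ((q - 1) div d) = to_ac (\<zeta> ^ i) \<and>
        (\<Sum>l<f * (2 * k). gx' x ^ (?p ^ l)) = of_nat j})"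
    define J where "J = {..<d} \<times> {..<?p}"
    have cardJ: "card J = D" "finite J" by (simp_all add: J_def D_def)
    have finZ: "finite (Z ij)" for ij using finA by (auto simp: Z_def split: prod.splits)
    have disj: "Z ij \<inter> Z ij' = {}" if ne: "ij \<in> J" "ij' \<in> J" "ij \<noteq> ij'" for ij ij'
    proof (rule ccontr)
      assume "Z ij \<inter> Z ij' \<noteq> {}"
      then obtain x where x: "x \<in> Z ij" "x \<in> Z ij'" by blast
      obtain i j i' j' where ij: "ij = (i, j)" "ij' = (i', j')" by fastforce
      from x have "to_ac (\<zeta> ^ i) = to_ac (\<zeta> ^ i')" "of_nat j = (of_nat j' :: 'k alg_closure)"
        by (auto simp: Z_def ij simp del: to_ac_power)
      then have "\<zeta> ^ i = \<zeta> ^ i'" "[j = j'] (mod CHAR('k alg_closure))"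
        by (simp_all only: to_ac_eq_iff of_nat_eq_iff_cong_CHAR)
      then have "[i = i'] (mod d)" "[j = j'] (mod ?p)" using \<zeta>_power_eq_iff by auto
      with ne show False by (auto simp: J_def ij cong_def)
    qed
    have mem: "\<exists>ij\<in>J. x \<in> Z ij \<and> ext_term (2 * k) x = \<omega> ^ fst ij * \<tau>' ^ snd ij" if "x \<in> A" for x
    proof -
      have "x ^ (N ^ (2 * k)) = x" "poly (cl E) x \<noteq> 0" using that by (simp_all add: A_def q_def)
      from class_exists[OF this] obtain i j where "i < d" "j < ?p"
        "poly (cl F) x ^ ((N ^ (2 * k) - 1) div d) = to_ac (\<zeta> ^ i)"
        "(\<Sum>l<f * (2 * k). gx' x ^ (?p ^ l)) = of_nat j" "ext_term (2 * k) x = \<omega> ^ i * \<tau>' ^ j" by metis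
      with that show ?thesis by (intro bexI[of _ "(i, j)"]) (auto simp: Z_def J_def q_def)
    qed
    have val: "ext_term (2 * k) x = \<omega> ^ fst ij * \<tau>' ^ snd ij" if "ij \<in> J" "x \<in> Z ij" for ij x
    proof -
      have "x \<in> A" using that by (auto simp: Z_def split: prod.splits)
      then obtain ij' where "ij' \<in> J" "x \<in> Z ij'" "ext_term (2 * k) x = \<omega> ^ fst ij' * \<tau>' ^ snd ij'"
        using mem by blast
      with disj[of ij ij'] that show ?thesis by blast
    qed
    have AU: "A = (\<Union>ij\<in>J. Z ij)"
    proof
      show "A \<subseteq> (\<Union>ij\<in>J. Z ij)" using mem by blast
      show "(\<Union>ij\<in>J. Z ij) \<subseteq> A" by (auto simp: Z_def)
    qed
    define M where "M = real q / D"
    have upper: "real (card (Z ij)) \<le> M + \<bar>C\<bar> * Q" if "ij \<in> J" for ij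
    proof -
      obtain i j where ij: "ij = (i, j)" by fastforce
      have "Z ij \<subseteq> {x. x \<noteq> 0 \<and> poly (cl F) x \<noteq> 0 \<and> x ^ (?p ^ (f * (2 * k))) = x \<and>
         poly (cl F) x ^ ((?p ^ (f * (2 * k)) - 1) div d) = to_ac (\<zeta> ^ i) \<and>
         (\<Sum>i<f * (2 * k). (to_ac y' * x + to_ac z / x) ^ (?p ^ i)) = of_nat j}" (is "_ \<subseteq> ?S")
      proof
        fix x assume x: "x \<in> Z ij"
        then have "poly (cl E) x \<noteq> 0" by (auto simp: Z_def ij A_def)
        then have "x \<noteq> 0" "poly (cl F) x \<noteq> 0"
          using E_0 to_ac_hom.poly_map_poly_hom[of E 0] FE by auto
        with x show "x \<in> ?S"
          by (auto simp: Z_def ij A_def q_def card_eq gx'_def power_mult)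
      qed
      moreover have "finite ?S"
      proof (rule finite_subset[OF _ card_frob_fixed(2)[of "2 * k"]])
        show "?S \<subseteq> {x. x ^ N ^ (2 * k) = x}" by (auto simp: card_eq power_mult)
      qed (use k in simp)
      ultimately have "real (card (Z ij)) \<le> real (card ?S)" by (simp add: card_mono)
      also have "\<dots> \<le> real (?p ^ (f * (2 * k))) / real (d * ?p) + C * real (?p ^ (f * k))"
        using k by (intro C) simp
      also have "?p ^ (f * (2 * k)) = q" by (simp add: q_def card_eq power_mult)
      also have "real (?p ^ (f * k)) = Q" by (simp add: Q_def card_eq power_mult)
      also have "C * Q \<le> \<bar>C\<bar> * Q" using Q1 by (intro mult_right_mono) auto
      finally show ?thesis by (simp add: M_def D_def)
    qed
    have cardA: "card A = (\<Sum>ij\<in>J. card (Z ij))"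
      unfolding AU using cardJ finZ disj by (intro card_UN_disjoint) auto
    \<comment> \<open>The lower bound is obtained from the total count and the upper bounds for the
      other \<open>D - 1\<close> classes.\<close>
    have dev: "\<bar>real (card (Z ij)) - M\<bar> \<le> D * \<bar>C\<bar> * Q + degree E" if ij: "ij \<in> J" for ij
    proof -
      have "real q - degree E \<le> real (card A)"
        unfolding A_def q_def using k by (intro card_fixed_ge) simp
      also have "real (card A) = real (card (Z ij)) + (\<Sum>ij'\<in>J - {ij}. real (card (Z ij')))"
        unfolding cardA using cardJ ij by (simp add: sum.remove)
      also have "(\<Sum>ij'\<in>J - {ij}. real (card (Z ij'))) \<le> (\<Sum>ij'\<in>J - {ij}. M + \<bar>C\<bar> * Q)"
        using upper by (intro sum_mono) auto
      also have "\<dots> = (real D - 1) * (M + \<bar>C\<bar> * Q)"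
        using cardJ ij Dpos by (simp add: of_nat_diff)
      finally have "real q - degree E \<le> real (card (Z ij)) + (real D - 1) * (M + \<bar>C\<bar> * Q)" by simp
      moreover have "real q = D * M" using Dpos by (simp add: M_def)
      moreover have "0 \<le> \<bar>C\<bar> * Q" using Q1 by simp
      ultimately have "M - real (card (Z ij)) \<le> D * \<bar>C\<bar> * Q + degree E" by (simp add: algebra_simps)
      moreover have "\<bar>C\<bar> * Q \<le> D * (\<bar>C\<bar> * Q)"
        using Dpos \<open>0 \<le> \<bar>C\<bar> * Q\<close> mult_right_mono[of 1 "real D" "\<bar>C\<bar> * Q"] by simp
      then have "real (card (Z ij)) - M \<le> D * \<bar>C\<bar> * Q + degree E"
        using upper[OF ij] by (simp add: mult.assoc)
      ultimately show ?thesis by linarith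
    qed
    have "(\<Sum>x\<in>A. ext_term (2 * k) x) = (\<Sum>ij\<in>J. \<Sum>x\<in>Z ij. ext_term (2 * k) x)"
      unfolding AU using cardJ finZ disj by (intro sum.UNION_disjoint) auto
    also have "\<dots> = (\<Sum>ij\<in>J. of_nat (card (Z ij)) * (\<omega> ^ fst ij * \<tau>' ^ snd ij))"
      using val by (intro sum.cong refl) simp
    \<comment> \<open>The common size \<open>M\<close> is split off, since the character values sum
      to zero over all classes; only deviations remain.\<close>
    also have "\<dots> = (\<Sum>ij\<in>J. of_real (real (card (Z ij)) - M) * (\<omega> ^ fst ij * \<tau>' ^ snd ij)) + of_real M * (\<Sum>ij\<in>J. \<omega> ^ fst ij * \<tau>' ^ snd ij)"
      by (simp add: sum_distrib_left algebra_simps flip: sum.distrib)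
    also have "(\<Sum>ij\<in>J. \<omega> ^ fst ij * \<tau>' ^ snd ij) = 0"
      using sum_class_characters by (simp add: J_def sum.cartesian_product case_prod_unfold)
    finally have "norm (\<Sum>x\<in>A. ext_term (2 * k) x) \<le> (\<Sum>ij\<in>J. norm (of_real (real (card (Z ij)) - M) * (\<omega> ^ fst ij * \<tau>' ^ snd ij)))"
      by (simp add: norm_sum)
    also have "\<dots> \<le> (\<Sum>ij\<in>J. D * \<bar>C\<bar> * Q + degree E)"
    proof (rule sum_mono)
      fix ij assume ij: "ij \<in> J"
      have "norm \<omega> = 1" using \<omega> d_pos by (rule norm_root_of_unity)
      moreover have "norm \<tau>' = 1" by (simp add: \<tau>'_def char_root_def)
      ultimately have "norm (of_real (real (card (Z ij)) - M) * (\<omega> ^ fst ij * \<tau>' ^ snd ij)) = \<bar>real (card (Z ij)) - M\<bar>"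
        by (simp only: norm_mult norm_power norm_of_real) simp
      with dev[OF ij] show "norm (of_real (real (card (Z ij)) - M) * (\<omega> ^ fst ij * \<tau>' ^ snd ij)) \<le> D * \<bar>C\<bar> * Q + degree E"
        by simp
    qed
    also have "\<dots> = D * (D * \<bar>C\<bar> * Q + degree E)" using cardJ by simp
    also have "\<dots> \<le> C' * Q"
    proof -
      have "real (degree E) \<le> degree E * Q" using Q1 by (simp add: mult_le_cancel_left1)
      then have "real D * (D * \<bar>C\<bar> * Q + degree E) \<le> real D * (D * \<bar>C\<bar> * Q + degree E * Q)"
        by (intro mult_left_mono) auto
      then show ?thesis by (simp add: C'_def algebra_simps)
    qed
    finally show ?thesis by (simp add: A_def q_def Q_def)
  qed
  then show ?thesis by (rule that)
qed

end

section \<open>Vanishing of the high coefficients of the L-function\<close>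

text \<open>A nonzero element of least degree in the ideal generated by \<open>U\<close> and
  \<open>M\<close> divides both, and without a common irreducible factor it is constant.\<close>

lemma poly_bezout:
  fixes U M :: "'a::field poly"
  assumes M: "M \<noteq> 0" and no: "\<And>Q. Q \<in> monic_irreducibles \<Longrightarrow> Q dvd U \<Longrightarrow> \<not> Q dvd M"
  obtains a b where "a * U + b * M = 1"
proof -
  define I where "I = {P. \<exists>a b. P = a * U + b * M}"
  have MI: "M \<in> I" unfolding I_def by (rule CollectI, rule exI[of _ 0], rule exI[of _ 1]) simp
  have UI: "U \<in> I" unfolding I_def by (rule CollectI, rule exI[of _ 1], rule exI[of _ 0]) simp
  have sub: "P - c * R \<in> I" if PR: "P \<in> I" "R \<in> I" for P R c
  proof -
    obtain a b a' b' where "P = a * U + b * M" "R = a' * U + b' * M" using PR unfolding I_def by blast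
    then have "P - c * R = (a - c * a') * U + (b - c * b') * M" by (simp add: algebra_simps)
    then show ?thesis unfolding I_def by blast
  qed
  have "\<exists>P. P \<in> I \<and> P \<noteq> 0" using MI M by blast
  then obtain D where D: "D \<in> I" "D \<noteq> 0" and min: "\<And>P. P \<in> I \<Longrightarrow> P \<noteq> 0 \<Longrightarrow> degree D \<le> degree P"
    using ex_has_least_nat[of "\<lambda>P. P \<in> I \<and> P \<noteq> 0" _ degree] by metis
  have dvd: "D dvd P" if "P \<in> I" for P
  proof -
    have "P mod D = P - (P div D) * D" by (simp add: minus_div_mult_eq_mod)
    then have "P mod D \<in> I" using sub[OF that D(1)] by metis
    then have "P mod D = 0" using min[of "P mod D"] degree_mod_less[OF D(2), of P] by (metis not_le)
    then show ?thesis by (simp add: dvd_eq_mod_eq_0)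
  qed
  have "degree D = 0"
  proof (rule ccontr)
    assume "degree D \<noteq> 0"
    then obtain Q where Q: "Q \<in> monic_irreducibles" "Q dvd D" using ex_monic_irreducible_factor by blast
    have "Q dvd U" "Q dvd M" using dvd_trans[OF Q(2) dvd] UI MI by metis+
    with no Q(1) show False by metis
  qed
  then obtain c where c: "D = [:c:]" by (elim degree_eq_zeroE)
  obtain a b where ab: "D = a * U + b * M" using D(1) unfolding I_def by blast
  have "smult (inverse c) D = 1" using c D(2) by (simp add: one_pCons)
  then have "smult (inverse c) a * U + smult (inverse c) b * M = 1"
    by (simp add: ab smult_add_right)
  then show ?thesis by (rule that)
qed

lemma mult_inverse_mod:
  fixes V U b M B :: "'a::field poly"
  assumes "V * U + b * M = 1"
  shows "(V * ((U * B) mod M)) mod M = B mod M"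
proof -
  have "V * (U * B) = (V * U + b * M) * B + (- (b * B)) * M" by (simp add: algebra_simps)
  also have "\<dots> = B + (- (b * B)) * M" by (simp only: assms mult_1_left)
  finally have "(V * (U * B)) mod M = B mod M" by (simp only: mod_mult_self1)
  then show ?thesis by (simp only: mod_mult_right_eq)
qed

lemma monic_irreducible_X: "[:0, 1 :: 'a::field:] \<in> monic_irreducibles"
  using irreducible_linear_field_poly[of 1 "0 :: 'a"] by (simp add: monic_irreducibles_def)

lemma finite_monic_irreducible_factors:
  "P \<noteq> (0 :: 'k::finite_field poly) \<Longrightarrow> finite (monic_irreducible_factors P)"
  by (rule finite_subset[OF _ finite_polys_degree_le[of "degree P"]])
     (auto simp: monic_irreducible_factors_altdef intro: dvd_imp_degree_le)

lemma monic_prod_monic_irreducibles: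
  assumes "S \<subseteq> monic_irreducibles"
  shows "lead_coeff (\<Prod>S) = 1"
proof -
  have "lead_coeff (\<Prod>S) = (\<Prod>Q\<in>S. lead_coeff Q)" by (rule lead_coeff_prod)
  also have "\<dots> = 1" using assms by (intro prod.neutral) (auto simp: monic_irreducibles_def)
  finally show ?thesis .
qed

lemma monic_poly_rad: "lead_coeff (poly_rad P) = 1"
  unfolding poly_rad_def by (rule monic_prod_monic_irreducibles) (auto simp: monic_irreducible_factors_altdef)

context finite_field_closure
begin

text \<open>The trace is a nonzero polynomial of degree below the number of elements, so it is
  nonzero at some \<open>b\<close>; a suitable power of the resulting root of unity is
  \<open>char_root\<close>, which is not 1.\<close>

lemma psi_nontrivial: "\<exists>b::'k. add_char f b \<noteq> 1"
proof -
  let ?p = "CHAR('k)"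
  have p: "?p > 1" using prime_gt_1_nat[OF CHAR_prime[where ?'a = 'k]] .
  define T where "T = (\<Sum>i<f. monom (1 :: 'k) (?p ^ i))"
  have "coeff T 1 = (\<Sum>i<f. if i = 0 then 1 else 0)"
    unfolding T_def coeff_sum
  proof (intro sum.cong refl)
    fix i
    have "?p ^ i = 1 \<longleftrightarrow> i = 0" using p by (auto simp: power_eq_1_iff)
    then show "coeff (monom (1 :: 'k) (?p ^ i)) 1 = (if i = 0 then 1 else 0)" by simp
  qed
  then have "coeff T 1 = 1" using f_pos by simp
  then have T0: "T \<noteq> 0" by auto
  have "degree T \<le> ?p ^ (f - 1)"
    unfolding T_def using p by (intro degree_sum_le order.trans[OF degree_monom_le] power_increasing) auto
  also have "\<dots> < N" unfolding card_eq using p f_pos by (intro power_strict_increasing) auto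
  finally have "card {b. poly T b = 0} < CARD('k)" using card_poly_roots_bound[OF T0] card_N by simp
  then have "{b. poly T b = 0} \<noteq> UNIV" by auto
  then obtain b where "poly T b \<noteq> 0" by auto
  then have b: "abs_trace f b \<noteq> 0" by (simp add: T_def poly_sum poly_monom abs_trace_def)
  have bN: "b ^ (?p ^ f) = b" using finite_field_power_card_eq_same[of b] by (simp add: card_N card_eq)
  have "abs_trace f b \<in> of_nat ` {..<?p}"
    using abs_trace_power_char[OF bN] card_prime_field[where ?'a = 'k] by blast
  then obtain j where j: "j < ?p" "of_nat j = abs_trace f b" by auto
  then have "j \<noteq> 0" using b by (metis of_nat_0)
  then have "coprime j ?p"
    using j(1) by (metis CHAR_prime coprime_commute gr0I nat_dvd_not_less prime_imp_coprime)
  then obtain i where "[j * i = Suc 0] (mod ?p)" using cong_solve_coprime_nat by blast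
  then have i: "[j * i = 1] (mod ?p)" by simp
  have "add_char f b = char_root TYPE('k) ^ j" by (rule add_char_eqI[OF j(2)])
  then have "add_char f b ^ i = char_root TYPE('k) ^ (j * i)" by (simp add: power_mult)
  also have "\<dots> = char_root TYPE('k) ^ 1" by (rule power_cong_exponent[OF char_root_power i])
  finally have "add_char f b ^ i \<noteq> 1" using char_root_neq_1[where ?'a = 'k] by simp
  then show ?thesis by (intro exI[of _ b]) auto
qed

end

context weil_sum
begin

text \<open>The modulus of the character. Since \<open>x\<close> divides \<open>poly_rad E\<close>,
  the extra factor makes \<open>M\<close> divisible by \<open>x ^ 2\<close>, so residues modulo
  \<open>M\<close> determine the coefficients 0 and 1 entering \<open>log_deriv_0\<close>, besides
  the values at the zeros of \<open>E\<close>.\<close>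

abbreviation M :: "'k poly" where "M \<equiv> [:0, 1:] * poly_rad E"

lemma rad_root: "poly (cl (poly_rad E)) x = 0 \<longleftrightarrow> poly (cl E) x = 0"
proof
  assume "poly (cl (poly_rad E)) x = 0"
  then have "(\<Prod>Q\<in>monic_irreducible_factors E. poly (cl Q) x) = 0"
    by (simp add: poly_rad_def to_ac_hom.map_poly_hom_prod poly_prod)
  then obtain Q where Q: "Q dvd E" "poly (cl Q) x = 0"
    using finite_monic_irreducible_factors[OF E_nz] by (auto simp: monic_irreducible_factors_def)
  from Q(1) obtain R where "E = Q * R" by (elim dvdE)
  then show "poly (cl E) x = 0" using Q(2) by (simp add: to_ac_hom.map_poly_hom_mult)
next
  assume "poly (cl E) x = 0"
  then have "minpoly x \<in> monic_irreducible_factors E"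
    using irreducible_minpoly minpoly_dvd_iff by (simp add: monic_irreducible_factors_altdef)
  then have "minpoly x dvd poly_rad E"
    unfolding poly_rad_def using finite_monic_irreducible_factors[OF E_nz] dvd_prod_eqI by blast
  then show "poly (cl (poly_rad E)) x = 0" using minpoly_dvd_iff by blast
qed

lemma X_dvd_rad: "[:0, 1:] dvd poly_rad E"
proof -
  have "[:0, 1:] dvd E" using E_0 poly_eq_0_iff_dvd[of E 0] by simp
  then have "[:0, 1:] \<in> monic_irreducible_factors E"
    unfolding monic_irreducible_factors_altdef using monic_irreducible_X by blast
  then show ?thesis
    unfolding poly_rad_def using finite_monic_irreducible_factors[OF E_nz] dvd_prod_eqI by blast
qed

lemma M_props: "lead_coeff M = 1" "M \<noteq> 0" "degree M = Suc (degree (poly_rad E))"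
  "poly (cl E) x = 0 \<Longrightarrow> poly (cl M) x = 0" "coeff M 0 = 0" "coeff M 1 = 0"
proof -
  have rad0: "poly_rad E \<noteq> 0" using monic_poly_rad[of E] by auto
  show "lead_coeff M = 1" using monic_poly_rad[of E] by (simp add: lead_coeff_mult del: mult_pCons_left)
  then show "M \<noteq> 0" by auto
  show "degree M = Suc (degree (poly_rad E))" using rad0 by (simp add: degree_mult_eq del: mult_pCons_left)
  show "poly (cl M) x = 0" if "poly (cl E) x = 0"
    using that rad_root[of x] by (simp add: to_ac_hom.map_poly_hom_mult del: mult_pCons_left)
  obtain R where "poly_rad E = [:0, 1:] * R" using X_dvd_rad by (elim dvdE)
  then show "coeff M 0 = 0" "coeff M 1 = 0" by simp_all
qed

definition residues :: "'k poly set" where "residues = {B. degree B < degree M}"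

lemma mod_M_residues: "P mod M \<in> residues"
  using degree_mod_less[OF M_props(2), of P] M_props(3) by (auto simp: residues_def simp del: mult_pCons_left)

lemma residues_mod: "B \<in> residues \<Longrightarrow> B mod M = B" "B \<in> residues \<Longrightarrow> B div M = 0"
  by (auto simp: residues_def mod_poly_less div_poly_less simp del: mult_pCons_left)

lemma sum_monics_residues:
  fixes h :: "'k poly \<Rightarrow> complex"
  assumes j: "degree M \<le> j"
  shows "(\<Sum>P\<in>monics j. h P) = (\<Sum>A\<in>monics (j - degree M). \<Sum>B\<in>residues. h (A * M + B))"
proof -
  have "(\<Sum>P\<in>monics j. h P) = (\<Sum>(A, B)\<in>monics (j - degree M) \<times> residues. h (A * M + B))"
  proof (rule sum.reindex_bij_witness[of _ "\<lambda>(A, B). A * M + B" "\<lambda>P. (P div M, P mod M)"])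
    fix P :: "'k poly" assume P: "P \<in> monics j"
    define A B where "A = P div M" and "B = P mod M"
    have PAB: "P = A * M + B" unfolding A_def B_def by (rule div_mult_mod_eq[symmetric])
    have B: "degree B < degree M" using mod_M_residues[of P] unfolding residues_def B_def by blast
    have P': "degree P = j" "lead_coeff P = 1" using P unfolding monics_def by blast+
    have AM: "A * M = P - B" using PAB by simp
    have "degree (A * M) = j" "lead_coeff (A * M) = 1"
    proof -
      have "degree B < degree P" using B j P' by simp
      then show "degree (A * M) = j" unfolding AM using P'(1) degree_add_eq_left[of "- B" P] by simp
      then show "lead_coeff (A * M) = 1"
        unfolding AM using P' \<open>degree B < degree P\<close> by (simp add: coeff_eq_0)
    qed
    then have "lead_coeff A = 1" using M_props(1) by (metis lead_coeff_mult mult.right_neutral)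
    moreover from this have "A \<noteq> 0" by auto
    ultimately have "A \<in> monics (j - degree M)"
      using \<open>degree (A * M) = j\<close> M_props(2) unfolding monics_def by (simp add: degree_mult_eq del: mult_pCons_left)
    then show "(P div M, P mod M) \<in> monics (j - degree M) \<times> residues"
      using mod_M_residues by (simp add: A_def del: mult_pCons_left)
    show "(case (P div M, P mod M) of (A, B) \<Rightarrow> A * M + B) = P" unfolding prod.case by (rule div_mult_mod_eq)
    then show "(case (P div M, P mod M) of (A, B) \<Rightarrow> h (A * M + B)) = h P" by (simp del: mult_pCons_left)
  next
    fix x :: "'k poly \<times> 'k poly" assume "x \<in> monics (j - degree M) \<times> residues"
    then obtain A B where x: "x = (A, B)" "degree A = j - degree M" "lead_coeff A = 1" "B \<in> residues"
      unfolding monics_def by blast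
    have "A \<noteq> 0" using x(3) by auto
    have dAM: "degree (A * M) = j" using x(2) \<open>A \<noteq> 0\<close> M_props(2) j by (simp add: degree_mult_eq del: mult_pCons_left)
    have lAM: "lead_coeff (A * M) = 1" using x(3) M_props(1) by (simp add: lead_coeff_mult del: mult_pCons_left)
    have dB: "degree B < j" using x(4) j by (simp add: residues_def del: mult_pCons_left)
    have "degree (A * M + B) = j" using degree_add_eq_left[of B "A * M"] dAM dB by metis
    moreover have "lead_coeff (A * M + B) = 1" using lead_coeff_add_le[of B "A * M"] dAM dB lAM by (metis add.commute)
    ultimately show "(case x of (A, B) \<Rightarrow> A * M + B) \<in> monics j" using x(1) unfolding monics_def by (simp del: mult_pCons_left)
    show "(case case x of (A, B) \<Rightarrow> A * M + B of P \<Rightarrow> (P div M, P mod M)) = x"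
      using x(1) residues_mod[OF x(4)] M_props(2) by (simp add: div_mult_self3 mod_mult_self3 del: mult_pCons_left)
  qed
  then show ?thesis by (simp add: sum.cartesian_product del: mult_pCons_left)
qed

text \<open>The part of \<open>resF\<close> that depends only on the residue modulo
  \<open>M\<close>; the sign, which depends on the degree, is separated into
  \<open>sgnF\<close>.\<close>

definition nrm :: "'k poly \<Rightarrow> 'k" where
  "nrm P = of_ac (\<Prod>\<rho>\<in>#proots (cl F). poly (cl P) \<rho>)"

definition sgnF :: 'k where "sgnF = (- 1) ^ size (proots (cl F))"

lemma resF_nrm: "to_ac (nrm P) = (\<Prod>\<rho>\<in>#proots (cl F). poly (cl P) \<rho>)" "resF P = sgnF ^ degree P * nrm P"
proof -
  have pull: "(\<Prod>\<rho>\<in>#A. c * poly (cl P) \<rho>) = c ^ size A * (\<Prod>\<rho>\<in>#A. poly (cl P) \<rho>)" for A c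
    by (induction A) (simp_all add: mult_ac)
  let ?r = "size (proots (cl F))"
  have res: "to_ac (resF P) = to_ac (sgnF ^ degree P) * (\<Prod>\<rho>\<in>#proots (cl F). poly (cl P) \<rho>)"
    unfolding to_ac_resF pull by (simp add: sgnF_def mult.commute flip: power_mult)
  have sq: "sgnF ^ degree P * sgnF ^ degree P = 1"
    by (simp add: sgnF_def flip: power_mult_distrib power_mult)
  have "to_ac (sgnF ^ degree P * resF P) = to_ac (sgnF ^ degree P * sgnF ^ degree P) * (\<Prod>\<rho>\<in>#proots (cl F). poly (cl P) \<rho>)"
    by (simp only: to_ac_mult res mult.assoc)
  then have prod: "(\<Prod>\<rho>\<in>#proots (cl F). poly (cl P) \<rho>) = to_ac (sgnF ^ degree P * resF P)" by (simp only: sq to_ac_1 mult_1_left)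
  have n: "nrm P = sgnF ^ degree P * resF P" unfolding nrm_def prod by (rule of_ac_to_ac)
  show "to_ac (nrm P) = (\<Prod>\<rho>\<in>#proots (cl F). poly (cl P) \<rho>)" unfolding n prod ..
  have "sgnF ^ degree P * nrm P = (sgnF ^ degree P * sgnF ^ degree P) * resF P" unfolding n by (simp only: mult.assoc)
  then show "resF P = sgnF ^ degree P * nrm P" unfolding sq by simp
qed

lemma nrm_mult: "nrm (P * R) = nrm P * nrm R"
proof -
  have "to_ac (nrm (P * R)) = to_ac (nrm P * nrm R)"
    unfolding to_ac_mult resF_nrm prod_mset.distrib[symmetric]
    by (intro arg_cong[of _ _ prod_mset] image_mset_cong) (simp add: to_ac_hom.map_poly_hom_mult)
  then show ?thesis by (simp only: to_ac_eq_iff)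
qed

lemma proots_F_E: "\<rho> \<in># proots (cl F) \<Longrightarrow> poly (cl E) \<rho> = 0"
proof -
  assume "\<rho> \<in># proots (cl F)"
  moreover have "cl F \<noteq> 0" using monic_F by auto
  ultimately show ?thesis by (intro FE) simp
qed

lemma poly_cl_add_mult_M: "poly (cl E) x = 0 \<Longrightarrow> poly (cl (A * M + B)) x = poly (cl B) x"
  using M_props(4) by (simp add: to_ac_hom.map_poly_hom_mult to_ac_hom.map_poly_hom_add del: mult_pCons_left)

lemma nrm_add_mult_M: "nrm (A * M + B) = nrm B"
proof -
  have "to_ac (nrm (A * M + B)) = to_ac (nrm B)"
    unfolding resF_nrm(1)
    by (intro arg_cong[of _ _ prod_mset] image_mset_cong poly_cl_add_mult_M proots_F_E)
  then show ?thesis by (simp only: to_ac_eq_iff)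
qed

lemma good_add_mult_M: "good (A * M + B) \<longleftrightarrow> good B"
  unfolding good_def using poly_cl_add_mult_M by simp

lemma log_deriv_0_add_mult_M: "log_deriv_0 (A * M + B) = log_deriv_0 B"
proof -
  have "coeff (A * M) 0 = 0" using M_props(5) by (simp only: coeff_mult_0 mult_zero_right)
  moreover have "coeff (A * M) 1 = 0" using M_props(5,6) by (simp only: coeff_mult_1 mult_zero_right add_0_right)
  ultimately show ?thesis by (simp only: log_deriv_0_def coeff_add add_0_left)
qed

text \<open>A Dirichlet character modulo \<open>M\<close>. The remaining factors of \<Lambda> depend
  only on the degree and, if \<open>y \<noteq> 0\<close>, on the second highest coefficient.\<close>

definition chr :: "'k poly \<Rightarrow> complex" where
  "chr B = (if good B then \<chi> (nrm B) * \<psi> (z * log_deriv_0 B) else 0)"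

lemma chr_add_mult_M: "chr (A * M + B) = chr B"
  unfolding chr_def nrm_add_mult_M good_add_mult_M log_deriv_0_add_mult_M ..

lemma chr_mod_M: "chr (B mod M) = chr B"
  using chr_add_mult_M[of "B div M" "B mod M"] unfolding div_mult_mod_eq by (rule sym)

lemma chr_mult: "chr (P * R) = chr P * chr R"
  by (auto simp: chr_def good_mult nrm_mult mult_char_mult[OF \<omega>_unit] log_deriv_0_mult good_coeff_0 distrib_left psi_add)

lemma \<Lambda>_chr: "\<Lambda> P = \<chi> sgnF ^ degree P * chr P * \<psi> (y * log_deriv_inf P)"
  by (simp add: \<Lambda>_def chr_def resF_nrm(2) mult_char_mult[OF \<omega>_unit] mult_char_power[OF \<omega>_unit] psi_add)

text \<open>Beyond \<open>degree M\<close> the second highest coefficient can be changed without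
  changing the residue modulo \<open>M\<close>. Shifting it by \<open>- b / y\<close> multiplies the
  sum by \<open>\<psi> b\<close>, which is not 1.\<close>

lemma \<Lambda>_sum_vanish_y:
  assumes y: "y \<noteq> 0" and j: "degree M < j"
  shows "(\<Sum>P\<in>monics j. \<Lambda> P) = 0"
proof -
  obtain b where b: "\<psi> b \<noteq> 1" using psi_nontrivial by blast
  define n where "n = j - degree M"
  have n: "n > 0" using j by (simp add: n_def del: mult_pCons_left)
  have coeff: "log_deriv_inf P = - coeff P (k - 1)" if "degree P = k" "k > 0" for P :: "'k poly" and k
    using that by (simp add: log_deriv_inf_def coeff_reflect_poly)
  have \<Lambda>: "\<Lambda> (A * M + B) = \<chi> sgnF ^ j * chr B * \<psi> (y * log_deriv_inf M) * \<psi> (y * log_deriv_inf A)"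
    if A: "A \<in> monics n" and B: "B \<in> residues" for A B
  proof -
    have A': "degree A = n" "lead_coeff A = 1" using A unfolding monics_def by blast+
    have "A \<noteq> 0" using A'(2) by auto
    have dAM: "degree (A * M) = j"
      using A'(1) \<open>A \<noteq> 0\<close> M_props(2) j by (simp add: degree_mult_eq n_def del: mult_pCons_left)
    have dB: "degree B < degree M" using B unfolding residues_def by blast
    then have deg: "degree (A * M + B) = j" using degree_add_eq_left[of B "A * M"] dAM j by (metis less_trans)
    have "coeff B (j - 1) = 0" using dB j by (intro coeff_eq_0) linarith
    then have "log_deriv_inf (A * M + B) = log_deriv_inf (A * M)"
      using coeff[OF deg] coeff[OF dAM] n j by (metis add.right_neutral coeff_add gr_implies_not0 gr0I)
    also have "\<dots> = log_deriv_inf A + log_deriv_inf M" using A'(2) M_props(1) by (rule log_deriv_inf_mult)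
    finally show ?thesis
      unfolding \<Lambda>_chr deg chr_add_mult_M by (simp only: distrib_left psi_add mult_ac)
  qed
  define S where "S = (\<Sum>A\<in>monics n. \<psi> (y * log_deriv_inf A))"
  have "S = (\<Sum>A\<in>monics n. \<psi> (y * log_deriv_inf (A + monom (- b / y) (n - 1))))"
    unfolding S_def
  proof (rule sum.reindex_bij_witness[of _ "\<lambda>A. A + monom (- b / y) (n - 1)" "\<lambda>A. A + monom (b / y) (n - 1)"])
    have *: "A + monom c (n - 1) \<in> monics n" if "A \<in> monics n" for A :: "'k poly" and c
    proof -
      have A': "degree A = n" "lead_coeff A = 1" using that unfolding monics_def by blast+
      have lt: "degree (monom c (n - 1)) < degree A" using n A' degree_monom_le[of c "n - 1"] by linarith
      then have "degree (A + monom c (n - 1)) = n" using A' by (simp add: degree_add_eq_left)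
      moreover have "coeff (A + monom c (n - 1)) n = 1" using A' n by simp
      ultimately show ?thesis unfolding monics_def by simp
    qed
    show "A + monom (- b / y) (n - 1) \<in> monics n" if "A \<in> monics n" for A :: "'k poly" using *[OF that] .
    show "A + monom (b / y) (n - 1) \<in> monics n" if "A \<in> monics n" for A :: "'k poly" using *[OF that] .
  qed (simp_all add: add.assoc add_monom)
  also have "\<dots> = (\<Sum>A\<in>monics n. \<psi> b * \<psi> (y * log_deriv_inf A))"
  proof (rule sum.cong[OF refl])
    fix A :: "'k poly" assume A: "A \<in> monics n"
    have A': "degree A = n" using A unfolding monics_def by blast
    have lt: "degree (monom (- b / y) (n - 1)) < degree A" using n A' degree_monom_le[of "- b / y" "n - 1"] by linarith
    then have "degree (A + monom (- b / y) (n - 1)) = n" using A' by (simp add: degree_add_eq_left)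
    from coeff[OF this n] coeff[OF A' n]
    have "y * log_deriv_inf (A + monom (- b / y) (n - 1)) = b + y * log_deriv_inf A"
      using y by (simp add: field_simps)
    then show "\<psi> (y * log_deriv_inf (A + monom (- b / y) (n - 1))) = \<psi> b * \<psi> (y * log_deriv_inf A)"
      by (simp add: psi_add)
  qed
  also have "\<dots> = \<psi> b * S" by (simp add: S_def sum_distrib_left)
  finally have "S = 0" using b by simp
  have "(\<Sum>P\<in>monics j. \<Lambda> P) = (\<Sum>A\<in>monics n. \<Sum>B\<in>residues. \<Lambda> (A * M + B))"
    unfolding n_def using j by (intro sum_monics_residues) simp
  also have "\<dots> = (\<Sum>A\<in>monics n. \<Sum>B\<in>residues. \<chi> sgnF ^ j * chr B * \<psi> (y * log_deriv_inf M) * \<psi> (y * log_deriv_inf A))"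
    by (intro sum.cong refl \<Lambda>)
  also have "\<dots> = (\<Sum>B\<in>residues. \<chi> sgnF ^ j * chr B * \<psi> (y * log_deriv_inf M)) * S"
    unfolding S_def sum_product by (rule sum.swap)
  finally show ?thesis using \<open>S = 0\<close> by simp
qed

text \<open>If \<open>chr\<close> were trivial, every term over an extension of even degree would be
  1, and the sum would have size about \<open>N ^ (2 * k)\<close>, against the bound of order
  \<open>N ^ k\<close>. Nontriviality of the character thus comes from Stepanov's estimate
  itself.\<close>

lemma ex_chr_neq_1: "\<exists>U. good U \<and> chr U \<noteq> 1" if y: "y = 0"
proof (rule ccontr)
  assume "\<not> ?thesis"
  then have triv: "\<And>U. good U \<Longrightarrow> chr U = 1" by blast
  \<comment> \<open>The sign squares to 1, so it disappears over extensions of even degree.\<close>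
  have "\<chi> sgnF ^ 2 = \<chi> (sgnF ^ 2)" by (simp only: mult_char_power[OF \<omega>_unit])
  also have "sgnF ^ 2 = 1" by (simp add: sgnF_def flip: power_mult)
  finally have s2: "\<chi> sgnF ^ 2 = 1" by (simp add: mult_char_1[OF \<omega>_unit])
  have one: "ext_term (2 * k) x = 1" if x: "x ^ (N ^ (2 * k)) = x" "poly (cl E) x \<noteq> 0" for x k
  proof -
    have "period x dvd 2 * k" using x(1) by (simp only: frob_fixed_iff)
    then have per: "period x * (2 * k div period x) = 2 * k" by simp
    have "\<Lambda> (minpoly x) = \<chi> sgnF ^ period x"
      using triv[of "minpoly x"] x(2) unfolding \<Lambda>_chr degree_minpoly good_minpoly by (simp add: y)
    then have "ext_term (2 * k) x = \<chi> sgnF ^ (2 * k)"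
      using \<Lambda>_minpoly_power[OF x(2,1)] per by (simp flip: power_mult)
    also have "\<dots> = 1" by (simp add: power_mult s2)
    finally show ?thesis .
  qed
  obtain C :: real and k0 where C: "\<And>k. k \<ge> k0 \<Longrightarrow>
    norm (\<Sum>x | x ^ (N ^ (2 * k)) = x \<and> poly (cl E) x \<noteq> 0. ext_term (2 * k) x) \<le> C * real N ^ k"
  proof (rule even_power_sum_bound, goal_cases)
    case (1 C k0)
    show ?case by (rule 1(1)[OF 1(2)])
  qed
  obtain n where n: "\<bar>C\<bar> + degree E < real N ^ n" using real_arch_pow[of "real N"] N_gt_1 by auto
  define k where "k = n + k0 + 1"
  have "real N ^ n \<le> real N ^ k" using N_gt_1 by (intro power_increasing) (auto simp: k_def)
  with n have Q: "\<bar>C\<bar> + degree E < real N ^ k" by simp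
  have "1 \<le> real N ^ k" using N_gt_1 by simp
  let ?A = "{x. x ^ (N ^ (2 * k)) = x \<and> poly (cl E) x \<noteq> 0}"
  have "real (N ^ (2 * k)) - degree E \<le> real (card ?A)" by (rule card_fixed_ge) (simp add: k_def)
  also have "\<dots> = norm (\<Sum>x\<in>?A. ext_term (2 * k) x)" using one by simp
  also have "\<dots> \<le> C * real N ^ k" by (rule C) (simp add: k_def)
  also have "\<dots> \<le> \<bar>C\<bar> * real N ^ k" using \<open>1 \<le> real N ^ k\<close> by (intro mult_right_mono) auto
  finally have "real N ^ k * real N ^ k \<le> \<bar>C\<bar> * real N ^ k + degree E" by (simp add: mult_2 power_add)
  also have "\<dots> \<le> (\<bar>C\<bar> + degree E) * real N ^ k"
    using \<open>1 \<le> real N ^ k\<close> by (simp add: distrib_right mult_le_cancel_left1)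
  also have "\<dots> < real N ^ k * real N ^ k" using Q \<open>1 \<le> real N ^ k\<close> by (intro mult_strict_right_mono) linarith+
  finally show False by simp
qed

text \<open>From \<open>degree M\<close> on, monic polynomials are equidistributed among all
  residues modulo \<open>M\<close>. Multiplication by an invertible residue \<open>U\<close>
  permutes the residues and multiplies the sum by \<open>chr U\<close>, which can be chosen
  different from 1.\<close>

lemma \<Lambda>_sum_vanish:
  assumes y: "y = 0" and j: "degree M \<le> j"
  shows "(\<Sum>P\<in>monics j. \<Lambda> P) = 0"
proof -
  obtain U where U: "good U" "chr U \<noteq> 1" using ex_chr_neq_1[OF y] by blast
  have "\<exists>a b. a * U + b * M = 1"
  proof -
    have "\<not> Q dvd M" if Q: "Q \<in> monic_irreducibles" "Q dvd U" for Q
    proof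
      assume QM: "Q dvd M"
      have "degree (cl Q) > 0" using monic_irreducible_degree_pos[OF Q(1)] by simp
      then obtain x where x: "poly (cl Q) x = 0" using alg_closed_imp_poly_has_root by blast
      from Q(2) obtain R where "U = Q * R" by (elim dvdE)
      then have "poly (cl U) x = 0" using x by (simp add: to_ac_hom.map_poly_hom_mult)
      moreover from QM obtain R where "M = Q * R" by (elim dvdE)
      then have "poly (cl M) x = 0" using x by (simp add: to_ac_hom.map_poly_hom_mult del: mult_pCons_left)
      then have "x = 0 \<or> poly (cl E) x = 0"
        by (auto simp: to_ac_hom.map_poly_hom_mult map_poly_pCons rad_root simp del: mult_pCons_left)
      then have "poly (cl E) x = 0" using E_0 to_ac_hom.poly_map_poly_hom[of E 0] by auto
      ultimately show False using U(1) by (auto simp: good_def)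
    qed
    then show ?thesis using poly_bezout[OF M_props(2)] by metis
  qed
  then obtain V b where V: "V * U + b * M = 1" by blast
  then have V': "U * V + b * M = 1" by (simp only: mult.commute[of U V])
  have inv: "(V * ((U * B) mod M)) mod M = B" "(U * ((V * B) mod M)) mod M = B" if "B \<in> residues" for B
    using mult_inverse_mod[OF V, of B] mult_inverse_mod[OF V', of B] residues_mod(1)[OF that] by (simp_all only:)
  have "(\<Sum>B\<in>residues. chr B) = (\<Sum>B\<in>residues. chr ((U * B) mod M))"
    by (rule sum.reindex_bij_witness[of _ "\<lambda>B. (U * B) mod M" "\<lambda>B. (V * B) mod M"])
       (use inv mod_M_residues in auto)
  also have "\<dots> = chr U * (\<Sum>B\<in>residues. chr B)"
    unfolding chr_mod_M chr_mult by (rule sum_distrib_left[symmetric])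
  finally have S0: "(\<Sum>B\<in>residues. chr B) = 0" using U(2) by simp
  have "(\<Sum>P\<in>monics j. \<Lambda> P) = (\<Sum>P\<in>monics j. \<chi> sgnF ^ j * chr P)"
    unfolding \<Lambda>_chr by (intro sum.cong refl) (simp add: y monics_def)
  also have "\<dots> = (\<Sum>A\<in>monics (j - degree M). \<Sum>B\<in>residues. \<chi> sgnF ^ j * chr (A * M + B))"
    by (rule sum_monics_residues[OF j])
  also have "\<dots> = 0" unfolding chr_add_mult_M sum_distrib_left[symmetric] S0 by simp
  finally show ?thesis .
qed

text \<open>The character sum over the base field is the first power sum attached to the L-function,
  and the even ones are bounded by Stepanov's method.\<close>

theorem weil_bound:
  "norm (\<Sum>a | poly E a \<noteq> 0. \<chi> (poly F a) * \<psi> (y * a + z / a))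
     \<le> real (degree (poly_rad E) + (if y = 0 then 0 else 1)) * sqrt (real N)"
proof -
  define a where "a = (\<lambda>j. \<Sum>P\<in>monics j. \<Lambda> P)"
  define S where "S = (\<lambda>i. \<Sum>Q | Q \<in> monic_irreducibles \<and> degree Q dvd i \<and> degree Q \<le> i.
                  of_nat (degree Q) * \<Lambda> Q ^ (i div degree Q))"
  obtain C :: real and k0 where C: "\<And>k. k \<ge> k0 \<Longrightarrow>
    norm (\<Sum>x | x ^ (N ^ (2 * k)) = x \<and> poly (cl E) x \<noteq> 0. ext_term (2 * k) x) \<le> C * real N ^ k"
  proof (rule even_power_sum_bound, goal_cases)
    case (1 C k0)
    show ?case by (rule 1(1)[OF 1(2)])
  qed
  have "norm (S 1) \<le> real (degree (poly_rad E) + (if y = 0 then 0 else 1)) * sqrt (real N)"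
  proof (rule first_power_sum_bound[where a = a])
    show "a 0 = 1" by (simp add: a_def monics_0 \<Lambda>_1)
    \<comment> \<open>Since \<open>degree M\<close> is \<open>degree (poly_rad E) + 1\<close>, the
      coefficients vanish from \<open>degree M\<close> on if \<open>y = 0\<close>, and beyond
      \<open>degree M\<close> otherwise. This explains the additional 1.\<close>
    show "a j = 0" if "degree (poly_rad E) + (if y = 0 then 0 else 1) < j" for j
    proof (cases "y = 0")
      case True
      with that show ?thesis unfolding a_def by (intro \<Lambda>_sum_vanish) (simp_all add: M_props(3) del: mult_pCons_left)
    next
      case False
      with that show ?thesis unfolding a_def by (intro \<Lambda>_sum_vanish_y) (simp_all add: M_props(3) del: mult_pCons_left)
    qed
    show "of_nat j * a j = (\<Sum>i=1..j. S i * a (j - i))" for j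
      unfolding a_def S_def by (rule euler_product_newton[OF \<Lambda>_mult \<Lambda>_1])
    show "norm (S (2 * k)) \<le> C * real N ^ k" if "k \<ge> max k0 1" for k
      unfolding S_def using that C[of k] by (subst prime_power_sums) auto
    show "real N > 0" using N_gt_1 by simp
  qed
  also have "S 1 = (\<Sum>x | x ^ (N ^ 1) = x \<and> poly (cl E) x \<noteq> 0. ext_term 1 x)"
    unfolding S_def by (rule prime_power_sums) simp
  also have "\<dots> = (\<Sum>a | poly E a \<noteq> 0. \<chi> (poly F a) * \<psi> (y * a + z / a))"
  proof (rule sum.reindex_bij_witness[of _ "to_ac" "of_ac"])
    fix x assume x: "x \<in> {x. x ^ (N ^ 1) = x \<and> poly (cl E) x \<noteq> 0}"
    then have ac: "to_ac (of_ac x :: 'k) = x" by (intro to_ac_of_ac') simp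
    then show "to_ac (of_ac x :: 'k) = x" .
    define u where "u = (of_ac x :: 'k)"
    have xu: "x = to_ac u" using ac by (simp add: u_def)
    show "(of_ac x :: 'k) \<in> {a. poly E a \<noteq> 0}" using x by (simp add: xu to_ac_hom.poly_map_poly_hom)
    have "to_ac y * x + to_ac z / x = to_ac (y * u + z / u)" by (simp add: xu)
    then show "\<chi> (poly F (of_ac x)) * \<psi> (y * of_ac x + z / of_ac x) = ext_term 1 x"
      by (simp add: ext_term_def gx_def xu to_ac_hom.poly_map_poly_hom)
         (metis of_ac_to_ac to_ac_add to_ac_divide to_ac_mult)
  next
    fix a :: 'k assume "a \<in> {a. poly E a \<noteq> 0}"
    then show "of_ac (to_ac a) = a" "to_ac a \<in> {x. x ^ (N ^ 1) = x \<and> poly (cl E) x \<noteq> 0}"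
      by (simp_all add: to_ac_hom.poly_map_poly_hom)
  qed
  finally show ?thesis .
qed

end

section \<open>Character sums with rational arguments\<close>

definition unity_root :: "nat \<Rightarrow> complex" where
  "unity_root n = cis (2 * pi / real n)"

lemma unity_root_power_eq_1_iff:
  assumes "n > 0"
  shows "unity_root n ^ j = 1 \<longleftrightarrow> n dvd j"
proof
  assume "n dvd j"
  then obtain i where "j = n * i" by (elim dvdE)
  then show "unity_root n ^ j = 1" using assms by (simp add: unity_root_def DeMoivre power_mult)
next
  assume "unity_root n ^ j = 1"
  then have "cis (real j * (2 * pi / real n)) = 1" by (simp add: unity_root_def DeMoivre)
  then have "cos (real j * (2 * pi / real n)) = 1" by (metis cis.sel(1) one_complex.sel(1))
  then obtain k :: int where "real j * (2 * pi / real n) = of_int k * 2 * pi"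
    using cos_one_2pi_int by auto
  then have "real j = of_int k * real n" using assms by (simp add: field_simps)
  then have "int j = k * int n" by (metis of_int_eq_iff of_int_mult of_int_of_nat_eq)
  then have "int n dvd int j" by simp
  then show "n dvd j" by (simp only: int_dvd_int_iff)
qed

lemma prime_elem_dvd_prod:
  "finite S \<Longrightarrow> prime_elem (Q :: 'a::comm_semiring_1) \<Longrightarrow> Q dvd prod g S \<Longrightarrow> \<exists>x\<in>S. Q dvd g x"
  by (induction S rule: finite_induct) (auto simp: prime_elem_dvd_mult_iff dest: prime_elem_not_unit)

lemma prod_monic_irreducibles_dvd:
  fixes P :: "'a::field poly"
  assumes "finite S" "S \<subseteq> monic_irreducibles" "\<And>Q. Q \<in> S \<Longrightarrow> Q dvd P"
  shows "\<Prod>S dvd P"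
  using assms
proof (induction S rule: finite_induct)
  case (insert Q S)
  have Q: "Q \<in> monic_irreducibles" using insert.prems by blast
  obtain R where R: "P = \<Prod>S * R" using insert by (metis dvdE insert_subset insertI2)
  have "Q dvd \<Prod>S * R" using insert.prems R by blast
  moreover have "\<not> Q dvd \<Prod>S"
  proof
    assume "Q dvd \<Prod>S"
    then have "\<exists>Q'\<in>S. Q dvd Q'"
      by (rule prime_elem_dvd_prod[OF insert.hyps(1) monic_irreducible_prime[OF Q]])
    then obtain Q' where Q': "Q' \<in> S" "Q dvd Q'" by blast
    then have "Q = Q'" using monic_irreducible_dvd_imp_eq[OF Q] insert.prems(1) by blast
    with Q' insert.hyps(2) show False by blast
  qed
  ultimately have "Q dvd R" using prime_elem_dvd_mult_iff[OF monic_irreducible_prime[OF Q]] by metis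
  then have "Q * \<Prod>S dvd R * \<Prod>S" by (rule mult_dvd_mono[OF _ dvd_refl])
  then show ?case using insert.hyps by (simp add: R mult.commute)
qed simp

lemma degree_poly_rad_le:
  assumes "P \<noteq> (0 :: 'k::finite_field poly)"
  shows "degree (poly_rad P) \<le> degree P"
proof -
  have "poly_rad P dvd P"
    unfolding poly_rad_def
    by (rule prod_monic_irreducibles_dvd[OF finite_monic_irreducible_factors[OF assms]])
       (auto simp: monic_irreducible_factors_altdef)
  then show ?thesis using assms by (rule dvd_imp_degree_le)
qed

lemma ex_factorization:
  fixes P :: "'a::field poly"
  assumes "P \<noteq> 0" "finite S" "monic_irreducible_factors P \<subseteq> S" "S \<subseteq> monic_irreducibles"
  shows "\<exists>v. P = smult (lead_coeff P) (\<Prod>Q\<in>S. Q ^ v Q) \<and> (\<forall>Q\<in>S. v Q > 0 \<longrightarrow> Q dvd P)"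
  using assms(1,3)
proof (induction "degree P" arbitrary: P rule: less_induct)
  case less
  show ?case
  proof (cases "degree P = 0")
    case True
    then obtain c where "P = [:c:]" by (elim degree_eq_zeroE)
    then show ?thesis by (intro exI[of _ "\<lambda>_. 0"]) simp
  next
    case False
    then obtain Q where Q: "Q \<in> monic_irreducibles" "Q dvd P" using ex_monic_irreducible_factor by blast
    then obtain R where R: "P = Q * R" by (elim dvdE)
    have Q0: "Q \<noteq> 0" "degree Q > 0" "lead_coeff Q = 1"
      using Q monic_irreducible_nonzero monic_irreducible_degree_pos by (auto simp: monic_irreducibles_def)
    have R0: "R \<noteq> 0" using R less.prems by auto
    have "degree R < degree P" using R R0 Q0 by (simp add: degree_mult_eq)
    moreover have sub: "monic_irreducible_factors R \<subseteq> S"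
      using less.prems(2) by (auto simp: monic_irreducible_factors_altdef R)
    ultimately obtain v where v: "R = smult (lead_coeff R) (\<Prod>Q\<in>S. Q ^ v Q)" "\<forall>Q\<in>S. v Q > 0 \<longrightarrow> Q dvd R"
      using less.hyps[OF _ R0] by blast
    have QS: "Q \<in> S" using less.prems(2) Q by (auto simp: monic_irreducible_factors_altdef)
    define v' where "v' = v(Q := Suc (v Q))"
    have "(\<Prod>Q\<in>S. Q ^ v' Q) = Q * (\<Prod>Q\<in>S. Q ^ v Q)"
    proof -
      have "(\<Prod>Q\<in>S. Q ^ v' Q) = Q ^ v' Q * (\<Prod>Q\<in>S - {Q}. Q ^ v' Q)" using assms(2) QS by (rule prod.remove)
      also have "(\<Prod>Q\<in>S - {Q}. Q ^ v' Q) = (\<Prod>Q\<in>S - {Q}. Q ^ v Q)" by (intro prod.cong) (auto simp: v'_def)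
      also have "Q ^ v' Q * \<dots> = Q * (Q ^ v Q * \<dots>)" by (simp add: v'_def mult.assoc)
      also have "Q ^ v Q * (\<Prod>Q\<in>S - {Q}. Q ^ v Q) = (\<Prod>Q\<in>S. Q ^ v Q)" using assms(2) QS by (rule prod.remove[symmetric])
      finally show ?thesis .
    qed
    moreover have "lead_coeff P = lead_coeff R" using Q0 by (simp add: R lead_coeff_mult)
    ultimately have "P = smult (lead_coeff P) (\<Prod>Q\<in>S. Q ^ v' Q)" using v(1) by (metis R mult_smult_right)
    moreover have "\<forall>Q'\<in>S. v' Q' > 0 \<longrightarrow> Q' dvd P" using v(2) Q(2) by (auto simp: v'_def R)
    ultimately show ?thesis by blast
  qed
qed

context finite_field_closure
begin

text \<open>The linear factors of a minimal polynomial belong to distinct conjugates: irreducible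
  polynomials over finite fields are separable.\<close>

lemma order_monic_irreducible:
  assumes "Q \<in> monic_irreducibles"
  shows "order \<rho> (cl Q) = (if minpoly \<rho> = Q then 1 else 0)"
proof (cases "minpoly \<rho> = Q")
  case True
  have ord: "order \<rho> (\<Prod>i<n. [:- (\<rho> ^ (N ^ i)), 1:]) = card {i. i < n \<and> \<rho> ^ (N ^ i) = \<rho>}" for n
  proof (induction n)
    case (Suc n)
    have nz: "(\<Prod>i<n. [:- (\<rho> ^ (N ^ i)), 1:]) \<noteq> 0" by (auto simp: prod_zero_iff)
    have lin: "order \<rho> [:- (\<rho> ^ (N ^ n)), 1:] = (if \<rho> ^ (N ^ n) = \<rho> then 1 else 0)"
      using order_power_n_n[of \<rho> 1] by (auto intro: order_0I)
    have "{i. i < Suc n \<and> \<rho> ^ (N ^ i) = \<rho>} = (if \<rho> ^ (N ^ n) = \<rho> then insert n {i. i < n \<and> \<rho> ^ (N ^ i) = \<rho>} else {i. i < n \<and> \<rho> ^ (N ^ i) = \<rho>})"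
      by (auto simp: less_Suc_eq)
    then show ?case unfolding prod.lessThan_Suc using nz lin Suc
      by (subst order_mult) (auto simp del: mult_pCons_right)
  qed simp
  have "{i. i < period \<rho> \<and> \<rho> ^ (N ^ i) = \<rho>} = {0}"
  proof -
    have "i = 0" if "i < period \<rho>" "\<rho> ^ (N ^ i) = \<rho>" for i
      using period_least[of i \<rho>] that by (metis gr0I not_le)
    then show ?thesis using period_pos[of \<rho>] by auto
  qed
  then show ?thesis using True ord[of "period \<rho>"] by (simp flip: cl_minpoly)
next
  case False
  then have "poly (cl Q) \<rho> \<noteq> 0" using minpoly_eqI[OF assms] by metis
  then show ?thesis using False by (simp add: order_0I)
qed

definition w :: complex where "w = unity_root (N - 1)"

lemma w_power_eq_1_iff: "w ^ j = 1 \<longleftrightarrow> (N - 1) dvd j"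
  unfolding w_def by (rule unity_root_power_eq_1_iff) (use N_gt_1 in simp)

lemma w_unit: "w ^ (CARD('k) - 1) = 1"
  by (simp only: card_N w_power_eq_1_iff dvd_refl)

lemma mult_char_w_power: "mult_char (w ^ i) x = (if x = 0 then 0 else mult_char w (x :: 'k) ^ i)"
  by (simp add: mult_char_def mult.commute flip: power_mult)

text \<open>Dividing out the greatest common divisor \<open>e\<close> of \<open>N - 1\<close> and all multiplicities makes the
  order \<open>(N - 1) div e\<close> of the character coprime to the multiplicities.\<close>

lemma factored_sum_bound:
  fixes E :: "'k poly" and u :: "'k poly \<Rightarrow> nat" and c y z :: 'k
  assumes E: "E \<noteq> 0" "poly E 0 = 0" and c: "c \<noteq> 0"
    and nontriv: "(\<exists>Q\<in>monic_irreducible_factors E. \<not> (N - 1) dvd u Q) \<or> y \<noteq> 0 \<or> z \<noteq> 0"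
  defines "F \<equiv> \<Prod>Q\<in>monic_irreducible_factors E. Q ^ u Q"
  shows "norm (\<Sum>a | poly E a \<noteq> 0. mult_char w (c * poly F a) * add_char f (y * a + z / a))
     \<le> real (degree (poly_rad E) + (if y = 0 then 0 else 1)) * sqrt (real N)"
proof -
  define S where "S = monic_irreducible_factors E"
  have S: "finite S" "S \<subseteq> monic_irreducibles" "\<And>Q. Q \<in> S \<Longrightarrow> Q dvd E"
    using finite_monic_irreducible_factors[OF E(1)] by (auto simp: S_def monic_irreducible_factors_altdef)
  \<comment> \<open>With \<open>N - 1\<close> included, \<open>d\<close> is an integer and
    \<open>w ^ e\<close> is killed by the power \<open>d\<close>. The \<open>e\<close>-th power
    inside \<open>F\<close> is moved into the character.\<close>
  define e where "e = Gcd (insert (N - 1) (u ` S))"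
  have eN: "e dvd N - 1" and eu: "\<And>Q. Q \<in> S \<Longrightarrow> e dvd u Q"
    unfolding e_def by (rule Gcd_dvd, simp)+
  have e0: "e > 0" using eN N_gt_1 by (auto intro: Nat.gr0I)
  define d where "d = (N - 1) div e"
  have de: "N - 1 = e * d" using eN by (simp add: d_def)
  define v where "v = (\<lambda>Q. u Q div e)"
  have uv: "u Q = e * v Q" if "Q \<in> S" for Q using eu[OF that] by (simp add: v_def)
  have gcd1: "Gcd (insert d (v ` S)) = 1"
  proof -
    have "e * Gcd (insert d (v ` S)) = Gcd ((*) e ` insert d (v ` S))" by (simp only: Gcd_mult normalize_nat_def id_apply)
    also have "(*) e ` insert d (v ` S) = insert (N - 1) (u ` S)"
    proof -
      have "(\<lambda>Q. e * v Q) ` S = u ` S" using uv by (intro image_cong) auto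
      then show ?thesis by (simp only: image_insert image_image de)
    qed
    finally have "e * Gcd (insert d (v ` S)) = e * 1" by (simp add: e_def)
    then show ?thesis using e0 by simp
  qed
  define F0 where "F0 = (\<Prod>Q\<in>S. Q ^ v Q)"
  have FF0: "F = F0 ^ e"
    unfolding F_def F0_def S_def[symmetric] prod_power_distrib
    by (intro prod.cong refl) (simp add: uv mult.commute flip: power_mult)
  have ord: "order \<rho> (cl F0) = (if minpoly \<rho> \<in> S then v (minpoly \<rho>) else 0)" for \<rho>
  proof -
    have "order \<rho> (\<Prod>Q\<in>S'. cl Q ^ v Q) = (\<Sum>Q\<in>S'. v Q * order \<rho> (cl Q))" if "S' \<subseteq> S" for S'
    proof -
      have "finite S'" using S(1) that by (rule finite_subset[rotated])
      then show ?thesis using that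
      proof (induction S')
        case (insert Q S')
        have nz: "cl Q' \<noteq> 0" if "Q' \<in> insert Q S'" for Q'
          using that insert.prems S(2) monic_irreducible_nonzero by (metis cl_eq_0_iff subsetD)
        then have "(\<Prod>Q\<in>S'. cl Q ^ v Q) \<noteq> 0" using insert.hyps(1) by (auto simp: prod_zero_iff)
        with insert nz show ?case by (simp add: order_mult order_power)
      qed simp
    qed
    from this[OF subset_refl] have "order \<rho> (cl F0) = (\<Sum>Q\<in>S. v Q * order \<rho> (cl Q))"
      by (simp add: F0_def to_ac_hom.map_poly_hom_prod to_ac_hom.map_poly_hom_power)
    also have "\<dots> = (\<Sum>Q\<in>S. if Q = minpoly \<rho> then v Q else 0)"
      using S(2) by (intro sum.cong refl) (auto simp: order_monic_irreducible)
    also have "\<dots> = (if minpoly \<rho> \<in> S then v (minpoly \<rho>) else 0)" using S(1) by simp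
    finally show ?thesis .
  qed
  interpret W: weil_sum f N type_k F0 E y z "w ^ e" d
  proof
    show "lead_coeff F0 = 1"
    proof -
      have "lead_coeff F0 = (\<Prod>Q\<in>S. lead_coeff (Q ^ v Q))" unfolding F0_def by (rule lead_coeff_prod)
      also have "\<dots> = 1" using S(2) by (intro prod.neutral) (auto simp: lead_coeff_power monic_irreducibles_def)
      finally show ?thesis .
    qed
    show "E \<noteq> 0" "poly E 0 = 0" by fact+
    show "poly (cl E) x = 0" if "poly (cl F0) x = 0" for x
    proof -
      have "(\<Prod>Q\<in>S. poly (cl Q) x ^ v Q) = 0"
        using that by (simp add: F0_def to_ac_hom.map_poly_hom_prod to_ac_hom.map_poly_hom_power poly_prod)
      then obtain Q where Q: "Q \<in> S" "poly (cl Q) x = 0" using S(1) by auto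
      then obtain R where "E = Q * R" using S(3) by (metis dvdE)
      then show ?thesis using Q(2) by (simp add: to_ac_hom.map_poly_hom_mult)
    qed
    show "d dvd N - 1" unfolding de by simp
    show "(w ^ e) ^ d = 1" by (simp only: w_power_eq_1_iff de dvd_refl flip: power_mult)
    show "d dvd b" if H: "\<And>\<rho>. d dvd b * order \<rho> (cl F0)" for b
    proof -
      have "d dvd b * v Q" if Q: "Q \<in> S" for Q
      proof -
        have "degree (cl Q) > 0" using monic_irreducible_degree_pos Q S(2) by (metis degree_cl subsetD)
        then obtain \<rho> where "poly (cl Q) \<rho> = 0" using alg_closed_imp_poly_has_root by blast
        then have "minpoly \<rho> = Q" using minpoly_eqI Q S(2) by blast
        then show ?thesis using H[of \<rho>] Q by (simp add: ord)
      qed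
      \<comment> \<open>\<open>d\<close> divides \<open>b\<close> times each member of a family with
        greatest common divisor 1.\<close>
      then have "d dvd Gcd ((*) b ` insert d (v ` S))" by (intro Gcd_greatest) auto
      then show ?thesis unfolding Gcd_mult gcd1 by simp
    qed
    show "w ^ e \<noteq> 1 \<or> y \<noteq> 0 \<or> z \<noteq> 0"
    proof (cases "y \<noteq> 0 \<or> z \<noteq> 0")
      case False
      then obtain Q where "Q \<in> S" "\<not> (N - 1) dvd u Q" using nontriv by (auto simp: S_def)
      then have "\<not> (N - 1) dvd e" using eu dvd_trans by metis
      then show ?thesis by (simp only: w_power_eq_1_iff) simp
    qed blast
  qed
  have "mult_char w (c * poly F a) = mult_char w c * mult_char (w ^ e) (poly F0 a)" if a: "poly E a \<noteq> 0" for a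
  proof -
    have "poly F0 a \<noteq> 0"
    proof
      assume "poly F0 a = 0"
      then have "(\<Prod>Q\<in>S. poly Q a ^ v Q) = 0" by (simp add: F0_def poly_prod)
      then obtain Q where Q: "Q \<in> S" "poly Q a = 0" using S(1) by auto
      then obtain R where "E = Q * R" using S(3) by (metis dvdE)
      with Q a show False by simp
    qed
    then show ?thesis
      by (simp add: mult_char_mult[OF w_unit] mult_char_w_power FF0 mult_char_power[OF w_unit])
  qed
  then have "(\<Sum>a | poly E a \<noteq> 0. mult_char w (c * poly F a) * add_char f (y * a + z / a)) =
      mult_char w c * (\<Sum>a | poly E a \<noteq> 0. mult_char (w ^ e) (poly F0 a) * add_char f (y * a + z / a))"
    by (simp add: sum_distrib_left mult.assoc)
  then have "norm (\<Sum>a | poly E a \<noteq> 0. mult_char w (c * poly F a) * add_char f (y * a + z / a)) =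
      norm (mult_char w c) * norm (\<Sum>a | poly E a \<noteq> 0. mult_char (w ^ e) (poly F0 a) * add_char f (y * a + z / a))"
    by (simp add: norm_mult)
  also have "\<dots> \<le> 1 * (real (degree (poly_rad E) + (if y = 0 then 0 else 1)) * sqrt (real N))"
    by (intro mult_mono W.weil_bound norm_mult_char_le[OF w_unit]) auto
  finally show ?thesis by simp
qed

lemma power_sum_bound:
  fixes y z :: 'k
  assumes "\<not> (N - 1) dvd i \<or> y \<noteq> 0 \<or> z \<noteq> 0"
  shows "norm (\<Sum>a | a \<noteq> 0. mult_char (w ^ i) a * add_char f (y * a + z / a)) \<le> (if y = 0 then 1 else 2) * sqrt (real N)"
proof -
  let ?X = "[:0, 1 :: 'k:]"
  have fac: "monic_irreducible_factors ?X = {?X}"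
    using monic_irreducible_dvd_imp_eq[OF _ monic_irreducible_X] monic_irreducible_X
    by (auto simp: monic_irreducible_factors_altdef)
  then have rad: "poly_rad ?X = ?X" by (simp add: poly_rad_def)
  have "norm (\<Sum>a | poly ?X a \<noteq> 0. mult_char w (1 * poly (\<Prod>Q\<in>monic_irreducible_factors ?X. Q ^ i) a) * add_char f (y * a + z / a))
     \<le> real (degree (poly_rad ?X) + (if y = 0 then 0 else 1)) * sqrt (real N)"
    by (rule factored_sum_bound) (use assms in \<open>auto simp: fac\<close>)
  also have "(\<Sum>a | poly ?X a \<noteq> 0. mult_char w (1 * poly (\<Prod>Q\<in>monic_irreducible_factors ?X. Q ^ i) a) * add_char f (y * a + z / a))
     = (\<Sum>a | a \<noteq> 0. mult_char (w ^ i) a * add_char f (y * a + z / a))"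
    by (intro sum.cong) (auto simp: fac mult_char_w_power mult_char_power[OF w_unit])
  also have "real (degree (poly_rad ?X) + (if y = 0 then 0 else 1)) = (if y = 0 then 1 else 2)"
    by (simp add: rad)
  finally show ?thesis .
qed

lemma dvd_mult_imp_quotient_dvd:
  fixes n i v :: nat
  assumes "n dvd i * v" "n > 0"
  shows "n div gcd i n dvd v"
proof -
  have g: "gcd i n > 0" using assms(2) by simp
  have "coprime (n div gcd i n) (i div gcd i n)"
    using assms(2) by (metis coprime_commute div_gcd_coprime not_gr_zero)
  moreover have "n div gcd i n dvd i div gcd i n * v"
  proof -
    have "gcd i n * (n div gcd i n) dvd gcd i n * (i div gcd i n * v)"
      using assms(1) by (metis dvd_mult_div_cancel gcd_dvd1 gcd_dvd2 mult.assoc)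
    then show ?thesis using g by (metis dvd_times_left_cancel_iff not_gr_zero)
  qed
  ultimately show ?thesis by (simp add: coprime_dvd_mult_right_iff)
qed

text \<open>At points that are neither zeros nor poles the denominator \<open>f2\<close> may be
  replaced by \<open>f2 ^ (n - 1)\<close>, which reduces the sum to a polynomial argument. If all
  multiplicities were divisible by \<open>N - 1\<close> although the character of \<open>f\<close>
  is nontrivial, then \<open>f\<close> would be a constant times a power of \<open>x\<close> times
  an \<open>e\<close>-th power, that is, exceptional.\<close>

lemma rational_sum_bound:
  fixes f1 f2 :: "'k poly" and y z :: 'k
  assumes red: "coprime f1 f2" "f1 \<noteq> 0" "f2 \<noteq> 0" "lead_coeff f2 = 1"
    and nonexc: "\<not> exceptional (Fract f1 f2)"
    and nontriv: "\<not> (N - 1) dvd i1 \<or> \<not> (N - 1) dvd i2 \<or> y \<noteq> 0 \<or> z \<noteq> 0"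
  shows "norm (\<Sum>a | a \<noteq> 0 \<and> poly f1 a \<noteq> 0 \<and> poly f2 a \<noteq> 0.
      mult_char (w ^ i1) a * mult_char (w ^ i2) (poly f1 a / poly f2 a) * add_char f (y * a + z / a))
     \<le> real (degree f1 + degree f2 + (if y = 0 then 1 else 2)) * sqrt (real N)"
proof -
  let ?X = "[:0, 1 :: 'k:]"
  define n where "n = N - 1"
  have n: "n > 0" using N_gt_1 by (simp add: n_def)
  define E where "E = ?X * f1 * f2"
  have E: "E \<noteq> 0" "poly E 0 = 0" "degree E = degree f1 + degree f2 + 1"
    using red by (simp_all add: E_def degree_mult_eq)
  define S where "S = monic_irreducible_factors E"
  have S: "finite S" "S \<subseteq> monic_irreducibles"
    using finite_monic_irreducible_factors[OF E(1)] by (auto simp: S_def monic_irreducible_factors_altdef)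
  have sub: "monic_irreducible_factors f1 \<subseteq> S" "monic_irreducible_factors f2 \<subseteq> S" "?X \<in> S"
    using monic_irreducible_X by (auto simp: S_def E_def monic_irreducible_factors_altdef simp del: mult_pCons_left)
  obtain v1 where v1: "f1 = smult (lead_coeff f1) (\<Prod>Q\<in>S. Q ^ v1 Q)" "\<And>Q. Q \<in> S \<Longrightarrow> v1 Q > 0 \<Longrightarrow> Q dvd f1"
    using ex_factorization[OF red(2) S(1) sub(1) S(2)] by blast
  obtain v2 where v2: "f2 = smult 1 (\<Prod>Q\<in>S. Q ^ v2 Q)" "\<And>Q. Q \<in> S \<Longrightarrow> v2 Q > 0 \<Longrightarrow> Q dvd f2"
    using ex_factorization[OF red(3) S(1) sub(2) S(2)] red(4) by auto
  \<comment> \<open>The exponents in \<open>x ^ i1 * f1 ^ i2 * f2 ^ (i2 * (n - 1))\<close>, where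
    \<open>n = N - 1\<close> annihilates the exponents of nonzero elements.\<close>
  define u where "u = (\<lambda>Q. (if Q = ?X then i1 else 0) + i2 * v1 Q + i2 * (n - 1) * v2 Q)"
  define F where "F = (\<Prod>Q\<in>S. Q ^ u Q)"
  define c where "c = lead_coeff f1 ^ i2"
  have c0: "c \<noteq> 0" using red(2) by (simp add: c_def)
  have disj: "v1 Q = 0 \<or> v2 Q = 0" if "Q \<in> S" for Q
  proof (rule ccontr)
    assume "\<not> ?thesis"
    then have "Q dvd f1" "Q dvd f2" using v1(2) v2(2) that by auto
    then have "Q dvd 1" using red(1) by (metis coprime_common_divisor)
    then show False using that S(2) monic_irreducible_prime prime_elem_not_unit by blast
  qed
  have "(\<exists>Q\<in>monic_irreducible_factors E. \<not> (N - 1) dvd u Q) \<or> y \<noteq> 0 \<or> z \<noteq> 0"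
  proof (rule ccontr)
    assume "\<not> ?thesis"
    then have du: "\<And>Q. Q \<in> S \<Longrightarrow> n dvd u Q" and yz: "y = 0" "z = 0" by (auto simp: S_def n_def)
    have "n dvd i2"
    proof (rule ccontr)
      assume i2: "\<not> n dvd i2"
      \<comment> \<open>The order of the character \<open>w ^ i2\<close>. Coprimality of
        \<open>f1\<close> and \<open>f2\<close>, and of \<open>n\<close> and \<open>n - 1\<close>,
        shows that \<open>e\<close> divides all multiplicities away from \<open>x\<close>.\<close>
      define e where "e = n div gcd i2 n"
      have "e dvd n" unfolding e_def by (metis dvd_div_mult_self dvd_triv_left gcd_dvd2)
      have "gcd i2 n \<noteq> n" using i2 by (metis gcd_dvd1)
      then have "e \<noteq> 1" using n by (metis e_def dvd_div_mult_self gcd_dvd2 mult_1)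
      moreover have "e \<noteq> 0" using n \<open>e dvd n\<close> by auto
      ultimately have e1: "e > 1" by simp
      have ev: "e dvd v1 Q \<and> e dvd v2 Q" if Q: "Q \<in> S" "Q \<noteq> ?X" for Q
      proof (cases "v1 Q = 0")
        case True
        have "n dvd i2 * (n - 1) * v2 Q" using du[OF Q(1)] Q(2) True by (simp add: u_def)
        moreover have "coprime n (n - 1)" using n by (metis coprime_diff_one_right_nat coprime_commute)
        ultimately have "n dvd i2 * v2 Q"
          by (metis coprime_dvd_mult_right_iff mult.assoc mult.commute)
        then show ?thesis using True dvd_mult_imp_quotient_dvd[OF _ n] by (simp add: e_def)
      next
        case False
        then have "n dvd i2 * v1 Q" using du[OF Q(1)] Q disj[OF Q(1)] by (simp add: u_def)
        then show ?thesis using False disj[OF Q(1)] dvd_mult_imp_quotient_dvd[OF _ n] by (simp add: e_def)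
      qed
      define g where "g = (\<lambda>v. \<Prod>Q\<in>S - {?X}. Q ^ (v Q div e))"
      have split: "(\<Prod>Q\<in>S. Q ^ v Q) = ?X ^ v ?X * g v ^ e" if "\<And>Q. Q \<in> S \<Longrightarrow> Q \<noteq> ?X \<Longrightarrow> e dvd v Q" for v
      proof -
        have "(\<Prod>Q\<in>S. Q ^ v Q) = ?X ^ v ?X * (\<Prod>Q\<in>S - {?X}. Q ^ v Q)" using S(1) sub(3) by (rule prod.remove)
        also have "(\<Prod>Q\<in>S - {?X}. Q ^ v Q) = g v ^ e"
          unfolding g_def prod_power_distrib using that by (intro prod.cong refl) (simp flip: power_mult)
        finally show ?thesis .
      qed
      have f1: "f1 = [:lead_coeff f1:] * (?X ^ v1 ?X * g v1 ^ e)" using v1(1) split[of v1] ev by simp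
      have f2: "f2 = ?X ^ v2 ?X * g v2 ^ e" using v2(1) split[of v2] ev by simp
      have g2: "g v2 ^ e \<noteq> 0" using f2 red(3) by auto
      have tp: "to_fract (P ^ k) = to_fract P ^ k" for P :: "'k poly" and k
        by (induction k) (simp_all add: to_fract_mult)
      have x0: "ratfun_x \<noteq> (0 :: 'k poly fract)" by simp
      have "Fract f1 f2 = to_fract f1 / to_fract f2" by (rule Fract_conv_to_fract)
      also have "\<dots> = ratfun_const (lead_coeff f1) * ratfun_x ^ v1 ?X * to_fract (g v1) ^ e / (ratfun_x ^ v2 ?X * to_fract (g v2) ^ e)"
        by (subst f1, subst f2) (simp only: to_fract_mult tp mult.assoc)
      also have "\<dots> = ratfun_const (lead_coeff f1) * ratfun_x powi (int (v1 ?X) - int (v2 ?X)) * (to_fract (g v1) / to_fract (g v2)) ^ e"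
        using x0 by (simp add: power_int_diff power_divide)
      finally have "exceptional (Fract f1 f2)"
        unfolding exceptional_def using e1 \<open>e dvd n\<close> by (auto simp: n_def card_N)
      with nonexc show False by blast
    qed
    moreover have "n dvd i1"
    proof -
      have "n dvd i1 + i2 * (v1 ?X + (n - 1) * v2 ?X)" using du[OF sub(3)] by (simp add: u_def algebra_simps)
      then show ?thesis using \<open>n dvd i2\<close> by (metis dvd_add_left_iff dvd_mult2)
    qed
    ultimately show False using nontriv yz by (simp add: n_def)
  qed
  then have "norm (\<Sum>a | poly E a \<noteq> 0. mult_char w (c * poly F a) * add_char f (y * a + z / a))
     \<le> real (degree (poly_rad E) + (if y = 0 then 0 else 1)) * sqrt (real N)"
    unfolding F_def S_def by (rule factored_sum_bound[OF E(1,2) c0])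
  also have "\<dots> \<le> real (degree f1 + degree f2 + (if y = 0 then 1 else 2)) * sqrt (real N)"
    using degree_poly_rad_le[OF E(1)] E(3) by (intro mult_right_mono) auto
  also have "(\<Sum>a | poly E a \<noteq> 0. mult_char w (c * poly F a) * add_char f (y * a + z / a)) =
     (\<Sum>a | a \<noteq> 0 \<and> poly f1 a \<noteq> 0 \<and> poly f2 a \<noteq> 0.
      mult_char (w ^ i1) a * mult_char (w ^ i2) (poly f1 a / poly f2 a) * add_char f (y * a + z / a))"
  proof (rule sum.cong)
    show "{a. poly E a \<noteq> 0} = {a. a \<noteq> 0 \<and> poly f1 a \<noteq> 0 \<and> poly f2 a \<noteq> 0}" by (auto simp: E_def)
    fix a assume "a \<in> {a. a \<noteq> 0 \<and> poly f1 a \<noteq> 0 \<and> poly f2 a \<noteq> 0}"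
    then have a: "a \<noteq> 0" "poly f1 a \<noteq> 0" "poly f2 a \<noteq> 0" by auto
    have p1: "poly f1 a = lead_coeff f1 * (\<Prod>Q\<in>S. poly Q a ^ v1 Q)"
      by (subst v1(1)) (simp add: poly_prod)
    have p2: "poly f2 a = (\<Prod>Q\<in>S. poly Q a ^ v2 Q)"
      by (subst v2(1)) (simp add: poly_prod)
    have pF: "c * poly F a = a ^ i1 * poly f1 a ^ i2 * poly f2 a ^ (i2 * (n - 1))"
    proof -
      have "poly F a = (\<Prod>Q\<in>S. (if Q = ?X then poly Q a ^ i1 else 1) * ((poly Q a ^ v1 Q) ^ i2 * (poly Q a ^ v2 Q) ^ (i2 * (n - 1))))"
        unfolding F_def poly_prod by (intro prod.cong refl) (simp add: u_def power_add mult_ac flip: power_mult)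
      also have "\<dots> = (\<Prod>Q\<in>S. if Q = ?X then poly Q a ^ i1 else 1) * ((\<Prod>Q\<in>S. poly Q a ^ v1 Q) ^ i2 * (\<Prod>Q\<in>S. poly Q a ^ v2 Q) ^ (i2 * (n - 1)))"
        unfolding prod.distrib prod_power_distrib ..
      also have "(\<Prod>Q\<in>S. if Q = ?X then poly Q a ^ i1 else 1) = a ^ i1"
        using S(1) sub(3) by simp
      finally show ?thesis unfolding p1 p2 c_def by (simp add: power_mult_distrib mult_ac)
    qed
    have inv: "poly f2 a ^ (n - 1) = inverse (poly f2 a)"
    proof -
      have "poly f2 a * poly f2 a ^ (n - 1) = poly f2 a ^ n" using n by (metis Suc_diff_1 power_Suc)
      also have "\<dots> = 1" using finite_field_power_card_units[OF a(3)] by (simp add: n_def card_N)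
      finally show ?thesis using a(3) by (simp add: field_simps)
    qed
    have "c * poly F a = a ^ i1 * (poly f1 a / poly f2 a) ^ i2"
    proof -
      have "poly f2 a ^ (i2 * (n - 1)) = inverse (poly f2 a) ^ i2" using inv by (metis power_mult mult.commute)
      then show ?thesis unfolding pF by (simp add: power_mult_distrib divide_inverse)
    qed
    then show "mult_char w (c * poly F a) * add_char f (y * a + z / a) =
      mult_char (w ^ i1) a * mult_char (w ^ i2) (poly f1 a / poly f2 a) * add_char f (y * a + z / a)"
      using a by (simp add: mult_char_mult[OF w_unit] mult_char_power[OF w_unit] mult_char_w_power)
  qed
  finally show ?thesis .
qed

end

subsection \<open>Sieving with characters\<close>

text \<open>\<open>\<rho> \<kappa>\<close> is the indicator of a condition,
  \<open>T \<kappa>\<close> indexes the characters expanding it, and \<open>t0\<close> is the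
  trivial one, whose coefficient \<open>\<theta> \<kappa>\<close> is the expected density. Any bound
  for products of characters then controls the count for a set of conditions.\<close>

locale character_expansion =
  fixes C :: "'c set" and Y :: "'a set" and T :: "'c \<Rightarrow> 't set" and t0 :: 't
    and e :: "'c \<Rightarrow> 't \<Rightarrow> 'a \<Rightarrow> complex" and c :: "'c \<Rightarrow> 't \<Rightarrow> complex"
    and \<rho> :: "'c \<Rightarrow> 'a \<Rightarrow> real" and \<theta> :: "'c \<Rightarrow> real"
  assumes finite_T: "\<kappa> \<in> C \<Longrightarrow> finite (T \<kappa>)" and t0_T: "\<kappa> \<in> C \<Longrightarrow> t0 \<in> T \<kappa>"
    and e_t0: "a \<in> Y \<Longrightarrow> e \<kappa> t0 a = 1"
    and c_t0: "\<kappa> \<in> C \<Longrightarrow> c \<kappa> t0 = of_real (\<theta> \<kappa>)" and \<theta>_nonneg: "\<kappa> \<in> C \<Longrightarrow> \<theta> \<kappa> \<ge> 0"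
    and expansion: "\<kappa> \<in> C \<Longrightarrow> a \<in> Y \<Longrightarrow> of_real (\<rho> \<kappa> a) = (\<Sum>t\<in>T \<kappa>. c \<kappa> t * e \<kappa> t a)"
begin

definition count :: "'c set \<Rightarrow> real" where
  "count K = (\<Sum>a\<in>Y. \<Prod>\<kappa>\<in>K. \<rho> \<kappa> a)"

definition total :: "'c \<Rightarrow> real" where
  "total \<kappa> = (\<Sum>t\<in>T \<kappa>. norm (c \<kappa> t))"

definition char_sum :: "'c set \<Rightarrow> ('c \<Rightarrow> 't) \<Rightarrow> complex" where
  "char_sum K g = (\<Sum>a\<in>Y. \<Prod>\<kappa>\<in>K. e \<kappa> (g \<kappa>) a)"

lemma total_split:
  assumes "\<kappa> \<in> C"
  shows "total \<kappa> = \<theta> \<kappa> + (\<Sum>t\<in>T \<kappa> - {t0}. norm (c \<kappa> t))"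
  unfolding total_def using sum.remove[OF finite_T[OF assms] t0_T[OF assms], of "\<lambda>t. norm (c \<kappa> t)"] assms
  by (simp add: c_t0 \<theta>_nonneg)

lemma count_expand:
  assumes "finite K" "K \<subseteq> C"
  shows "of_real (count K) = (\<Sum>g\<in>PiE K T. (\<Prod>\<kappa>\<in>K. c \<kappa> (g \<kappa>)) * char_sum K g)"
proof -
  have "of_real (count K) = (\<Sum>a\<in>Y. \<Prod>\<kappa>\<in>K. \<Sum>t\<in>T \<kappa>. c \<kappa> t * e \<kappa> t a)"
    by (simp add: count_def expansion subsetD[OF assms(2)] cong: prod.cong)
  also have "\<dots> = (\<Sum>a\<in>Y. \<Sum>g\<in>PiE K T. \<Prod>\<kappa>\<in>K. c \<kappa> (g \<kappa>) * e \<kappa> (g \<kappa>) a)"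
    using assms finite_T by (intro sum.cong refl prod_sum_PiE) auto
  also have "\<dots> = (\<Sum>g\<in>PiE K T. \<Sum>a\<in>Y. \<Prod>\<kappa>\<in>K. c \<kappa> (g \<kappa>) * e \<kappa> (g \<kappa>) a)" by (rule sum.swap)
  also have "\<dots> = (\<Sum>g\<in>PiE K T. (\<Prod>\<kappa>\<in>K. c \<kappa> (g \<kappa>)) * char_sum K g)"
    by (simp add: char_sum_def prod.distrib sum_distrib_left)
  finally show ?thesis .
qed

lemma sum_norm_coefficients:
  assumes "finite K" "K \<subseteq> C"
  shows "(\<Sum>g\<in>PiE K T. norm (\<Prod>\<kappa>\<in>K. c \<kappa> (g \<kappa>))) = (\<Prod>\<kappa>\<in>K. total \<kappa>)"
  unfolding total_def using assms finite_T by (subst prod_sum_PiE) (auto simp: prod_norm)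

text \<open>The product over \<open>K\<close> is multiplied out. The trivial choice everywhere gives
  the main term, and the absolute values of the other coefficients add up to the difference of the
  two products.\<close>

lemma count_main_term:
  assumes K: "finite K" "K \<subseteq> C"
    and b: "\<And>g. g \<in> PiE K T \<Longrightarrow> \<exists>\<kappa>\<in>K. g \<kappa> \<noteq> t0 \<Longrightarrow> norm (char_sum K g) \<le> b"
  shows "\<bar>count K - (\<Prod>\<kappa>\<in>K. \<theta> \<kappa>) * card Y\<bar> \<le> b * ((\<Prod>\<kappa>\<in>K. total \<kappa>) - (\<Prod>\<kappa>\<in>K. \<theta> \<kappa>))"
proof -
  define g0 where "g0 = restrict (\<lambda>_. t0) K"
  have g0: "g0 \<in> PiE K T" using K(2) by (auto simp: g0_def t0_T)
  have fin: "finite (PiE K T)" using K finite_T by (intro finite_PiE) auto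
  have c0: "(\<Prod>\<kappa>\<in>K. c \<kappa> (g0 \<kappa>)) = of_real (\<Prod>\<kappa>\<in>K. \<theta> \<kappa>)" using K(2) by (simp add: g0_def c_t0 subsetD cong: prod.cong)
  have cs0: "char_sum K g0 = of_nat (card Y)" by (simp add: char_sum_def g0_def e_t0 cong: prod.cong)
  have "of_real (count K) = (\<Prod>\<kappa>\<in>K. c \<kappa> (g0 \<kappa>)) * char_sum K g0 +
      (\<Sum>g\<in>PiE K T - {g0}. (\<Prod>\<kappa>\<in>K. c \<kappa> (g \<kappa>)) * char_sum K g)"
    unfolding count_expand[OF K] by (rule sum.remove[OF fin g0])
  then have "of_real (count K - (\<Prod>\<kappa>\<in>K. \<theta> \<kappa>) * card Y) = (\<Sum>g\<in>PiE K T - {g0}. (\<Prod>\<kappa>\<in>K. c \<kappa> (g \<kappa>)) * char_sum K g)"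
    by (simp add: c0 cs0)
  then have "\<bar>count K - (\<Prod>\<kappa>\<in>K. \<theta> \<kappa>) * card Y\<bar> = norm (\<Sum>g\<in>PiE K T - {g0}. (\<Prod>\<kappa>\<in>K. c \<kappa> (g \<kappa>)) * char_sum K g)"
    by (metis norm_of_real)
  also have "\<dots> \<le> (\<Sum>g\<in>PiE K T - {g0}. norm (\<Prod>\<kappa>\<in>K. c \<kappa> (g \<kappa>)) * b)"
  proof (rule order.trans[OF norm_sum sum_mono])
    fix g assume g: "g \<in> PiE K T - {g0}"
    have "\<exists>\<kappa>\<in>K. g \<kappa> \<noteq> t0"
    proof (rule ccontr)
      assume "\<not> ?thesis"
      then have "g = g0" using g by (intro ext) (auto simp: g0_def restrict_def PiE_def extensional_def)
      with g show False by simp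
    qed
    then have "norm (char_sum K g) \<le> b" using g b by blast
    then show "norm ((\<Prod>\<kappa>\<in>K. c \<kappa> (g \<kappa>)) * char_sum K g) \<le> norm (\<Prod>\<kappa>\<in>K. c \<kappa> (g \<kappa>)) * b"
      by (simp add: norm_mult mult_left_mono)
  qed
  also have "\<dots> = b * (\<Sum>g\<in>PiE K T - {g0}. norm (\<Prod>\<kappa>\<in>K. c \<kappa> (g \<kappa>)))"
    by (simp add: sum_distrib_left mult.commute)
  also have "(\<Sum>g\<in>PiE K T - {g0}. norm (\<Prod>\<kappa>\<in>K. c \<kappa> (g \<kappa>))) = (\<Prod>\<kappa>\<in>K. total \<kappa>) - (\<Prod>\<kappa>\<in>K. \<theta> \<kappa>)"
  proof -
    have "norm (\<Prod>\<kappa>\<in>K. c \<kappa> (g0 \<kappa>)) = (\<Prod>\<kappa>\<in>K. \<theta> \<kappa>)"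
      unfolding c0 norm_of_real by (intro abs_of_nonneg prod_nonneg) (use K(2) \<theta>_nonneg in auto)
    then show ?thesis using sum.remove[OF fin g0, of "\<lambda>g. norm (\<Prod>\<kappa>\<in>K. c \<kappa> (g \<kappa>))"] sum_norm_coefficients[OF K] by simp
  qed
  finally show ?thesis .
qed

text \<open>The terms that are trivial at \<kappa> reassemble to
  \<open>\<theta> \<kappa> * count K\<close>. Comparing with \<open>count K\<close> instead of its
  main term leaves only characters with a nontrivial component at \<kappa>, so the sharper estimates
  for these can be used.\<close>

lemma count_insert:
  assumes K: "finite K" "K \<subseteq> C" "\<kappa> \<in> C" "\<kappa> \<notin> K"
    and b: "\<And>g. g \<in> PiE (insert \<kappa> K) T \<Longrightarrow> g \<kappa> \<noteq> t0 \<Longrightarrow> norm (char_sum (insert \<kappa> K) g) \<le> b"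
  shows "\<bar>count (insert \<kappa> K) - \<theta> \<kappa> * count K\<bar> \<le> b * (total \<kappa> - \<theta> \<kappa>) * (\<Prod>\<kappa>\<in>K. total \<kappa>)"
proof -
  have fin: "finite (PiE K T)" using K finite_T by (intro finite_PiE) auto
  let ?upd = "\<lambda>t g. g(\<kappa> := t)"
  have inK: "(\<Prod>\<kappa>'\<in>K. h \<kappa>' (?upd t g \<kappa>')) = (\<Prod>\<kappa>'\<in>K. h \<kappa>' (g \<kappa>'))" for h :: "'c \<Rightarrow> 't \<Rightarrow> complex" and t g
    using K(4) by (intro prod.cong) auto
  have cs: "char_sum (insert \<kappa> K) (?upd t0 g) = char_sum K g" for g
    unfolding char_sum_def using K by (intro sum.cong refl) (auto simp: e_t0 intro!: prod.cong)
  have "PiE (insert \<kappa> K) T = (\<lambda>(t, g). ?upd t g) ` (T \<kappa> \<times> PiE K T)" by (rule PiE_insert_eq)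
  moreover have "inj_on (\<lambda>(t, g). ?upd t g) (T \<kappa> \<times> PiE K T)" using K(4) by (rule inj_combinator)
  ultimately have "of_real (count (insert \<kappa> K)) = (\<Sum>(t, g)\<in>T \<kappa> \<times> PiE K T.
      (\<Prod>\<kappa>'\<in>insert \<kappa> K. c \<kappa>' (?upd t g \<kappa>')) * char_sum (insert \<kappa> K) (?upd t g))"
    using count_expand[of "insert \<kappa> K"] K by (simp add: sum.reindex case_prod_unfold comp_def)
  also have "\<dots> = (\<Sum>t\<in>T \<kappa>. \<Sum>g\<in>PiE K T. c \<kappa> t * (\<Prod>\<kappa>'\<in>K. c \<kappa>' (g \<kappa>')) * char_sum (insert \<kappa> K) (?upd t g))"
    using K by (simp add: sum.cartesian_product case_prod_unfold inK del: fun_upd_apply) (simp add: fun_upd_same)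
  also have "\<dots> = (\<Sum>g\<in>PiE K T. c \<kappa> t0 * (\<Prod>\<kappa>'\<in>K. c \<kappa>' (g \<kappa>')) * char_sum K g) +
     (\<Sum>t\<in>T \<kappa> - {t0}. \<Sum>g\<in>PiE K T. c \<kappa> t * (\<Prod>\<kappa>'\<in>K. c \<kappa>' (g \<kappa>')) * char_sum (insert \<kappa> K) (?upd t g))"
    by (subst sum.remove[OF finite_T[OF K(3)] t0_T[OF K(3)]]) (simp add: cs)
  also have "(\<Sum>g\<in>PiE K T. c \<kappa> t0 * (\<Prod>\<kappa>'\<in>K. c \<kappa>' (g \<kappa>')) * char_sum K g) = of_real (\<theta> \<kappa> * count K)"
    by (simp add: count_expand[OF K(1,2)] c_t0[OF K(3)] sum_distrib_left mult.assoc)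
  finally have "of_real (count (insert \<kappa> K) - \<theta> \<kappa> * count K) =
     (\<Sum>t\<in>T \<kappa> - {t0}. \<Sum>g\<in>PiE K T. c \<kappa> t * (\<Prod>\<kappa>'\<in>K. c \<kappa>' (g \<kappa>')) * char_sum (insert \<kappa> K) (?upd t g))"
    by (simp del: fun_upd_apply)
  then have "\<bar>count (insert \<kappa> K) - \<theta> \<kappa> * count K\<bar> =
     norm (\<Sum>t\<in>T \<kappa> - {t0}. \<Sum>g\<in>PiE K T. c \<kappa> t * (\<Prod>\<kappa>'\<in>K. c \<kappa>' (g \<kappa>')) * char_sum (insert \<kappa> K) (?upd t g))"
    by (metis norm_of_real)
  also have "\<dots> \<le> (\<Sum>t\<in>T \<kappa> - {t0}. \<Sum>g\<in>PiE K T. norm (c \<kappa> t) * norm (\<Prod>\<kappa>'\<in>K. c \<kappa>' (g \<kappa>')) * b)"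
  proof (intro order.trans[OF norm_sum sum_mono])
    fix t g assume "t \<in> T \<kappa> - {t0}" "g \<in> PiE K T"
    then have "norm (char_sum (insert \<kappa> K) (?upd t g)) \<le> b" by (intro b) (auto intro!: PiE_fun_upd)
    then show "norm (c \<kappa> t * (\<Prod>\<kappa>'\<in>K. c \<kappa>' (g \<kappa>')) * char_sum (insert \<kappa> K) (?upd t g)) \<le>
       norm (c \<kappa> t) * norm (\<Prod>\<kappa>'\<in>K. c \<kappa>' (g \<kappa>')) * b"
      by (simp add: norm_mult mult_left_mono)
  qed
  also have "\<dots> = b * (\<Sum>t\<in>T \<kappa> - {t0}. norm (c \<kappa> t)) * (\<Sum>g\<in>PiE K T. norm (\<Prod>\<kappa>'\<in>K. c \<kappa>' (g \<kappa>')))"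
    by (simp add: sum_distrib_left sum_distrib_right sum_product mult_ac)
  also have "\<dots> = b * (total \<kappa> - \<theta> \<kappa>) * (\<Prod>\<kappa>\<in>K. total \<kappa>)"
    unfolding sum_norm_coefficients[OF K(1,2)] total_split[OF K(3)] by simp
  finally show ?thesis .
qed

end

text \<open>Where the product over \<open>K0\<close> vanishes the right side is at most 0; elsewhere
  the inequality is the Bonferroni bound. The loss from \<open>K2\<close> is deliberately not
  multiplied by the product over \<open>K0\<close>, so it may be estimated without those
  conditions.\<close>

lemma sieve_pointwise:
  fixes \<rho> :: "'c \<Rightarrow> real"
  assumes fin: "finite K0" "finite K1" "finite K2" and \<rho>: "\<And>\<kappa>. \<rho> \<kappa> = 0 \<or> \<rho> \<kappa> = 1"
  shows "(\<Prod>\<kappa>\<in>K0. \<rho> \<kappa>) * (\<Prod>\<kappa>\<in>K1. \<rho> \<kappa>) * (\<Prod>\<kappa>\<in>K2. \<rho> \<kappa>) \<ge>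
    (\<Sum>\<kappa>\<in>K1. \<rho> \<kappa> * (\<Prod>\<kappa>\<in>K0. \<rho> \<kappa>)) - (real (card K1) - 1) * (\<Prod>\<kappa>\<in>K0. \<rho> \<kappa>) - (\<Sum>\<kappa>\<in>K2. 1 - \<rho> \<kappa>)"
proof -
  have prod01: "(\<Prod>\<kappa>\<in>K. \<rho> \<kappa>) = 0 \<or> (\<Prod>\<kappa>\<in>K. \<rho> \<kappa>) = 1" for K
  proof (induction K rule: infinite_finite_induct)
    case (insert \<kappa> K)
    then show ?case using \<rho>[of \<kappa>] by auto
  qed simp_all
  have bonf: "(\<Prod>\<kappa>\<in>K. \<rho> \<kappa>) \<ge> 1 - (\<Sum>\<kappa>\<in>K. 1 - \<rho> \<kappa>)" if "finite K" for K
    using that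
  proof (induction K rule: finite_induct)
    case (insert \<kappa> K)
    have "(\<Sum>\<kappa>\<in>K. 1 - \<rho> \<kappa>) \<ge> 0" by (intro sum_nonneg) (metis \<rho> diff_ge_0_iff_ge order_refl zero_le_one)
    then show ?case using insert \<rho>[of \<kappa>] by auto
  qed simp
  have nn: "(\<Sum>\<kappa>\<in>K2. 1 - \<rho> \<kappa>) \<ge> 0" by (intro sum_nonneg) (metis \<rho> diff_ge_0_iff_ge order_refl zero_le_one)
  show ?thesis
  proof (cases "(\<Prod>\<kappa>\<in>K0. \<rho> \<kappa>) = 0")
    case True
    then show ?thesis using nn by simp
  next
    case False
    then have K0: "(\<Prod>\<kappa>\<in>K0. \<rho> \<kappa>) = 1" using prod01 by blast
    have "(\<Sum>\<kappa>\<in>K1. 1 - \<rho> \<kappa>) = real (card K1) - (\<Sum>\<kappa>\<in>K1. \<rho> \<kappa>)" by (simp add: sum_subtractf)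
    moreover have "(\<Prod>\<kappa>\<in>K1. \<rho> \<kappa>) * (\<Prod>\<kappa>\<in>K2. \<rho> \<kappa>) \<ge> 1 - (\<Sum>\<kappa>\<in>K1. 1 - \<rho> \<kappa>) - (\<Sum>\<kappa>\<in>K2. 1 - \<rho> \<kappa>)"
    proof -
      have "(\<Sum>\<kappa>\<in>K1. 1 - \<rho> \<kappa>) \<ge> 0" by (intro sum_nonneg) (metis \<rho> diff_ge_0_iff_ge order_refl zero_le_one)
      then show ?thesis using bonf[OF fin(2)] bonf[OF fin(3)] nn prod01[of K1] prod01[of K2] by auto
    qed
    ultimately show ?thesis by (simp add: K0)
  qed
qed

section \<open>Orthogonality relations for the indicator functions\<close>

context finite_field_closure
begin

abbreviation \<psi> :: "'k \<Rightarrow> complex" where "\<psi> \<equiv> add_char f"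

lemma psi_add: "\<psi> (a + b) = \<psi> a * \<psi> b"
  by (rule add_char_add) (metis card_N card_eq finite_field_power_card_eq_same)+

lemma psi_minus: "\<psi> (- a) * \<psi> a = 1"
  using psi_add[of "- a" a] by simp

lemma psi_sum: "\<psi> (sum h A) = (\<Prod>x\<in>A. \<psi> (h x))"
  by (induction A rule: infinite_finite_induct) (simp_all add: psi_add)

lemma sum_psi: "(\<Sum>x\<in>UNIV. \<psi> (x * b)) = (if b = 0 then of_nat N else 0)"
proof (cases "b = 0")
  case False
  obtain a where a: "\<psi> a \<noteq> 1" using psi_nontrivial by blast
  have "(\<Sum>x\<in>UNIV. \<psi> (x * b)) = (\<Sum>x\<in>UNIV. \<psi> ((x + a / b) * b))"
    by (rule sum.reindex_bij_witness[of _ "\<lambda>x. x + a / b" "\<lambda>x. x - a / b"]) auto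
  also have "\<dots> = \<psi> a * (\<Sum>x\<in>UNIV. \<psi> (x * b))"
    using False by (simp add: distrib_right psi_add sum_distrib_left mult.commute[of "\<psi> a"] cong: sum.cong)
  finally show ?thesis using a False by simp
qed (simp add: card_N)

text \<open>The annihilator of \<open>U\<close> under the pairing \<open>\<psi> (y * u)\<close>;
  every additive character of the field trivial on a subgroup \<open>U\<close> is given by one of
  its elements.\<close>

definition perp :: "'k set \<Rightarrow> 'k set" where
  "perp U = {y. \<forall>u\<in>U. \<psi> (y * u) = 1}"

text \<open>Summing \<open>\<psi> (y * (a - u))\<close> over all \<open>y\<close> and all
  \<open>u\<close> in \<open>U\<close> in both orders gives the indicator of \<open>U\<close>; the
  case \<open>a = 0\<close> gives the cardinality of the annihilator.\<close>

lemma perp_indicator: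
  assumes U: "0 \<in> U" "\<And>u v. u \<in> U \<Longrightarrow> v \<in> U \<Longrightarrow> u - v \<in> U"
  shows "card U * card (perp U) = N"
    and "(\<Sum>y\<in>perp U. \<psi> (y * a)) = (if a \<in> U then of_nat (card (perp U)) else 0)"
proof -
  have neg: "- u \<in> U" if "u \<in> U" for u using U(2)[OF U(1) that] by simp
  have add: "u + v \<in> U" if "u \<in> U" "v \<in> U" for u v using U(2)[OF that(1) neg[OF that(2)]] by simp
  have inner: "(\<Sum>u\<in>U. \<psi> (y * - u)) = (if y \<in> perp U then of_nat (card U) else 0)" for y
  proof (cases "y \<in> perp U")
    case True
    then have "(\<Sum>u\<in>U. \<psi> (y * - u)) = (\<Sum>u\<in>U. 1)"
      using neg by (intro sum.cong refl) (auto simp: perp_def simp del: mult_minus_right)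
    with True show ?thesis by simp
  next
    case False
    then obtain v where v: "v \<in> U" "\<psi> (y * v) \<noteq> 1" by (auto simp: perp_def)
    have "(\<Sum>u\<in>U. \<psi> (y * - u)) = (\<Sum>u\<in>U. \<psi> (y * - (u - v)))"
      by (rule sum.reindex_bij_witness[of _ "\<lambda>u. u - v" "\<lambda>u. u + v"]) (use U add v in auto)
    also have "\<dots> = \<psi> (y * v) * (\<Sum>u\<in>U. \<psi> (y * - u))"
      by (simp add: sum_distrib_left flip: psi_add) (simp add: algebra_simps)
    finally show ?thesis using v False by simp
  qed
  have main: "of_nat (card U) * (\<Sum>y\<in>perp U. \<psi> (y * a)) = (if a \<in> U then of_nat N else 0)" for a
  proof -
    have "of_nat (card U) * (\<Sum>y\<in>perp U. \<psi> (y * a)) = (\<Sum>y\<in>UNIV. (if y \<in> perp U then of_nat (card U) else 0) * \<psi> (y * a))"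
      by (simp add: sum_distrib_left if_distrib[where f = "\<lambda>c. c * _"] sum.If_cases cong: if_cong)
    also have "\<dots> = (\<Sum>y\<in>UNIV. \<Sum>u\<in>U. \<psi> (y * (a - u)))"
      unfolding inner[symmetric]
      by (intro sum.cong refl) (simp add: sum_distrib_right flip: psi_add, simp add: algebra_simps)
    also have "\<dots> = (\<Sum>u\<in>U. \<Sum>y\<in>UNIV. \<psi> (y * (a - u)))" by (rule sum.swap)
    also have "\<dots> = (\<Sum>u\<in>U. if u = a then of_nat N else 0)" unfolding sum_psi by (intro sum.cong) auto
    finally show ?thesis by simp
  qed
  have "of_nat (card U * card (perp U)) = (of_nat N :: complex)" using main[of 0] U(1) by simp
  then show c: "card U * card (perp U) = N" by (simp only: of_nat_eq_iff)
  then have "card U \<noteq> 0" using N_gt_1 by auto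
  then show "(\<Sum>y\<in>perp U. \<psi> (y * a)) = (if a \<in> U then of_nat (card (perp U)) else 0)"
    using main[of a] by (auto simp flip: c)
qed

lemma zero_in_perp: "0 \<in> perp U"
  by (simp add: perp_def)

text \<open>In terms of discrete logarithms, being an \<open>l\<close>-th power means that
  \<open>l\<close> divides the exponent, because \<open>l\<close> divides the group order. The sum
  over characters of order dividing \<open>l\<close> is then a geometric sum over an
  \<open>l\<close>-th root of unity.\<close>

lemma power_indicator:
  assumes l: "l dvd N - 1" "l > 0" and x: "x \<noteq> 0"
  shows "(\<Sum>s<l. mult_char (w ^ ((N - 1) div l * s)) x) = (if \<exists>y. y ^ l = (x :: 'k) then of_nat l else 0)"
proof -
  let ?n = "N - 1"
  have n: "?n > 0" "?n = ?n div l * l" using N_gt_1 l by auto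
  define \<zeta> where "\<zeta> = w ^ (?n div l * dlog x)"
  have power: "\<zeta> = 1 \<longleftrightarrow> l dvd dlog x"
  proof -
    have "?n dvd ?n div l * dlog x \<longleftrightarrow> ?n div l * l dvd ?n div l * dlog x" using n(2) by simp
    also have "\<dots> \<longleftrightarrow> l dvd dlog x" using n by (metis dvd_times_left_cancel_iff mult_eq_0_iff not_gr_zero)
    finally show ?thesis unfolding \<zeta>_def w_power_eq_1_iff .
  qed
  have ex: "(\<exists>y. y ^ l = x) \<longleftrightarrow> l dvd dlog x"
  proof
    assume "l dvd dlog x"
    then obtain j where "dlog x = l * j" by (elim dvdE)
    then have "(gen ^ j) ^ l = x" using gen_power_dlog[OF x] by (simp add: mult.commute flip: power_mult)
    then show "\<exists>y. y ^ l = x" by blast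
  next
    assume "\<exists>y. y ^ l = x"
    then obtain y where y: "y ^ l = x" by blast
    then have "y \<noteq> 0" using x l by (auto simp: zero_power)
    have "(gen :: 'k) ^ (dlog y * l) = gen ^ dlog x" unfolding power_mult gen_power_dlog[OF \<open>y \<noteq> 0\<close>] gen_power_dlog[OF x] by (rule y)
    then have "[dlog y * l = dlog x] (mod ?n)" by (simp only: gen_power_eq_iff card_N)
    then have "[dlog y * l = dlog x] (mod l)" using l(1) by (rule cong_dvd_modulus_nat)
    then show "l dvd dlog x" by (metis cong_dvd_iff dvd_triv_right)
  qed
  have "(\<Sum>s<l. mult_char (w ^ (?n div l * s)) x) = (\<Sum>s<l. \<zeta> ^ s)"
    using x by (intro sum.cong refl) (simp add: mult_char_def \<zeta>_def mult_ac flip: power_mult)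
  also have "\<dots> = (if \<zeta> = 1 then of_nat l else 0)"
  proof (cases "\<zeta> = 1")
    case False
    have "?n dvd ?n div l * dlog x * l" using n(2) by (metis dvd_triv_left mult.assoc mult.commute)
    then have "\<zeta> ^ l = 1" unfolding \<zeta>_def power_mult[symmetric] w_power_eq_1_iff .
    then show ?thesis using False geometric_sum[of \<zeta> l] by simp
  qed simp
  finally show ?thesis unfolding power ex .
qed

end

subsection \<open>Extensions of finite fields and normal elements\<close>

text \<open>The powers of \<open>gen ^ e\<close>, with \<open>e\<close> the index of the subgroup of
  order \<open>q - 1\<close>, together with 0 provide as many roots of \<open>x ^ q - x\<close> as
  its degree.\<close>

lemma card_base_field:
  assumes q: "q > 1" "q - 1 dvd CARD('k::finite_field) - 1"
  shows "card (base_field q :: 'k set) = q"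
proof (rule antisym)
  let ?P = "monom 1 q - monom 1 1 :: 'k poly"
  have "coeff ?P q = 1" using q by simp
  then have P0: "?P \<noteq> 0" by (metis coeff_0 zero_neq_one)
  have roots: "{x. poly ?P x = 0} = base_field q" by (auto simp: base_field_def poly_monom)
  have "degree ?P \<le> q" using q by (intro degree_diff_le) (auto simp: degree_monom_eq)
  then show "card (base_field q :: 'k set) \<le> q" using card_poly_roots_bound[OF P0] unfolding roots by simp
  obtain e where e: "CARD('k) - 1 = (q - 1) * e" using q(2) by (elim dvdE)
  have e0: "e > 0" using e card_field_gt_1[where ?'k = 'k] by (cases e) auto
  let ?h = "\<lambda>j. gen ^ (e * j) :: 'k"
  have "inj_on ?h {..<q - 1}"
  proof (rule inj_onI)
    fix i j assume ij: "i \<in> {..<q - 1}" "j \<in> {..<q - 1}" "?h i = ?h j"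
    have "[e * i = e * j] (mod (e * (q - 1)))" using ij(3) by (simp only: gen_power_eq_iff e mult.commute)
    moreover have "e * i < e * (q - 1)" "e * j < e * (q - 1)" using ij e0 by auto
    ultimately have "e * i = e * j" by (simp only: cong_less_modulus_unique_nat)
    then show "i = j" using e0 by simp
  qed
  then have "card (?h ` {..<q - 1}) = q - 1" by (simp add: card_image)
  then have "card (insert 0 (?h ` {..<q - 1})) = q" using q(1) by (subst card_insert_disjoint) auto
  moreover have "insert 0 (?h ` {..<q - 1}) \<subseteq> base_field q"
  proof -
    have "?h j ^ q = ?h j" for j
    proof -
      have "(gen :: 'k) ^ (e * j * q) = gen ^ (e * j)"
      proof (simp only: gen_power_eq_iff e)
        have "[q = 1] (mod (q - 1))" using q(1) by (simp add: cong_altdef_nat)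
        then have "[e * q = e * 1] (mod (e * (q - 1)))" by (rule cong_cmult_leftI)
        then have "[j * (e * q) = j * (e * 1)] (mod (e * (q - 1)))" by (rule cong_scalar_left)
        then show "[e * j * q = e * j] (mod ((q - 1) * e))" by (simp only: mult_ac mult_1_right mult_1_left)
      qed
      then show ?thesis by (simp only: power_mult)
    qed
    then show ?thesis using q(1) by (auto simp: base_field_def zero_power)
  qed
  ultimately show "q \<le> card (base_field q :: 'k set)" by (metis card_mono finite)
qed

text \<open>Translating the sum of all elements by 1 shows that the cardinality of the field is zero
  in it.\<close>

lemma CHAR_eqI:
  assumes "CARD('k::finite_field) = p ^ e" "prime p"
  shows "CHAR('k) = p"
proof -
  have "(\<Sum>x\<in>UNIV. x) = (\<Sum>x\<in>UNIV. x + 1 :: 'k)"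
    by (rule sum.reindex_bij_witness[of _ "\<lambda>x. x + 1" "\<lambda>x. x - 1"]) auto
  then have "CHAR('k) dvd p ^ e" by (simp add: sum.distrib assms(1) flip: of_nat_eq_0_iff_char_dvd)
  moreover have "prime CHAR('k)" by simp
  ultimately show ?thesis using assms(2) by (metis prime_dvd_power primes_dvd_imp_eq)
qed

text \<open>Every element of the smaller field is the value at \<open>gen\<close> of an integer polynomial. Up to multiples
  of the characteristic, the integer polynomials vanishing at \<open>gen\<close> are the multiples of a single
  monic one, \<open>M\<close>, and evaluation at a root of \<open>M\<close> in the bigger field gives the embedding.\<close>

lemma ex_finite_field_embedding:
  assumes card_k: "CARD('k::finite_field) = CARD('f::finite_field) ^ m"
    and char_eq: "CHAR('f) = CHAR('k)"
  shows "\<exists>\<iota> :: 'f \<Rightarrow> 'k. comm_ring_morphism \<iota>"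
proof -
  define q where "q = CARD('f)"
  have q: "q > 1" using card_field_gt_1[where ?'k = 'f] by (simp add: q_def)
  interpret hf: comm_ring_morphism "of_int :: int \<Rightarrow> 'f" by unfold_locales simp_all
  interpret hk: comm_ring_morphism "of_int :: int \<Rightarrow> 'k" by unfold_locales simp_all
  have p0: "(of_int a :: 'f) = 0 \<longleftrightarrow> (of_int a :: 'k) = 0" for a
    unfolding of_int_eq_0_iff_char_dvd char_eq ..
  define evf where "evf = (\<lambda>A. poly (map_poly of_int A) (gen :: 'f))"
  define A0 :: "int poly" where "A0 = monom 1 q - monom 1 1"
  have A0_hom: "map_poly of_int A0 = (monom 1 q - monom 1 1 :: 'f poly)" "map_poly of_int A0 = (monom 1 q - monom 1 1 :: 'k poly)"
    by (simp_all add: A0_def hf.map_poly_hom_diff hk.map_poly_hom_diff map_poly_monom)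
  have "evf A0 = 0" by (simp add: evf_def A0_hom poly_monom q_def finite_field_power_card_eq_same)
  moreover have degA0: "degree A0 = q" "lead_coeff A0 = 1"
  proof -
    show d: "degree A0 = q"
      unfolding A0_def diff_conv_add_uminus using q by (subst degree_add_eq_left) (auto simp: degree_monom_eq)
    show "lead_coeff A0 = 1" unfolding d using q by (simp add: A0_def)
  qed
  ultimately have ex: "\<exists>M. lead_coeff M = 1 \<and> evf M = 0" by blast
  \<comment> \<open>Monic integer polynomials, of least degree: division by \<open>M\<close> works
    over the integers, while remainders vanish only after reduction modulo the
    characteristic.\<close>
  obtain M where M: "lead_coeff M = 1" "evf M = 0"
    and M_least: "\<And>M'. lead_coeff M' = 1 \<Longrightarrow> evf M' = 0 \<Longrightarrow> degree M \<le> degree M'"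
    using exists_least_iff[of "\<lambda>d. \<exists>M. (lead_coeff M = 1 \<and> evf M = 0) \<and> degree M = d"] ex
    by (metis not_less)
  have M0: "M \<noteq> 0" using M by auto
  have small: "map_poly of_int R = (0 :: 'f poly)" if R: "evf R = 0" "R = 0 \<or> degree R < degree M" for R
  proof (rule ccontr)
    assume nz: "map_poly of_int R \<noteq> (0 :: 'f poly)"
    define i where "i = degree (map_poly of_int R :: 'f poly)"
    have i: "(of_int (coeff R i) :: 'f) \<noteq> 0" using nz unfolding i_def by (metis coeff_map_poly leading_coeff_0_iff of_int_0)
    have "R \<noteq> 0" using nz by auto
    then have iM: "i < degree M" using R(2) by (metis map_poly_degree_leq i_def le_less_trans)
    obtain c where c: "(of_int c :: 'f) * of_int (coeff R i) = 1"
    proof -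
      have "coprime (coeff R i) (int CHAR('f))"
        using i by (simp add: of_int_eq_0_iff_char_dvd prime_imp_coprime coprime_commute)
      then obtain c where "[coeff R i * c = 1] (mod int CHAR('f))" using cong_solve_coprime_int by blast
      then have "(of_int (coeff R i * c) :: 'f) = of_int 1" by (simp only: of_int_eq_iff_cong_CHAR)
      then show ?thesis using that[of c] by (simp add: mult.commute)
    qed
    \<comment> \<open>If the reduction of a remainder were nonzero, multiplying by the inverse
      \<open>c\<close> of its leading coefficient and replacing this coefficient by 1 would give a
      monic integer polynomial of smaller degree vanishing at \<open>gen\<close>.\<close>
    define R' where "R' = monom 1 i + smult c (poly_cutoff i R)"
    have coeffs: "coeff R' j = (if j < i then c * coeff R j else if j = i then 1 else 0)" for j
      by (simp add: R'_def coeff_poly_cutoff)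
    have "degree R' = i" using coeffs by (intro antisym degree_le le_degree) auto
    then have "lead_coeff R' = 1" using coeffs by simp
    moreover have "map_poly of_int R' = smult (of_int c) (map_poly of_int R :: 'f poly)"
    proof (rule poly_eqI)
      fix j
      have "(of_int (coeff R j) :: 'f) = 0" if "j > i"
        using that coeff_eq_0[of "map_poly of_int R :: 'f poly" j] by (simp add: i_def coeff_map_poly)
      then show "coeff (map_poly of_int R') j = coeff (smult (of_int c) (map_poly of_int R :: 'f poly)) j"
        using c by (auto simp: coeff_map_poly coeffs)
    qed
    then have "evf R' = 0" using R(1) by (simp add: evf_def)
    ultimately show False using M_least[of R'] \<open>degree R' = i\<close> iM by simp
  qed
  have small_k: "map_poly of_int R = (0 :: 'k poly)" if "map_poly of_int R = (0 :: 'f poly)" for R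
    using that by (simp add: poly_eq_iff coeff_map_poly p0)
  have division: "\<exists>B R. A = M * B + R \<and> map_poly of_int R = (0 :: 'k poly)" if A: "evf A = 0" for A
  proof -
    obtain B R where BR: "pseudo_divmod A M = (B, R)" by fastforce
    have AR: "A = M * B + R" "R = 0 \<or> degree R < degree M"
      using pseudo_divmod[OF M0 BR] M(1) by auto
    have "evf R = 0" using A M(2) unfolding AR(1) evf_def hf.map_poly_hom_add hf.map_poly_hom_mult by simp
    then have "map_poly of_int R = (0 :: 'k poly)" using small AR(2) small_k by blast
    with AR(1) show ?thesis by blast
  qed
  obtain \<delta> :: 'k where \<delta>: "poly (map_poly of_int M) \<delta> = 0"
  proof -
    obtain B R where BR: "A0 = M * B + R" "map_poly of_int R = (0 :: 'k poly)" using division[OF \<open>evf A0 = 0\<close>] by blast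
    let ?M = "map_poly of_int M :: 'k poly" and ?B = "map_poly of_int B :: 'k poly"
    have MB: "monom 1 q - monom 1 1 = ?M * ?B"
      using arg_cong[OF BR(1), of "map_poly (of_int :: int \<Rightarrow> 'k)"]
      by (simp add: hk.map_poly_hom_add hk.map_poly_hom_mult BR(2) A0_hom)
    have deg: "degree (monom 1 q - monom 1 1 :: 'k poly) = q"
      unfolding diff_conv_add_uminus using q by (subst degree_add_eq_left) (auto simp: degree_monom_eq)
    have nz: "?M * ?B \<noteq> 0" using deg q unfolding MB by auto
    have "degree ?M > 0"
    proof -
      have "degree M \<noteq> 0"
      proof
        assume "degree M = 0"
        then have "M = 1" using M(1) by (metis degree_0_id lead_coeff_pCons(1) one_pCons coeff_pCons_0 degree_eq_zeroE)
        then show False using M(2) by (simp add: evf_def)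
      qed
      moreover have "degree ?M = degree M" using M(1) by (intro map_poly_degree_eq) simp
      ultimately show ?thesis by simp
    qed
    then have degB: "degree ?B < q" using deg nz unfolding MB by (simp add: degree_mult_eq)
    have "q - 1 dvd CARD('k) - 1"
    proof -
      have "[q ^ m = 1 ^ m] (mod (q - 1))" using q by (intro cong_pow) (simp add: cong_altdef_nat)
      then show ?thesis unfolding card_k q_def[symmetric] using q by (simp add: cong_altdef_nat)
    qed
    then have c: "card (base_field q :: 'k set) = q" by (rule card_base_field[OF q])
    \<comment> \<open>\<open>x ^ q - x\<close> has \<open>q\<close> roots in the bigger field, too
      many for the cofactor \<open>B\<close> alone; one of the others is a root of
      \<open>M\<close>.\<close>
    have "\<not> base_field q \<subseteq> {x. poly ?B x = 0}"
    proof
      assume "base_field q \<subseteq> {x. poly ?B x = 0}"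
      then have "q \<le> card {x. poly ?B x = 0}" using c by (metis card_mono finite)
      moreover have "card {x. poly ?B x = 0} \<le> degree ?B" using nz by (intro card_poly_roots_bound) auto
      ultimately show False using degB by linarith
    qed
    then obtain x where x: "x \<in> base_field q" "poly ?B x \<noteq> 0" by blast
    have "poly (monom 1 q - monom 1 1) x = 0" using x(1) by (simp add: base_field_def poly_monom)
    then have "poly ?M x = 0" unfolding MB using x(2) by simp
    then show ?thesis by (rule that)
  qed
  define evk where "evk = (\<lambda>A. poly (map_poly of_int A) \<delta>)"
  have ker: "evk A = 0" if A: "evf A = 0" for A
  proof -
    obtain B R where BR: "A = M * B + R" "map_poly of_int R = (0 :: 'k poly)" using division[OF A] by blast
    then show ?thesis unfolding BR(1) evk_def hk.map_poly_hom_add hk.map_poly_hom_mult by (simp add: \<delta>)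
  qed
  have surj: "\<exists>A. evf A = x" for x
  proof (cases "x = 0")
    case True
    then show ?thesis by (intro exI[of _ 0]) (simp add: evf_def)
  next
    case False
    then show ?thesis
      by (intro exI[of _ "monom 1 (dlog x)"]) (simp add: evf_def map_poly_monom poly_monom)
  qed
  define \<iota> where "\<iota> = (\<lambda>x. evk (SOME A. evf A = x))"
  have ev: "\<iota> (evf A) = evk A" for A
  proof -
    let ?B = "SOME B. evf B = evf A"
    have "evf ?B = evf A" by (rule someI) simp
    then have "evf (?B - A) = 0" by (simp add: evf_def hf.map_poly_hom_diff)
    then have "evk (?B - A) = 0" by (rule ker)
    then show ?thesis by (simp add: \<iota>_def evk_def hk.map_poly_hom_diff)
  qed
  have "comm_ring_morphism \<iota>"
  proof
    show "\<iota> 1 = 1" using ev[of 1] by (simp add: evf_def evk_def)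
    fix a b
    obtain A B where AB: "a = evf A" "b = evf B" using surj by metis
    show "\<iota> (a + b) = \<iota> a + \<iota> b" using ev[of A] ev[of B] ev[of "A + B"]
      by (simp add: AB evf_def evk_def hf.map_poly_hom_add hk.map_poly_hom_add)
    show "\<iota> (a * b) = \<iota> a * \<iota> b" using ev[of A] ev[of B] ev[of "A * B"]
      by (simp add: AB evf_def evk_def hf.map_poly_hom_mult hk.map_poly_hom_mult)
  qed
  then show ?thesis by blast
qed

lemma card_polys_degree_less:
  assumes m: "m > 0"
  shows "card {A :: 'f::finite_field poly. degree A < m} = CARD('f) ^ m"
proof -
  have "bij_betw (\<lambda>A. \<lambda>i\<in>{..<m}. coeff A i) {A :: 'f poly. degree A < m} (PiE {..<m} (\<lambda>_. UNIV))"
  proof (rule bij_betwI[where g = "\<lambda>c. \<Sum>i<m. monom (c i) i"])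
    show "(\<lambda>A. \<lambda>i\<in>{..<m}. coeff A i) \<in> {A :: 'f poly. degree A < m} \<rightarrow> (PiE {..<m} (\<lambda>_. UNIV))" by auto
    show "(\<lambda>c. \<Sum>i<m. monom (c i) i) \<in> PiE {..<m} (\<lambda>_. UNIV) \<rightarrow> {A :: 'f poly. degree A < m}"
    proof (intro Pi_I CollectI)
      fix c :: "nat \<Rightarrow> 'f"
      have "degree (\<Sum>i<m. monom (c i) i) \<le> m - 1" by (intro degree_le) (auto simp: coeff_sum)
      then show "degree (\<Sum>i<m. monom (c i) i) < m" using m by linarith
    qed
    show "(\<Sum>i<m. monom ((\<lambda>i\<in>{..<m}. coeff A i) i) i) = A" if "A \<in> {A. degree A < m}" for A
      using that by (intro poly_eqI) (auto simp: coeff_sum coeff_eq_0)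
    show "(\<lambda>i\<in>{..<m}. coeff (\<Sum>i<m. monom (c i) i) i) = c" if "c \<in> PiE {..<m} (\<lambda>_. UNIV)" for c :: "nat \<Rightarrow> 'f"
      using that by (intro ext) (auto simp: coeff_sum PiE_def extensional_def)
  qed
  then have "card {A :: 'f poly. degree A < m} = card (PiE {..<m} (\<lambda>_. UNIV :: 'f set))" by (rule bij_betw_same_card)
  then show ?thesis by (simp add: card_PiE)
qed

lemma card_range_additive:
  fixes h :: "'a::{ab_group_add,finite} \<Rightarrow> 'b::ab_group_add"
  assumes "\<And>x y. h (x - y) = h x - h y"
  shows "card (range h) * card {x. h x = 0} = CARD('a)"
proof -
  have fibre: "card {x. h x = y} = card {x. h x = 0}" if y: "y \<in> range h" for y
  proof -
    obtain x0 where "y = h x0" using y by blast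
    then have "bij_betw (\<lambda>x. x - x0) {x. h x = y} {x. h x = 0}"
      by (intro bij_betwI[of _ _ _ "\<lambda>x. x + x0"]) (auto simp: assms, metis add_diff_cancel assms eq_iff_diff_eq_0)
    then show ?thesis by (rule bij_betw_same_card)
  qed
  have "CARD('a) = card (\<Union>y\<in>range h. {x. h x = y})" by (intro arg_cong[where f = card]) auto
  also have "\<dots> = (\<Sum>y\<in>range h. card {x. h x = y})" by (rule card_UN_disjoint) auto
  also have "\<dots> = card (range h) * card {x. h x = 0}" using fibre by simp
  finally show ?thesis by simp
qed

text \<open>If no prime divisor \<open>l\<close> of the group order makes \<alpha> an
  \<open>l\<close>-th power, the discrete logarithm of \<alpha> is coprime to that order, and
  \<open>gen\<close> is a power of \<alpha>.\<close>

lemma primitive_elementI: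
  fixes \<alpha> :: "'k::finite_field"
  assumes "\<alpha> \<noteq> 0" and no: "\<And>l. prime l \<Longrightarrow> l dvd CARD('k) - 1 \<Longrightarrow> \<nexists>y. y ^ l = \<alpha>"
  shows "primitive_element \<alpha>"
  unfolding primitive_element_def
proof (intro conjI allI impI)
  fix x :: 'k assume x: "x \<noteq> 0"
  have "coprime (dlog \<alpha>) (CARD('k) - 1)"
  proof (rule ccontr)
    assume "\<not> ?thesis"
    then obtain l where l: "prime l" "l dvd dlog \<alpha>" "l dvd CARD('k) - 1"
      using prime_factor_nat[of "gcd (dlog \<alpha>) (CARD('k) - 1)"] by (auto simp: coprime_iff_gcd_eq_1)
    obtain j where "dlog \<alpha> = j * l" using l(2) by (metis dvd_def mult.commute)
    then have "(gen ^ j) ^ l = \<alpha>" using gen_power_dlog[OF assms(1)] by (simp add: power_mult)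
    then show False using no[OF l(1,3)] by blast
  qed
  then obtain u where u: "[dlog \<alpha> * u = 1] (mod (CARD('k) - 1))" using cong_solve_coprime_nat by (metis One_nat_def)
  have "gen = (gen :: 'k) ^ (dlog \<alpha> * u)"
    using u gen_power_eq_iff[where ?'k = 'k, of 1 "dlog \<alpha> * u"] by (simp add: cong_sym)
  also have "\<dots> = \<alpha> ^ u" by (simp only: power_mult gen_power_dlog[OF assms(1)])
  finally have "x = \<alpha> ^ (u * dlog x)" using gen_power_dlog[OF x] by (simp add: power_mult)
  then show "\<exists>i::int. x = \<alpha> powi i" by (metis power_int_of_nat)
qed fact

section \<open>Linearized polynomials and the Frobenius module structure\<close>

text \<open>The factors of \<open>x ^ m - 1\<close> have coefficients in a separate type
  \<open>'f\<close>, whereas the subfield of order \<open>q\<close> is a subset of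
  \<open>'k\<close>; \<iota> identifies the two.\<close>

locale field_extension = comm_ring_morphism \<iota> for \<iota> :: "'f::finite_field \<Rightarrow> 'k::finite_field" +
  fixes e q m :: nat
  assumes card_f: "CARD('f) = q" and card_k: "CARD('k) = q ^ m" and q_char: "q = CHAR('k) ^ e"
begin

sublocale finite_field_closure "e * m" "q ^ m" "TYPE('k)"
  by unfold_locales (simp_all add: card_k q_char power_mult)

lemma q_gt_1: "q > 1"
  using card_field_gt_1[where ?'k = 'f] by (simp add: card_f)

lemma m_pos: "m > 0"
  using card_field_gt_1[where ?'k = 'k] by (cases m) (auto simp: card_k)

lemma emb_eq_0_iff: "\<iota> x = 0 \<longleftrightarrow> x = 0"
proof
  assume "\<iota> x = 0"
  then have "\<iota> (x * inverse x) = 0" by (simp add: hom_mult)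
  then show "x = 0" by (cases "x = 0") (simp_all add: hom_one)
qed (simp add: hom_zero)

lemma inj_emb: "inj \<iota>"
  by (rule injI) (metis emb_eq_0_iff eq_iff_diff_eq_0 hom_diff)

lemma range_emb: "range \<iota> = base_field q"
proof (rule card_subset_eq)
  show "range \<iota> \<subseteq> base_field q"
    using finite_field_power_card_eq_same[where ?'a = 'f] by (auto simp: base_field_def card_f simp flip: hom_power)
  have "[q ^ m = 1 ^ m] (mod (q - 1))" using q_gt_1 by (intro cong_pow) (simp add: cong_altdef_nat)
  then have "q - 1 dvd CARD('k) - 1" using q_gt_1 by (simp add: card_k cong_altdef_nat)
  then show "card (range \<iota>) = card (base_field q :: 'k set)"
    by (simp add: card_base_field[OF q_gt_1] card_image inj_emb card_f)
qed simp

lemma q_power_add: "(x + y :: 'k) ^ (q ^ i) = x ^ (q ^ i) + y ^ (q ^ i)"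
  by (rule freshmans_dream'[where n = "e * i"]) (simp_all add: q_char power_mult)

lemma q_power_diff: "(x - y :: 'k) ^ (q ^ i) = x ^ (q ^ i) - y ^ (q ^ i)"
  using q_power_add[of "x - y" y i] by simp

lemma q_add: "(x + y :: 'k) ^ q = x ^ q + y ^ q"
  using q_power_add[of x y 1] by simp

lemma emb_power_q: "\<iota> x ^ q = \<iota> x"
  using range_emb by (auto simp: base_field_def)

text \<open>The module structure over polynomials in which \<open>x\<close> acts as the
  \<open>q\<close>-th power map: multiplication of polynomials becomes composition, and
  \<open>x ^ m - 1\<close> acts as zero.\<close>

definition lin :: "'f poly \<Rightarrow> 'k \<Rightarrow> 'k" where
  "lin A \<alpha> = (\<Sum>i\<le>degree A. \<iota> (coeff A i) * \<alpha> ^ (q ^ i))"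

lemma lin_altdef: "degree A \<le> n \<Longrightarrow> lin A \<alpha> = (\<Sum>i\<le>n. \<iota> (coeff A i) * \<alpha> ^ (q ^ i))"
  unfolding lin_def by (intro sum.mono_neutral_left) (auto simp: coeff_eq_0 hom_zero)

lemma lin_0 [simp]: "lin 0 \<alpha> = 0" and lin_1 [simp]: "lin 1 \<alpha> = \<alpha>"
  by (simp_all add: lin_def hom_simps)

lemma lin_add: "lin (A + B) \<alpha> = lin A \<alpha> + lin B \<alpha>"
  by (subst (1 2 3) lin_altdef[of _ "max (degree A) (degree B)"])
     (auto simp: degree_add_le hom_add distrib_right sum.distrib)

lemma lin_smult: "lin (smult c A) \<alpha> = \<iota> c * lin A \<alpha>"
  by (subst (1 2) lin_altdef[of _ "degree A"]) (auto simp: degree_smult_le hom_mult sum_distrib_left mult.assoc)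

lemma lin_diff: "lin (A - B) \<alpha> = lin A \<alpha> - lin B \<alpha>"
  using lin_add[of "A - B" B \<alpha>] by simp

lemma lin_arg_diff: "lin A (\<alpha> - \<beta>) = lin A \<alpha> - lin A \<beta>"
  by (simp add: lin_def q_power_diff right_diff_distrib sum_subtractf)

lemma lin_arg_0 [simp]: "lin A 0 = 0"
  using lin_arg_diff[of A 0 0] by simp

lemma lin_monom: "lin (monom c i) \<alpha> = \<iota> c * \<alpha> ^ (q ^ i)"
proof -
  have "lin (monom c i) \<alpha> = (\<Sum>j\<le>i. \<iota> (coeff (monom c i) j) * \<alpha> ^ (q ^ j))"
    by (rule lin_altdef) (rule degree_monom_le)
  also have "\<dots> = (\<Sum>j\<le>i. if j = i then \<iota> c * \<alpha> ^ (q ^ j) else 0)"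
    by (intro sum.cong) (auto simp: hom_zero)
  finally show ?thesis by simp
qed

lemma lin_pCons: "lin (pCons c A) \<alpha> = \<iota> c * \<alpha> + lin A \<alpha> ^ q"
proof -
  have "lin (pCons c A) \<alpha> = (\<Sum>i\<le>Suc (degree A). \<iota> (coeff (pCons c A) i) * \<alpha> ^ (q ^ i))"
    by (rule lin_altdef) (rule degree_pCons_le)
  also have "\<dots> = \<iota> c * \<alpha> + (\<Sum>i\<le>degree A. \<iota> (coeff A i) * \<alpha> ^ (q ^ Suc i))"
    by (simp add: sum.atMost_Suc_shift del: sum.atMost_Suc power_Suc)
  also have "(\<Sum>i\<le>degree A. \<iota> (coeff A i) * \<alpha> ^ (q ^ Suc i)) = (\<Sum>i\<le>degree A. (\<iota> (coeff A i) * \<alpha> ^ (q ^ i)) ^ q)"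
    by (simp add: power_mult_distrib emb_power_q mult.commute flip: power_mult)
  also have "\<dots> = lin A \<alpha> ^ q"
  proof -
    have "(\<Sum>i\<in>S. h i :: 'k) ^ q = (\<Sum>i\<in>S. h i ^ q)" for S :: "nat set" and h
      using q_gt_1 by (induction S rule: infinite_finite_induct) (simp_all add: q_add zero_power)
    then show ?thesis by (simp add: lin_def)
  qed
  finally show ?thesis .
qed

lemma lin_mult: "lin (A * B) \<alpha> = lin A (lin B \<alpha>)"
proof (induction A)
  case (pCons c A)
  then show ?case
    by (simp add: mult_pCons_left lin_add lin_smult lin_pCons hom_zero)
qed simp

definition xm1 :: "'f poly" where "xm1 = monom 1 m - 1"

lemma degree_xm1: "degree xm1 = m" and lead_coeff_xm1: "lead_coeff xm1 = 1" and xm1_nonzero: "xm1 \<noteq> 0"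
proof -
  show d: "degree xm1 = m"
    unfolding xm1_def diff_conv_add_uminus using m_pos by (subst degree_add_eq_left) (auto simp: degree_monom_eq)
  show l: "lead_coeff xm1 = 1" unfolding d using m_pos by (simp add: xm1_def)
  then show "xm1 \<noteq> 0" by auto
qed

lemma lin_xm1: "lin xm1 \<alpha> = 0"
  using finite_field_power_card_eq_same[of \<alpha>] by (simp add: xm1_def lin_diff lin_monom hom_one card_k)

definition ker :: "'f poly \<Rightarrow> 'k set" where "ker A = {\<alpha>. lin A \<alpha> = 0}"

lemma card_ker_le:
  assumes "A \<noteq> 0"
  shows "card (ker A) \<le> q ^ degree A"
proof -
  define P where "P = (\<Sum>i\<le>degree A. monom (\<iota> (coeff A i)) (q ^ i))"
  have ker: "ker A = {x. poly P x = 0}" by (simp add: ker_def P_def lin_def poly_sum poly_monom)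
  have "coeff P (q ^ degree A) = (\<Sum>i\<le>degree A. if i = degree A then \<iota> (coeff A i) else 0)"
    unfolding P_def coeff_sum using q_gt_1 by (intro sum.cong) auto
  also have "\<dots> = \<iota> (lead_coeff A)" by simp
  finally have "P \<noteq> 0" using assms by (metis coeff_0 emb_eq_0_iff leading_coeff_0_iff)
  then have "card (ker A) \<le> degree P" unfolding ker by (rule card_poly_roots_bound)
  also have "degree P \<le> q ^ degree A"
    unfolding P_def using q_gt_1
    by (intro degree_sum_le) (auto intro!: order.trans[OF degree_monom_le] power_increasing)
  finally show ?thesis .
qed

text \<open>The range of \<open>lin B\<close> lies in the kernel of \<open>lin A\<close>. Since the
  kernels have at most \<open>q ^ degree A\<close> and \<open>q ^ degree B\<close> elements, and
  range and kernel of \<open>lin B\<close> have cardinalities with product \<open>q ^ m\<close>, all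
  inequalities are equalities.\<close>

lemma
  assumes AB: "A * B = xm1"
  shows card_ker: "card (ker A) = q ^ degree A" and range_lin: "range (lin B) = ker A"
proof -
  have nz: "A \<noteq> 0" "B \<noteq> 0" using xm1_nonzero AB by auto
  have deg: "degree A + degree B = m" using degree_xm1 nz by (simp add: degree_mult_eq flip: AB)
  have sub: "range (lin B) \<subseteq> ker A" using lin_xm1 by (auto simp: ker_def AB simp flip: lin_mult)
  have le: "card (range (lin B)) \<le> card (ker A)" by (rule card_mono[OF _ sub]) simp
  have "card (range (lin B)) * card {x. lin B x = 0} = CARD('k)"
    by (rule card_range_additive) (rule lin_arg_diff)
  then have "q ^ degree A * q ^ degree B = card (range (lin B)) * card (ker B)"
    by (simp add: ker_def card_k flip: deg power_add)
  also have "\<dots> \<le> card (range (lin B)) * q ^ degree B" by (intro mult_left_mono card_ker_le nz) simp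
  finally have "q ^ degree A \<le> card (range (lin B))" using q_gt_1 by simp
  with le card_ker_le[OF nz(1)]
  show "card (ker A) = q ^ degree A" "range (lin B) = ker A"
    using card_subset_eq[OF _ sub] by simp_all
qed

lemma field_trace_lin: "field_trace q m \<alpha> = lin (\<Sum>i<m. monom 1 i) \<alpha>"
proof -
  have "lin (\<Sum>i\<in>S. monom 1 i) \<alpha> = (\<Sum>i\<in>S. \<alpha> ^ (q ^ i))" for S
    by (induction S rule: infinite_finite_induct) (simp_all add: lin_add lin_monom hom_one)
  then show ?thesis by (simp add: field_trace_def)
qed

lemma trace_factorization: "(\<Sum>i<m. monom 1 i) * [:- 1, 1:] = xm1"
proof -
  have "(\<Sum>i<m. monom (1 :: 'f) i) * [:- 1, 1:] = (\<Sum>i<m. monom 1 (Suc i) - monom 1 i)"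
    unfolding sum_distrib_right by (intro sum.cong) (auto simp: monom_Suc)
  also have "\<dots> = monom 1 m - monom 1 0" by (rule sum_lessThan_telescope)
  finally show ?thesis by (simp add: xm1_def monom_0 one_pCons)
qed

lemma degree_trace_poly: "degree (\<Sum>i<m. monom (1 :: 'f) i) = m - 1"
proof -
  have nz: "(\<Sum>i<m. monom (1 :: 'f) i) \<noteq> 0" using trace_factorization xm1_nonzero by auto
  have "degree ((\<Sum>i<m. monom (1 :: 'f) i) * [:- 1, 1:]) = m" by (simp only: trace_factorization degree_xm1)
  then show ?thesis using nz by (simp add: degree_mult_eq del: mult_pCons_right)
qed

lemma card_trace_kernel: "card {x :: 'k. field_trace q m x = 0} = q ^ (m - 1)"
  using card_ker[OF trace_factorization] by (simp add: ker_def field_trace_lin degree_trace_poly)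

lemma trace_surj: "a \<in> base_field q \<Longrightarrow> \<exists>x :: 'k. field_trace q m x = a"
proof -
  assume "a \<in> base_field q"
  then have "a \<in> ker [:- 1, 1:]" using q_gt_1 by (simp add: ker_def base_field_def lin_pCons hom_simps zero_power)
  then have "a \<in> range (lin (\<Sum>i<m. monom 1 i))"
    using range_lin[of "[:- 1, 1:]" "\<Sum>i<m. monom 1 i"] trace_factorization by (simp add: mult.commute del: mult_pCons_left mult_pCons_right)
  then show ?thesis by (auto simp: field_trace_lin)
qed

lemma trace_diff: "field_trace q m (x - y :: 'k) = field_trace q m x - field_trace q m y"
  by (simp add: field_trace_lin lin_arg_diff)

text \<open>An annihilator \<open>D\<close> of \<alpha> of least degree divides
  \<open>x ^ m - 1\<close>. If its degree is below \<open>m\<close>, the cofactor has an irreducible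
  factor \<open>Q\<close>, and the multiple \<open>xm1 div Q\<close> of \<open>D\<close> still
  annihilates \<alpha>. Independence of the conjugates follows, and counting gives that they
  span.\<close>

lemma normal_elementI:
  assumes "\<And>Q. Q \<in> monic_irreducible_factors xm1 \<Longrightarrow> lin (xm1 div Q) \<alpha> \<noteq> 0"
  shows "normal_element q m \<alpha>"
proof -
  have no_ann: "A = 0" if A: "lin A \<alpha> = 0" "degree A < m" for A
  proof (rule ccontr)
    assume A0: "A \<noteq> 0"
    obtain D where D: "D \<noteq> 0" "lin D \<alpha> = 0" and least: "\<And>B. B \<noteq> 0 \<Longrightarrow> lin B \<alpha> = 0 \<Longrightarrow> degree D \<le> degree B"
      using ex_has_least_nat[of "\<lambda>B. B \<noteq> 0 \<and> lin B \<alpha> = 0" A degree] A A0 by metis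
    have dvd: "D dvd B" if "lin B \<alpha> = 0" for B
    proof -
      have "lin (B mod D) \<alpha> = lin B \<alpha> - lin (B div D) (lin D \<alpha>)"
        unfolding lin_mult[symmetric] lin_diff[symmetric] by (simp add: minus_div_mult_eq_mod)
      then have "lin (B mod D) \<alpha> = 0" using that D by simp
      then have "B mod D = 0" using least[of "B mod D"] degree_mod_less[OF D(1), of B] by (metis not_le)
      then show ?thesis by (simp add: dvd_eq_mod_eq_0)
    qed
    obtain E where E: "xm1 = D * E" using dvd[OF lin_xm1] by (elim dvdE)
    have nz: "E \<noteq> 0" using E xm1_nonzero by auto
    have "degree D \<le> degree A" using least A0 A(1) by blast
    moreover have "degree D + degree E = m" using D(1) nz degree_xm1 by (simp add: E degree_mult_eq)
    ultimately have "degree E \<noteq> 0" using A(2) by linarith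
    then obtain Q where Q: "Q \<in> monic_irreducibles" "Q dvd E" using ex_monic_irreducible_factor by blast
    obtain R where R: "E = Q * R" using Q(2) by (elim dvdE)
    have "xm1 = (R * D) * Q" by (simp add: E R mult_ac)
    then have "xm1 div Q = R * D" using monic_irreducible_nonzero[OF Q(1)] by (metis nonzero_mult_div_cancel_right)
    then have "lin (xm1 div Q) \<alpha> = 0" using D(2) by (simp add: lin_mult)
    moreover have "Q \<in> monic_irreducible_factors xm1"
      using Q(1) \<open>xm1 = (R * D) * Q\<close> by (simp add: monic_irreducible_factors_altdef)
    ultimately show False using assms by blast
  qed
  have inv: "\<exists>A. degree A < m \<and> (\<forall>i<m. \<iota> (coeff A i) = c i)" if c: "\<And>i. i < m \<Longrightarrow> c i \<in> base_field q" for c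
  proof -
    have "\<exists>d. \<forall>i<m. \<iota> (d i) = c i" using c unfolding range_emb[symmetric] image_iff by metis
    then obtain d where d: "\<And>i. i < m \<Longrightarrow> \<iota> (d i) = c i" by blast
    define A where "A = (\<Sum>i<m. monom (d i) i)"
    have "coeff A j = (if j < m then d j else 0)" for j
      by (simp add: A_def coeff_sum)
    moreover from this have "degree A \<le> m - 1" by (intro degree_le) auto
    ultimately show ?thesis using d m_pos by (intro exI[of _ A]) auto
  qed
  have lin_coeffs: "lin A \<alpha> = (\<Sum>i<m. \<iota> (coeff A i) * \<alpha> ^ (q ^ i))" if "degree A < m" for A
    using lin_altdef[of A "m - 1" \<alpha>] that m_pos by (simp add: lessThan_Suc_atMost[symmetric])
  have indep: "c i = 0" if c: "\<And>i. i < m \<Longrightarrow> c i \<in> base_field q" "(\<Sum>i<m. c i * \<alpha> ^ (q ^ i)) = 0" "i < m" for c i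
  proof -
    obtain A where A: "degree A < m" "\<And>i. i < m \<Longrightarrow> \<iota> (coeff A i) = c i" using inv[of c] c(1) by blast
    then have "lin A \<alpha> = 0" using c(2) by (simp add: lin_coeffs A cong: sum.cong_simp)
    then have "A = 0" using A(1) by (rule no_ann)
    then show ?thesis using A(2)[OF c(3)] by (simp add: hom_zero)
  qed
  have "lin A \<alpha> \<noteq> lin B \<alpha>" if "A \<noteq> B" "degree A < m" "degree B < m" for A B
    using no_ann[of "A - B"] that degree_diff_less[of A m B] m_pos by (auto simp: lin_diff)
  then have "inj_on (\<lambda>A. lin A \<alpha>) {A. degree A < m}" unfolding inj_on_def by blast
  moreover have "card {A :: 'f poly. degree A < m} = q ^ m"
    using card_polys_degree_less[OF m_pos, where ?'f = 'f] by (simp add: card_f)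
  ultimately have "card ((\<lambda>A. lin A \<alpha>) ` {A. degree A < m}) = CARD('k)" by (simp add: card_image card_k)
  then have surj: "(\<lambda>A. lin A \<alpha>) ` {A. degree A < m} = UNIV" by (intro card_subset_eq) auto
  have span: "\<exists>c. (\<forall>i<m. c i \<in> base_field q) \<and> x = (\<Sum>i<m. c i * \<alpha> ^ (q ^ i))" for x
  proof -
    obtain A where "degree A < m" "x = lin A \<alpha>" using surj by blast
    then show ?thesis using lin_coeffs by (intro exI[of _ "\<lambda>i. \<iota> (coeff A i)"]) (auto simp flip: range_emb)
  qed
  from indep span show ?thesis unfolding normal_element_def by blast
qed

end

subsection \<open>The sieve for normal primitive pairs\<close>

text \<open>The terms belonging to primes other than \<open>l0\<close> are divisible by the full
  power of \<open>l0\<close> in \<open>n\<close>, so the remaining term is as well, which forces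
  \<open>l0\<close> to divide \<open>s0\<close>. Thus characters of different prime orders cannot
  cancel one another.\<close>

lemma dvd_sum_quotients:
  fixes n l0 s0 :: nat
  assumes n: "n > 0" and l0: "prime l0" "l0 dvd n" and K: "finite K"
    and h: "\<And>x. x \<in> K \<Longrightarrow> h x = 0 \<or> (\<exists>l s. prime l \<and> l dvd n \<and> l \<noteq> l0 \<and> h x = n div l * s)"
    and dvd: "n dvd n div l0 * s0 + sum h K"
  shows "l0 dvd s0"
proof -
  define v where "v = multiplicity l0 n"
  have v: "l0 ^ v dvd n" "\<not> l0 ^ Suc v dvd n"
    unfolding v_def using n prime_gt_1_nat[OF l0(1)]
    by (simp_all only: multiplicity_dvd, subst power_dvd_iff_le_multiplicity) auto
  have "l0 ^ v dvd h x" if x: "x \<in> K" for x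
  proof (cases "h x = 0")
    case False
    then obtain l s where l: "prime l" "l dvd n" "l \<noteq> l0" "h x = n div l * s" using h[OF x] by auto
    have "coprime (l0 ^ v) l" using l l0(1) primes_coprime[of l0 l] by simp
    moreover have "l0 ^ v dvd l * (n div l)" using v(1) l by simp
    ultimately have "l0 ^ v dvd n div l" by (simp only: coprime_dvd_mult_right_iff)
    then show ?thesis unfolding l(4) by (rule dvd_mult2)
  qed simp
  then have "l0 ^ v dvd sum h K" by (rule dvd_sum)
  moreover have "l0 ^ v dvd n div l0 * s0 + sum h K" using v(1) dvd by (rule dvd_trans)
  ultimately have d: "l0 ^ v dvd n div l0 * s0" by (metis dvd_add_left_iff)
  show ?thesis
  proof (rule ccontr)
    assume "\<not> l0 dvd s0"
    then have "coprime (l0 ^ v) s0" using l0(1) by (simp add: prime_imp_coprime)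
    then have "l0 ^ v dvd n div l0" using d by (simp add: coprime_dvd_mult_left_iff)
    then have "l0 * l0 ^ v dvd l0 * (n div l0)" by (rule mult_dvd_mono[OF dvd_refl])
    then show False using v(2) l0(2) by simp
  qed
qed

text \<open>\<open>Pow1 l\<close> and \<open>Pow2 l\<close> forbid \<alpha> and
  \<open>f(\<alpha>)\<close> to be \<open>l\<close>-th powers, \<open>Free Q\<close> concerns
  normality at the factor \<open>Q\<close>, and \<open>Tr\<close> is the trace condition.\<close>

datatype 'p condition = Pow1 nat | Pow2 nat | Free 'p | Tr

locale sieve_setup = field_extension \<iota> e q m for \<iota> :: "'f::finite_field \<Rightarrow> 'k::finite_field" and e q m +
  fixes f1 f2 :: "'k poly" and n :: nat and a :: 'k
  assumes red: "coprime f1 f2" "f1 \<noteq> 0" "f2 \<noteq> 0" "lead_coeff f2 = 1"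
    and nonexc: "\<not> exceptional (Fract f1 f2)"
    and deg_le: "degree f1 + degree f2 \<le> n"
    and a: "a \<in> base_field q"
begin

abbreviation N where "N \<equiv> q ^ m"

definition val :: "'k \<Rightarrow> 'k" where "val \<alpha> = poly f1 \<alpha> / poly f2 \<alpha>"

definition dom :: "'k set" where "dom = {\<alpha>. \<alpha> \<noteq> 0 \<and> poly f1 \<alpha> \<noteq> 0 \<and> poly f2 \<alpha> \<noteq> 0}"

definition U :: "'f poly \<Rightarrow> 'k set" where "U Q = ker (xm1 div Q)"

definition V :: "'k set" where "V = {x. field_trace q m x = 0}"

text \<open>One element of trace \<open>a\<close>. It turns the trace condition into membership of
  \<open>inverse \<alpha> - \<beta>\<close> in the subgroup \<open>V\<close>.\<close>

definition \<beta> :: 'k where "\<beta> = (SOME x. field_trace q m x = a)"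

lemma trace_\<beta>: "field_trace q m \<beta> = a"
  unfolding \<beta>_def by (rule someI_ex[OF trace_surj[OF a]])

definition conditions :: "'f poly condition set" where
  "conditions = Pow1 ` prime_factors (N - 1) \<union> Pow2 ` prime_factors (N - 1)
     \<union> Free ` monic_irreducible_factors xm1 \<union> {Tr}"

text \<open>One index type serves all four kinds: the first component gives the exponent of a
  multiplicative character, the second the parameter of an additive one, and \<open>(0, 0)\<close>
  is trivial for each kind.\<close>

primrec idx :: "'f poly condition \<Rightarrow> (nat \<times> 'k) set" where
  "idx (Pow1 l) = {..<l} \<times> {0}"
| "idx (Pow2 l) = {..<l} \<times> {0}"
| "idx (Free Q) = {0} \<times> perp (U Q)"
| "idx Tr = {0} \<times> perp V"

primrec \<theta> :: "'f poly condition \<Rightarrow> real" where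
  "\<theta> (Pow1 l) = 1 - 1 / real l"
| "\<theta> (Pow2 l) = 1 - 1 / real l"
| "\<theta> (Free Q) = 1 - 1 / real q ^ degree Q"
| "\<theta> Tr = 1 / real q"

text \<open>The first three conditions say that an element lies outside a subgroup: one minus the
  mean over the characters trivial on it, hence the correction at \<open>(0, 0)\<close>. For
  \<open>Tr\<close> it is a plain mean, twisted by \<beta>.\<close>

primrec coef :: "'f poly condition \<Rightarrow> nat \<times> 'k \<Rightarrow> complex" where
  "coef (Pow1 l) t = of_bool (t = (0, 0)) - 1 / of_nat l"
| "coef (Pow2 l) t = of_bool (t = (0, 0)) - 1 / of_nat l"
| "coef (Free Q) t = of_bool (t = (0, 0)) - 1 / of_nat q ^ degree Q"
| "coef Tr t = \<psi> (- (snd t * \<beta>)) / of_nat q"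

fun i1 :: "'f poly condition \<Rightarrow> nat \<times> 'k \<Rightarrow> nat" where
  "i1 (Pow1 l) t = (N - 1) div l * fst t"
| "i1 _ t = 0"

fun i2 :: "'f poly condition \<Rightarrow> nat \<times> 'k \<Rightarrow> nat" where
  "i2 (Pow2 l) t = (N - 1) div l * fst t"
| "i2 _ t = 0"

fun yc :: "'f poly condition \<Rightarrow> nat \<times> 'k \<Rightarrow> 'k" where
  "yc (Free Q) t = snd t"
| "yc _ t = 0"

fun zc :: "'f poly condition \<Rightarrow> nat \<times> 'k \<Rightarrow> 'k" where
  "zc Tr t = snd t"
| "zc _ t = 0"

definition ch :: "'f poly condition \<Rightarrow> nat \<times> 'k \<Rightarrow> 'k \<Rightarrow> complex" where
  "ch \<kappa> t \<alpha> = mult_char (w ^ i1 \<kappa> t) \<alpha> * mult_char (w ^ i2 \<kappa> t) (val \<alpha>) * \<psi> (yc \<kappa> t * \<alpha> + zc \<kappa> t / \<alpha>)"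

primrec holds :: "'f poly condition \<Rightarrow> 'k \<Rightarrow> bool" where
  "holds (Pow1 l) \<alpha> \<longleftrightarrow> (\<nexists>y. y ^ l = \<alpha>)"
| "holds (Pow2 l) \<alpha> \<longleftrightarrow> (\<nexists>y. y ^ l = val \<alpha>)"
| "holds (Free Q) \<alpha> \<longleftrightarrow> lin (xm1 div Q) \<alpha> \<noteq> 0"
| "holds Tr \<alpha> \<longleftrightarrow> field_trace q m (inverse \<alpha>) = a"

lemma dom_nonzero: "\<alpha> \<in> dom \<Longrightarrow> \<alpha> \<noteq> 0 \<and> val \<alpha> \<noteq> 0"
  by (simp add: dom_def val_def)

lemma xm1_factor:
  assumes "Q \<in> monic_irreducible_factors xm1"
  shows "(xm1 div Q) * Q = xm1" and "degree (xm1 div Q) = m - degree Q" and "degree Q \<le> m"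
    and "Q \<in> monic_irreducibles"
proof -
  show eq: "(xm1 div Q) * Q = xm1" and Q: "Q \<in> monic_irreducibles"
    using assms by (simp_all add: monic_irreducible_factors_altdef)
  then have "xm1 div Q \<noteq> 0" "Q \<noteq> 0" using xm1_nonzero by auto
  then have "degree (xm1 div Q) + degree Q = m" using degree_xm1 eq by (metis degree_mult_eq)
  then show "degree (xm1 div Q) = m - degree Q" "degree Q \<le> m" by auto
qed

lemma U_subgroup: "0 \<in> U Q" "u \<in> U Q \<Longrightarrow> v \<in> U Q \<Longrightarrow> u - v \<in> U Q"
  by (simp_all add: U_def ker_def lin_arg_diff)

lemma V_subgroup: "0 \<in> V" "u \<in> V \<Longrightarrow> v \<in> V \<Longrightarrow> u - v \<in> V"
  by (simp_all add: V_def trace_diff) (simp add: field_trace_lin)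

lemma card_perp_U:
  assumes "Q \<in> monic_irreducible_factors xm1"
  shows "card (perp (U Q)) = q ^ degree Q"
proof -
  note Q = xm1_factor[OF assms]
  have "q ^ (m - degree Q) * card (perp (U Q)) = q ^ m"
    using perp_indicator(1)[OF U_subgroup, of Q] card_ker[OF Q(1)] Q(2) by (simp add: U_def)
  also have "\<dots> = q ^ (m - degree Q) * q ^ degree Q" using Q(3) by (simp flip: power_add)
  finally show ?thesis using q_gt_1 by simp
qed

lemma card_perp_V: "card (perp V) = q"
proof -
  have "q ^ (m - 1) * card (perp V) = q ^ m"
    using perp_indicator(1)[OF V_subgroup] by (simp add: V_def card_trace_kernel)
  also have "\<dots> = q ^ (m - 1) * q" using m_pos by (metis Suc_diff_1 power_Suc2)
  finally show ?thesis using q_gt_1 by simp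
qed

lemma prime_factor_N:
  assumes "l \<in> prime_factors (N - 1)"
  shows "prime l" "l dvd N - 1" "l > 0"
  using assms by (auto simp: in_prime_factors_iff prime_gt_0_nat)

lemma ch_dom:
  assumes "\<alpha> \<in> dom"
  shows "ch \<kappa> t \<alpha> = mult_char w \<alpha> ^ i1 \<kappa> t * mult_char w (val \<alpha>) ^ i2 \<kappa> t * \<psi> (yc \<kappa> t * \<alpha> + zc \<kappa> t / \<alpha>)"
  using dom_nonzero[OF assms] by (simp add: ch_def mult_char_w_power[of "i1 _ _"] mult_char_w_power[of "i2 _ _"])

lemma sum_coef:
  assumes "finite S" "t0 \<in> S"
  shows "(\<Sum>t\<in>S. (of_bool (t = t0) - c) * h t) = h t0 - c * (\<Sum>t\<in>S. h t :: complex)"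
  using assms by (simp add: left_diff_distrib sum_subtractf sum_distrib_left)

sublocale expansion: character_expansion conditions dom idx "(0, 0)" ch coef "\<lambda>\<kappa> \<alpha>. of_bool (holds \<kappa> \<alpha>)" \<theta>
proof
  show "finite (idx \<kappa>)" for \<kappa> by (cases \<kappa>) auto
  show "(0, 0) \<in> idx \<kappa>" if "\<kappa> \<in> conditions" for \<kappa>
    using that prime_factor_N(3) by (auto simp: conditions_def zero_in_perp)
  show "ch \<kappa> (0, 0) \<alpha> = 1" if "\<alpha> \<in> dom" for \<kappa> \<alpha>
    by (cases \<kappa>) (simp_all add: ch_dom[OF that])
  show "coef \<kappa> (0, 0) = of_real (\<theta> \<kappa>)" for \<kappa> by (cases \<kappa>) simp_all
  show "\<theta> \<kappa> \<ge> 0" if "\<kappa> \<in> conditions" for \<kappa>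
    using that q_gt_1 by (cases \<kappa>) (auto simp: divide_le_eq_1)
  show "complex_of_real (of_bool (holds \<kappa> \<alpha>)) = (\<Sum>t\<in>idx \<kappa>. coef \<kappa> t * ch \<kappa> t \<alpha>)"
    if \<kappa>: "\<kappa> \<in> conditions" and \<alpha>: "\<alpha> \<in> dom" for \<kappa> \<alpha>
  proof (cases \<kappa>)
    case (Pow1 l)
    then have l: "l \<in> prime_factors (N - 1)" using \<kappa> by (auto simp: conditions_def)
    note l = prime_factor_N[OF l]
    have "(\<Sum>t\<in>idx \<kappa>. coef \<kappa> t * ch \<kappa> t \<alpha>) = ch \<kappa> (0, 0) \<alpha> - 1 / of_nat l * (\<Sum>t\<in>idx \<kappa>. ch \<kappa> t \<alpha>)"
      unfolding Pow1 coef.simps by (rule sum_coef) (use l in auto)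
    also have "(\<Sum>t\<in>idx \<kappa>. ch \<kappa> t \<alpha>) = (\<Sum>s<l. mult_char (w ^ ((N - 1) div l * s)) \<alpha>)"
      by (rule sum.reindex_bij_witness[of _ "\<lambda>s. (s, 0)" fst])
         (auto simp: Pow1 ch_def dom_nonzero[OF \<alpha>] mult_char_w_power[of 0, simplified])
    also have "\<dots> = (if \<exists>y. y ^ l = \<alpha> then of_nat l else 0)"
      using l dom_nonzero[OF \<alpha>] by (intro power_indicator) auto
    finally show ?thesis using l by (simp add: Pow1 ch_dom[OF \<alpha>])
  next
    case (Pow2 l)
    then have l: "l \<in> prime_factors (N - 1)" using \<kappa> by (auto simp: conditions_def)
    note l = prime_factor_N[OF l]
    have "(\<Sum>t\<in>idx \<kappa>. coef \<kappa> t * ch \<kappa> t \<alpha>) = ch \<kappa> (0, 0) \<alpha> - 1 / of_nat l * (\<Sum>t\<in>idx \<kappa>. ch \<kappa> t \<alpha>)"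
      unfolding Pow2 coef.simps by (rule sum_coef) (use l in auto)
    also have "(\<Sum>t\<in>idx \<kappa>. ch \<kappa> t \<alpha>) = (\<Sum>s<l. mult_char (w ^ ((N - 1) div l * s)) (val \<alpha>))"
      by (rule sum.reindex_bij_witness[of _ "\<lambda>s. (s, 0)" fst])
         (auto simp: Pow2 ch_def dom_nonzero[OF \<alpha>] mult_char_w_power[of 0, simplified])
    also have "\<dots> = (if \<exists>y. y ^ l = val \<alpha> then of_nat l else 0)"
      using l dom_nonzero[OF \<alpha>] by (intro power_indicator) auto
    finally show ?thesis using l by (simp add: Pow2 ch_dom[OF \<alpha>])
  next
    case (Free Q)
    then have Q: "Q \<in> monic_irreducible_factors xm1" using \<kappa> by (auto simp: conditions_def)
    have "(\<Sum>t\<in>idx \<kappa>. coef \<kappa> t * ch \<kappa> t \<alpha>) = ch \<kappa> (0, 0) \<alpha> - 1 / of_nat q ^ degree Q * (\<Sum>t\<in>idx \<kappa>. ch \<kappa> t \<alpha>)"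
      unfolding Free coef.simps by (rule sum_coef) (auto simp: zero_in_perp)
    also have "(\<Sum>t\<in>idx \<kappa>. ch \<kappa> t \<alpha>) = (\<Sum>y\<in>perp (U Q). \<psi> (y * \<alpha>))"
      by (rule sum.reindex_bij_witness[of _ "\<lambda>s. (0, s)" snd]) (auto simp: Free ch_dom[OF \<alpha>])
    also have "\<dots> = (if \<alpha> \<in> U Q then of_nat (card (perp (U Q))) else 0)"
      by (rule perp_indicator(2)[OF U_subgroup])
    finally show ?thesis using q_gt_1 by (simp add: Free ch_dom[OF \<alpha>] card_perp_U[OF Q, unfolded U_def ker_def] U_def ker_def)
  next
    case Tr
    have "(\<Sum>t\<in>idx \<kappa>. coef \<kappa> t * ch \<kappa> t \<alpha>) = (\<Sum>z\<in>perp V. \<psi> (z * (inverse \<alpha> - \<beta>)) / of_nat q)"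
      by (rule sum.reindex_bij_witness[of _ "\<lambda>s. (0, s)" snd])
         (auto simp: Tr ch_dom[OF \<alpha>] psi_add[symmetric] algebra_simps divide_inverse)
    also have "\<dots> = (\<Sum>z\<in>perp V. \<psi> (z * (inverse \<alpha> - \<beta>))) / of_nat q" by (simp add: sum_divide_distrib)
    also have "(\<Sum>z\<in>perp V. \<psi> (z * (inverse \<alpha> - \<beta>))) = (if inverse \<alpha> - \<beta> \<in> V then of_nat (card (perp V)) else 0)"
      by (rule perp_indicator(2)[OF V_subgroup])
    finally show ?thesis using q_gt_1
      by (simp add: Tr card_perp_V[unfolded V_def] V_def trace_diff trace_\<beta>)
  qed
qed

text \<open>The coefficients of the nontrivial characters add up in absolute value to the density
  once more. This factor 2 per condition produces the powers of 2 in \<open>W\<close>.\<close>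

lemma total_nonTr:
  assumes \<kappa>: "\<kappa> \<in> conditions" "\<kappa> \<noteq> Tr"
  shows "expansion.total \<kappa> = 2 * \<theta> \<kappa>"
proof -
  have tot: "expansion.total \<kappa> = \<theta> \<kappa> + (real (card (idx \<kappa>)) - 1) * c"
    if "\<And>t. t \<noteq> (0, 0) \<Longrightarrow> norm (coef \<kappa> t) = c" for c
  proof -
    have "(\<Sum>t\<in>idx \<kappa> - {(0, 0)}. norm (coef \<kappa> t)) = (\<Sum>t\<in>idx \<kappa> - {(0, 0)}. c)"
      using that by (intro sum.cong) auto
    also have "\<dots> = (real (card (idx \<kappa>)) - 1) * c"
    proof -
      have "card (idx \<kappa>) > 0" using expansion.t0_T[OF \<kappa>(1)] expansion.finite_T[OF \<kappa>(1)] by (auto simp: card_gt_0_iff)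
      then show ?thesis using expansion.t0_T[OF \<kappa>(1)] by (simp add: of_nat_diff Suc_le_eq)
    qed
    finally show ?thesis using expansion.total_split[OF \<kappa>(1)] by simp
  qed
  show ?thesis
  proof (cases \<kappa>)
    case (Pow1 l)
    then have l: "l \<in> prime_factors (N - 1)" using \<kappa> by (auto simp: conditions_def)
    show ?thesis using tot[of "1 / real l"] prime_factor_N(3)[OF l] by (simp add: Pow1 norm_divide field_simps)
  next
    case (Pow2 l)
    then have l: "l \<in> prime_factors (N - 1)" using \<kappa> by (auto simp: conditions_def)
    show ?thesis using tot[of "1 / real l"] prime_factor_N(3)[OF l] by (simp add: Pow2 norm_divide field_simps)
  next
    case (Free Q)
    then have Q: "Q \<in> monic_irreducible_factors xm1" using \<kappa> by (auto simp: conditions_def)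
    show ?thesis using tot[of "1 / real q ^ degree Q"] q_gt_1
      by (simp add: Free norm_divide norm_power card_perp_U[OF Q] card_cartesian_product field_simps)
  qed (use \<kappa> in simp)
qed

lemma total_Tr: "expansion.total Tr = 1"
proof -
  have "expansion.total Tr = (\<Sum>t\<in>idx Tr. 1 / real q)"
    unfolding expansion.total_def by (intro sum.cong) (simp_all add: norm_divide norm_add_char)
  then show ?thesis using q_gt_1 by (simp add: card_perp_V card_cartesian_product)
qed

lemma char_sum_eq:
  assumes "finite K"
  shows "expansion.char_sum K g = (\<Sum>\<alpha>\<in>dom. mult_char (w ^ (\<Sum>\<kappa>\<in>K. i1 \<kappa> (g \<kappa>))) \<alpha> *
    mult_char (w ^ (\<Sum>\<kappa>\<in>K. i2 \<kappa> (g \<kappa>))) (val \<alpha>) * \<psi> ((\<Sum>\<kappa>\<in>K. yc \<kappa> (g \<kappa>)) * \<alpha> + (\<Sum>\<kappa>\<in>K. zc \<kappa> (g \<kappa>)) / \<alpha>))"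
  unfolding expansion.char_sum_def
proof (intro sum.cong refl)
  fix \<alpha> assume \<alpha>: "\<alpha> \<in> dom"
  have pow: "mult_char (w ^ i) x = mult_char w x ^ i" if "x \<noteq> 0" for i and x :: 'k
    using that by (simp add: mult_char_w_power[of i])
  have "(\<Prod>\<kappa>\<in>K. \<psi> (yc \<kappa> (g \<kappa>) * \<alpha> + zc \<kappa> (g \<kappa>) / \<alpha>)) =
      \<psi> ((\<Sum>\<kappa>\<in>K. yc \<kappa> (g \<kappa>)) * \<alpha> + (\<Sum>\<kappa>\<in>K. zc \<kappa> (g \<kappa>)) / \<alpha>)"
    by (simp add: sum.distrib sum_distrib_right sum_divide_distrib flip: psi_sum)
  then show "(\<Prod>\<kappa>\<in>K. ch \<kappa> (g \<kappa>) \<alpha>) = mult_char (w ^ (\<Sum>\<kappa>\<in>K. i1 \<kappa> (g \<kappa>))) \<alpha> *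
    mult_char (w ^ (\<Sum>\<kappa>\<in>K. i2 \<kappa> (g \<kappa>))) (val \<alpha>) * \<psi> ((\<Sum>\<kappa>\<in>K. yc \<kappa> (g \<kappa>)) * \<alpha> + (\<Sum>\<kappa>\<in>K. zc \<kappa> (g \<kappa>)) / \<alpha>)"
    unfolding pow[OF conjunct1[OF dom_nonzero[OF \<alpha>]]] pow[OF conjunct2[OF dom_nonzero[OF \<alpha>]]]
    by (simp add: ch_dom[OF \<alpha>] prod.distrib power_sum)
qed

text \<open>A Bezout relation between \<open>Q0\<close> and the product of \<open>S\<close> writes
  every \<open>x\<close> as \<open>u + v\<close> with \<open>u\<close> in \<open>U Q0\<close> and
  \<open>v\<close> in all \<open>U Q\<close> with \<open>Q\<close> in \<open>S\<close>. On
  \<open>u\<close> the character of \<open>y0\<close> is trivial by membership, on \<open>v\<close>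
  by the relation.\<close>

lemma perp_U_independent:
  assumes S: "finite S" "S \<subseteq> monic_irreducible_factors xm1" "Q0 \<in> monic_irreducible_factors xm1" "Q0 \<notin> S"
    and y: "y0 \<in> perp (U Q0)" "\<And>Q. Q \<in> S \<Longrightarrow> y Q \<in> perp (U Q)" "y0 + sum y S = 0"
  shows "y0 = 0"
proof -
  have irr: "Q \<in> monic_irreducibles" if "Q \<in> insert Q0 S" for Q
    using that S(2,3) xm1_factor(4) by blast
  have "\<Prod>S \<noteq> 0" using irr S(1) monic_irreducible_nonzero by (auto simp: prod_zero_iff dest!: bspec)
  moreover have "\<not> Q dvd \<Prod>S" if Q: "Q \<in> monic_irreducibles" "Q dvd Q0" for Q
  proof
    assume "Q dvd \<Prod>S"
    then have "\<exists>Q'\<in>S. Q dvd Q'" by (rule prime_elem_dvd_prod[OF S(1) monic_irreducible_prime[OF Q(1)]])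
    then obtain Q' where Q': "Q' \<in> S" "Q dvd Q'" by blast
    then have "Q = Q'" "Q = Q0" using monic_irreducible_dvd_imp_eq[OF Q(1)] irr Q(2) by blast+
    with Q' S(4) show False by blast
  qed
  ultimately obtain b c where bez: "b * Q0 + c * \<Prod>S = 1"
    using poly_bezout[of "\<Prod>S" Q0] by metis
  have "\<psi> (y0 * x) = 1" for x
  proof -
    define u where "u = lin Q0 (lin b x)"
    define v where "v = lin (\<Prod>S) (lin c x)"
    have "x = lin (b * Q0 + c * \<Prod>S) x" unfolding bez by simp
    also have "\<dots> = lin (Q0 * b) x + lin (\<Prod>S * c) x" by (simp only: lin_add mult.commute)
    finally have x: "x = u + v" by (simp only: u_def v_def lin_mult)
    have "lin (xm1 div Q0) u = lin ((xm1 div Q0) * Q0) (lin b x)" by (simp only: u_def lin_mult)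
    then have "u \<in> U Q0" by (simp add: U_def ker_def xm1_factor(1)[OF S(3)] lin_xm1)
    then have 1: "\<psi> (y0 * u) = 1" using y(1) by (simp add: perp_def)
    have 2: "\<psi> (y Q * v) = 1" if Q: "Q \<in> S" for Q
    proof -
      have Q': "Q \<in> monic_irreducible_factors xm1" using Q S(2) by blast
      have "\<Prod>S = Q * \<Prod>(S - {Q})" using S(1) Q by (rule prod.remove)
      then have "lin (xm1 div Q) v = lin ((xm1 div Q) * Q) (lin (\<Prod>(S - {Q})) (lin c x))"
        by (simp only: v_def lin_mult)
      then have "v \<in> U Q" by (simp add: U_def ker_def xm1_factor(1)[OF Q'] lin_xm1)
      then show ?thesis using y(2)[OF Q] by (simp add: perp_def)
    qed
    have "\<psi> (sum y S * v) = (\<Prod>Q\<in>S. \<psi> (y Q * v))" by (simp add: sum_distrib_right psi_sum)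
    then have "\<psi> (sum y S * v) = 1" using 2 by simp
    moreover have "y0 * v = - (sum y S * v)" using y(3) by (metis add_eq_0_iff2 mult_minus_left)
    ultimately have "\<psi> (y0 * v) = 1" using psi_minus[of "sum y S * v"] by simp
    then show ?thesis using 1 by (simp add: x distrib_left psi_add)
  qed
  then have "(\<Sum>x\<in>UNIV. \<psi> (x * y0)) = of_nat N" by (simp add: mult.commute[of _ y0] card_N)
  then show ?thesis using q_gt_1 unfolding sum_psi by (auto split: if_splits)
qed

text \<open>A nontrivial choice at one condition cannot be cancelled by the others: characters of
  distinct prime orders are independent, and so are the annihilators of distinct irreducible
  factors. The surviving component is of the kind of the given condition.\<close>

lemma nontrivial_choice:
  assumes K: "finite K" "K \<subseteq> conditions" and g: "g \<in> PiE K idx" and \<kappa>0: "\<kappa>0 \<in> K" "g \<kappa>0 \<noteq> (0, 0)"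
  shows "case \<kappa>0 of Pow1 l \<Rightarrow> \<not> N - 1 dvd (\<Sum>\<kappa>\<in>K. i1 \<kappa> (g \<kappa>)) | Pow2 l \<Rightarrow> \<not> N - 1 dvd (\<Sum>\<kappa>\<in>K. i2 \<kappa> (g \<kappa>))
    | Free Q \<Rightarrow> (\<Sum>\<kappa>\<in>K. yc \<kappa> (g \<kappa>)) \<noteq> 0 | Tr \<Rightarrow> (\<Sum>\<kappa>\<in>K. zc \<kappa> (g \<kappa>)) \<noteq> 0"
proof -
  have n: "N - 1 > 0" using N_gt_1 by simp
  have gT: "g \<kappa> \<in> idx \<kappa>" if "\<kappa> \<in> K" for \<kappa> using g that by blast
  have split: "(\<Sum>\<kappa>\<in>K. h \<kappa>) = h \<kappa>0 + (\<Sum>\<kappa>\<in>K - {\<kappa>0}. h \<kappa>)" for h :: "_ \<Rightarrow> 'x::comm_monoid_add"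
    using K(1) \<kappa>0(1) by (rule sum.remove)
  show ?thesis
  proof (cases \<kappa>0)
    case (Pow1 l)
    obtain s where s: "g \<kappa>0 = (s, 0)" "s < l" "s > 0" using gT[OF \<kappa>0(1)] \<kappa>0(2) Pow1 by auto
    have l: "prime l" "l dvd N - 1" using K(2) \<kappa>0(1) prime_factor_N by (auto simp: Pow1 conditions_def)
    have "\<not> N - 1 dvd (\<Sum>\<kappa>\<in>K. i1 \<kappa> (g \<kappa>))"
    proof
      assume "N - 1 dvd (\<Sum>\<kappa>\<in>K. i1 \<kappa> (g \<kappa>))"
      then have "N - 1 dvd (N - 1) div l * s + (\<Sum>\<kappa>\<in>K - {\<kappa>0}. i1 \<kappa> (g \<kappa>))"
        unfolding split by (simp only: Pow1 s(1)[unfolded Pow1] i1.simps fst_conv)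
      moreover have "i1 \<kappa> (g \<kappa>) = 0 \<or> (\<exists>l' s. prime l' \<and> l' dvd N - 1 \<and> l' \<noteq> l \<and> i1 \<kappa> (g \<kappa>) = (N - 1) div l' * s)"
        if "\<kappa> \<in> K - {\<kappa>0}" for \<kappa>
      proof (cases \<kappa>)
        case [simp]: (Pow1 l')
        then have "prime l'" "l' dvd N - 1" "l' \<noteq> l"
          using that K(2) prime_factor_N \<open>\<kappa>0 = Pow1 l\<close> by (auto simp: conditions_def)
        then show ?thesis by (simp only: Pow1 i1.simps) blast
      qed auto
      ultimately have "l dvd s" using K(1) by (intro dvd_sum_quotients[OF n l, of "K - {\<kappa>0}"]) auto
      with s show False by (auto dest: dvd_imp_le)
    qed
    then show ?thesis unfolding Pow1 condition.case .
  next
    case (Pow2 l)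
    obtain s where s: "g \<kappa>0 = (s, 0)" "s < l" "s > 0" using gT[OF \<kappa>0(1)] \<kappa>0(2) Pow2 by auto
    have l: "prime l" "l dvd N - 1" using K(2) \<kappa>0(1) prime_factor_N by (auto simp: Pow2 conditions_def)
    have "\<not> N - 1 dvd (\<Sum>\<kappa>\<in>K. i2 \<kappa> (g \<kappa>))"
    proof
      assume "N - 1 dvd (\<Sum>\<kappa>\<in>K. i2 \<kappa> (g \<kappa>))"
      then have "N - 1 dvd (N - 1) div l * s + (\<Sum>\<kappa>\<in>K - {\<kappa>0}. i2 \<kappa> (g \<kappa>))"
        unfolding split by (simp only: Pow2 s(1)[unfolded Pow2] i2.simps fst_conv)
      moreover have "i2 \<kappa> (g \<kappa>) = 0 \<or> (\<exists>l' s. prime l' \<and> l' dvd N - 1 \<and> l' \<noteq> l \<and> i2 \<kappa> (g \<kappa>) = (N - 1) div l' * s)"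
        if "\<kappa> \<in> K - {\<kappa>0}" for \<kappa>
      proof (cases \<kappa>)
        case [simp]: (Pow2 l')
        then have "prime l'" "l' dvd N - 1" "l' \<noteq> l"
          using that K(2) prime_factor_N \<open>\<kappa>0 = Pow2 l\<close> by (auto simp: conditions_def)
        then show ?thesis by (simp only: Pow2 i2.simps) blast
      qed auto
      ultimately have "l dvd s" using K(1) by (intro dvd_sum_quotients[OF n l, of "K - {\<kappa>0}"]) auto
      with s show False by (auto dest: dvd_imp_le)
    qed
    then show ?thesis unfolding Pow2 condition.case .
  next
    case (Free Q0)
    obtain y0 where y0: "g \<kappa>0 = (0, y0)" "y0 \<in> perp (U Q0)" "y0 \<noteq> 0" using gT[OF \<kappa>0(1)] \<kappa>0(2) Free by auto
    define S where "S = {Q. Free Q \<in> K - {\<kappa>0}}"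
    have FS: "Free ` S \<subseteq> K - {\<kappa>0}" by (auto simp: S_def)
    have "(\<Sum>\<kappa>\<in>K - {\<kappa>0}. yc \<kappa> (g \<kappa>)) = (\<Sum>\<kappa>\<in>Free ` S. yc \<kappa> (g \<kappa>))"
    proof (rule sum.mono_neutral_right[OF _ FS], use K(1) in simp, intro ballI)
      fix \<kappa> assume "\<kappa> \<in> K - {\<kappa>0} - Free ` S"
      then show "yc \<kappa> (g \<kappa>) = 0" by (cases \<kappa>) (auto simp: S_def)
    qed
    also have "\<dots> = (\<Sum>Q\<in>S. snd (g (Free Q)))" by (subst sum.reindex) (auto simp: inj_on_def)
    finally have sum: "(\<Sum>\<kappa>\<in>K. yc \<kappa> (g \<kappa>)) = y0 + (\<Sum>Q\<in>S. snd (g (Free Q)))"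
      unfolding split by (simp add: Free y0(1)[unfolded Free])
    have "(\<Sum>\<kappa>\<in>K. yc \<kappa> (g \<kappa>)) \<noteq> 0"
    proof
      assume 0: "(\<Sum>\<kappa>\<in>K. yc \<kappa> (g \<kappa>)) = 0"
      have "y0 = 0"
      proof (rule perp_U_independent[of S Q0])
        show "finite S" using FS K(1) by (intro finite_imageD[OF finite_subset[OF FS]]) (auto simp: inj_on_def)
        show "S \<subseteq> monic_irreducible_factors xm1" "Q0 \<in> monic_irreducible_factors xm1" "Q0 \<notin> S"
          using K(2) \<kappa>0(1) by (auto simp: S_def Free conditions_def)
        show "snd (g (Free Q)) \<in> perp (U Q)" if "Q \<in> S" for Q
          using gT[of "Free Q"] that by (auto simp: S_def)
        show "y0 + (\<Sum>Q\<in>S. snd (g (Free Q))) = 0" using 0 unfolding sum .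
      qed (rule y0(2))
      with y0(3) show False by blast
    qed
    then show ?thesis unfolding Free condition.case .
  next
    case Tr
    obtain z0 where z0: "g \<kappa>0 = (0, z0)" "z0 \<noteq> 0" using gT[OF \<kappa>0(1)] \<kappa>0(2) Tr by auto
    have "zc \<kappa> t = 0" if "\<kappa> \<noteq> Tr" for \<kappa> t using that by (cases \<kappa>) auto
    then have "(\<Sum>\<kappa>\<in>K - {\<kappa>0}. zc \<kappa> (g \<kappa>)) = 0" by (intro sum.neutral) (auto simp: Tr)
    then have "(\<Sum>\<kappa>\<in>K. zc \<kappa> (g \<kappa>)) = z0" unfolding split by (simp add: Tr z0(1)[unfolded Tr])
    with z0(2) show ?thesis by (simp add: Tr)
  qed
qed

lemma dom_sum_bound:
  assumes "\<not> N - 1 dvd i \<or> \<not> N - 1 dvd j \<or> y \<noteq> 0 \<or> z \<noteq> 0"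
  shows "norm (\<Sum>\<alpha>\<in>dom. mult_char (w ^ i) \<alpha> * mult_char (w ^ j) (val \<alpha>) * \<psi> (y * \<alpha> + z / \<alpha>))
    \<le> real (degree f1 + degree f2 + (if y = 0 then 1 else 2)) * sqrt (real N)"
  unfolding dom_def val_def by (rule rational_sum_bound[OF red nonexc assms])

lemma char_sum_bound:
  assumes K: "finite K" "K \<subseteq> conditions" and g: "g \<in> PiE K idx" and ex: "\<exists>\<kappa>\<in>K. g \<kappa> \<noteq> (0, 0)"
  shows "norm (expansion.char_sum K g) \<le> real (n + 2) * sqrt (real N)"
proof -
  obtain \<kappa>0 where \<kappa>0: "\<kappa>0 \<in> K" "g \<kappa>0 \<noteq> (0, 0)" using ex by blast
  have "norm (expansion.char_sum K g) \<le>
     real (degree f1 + degree f2 + (if (\<Sum>\<kappa>\<in>K. yc \<kappa> (g \<kappa>)) = 0 then 1 else 2)) * sqrt (real N)"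
    unfolding char_sum_eq[OF K(1)]
    by (rule dom_sum_bound) (use nontrivial_choice[OF K g \<kappa>0] in \<open>cases \<kappa>0; auto\<close>)
  also have "\<dots> \<le> real (n + 2) * sqrt (real N)"
    using deg_le by (intro mult_right_mono) auto
  finally show ?thesis .
qed

lemma card_outside_dom: "card {\<alpha>. \<alpha> \<noteq> 0 \<and> \<alpha> \<notin> dom} \<le> n"
proof -
  have "card {\<alpha>. \<alpha> \<noteq> 0 \<and> \<alpha> \<notin> dom} \<le> card ({\<alpha>. poly f1 \<alpha> = 0} \<union> {\<alpha>. poly f2 \<alpha> = 0})"
    by (intro card_mono) (auto simp: dom_def)
  also have "\<dots> \<le> card {\<alpha>. poly f1 \<alpha> = 0} + card {\<alpha>. poly f2 \<alpha> = 0}" by (rule card_Un_le)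
  also have "\<dots> \<le> degree f1 + degree f2" using red by (intro add_mono card_poly_roots_bound) auto
  finally show ?thesis using deg_le by linarith
qed

lemma card_dom: "real (card dom) \<ge> real N - 1 - real n"
proof -
  have "N = card (UNIV :: 'k set)" by (simp add: card_N)
  also have "UNIV = insert 0 (dom \<union> {\<alpha>. \<alpha> \<noteq> 0 \<and> \<alpha> \<notin> dom})" by auto
  also have "card \<dots> \<le> Suc (card (dom \<union> {\<alpha>. \<alpha> \<noteq> 0 \<and> \<alpha> \<notin> dom}))" by (simp add: card_insert_if)
  also have "\<dots> \<le> Suc (card dom + card {\<alpha>. \<alpha> \<noteq> 0 \<and> \<alpha> \<notin> dom})" using card_Un_le by simp
  finally show ?thesis using card_outside_dom by linarith
qed

text \<open>For \<open>Pow1\<close> and \<open>Free\<close> the character sum does not involve \<open>f\<close>: up to the at most \<open>n\<close> elements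
  outside \<open>dom\<close> it is a complete sum whose bound is independent of \<open>n\<close>.\<close>

primrec err :: "'f poly condition \<Rightarrow> real" where
  "err (Pow1 l) = sqrt (real N) + real n"
| "err (Pow2 l) = real (n + 1) * sqrt (real N)"
| "err (Free Q) = 2 * sqrt (real N) + real n"
| "err Tr = 0"

lemma char_sum_bound_pair:
  assumes \<kappa>: "\<kappa> \<in> conditions" "\<kappa> \<noteq> Tr" and g: "g \<in> PiE {\<kappa>, Tr} idx" "g \<kappa> \<noteq> (0, 0)"
  shows "norm (expansion.char_sum {\<kappa>, Tr} g) \<le> err \<kappa>"
proof -
  have K: "finite {\<kappa>, Tr}" "{\<kappa>, Tr} \<subseteq> conditions" using \<kappa> by (auto simp: conditions_def)
  define z where "z = snd (g Tr)"
  have incomplete: "norm (\<Sum>\<alpha>\<in>dom. mult_char (w ^ i) \<alpha> * \<psi> (y * \<alpha> + z / \<alpha>)) \<le> (if y = 0 then 1 else 2) * sqrt (real N) + real n"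
    if nontriv: "\<not> N - 1 dvd i \<or> y \<noteq> 0" for i y
  proof -
    let ?h = "\<lambda>\<alpha>. mult_char (w ^ i) \<alpha> * \<psi> (y * \<alpha> + z / \<alpha>)"
    have le1: "norm (?h \<alpha>) \<le> 1" for \<alpha>
    proof -
      have "(w ^ i) ^ (CARD('k) - 1) = 1" by (simp only: power_mult[symmetric] mult.commute[of i]) (simp only: power_mult w_unit power_one)
      then show ?thesis by (simp add: norm_mult norm_add_char norm_mult_char_le)
    qed
    have "{\<alpha>. \<alpha> \<noteq> 0} = dom \<union> {\<alpha>. \<alpha> \<noteq> 0 \<and> \<alpha> \<notin> dom}" using dom_nonzero by auto
    then have "(\<Sum>\<alpha> | \<alpha> \<noteq> 0. ?h \<alpha>) = (\<Sum>\<alpha>\<in>dom. ?h \<alpha>) + (\<Sum>\<alpha> | \<alpha> \<noteq> 0 \<and> \<alpha> \<notin> dom. ?h \<alpha>)"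
      by (simp only:, subst sum.union_disjoint) auto
    then have "(\<Sum>\<alpha>\<in>dom. ?h \<alpha>) = (\<Sum>\<alpha> | \<alpha> \<noteq> 0. ?h \<alpha>) - (\<Sum>\<alpha> | \<alpha> \<noteq> 0 \<and> \<alpha> \<notin> dom. ?h \<alpha>)" by simp
    then have "norm (\<Sum>\<alpha>\<in>dom. ?h \<alpha>) \<le> norm (\<Sum>\<alpha> | \<alpha> \<noteq> 0. ?h \<alpha>) + norm (\<Sum>\<alpha> | \<alpha> \<noteq> 0 \<and> \<alpha> \<notin> dom. ?h \<alpha>)"
      by (simp only: norm_triangle_ineq4)
    moreover have "norm (\<Sum>\<alpha> | \<alpha> \<noteq> 0. ?h \<alpha>) \<le> (if y = 0 then 1 else 2) * sqrt (real N)"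
      by (rule power_sum_bound) (use nontriv in blast)
    moreover have "norm (\<Sum>\<alpha> | \<alpha> \<noteq> 0 \<and> \<alpha> \<notin> dom. ?h \<alpha>) \<le> of_nat (card {\<alpha>. \<alpha> \<noteq> 0 \<and> \<alpha> \<notin> dom}) * 1"
      by (intro sum_norm_bound le1)
    ultimately show ?thesis using card_outside_dom by linarith
  qed
  have one: "mult_char (w ^ 0) (val \<alpha>) = 1" if "\<alpha> \<in> dom" for \<alpha>
    using dom_nonzero[OF that] mult_char_w_power[of 0 "val \<alpha>"] by simp
  note nontrivial = nontrivial_choice[OF K g(1) insertI1 g(2)]
  show ?thesis
  proof (cases \<kappa>)
    case (Pow1 l)
    have "expansion.char_sum {\<kappa>, Tr} g = (\<Sum>\<alpha>\<in>dom. mult_char (w ^ i1 \<kappa> (g \<kappa>)) \<alpha> * \<psi> (0 * \<alpha> + z / \<alpha>))"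
      unfolding char_sum_eq[OF K(1)] by (intro sum.cong refl) (simp add: Pow1 z_def one[simplified])
    then show ?thesis using incomplete[of "i1 \<kappa> (g \<kappa>)" 0] nontrivial by (simp add: Pow1)
  next
    case (Pow2 l)
    have "norm (expansion.char_sum {\<kappa>, Tr} g) \<le> real (degree f1 + degree f2 + (if (\<Sum>\<kappa>\<in>{\<kappa>, Tr}. yc \<kappa> (g \<kappa>)) = 0 then 1 else 2)) * sqrt (real N)"
      unfolding char_sum_eq[OF K(1)]
      by (rule dom_sum_bound) (use nontrivial in \<open>auto simp: Pow2\<close>)
    \<comment> \<open>Neither \<open>Pow2\<close> nor \<open>Tr\<close> contributes an additive
      character in \<alpha>, so the degree bound drops from \<open>n + 2\<close> to
      \<open>n + 1\<close>.\<close>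
    also have "\<dots> \<le> real (n + 1) * sqrt (real N)"
      using deg_le by (intro mult_right_mono) (auto simp: Pow2)
    finally show ?thesis by (simp add: Pow2)
  next
    case (Free Q)
    have "expansion.char_sum {\<kappa>, Tr} g = (\<Sum>\<alpha>\<in>dom. mult_char (w ^ 0) \<alpha> * \<psi> (yc \<kappa> (g \<kappa>) * \<alpha> + z / \<alpha>))"
      unfolding char_sum_eq[OF K(1)] by (intro sum.cong refl) (simp add: Free z_def one[simplified])
    then show ?thesis using incomplete[of 0 "yc \<kappa> (g \<kappa>)"] nontrivial by (simp add: Free)
  qed (use \<kappa> in simp)
qed

text \<open>The map sending \<alpha> to \<open>inverse \<alpha> - \<beta>\<close> is injective into
  \<open>V\<close>. An exact bound without error term is possible here because nothing but the trace
  is prescribed.\<close>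

lemma count_Tr_le: "expansion.count {Tr} \<le> real N / real q"
proof -
  have "expansion.count {Tr} = real (card {\<alpha> \<in> dom. holds Tr \<alpha>})"
    unfolding expansion.count_def by (simp add: of_bool_def sum.If_cases Collect_conj_eq)
  also have "card {\<alpha> \<in> dom. holds Tr \<alpha>} \<le> card V"
  proof (rule card_inj_on_le[of "\<lambda>\<alpha>. inverse \<alpha> - \<beta>"])
    show "inj_on (\<lambda>\<alpha>. inverse \<alpha> - \<beta>) {\<alpha> \<in> dom. holds Tr \<alpha>}" by (rule inj_onI) simp
    show "(\<lambda>\<alpha>. inverse \<alpha> - \<beta>) ` {\<alpha> \<in> dom. holds Tr \<alpha>} \<subseteq> V"
      using trace_\<beta> by (intro image_subsetI) (simp add: V_def trace_diff)
  qed simp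
  also have "card V = q ^ (m - 1)" unfolding V_def by (rule card_trace_kernel)
  also have "real (q ^ (m - 1)) = real N / real q"
    using m_pos q_gt_1 by (cases m) auto
  finally show ?thesis by simp
qed

definition conds :: "nat set \<Rightarrow> 'f poly set \<Rightarrow> 'f poly condition set" where
  "conds A B = Pow1 ` A \<union> Pow2 ` A \<union> Free ` B"

lemma sum_conds:
  "finite A \<Longrightarrow> finite B \<Longrightarrow> sum h (conds A B) = (\<Sum>l\<in>A. h (Pow1 l) + h (Pow2 l)) + (\<Sum>Q\<in>B. h (Free Q))"
  unfolding conds_def
  by (subst sum.union_disjoint, auto, subst sum.union_disjoint) (auto simp: sum.reindex inj_on_def sum.distrib)

lemma prod_conds:
  "finite A \<Longrightarrow> finite B \<Longrightarrow> prod h (conds A B) = (\<Prod>l\<in>A. h (Pow1 l) * h (Pow2 l)) * (\<Prod>Q\<in>B. h (Free Q))"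
  unfolding conds_def
  by (subst prod.union_disjoint, auto, subst prod.union_disjoint) (auto simp: prod.reindex inj_on_def prod.distrib)

lemma finite_conds: "finite A \<Longrightarrow> finite B \<Longrightarrow> finite (conds A B)"
  by (simp add: conds_def)

lemma card_conds: "finite A \<Longrightarrow> finite B \<Longrightarrow> card (conds A B) = 2 * card A + card B"
  using sum_conds[of A B "\<lambda>_. 1 :: nat"] by simp

lemma conds_simps [simp]: "Tr \<notin> conds A B" "Pow1 l \<in> conds A B \<longleftrightarrow> l \<in> A" "Pow2 l \<in> conds A B \<longleftrightarrow> l \<in> A"
  "Free Q \<in> conds A B \<longleftrightarrow> Q \<in> B"
  by (auto simp: conds_def)

lemma conds_Int: "conds A B \<inter> conds A' B' = conds (A \<inter> A') (B \<inter> B')"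
  by (auto simp: conds_def)

lemma conds_empty: "conds {} {} = {}"
  by (simp add: conds_def)

text \<open>The indices 0, 1 and 2 belong to \<open>k\<close> and \<open>g\<close>, to
  \<open>P\<close> and \<open>G\<close>, and to \<open>L\<close> and \<open>H\<close>. Each prime
  yields two conditions, for \<alpha> and for \<open>f(\<alpha>)\<close>, which explains the squares
  and the factors 2.\<close>

theorem sieve:
  assumes A: "prime_factors (N - 1) = A0 \<union> A1 \<union> A2" "A0 \<inter> A1 = {}" "A0 \<inter> A2 = {}" "A1 \<inter> A2 = {}"
    and B: "monic_irreducible_factors xm1 = B0 \<union> B1 \<union> B2" "B0 \<inter> B1 = {}" "B0 \<inter> B2 = {}" "B1 \<inter> B2 = {}"
    and \<delta>: "\<delta> = 1 - 2 * (\<Sum>l\<in>A1. 1 / real l) - (\<Sum>Q\<in>B1. 1 / real q ^ degree Q)"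
    and \<epsilon>1: "\<epsilon>1 = (\<Sum>l\<in>A2. 1 / real l)" and \<epsilon>2: "\<epsilon>2 = (\<Sum>Q\<in>B2. 1 / real q ^ degree Q)"
    and \<Theta>: "\<Theta> = (\<Prod>l\<in>A0. 1 - 1 / real l)\<^sup>2 * (\<Prod>Q\<in>B0. 1 - 1 / real q ^ degree Q)"
    and W: "W = (2 ^ card A0)\<^sup>2 * 2 ^ card B0"
    and pos: "\<delta> * \<Theta> - (2 * \<epsilon>1 + \<epsilon>2) > 0"
    and bound: "sqrt (real N) / real q * (\<delta> * \<Theta> - (2 * \<epsilon>1 + \<epsilon>2)) >
      (real n + 2) * (\<Theta> * W * (2 * real (card A1) + real (card B1) - 1 + 2 * \<delta>) + (real (card A2) - \<epsilon>1))
      + 2 * (real (card B2) - \<epsilon>2) + real n / sqrt (real N) * (real (card A2) + real (card B2) - \<epsilon>1 - \<epsilon>2)"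
  shows "\<exists>\<alpha>\<in>dom. \<forall>\<kappa>\<in>conditions. holds \<kappa> \<alpha>"
proof -
  have finA: "finite A0" "finite A1" "finite A2"
    using A(1) by (metis finite_Un finite_set_mset)+
  have finB: "finite B0" "finite B1" "finite B2"
    using B(1) finite_monic_irreducible_factors[OF xm1_nonzero] by (metis finite_Un)+
  define K0 K1 K2 where "K0 = conds A0 B0" and "K1 = conds A1 B1" and "K2 = conds A2 B2"
  note K_defs = K0_def K1_def K2_def
  have fin: "finite K0" "finite K1" "finite K2" by (simp_all add: K_defs finite_conds finA finB)
  have all: "conditions = insert Tr (K0 \<union> K1 \<union> K2)"
    unfolding conditions_def A(1) B(1) K_defs conds_def by blast
  have disj: "K0 \<inter> K1 = {}" "K0 \<inter> K2 = {}" "K1 \<inter> K2 = {}"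
    by (simp_all add: K_defs conds_Int A B conds_empty)
  have Tr: "Tr \<notin> K0" "Tr \<notin> K1" "Tr \<notin> K2" by (simp_all add: K_defs)
  define KT where "KT = insert Tr K0"
  have KT: "finite KT" "KT \<subseteq> conditions" using fin by (auto simp: KT_def all)
  define b where "b = (real n + 2) * sqrt (real N)"
  define cnt where "cnt = expansion.count"
  define S where "S = sqrt (real N)"
  have S: "S > 0" "S \<ge> 1" "S * S = real N" using q_gt_1 by (simp_all add: S_def)
  have prod\<theta>: "(\<Prod>\<kappa>\<in>K0. \<theta> \<kappa>) = \<Theta>"
    by (simp add: K0_def prod_conds finA finB \<Theta> power2_eq_square prod.distrib)
  have "\<theta> \<kappa> \<ge> 0" if "\<kappa> \<in> K0 \<union> K1 \<union> K2" for \<kappa> using that by (intro expansion.\<theta>_nonneg) (auto simp: all)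
  note \<theta>_nonneg = this
  have \<Theta>0: "\<Theta> \<ge> 0" unfolding prod\<theta>[symmetric] by (intro prod_nonneg) (use \<theta>_nonneg in blast)
  have \<epsilon>0: "\<epsilon>1 \<ge> 0" "\<epsilon>2 \<ge> 0" by (simp_all add: \<epsilon>1 \<epsilon>2 sum_nonneg)
  have \<delta>0: "\<delta> > 0"
  proof (rule ccontr)
    assume "\<not> ?thesis"
    then have "\<delta> * \<Theta> \<le> 0" using \<Theta>0 by (intro mult_nonpos_nonneg) auto
    then show False using pos \<epsilon>0 by linarith
  qed
  have tot: "(\<Prod>\<kappa>\<in>KT. expansion.total \<kappa>) = W * \<Theta>"
  proof -
    have "(\<Prod>\<kappa>\<in>K0. expansion.total \<kappa>) = (\<Prod>\<kappa>\<in>K0. 2 * \<theta> \<kappa>)"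
      using Tr(1) by (intro prod.cong refl total_nonTr) (auto simp: all)
    also have "\<dots> = 2 ^ card K0 * \<Theta>" by (simp add: prod.distrib prod\<theta>)
    also have "2 ^ card K0 = W"
      by (simp add: K0_def card_conds finA finB W power_add power_mult mult.commute)
    finally show ?thesis using fin(1) Tr(1) by (simp add: KT_def total_Tr)
  qed
  have \<theta>KT: "(\<Prod>\<kappa>\<in>KT. \<theta> \<kappa>) = \<Theta> / real q" using fin(1) Tr(1) by (simp add: KT_def prod\<theta>)
  have b_bound: "norm (expansion.char_sum K g) \<le> b"
    if "finite K" "K \<subseteq> conditions" "g \<in> PiE K idx" "\<exists>\<kappa>\<in>K. g \<kappa> \<noteq> (0, 0)" for K g
    using char_sum_bound[OF that] by (simp add: b_def add.commute)

  have base: "cnt KT \<ge> \<Theta> * real N / real q - b * W * \<Theta>"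
  proof -
    have "\<bar>cnt KT - \<Theta> / real q * card dom\<bar> \<le> b * (W * \<Theta> - \<Theta> / real q)"
      using expansion.count_main_term[OF KT b_bound[OF KT]] unfolding cnt_def tot \<theta>KT .
    then have "cnt KT \<ge> \<Theta> / real q * (real (card dom) + b) - b * W * \<Theta>" by (simp add: algebra_simps)
    \<comment> \<open>At most \<open>n + 1\<close> elements lie outside \<open>dom\<close>, and
      \<open>b \<ge> n + 2\<close>. The part of the error that is saved by excluding the trivial
      character pays for them.\<close>
    moreover have "\<Theta> / real q * (real (card dom) + b) \<ge> \<Theta> / real q * real N"
    proof (rule mult_left_mono)
      have "(real n + 2) * 1 \<le> b" unfolding b_def S_def[symmetric] using S(2) by (intro mult_left_mono) auto
      then show "real N \<le> real (card dom) + b" using card_dom by (simp only: mult_1_right)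
    qed (use \<Theta>0 in simp)
    ultimately show ?thesis by simp
  qed

  \<comment> \<open>The error has a factor \<open>\<theta> \<kappa>\<close> because the nontrivial
    coefficients at \<kappa> have total absolute value \<open>\<theta> \<kappa>\<close>.\<close>
  have medium: "cnt (insert \<kappa> KT) \<ge> \<theta> \<kappa> * cnt KT - b * (W * \<Theta>) * \<theta> \<kappa>" if \<kappa>: "\<kappa> \<in> K1" for \<kappa>
  proof -
    have \<kappa>': "\<kappa> \<in> conditions" "\<kappa> \<noteq> Tr" "\<kappa> \<notin> KT" using \<kappa> Tr disj by (auto simp: all KT_def)
    have "\<bar>cnt (insert \<kappa> KT) - \<theta> \<kappa> * cnt KT\<bar> \<le> b * (expansion.total \<kappa> - \<theta> \<kappa>) * (\<Prod>\<kappa>\<in>KT. expansion.total \<kappa>)"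
      unfolding cnt_def
    proof (rule expansion.count_insert[OF KT \<kappa>'(1,3)])
      fix g assume "g \<in> PiE (insert \<kappa> KT) idx" "g \<kappa> \<noteq> (0, 0)"
      then show "norm (expansion.char_sum (insert \<kappa> KT) g) \<le> b"
        using KT \<kappa>' by (intro b_bound) auto
    qed
    then have "\<bar>cnt (insert \<kappa> KT) - \<theta> \<kappa> * cnt KT\<bar> \<le> b * \<theta> \<kappa> * (W * \<Theta>)"
      unfolding tot total_nonTr[OF \<kappa>'(1,2)] by simp
    then show ?thesis by (simp add: algebra_simps abs_le_iff)
  qed

  \<comment> \<open>The elements with the right trace that violate \<kappa>. Without the conditions
    from \<open>K0\<close> no factor \<open>W\<close> enters, and the finer bound \<open>err\<close>
    applies.\<close>
  have large: "cnt {Tr} - cnt {\<kappa>, Tr} \<le> (1 - \<theta> \<kappa>) * (real N / real q) + err \<kappa> * \<theta> \<kappa>" if \<kappa>: "\<kappa> \<in> K2" for \<kappa>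
  proof -
    have \<kappa>': "\<kappa> \<in> conditions" "\<kappa> \<noteq> Tr" using \<kappa> Tr by (auto simp: all)
    have "\<bar>cnt {\<kappa>, Tr} - \<theta> \<kappa> * cnt {Tr}\<bar> \<le> err \<kappa> * (expansion.total \<kappa> - \<theta> \<kappa>) * (\<Prod>\<kappa>\<in>{Tr}. expansion.total \<kappa>)"
      unfolding cnt_def using \<kappa>' by (intro expansion.count_insert char_sum_bound_pair) (auto simp: all)
    then have "\<bar>cnt {\<kappa>, Tr} - \<theta> \<kappa> * cnt {Tr}\<bar> \<le> err \<kappa> * \<theta> \<kappa>"
      unfolding total_nonTr[OF \<kappa>'(1,2)] by (simp add: total_Tr)
    moreover have "(1 - \<theta> \<kappa>) * cnt {Tr} \<le> (1 - \<theta> \<kappa>) * (real N / real q)"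
    proof (rule mult_left_mono)
      show "cnt {Tr} \<le> real N / real q" unfolding cnt_def by (rule count_Tr_le)
      show "0 \<le> 1 - \<theta> \<kappa>" using \<kappa>'(2) by (cases \<kappa>) auto
    qed
    ultimately show ?thesis by (simp add: algebra_simps abs_le_iff)
  qed

  have "cnt conditions \<ge> (\<Sum>\<kappa>\<in>K1. cnt (insert \<kappa> KT)) - (real (card K1) - 1) * cnt KT
      - (\<Sum>\<kappa>\<in>K2. cnt {Tr} - cnt {\<kappa>, Tr})"
  proof -
    let ?\<rho> = "\<lambda>\<alpha> \<kappa>. of_bool (holds \<kappa> \<alpha>) :: real"
    have "(\<Sum>\<alpha>\<in>dom. ?\<rho> \<alpha> Tr * ((\<Sum>\<kappa>\<in>K1. ?\<rho> \<alpha> \<kappa> * (\<Prod>\<kappa>\<in>K0. ?\<rho> \<alpha> \<kappa>)) -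
        (real (card K1) - 1) * (\<Prod>\<kappa>\<in>K0. ?\<rho> \<alpha> \<kappa>) - (\<Sum>\<kappa>\<in>K2. 1 - ?\<rho> \<alpha> \<kappa>)))
      \<le> (\<Sum>\<alpha>\<in>dom. ?\<rho> \<alpha> Tr * ((\<Prod>\<kappa>\<in>K0. ?\<rho> \<alpha> \<kappa>) * (\<Prod>\<kappa>\<in>K1. ?\<rho> \<alpha> \<kappa>) * (\<Prod>\<kappa>\<in>K2. ?\<rho> \<alpha> \<kappa>)))"
      by (intro sum_mono mult_left_mono sieve_pointwise fin) auto
    also have "\<dots> = cnt conditions"
      unfolding cnt_def expansion.count_def all
    proof (intro sum.cong refl)
      fix \<alpha>
      have "(K0 \<union> K1) \<inter> K2 = {}" using disj by blast
      then show "?\<rho> \<alpha> Tr * ((\<Prod>\<kappa>\<in>K0. ?\<rho> \<alpha> \<kappa>) * (\<Prod>\<kappa>\<in>K1. ?\<rho> \<alpha> \<kappa>) * (\<Prod>\<kappa>\<in>K2. ?\<rho> \<alpha> \<kappa>))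
        = prod (?\<rho> \<alpha>) (insert Tr (K0 \<union> K1 \<union> K2))"
        using fin disj Tr by (simp add: prod.union_disjoint)
    qed
    also have "(\<Sum>\<alpha>\<in>dom. ?\<rho> \<alpha> Tr * ((\<Sum>\<kappa>\<in>K1. ?\<rho> \<alpha> \<kappa> * (\<Prod>\<kappa>\<in>K0. ?\<rho> \<alpha> \<kappa>)) -
        (real (card K1) - 1) * (\<Prod>\<kappa>\<in>K0. ?\<rho> \<alpha> \<kappa>) - (\<Sum>\<kappa>\<in>K2. 1 - ?\<rho> \<alpha> \<kappa>))) =
      (\<Sum>\<kappa>\<in>K1. cnt (insert \<kappa> KT)) - (real (card K1) - 1) * cnt KT - (\<Sum>\<kappa>\<in>K2. cnt {Tr} - cnt {\<kappa>, Tr})"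
    proof -
      have ins: "cnt (insert \<kappa> KT) = (\<Sum>\<alpha>\<in>dom. ?\<rho> \<alpha> Tr * (?\<rho> \<alpha> \<kappa> * (\<Prod>\<kappa>\<in>K0. ?\<rho> \<alpha> \<kappa>)))" if "\<kappa> \<in> K1" for \<kappa>
      proof -
        have "\<kappa> \<noteq> Tr" "\<kappa> \<notin> K0" using that disj Tr by auto
        then show ?thesis using fin(1) Tr(1)
          unfolding cnt_def expansion.count_def KT_def by (intro sum.cong refl) (simp add: mult_ac)
      qed
      have pair: "cnt {Tr} - cnt {\<kappa>, Tr} = (\<Sum>\<alpha>\<in>dom. ?\<rho> \<alpha> Tr * (1 - ?\<rho> \<alpha> \<kappa>))" if "\<kappa> \<in> K2" for \<kappa>
      proof -
        have "\<kappa> \<noteq> Tr" using that Tr by auto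
        then show ?thesis unfolding cnt_def expansion.count_def
          by (simp add: right_diff_distrib sum_subtractf mult.commute)
      qed
      have "cnt KT = (\<Sum>\<alpha>\<in>dom. ?\<rho> \<alpha> Tr * (\<Prod>\<kappa>\<in>K0. ?\<rho> \<alpha> \<kappa>))"
        using fin(1) Tr(1) by (simp add: cnt_def expansion.count_def KT_def)
      moreover have "(\<Sum>\<kappa>\<in>K1. cnt (insert \<kappa> KT)) = (\<Sum>\<alpha>\<in>dom. ?\<rho> \<alpha> Tr * (\<Sum>\<kappa>\<in>K1. ?\<rho> \<alpha> \<kappa> * (\<Prod>\<kappa>\<in>K0. ?\<rho> \<alpha> \<kappa>)))"
        unfolding sum_distrib_left by (subst sum.swap) (intro sum.cong refl ins)
      moreover have "(\<Sum>\<kappa>\<in>K2. cnt {Tr} - cnt {\<kappa>, Tr}) = (\<Sum>\<alpha>\<in>dom. ?\<rho> \<alpha> Tr * (\<Sum>\<kappa>\<in>K2. 1 - ?\<rho> \<alpha> \<kappa>))"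
        unfolding sum_distrib_left by (subst sum.swap) (intro sum.cong refl pair)
      ultimately show ?thesis
        by (simp only: sum_distrib_left[of "real (card K1) - 1"] right_diff_distrib sum_subtractf mult.left_commute)
    qed
    finally show ?thesis .
  qed
  moreover have "(\<Sum>\<kappa>\<in>K1. cnt (insert \<kappa> KT)) \<ge> (\<Sum>\<kappa>\<in>K1. \<theta> \<kappa>) * cnt KT - b * (W * \<Theta>) * (\<Sum>\<kappa>\<in>K1. \<theta> \<kappa>)"
    unfolding sum_distrib_right sum_distrib_left sum_subtractf[symmetric] by (intro sum_mono medium)
  moreover have "(\<Sum>\<kappa>\<in>K2. cnt {Tr} - cnt {\<kappa>, Tr}) \<le> (2 * \<epsilon>1 + \<epsilon>2) * (real N / real q)
      + (real (card A2) - \<epsilon>1) * (S + real n + (real n + 1) * S) + (real (card B2) - \<epsilon>2) * (2 * S + real n)"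
  proof -
    have "(\<Sum>\<kappa>\<in>K2. cnt {Tr} - cnt {\<kappa>, Tr}) \<le> (\<Sum>\<kappa>\<in>K2. (1 - \<theta> \<kappa>) * (real N / real q) + err \<kappa> * \<theta> \<kappa>)"
      by (intro sum_mono large)
    also have "\<dots> = (\<Sum>\<kappa>\<in>K2. 1 - \<theta> \<kappa>) * (real N / real q) + (\<Sum>\<kappa>\<in>K2. err \<kappa> * \<theta> \<kappa>)"
      by (simp only: sum.distrib sum_distrib_right)
    also have "(\<Sum>\<kappa>\<in>K2. 1 - \<theta> \<kappa>) = 2 * \<epsilon>1 + \<epsilon>2"
      by (simp add: K2_def sum_conds finA finB \<epsilon>1 \<epsilon>2 sum_distrib_left)
    also have "(\<Sum>\<kappa>\<in>K2. err \<kappa> * \<theta> \<kappa>) = (S + real n + (real n + 1) * S) * (\<Sum>l\<in>A2. 1 - 1 / real l) + (2 * S + real n) * (\<Sum>Q\<in>B2. 1 - 1 / real q ^ degree Q)"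
      by (simp add: K2_def sum_conds finA finB S_def sum_distrib_left distrib_right add.commute mult.assoc)
    also have "(\<Sum>l\<in>A2. 1 - 1 / real l) = real (card A2) - \<epsilon>1" by (simp add: \<epsilon>1 sum_subtractf)
    also have "(\<Sum>Q\<in>B2. 1 - 1 / real q ^ degree Q) = real (card B2) - \<epsilon>2" by (simp add: \<epsilon>2 sum_subtractf)
    finally show ?thesis by (simp add: mult.commute)
  qed
  \<comment> \<open>This is the origin of \<delta>: it becomes the coefficient of
    \<open>cnt KT\<close>. The errors of \<open>medium\<close> and \<open>base\<close> then add up
    to \<open>b * W * \<Theta>\<close> times \<open>card K1 - 1 + 2 * \<delta>\<close>.\<close>
  moreover have "(\<Sum>\<kappa>\<in>K1. \<theta> \<kappa>) = real (card K1) - 1 + \<delta>"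
    by (simp add: K1_def sum_conds card_conds finA finB \<delta> sum_subtractf sum.distrib sum_distrib_left)
  moreover have cardK1: "real (card K1) = 2 * real (card A1) + real (card B1)"
    by (simp add: K1_def card_conds finA finB)
  moreover have "\<delta> * cnt KT \<ge> \<delta> * (\<Theta> * real N / real q - b * W * \<Theta>)" using base \<delta>0 by (intro mult_left_mono) auto
  ultimately have "cnt conditions \<ge> \<delta> * (\<Theta> * real N / real q - b * W * \<Theta>)
      - b * (W * \<Theta>) * (2 * real (card A1) + real (card B1) - 1 + \<delta>)
      - ((2 * \<epsilon>1 + \<epsilon>2) * (real N / real q)
        + (real (card A2) - \<epsilon>1) * (S + real n + (real n + 1) * S) + (real (card B2) - \<epsilon>2) * (2 * S + real n))"
    by (simp add: algebra_simps)
  \<comment> \<open>The errors of \<open>Pow1\<close> and \<open>Pow2\<close> together are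
    \<open>(n + 2) * S + n\<close> per prime, that of \<open>Free\<close> is
    \<open>2 * S + n\<close>. Taking out a factor \<open>S\<close> yields exactly the quantity in
    the hypothesis.\<close>
  also have "\<delta> * (\<Theta> * real N / real q - b * W * \<Theta>)
      - b * (W * \<Theta>) * (2 * real (card A1) + real (card B1) - 1 + \<delta>)
      - ((2 * \<epsilon>1 + \<epsilon>2) * (real N / real q)
        + (real (card A2) - \<epsilon>1) * (S + real n + (real n + 1) * S) + (real (card B2) - \<epsilon>2) * (2 * S + real n))
    = S * (S / real q * (\<delta> * \<Theta> - (2 * \<epsilon>1 + \<epsilon>2)) -
      ((real n + 2) * (\<Theta> * W * (2 * real (card A1) + real (card B1) - 1 + 2 * \<delta>) + (real (card A2) - \<epsilon>1))
      + 2 * (real (card B2) - \<epsilon>2) + real n / S * (real (card A2) + real (card B2) - \<epsilon>1 - \<epsilon>2)))"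
    using S(1) q_gt_1 unfolding b_def S_def[symmetric] S(3)[symmetric] by (simp add: field_simps)
  finally have "cnt conditions > 0"
    using bound S(1) unfolding S_def[symmetric]
    by (smt (verit, ccfv_SIG) mult_pos_pos)
  then obtain \<alpha> where \<alpha>: "\<alpha> \<in> dom" "(\<Prod>\<kappa>\<in>conditions. of_bool (holds \<kappa> \<alpha>) :: real) \<noteq> 0"
    unfolding cnt_def expansion.count_def by (metis (no_types, lifting) less_irrefl sum.neutral)
  have "finite conditions" using fin by (simp add: all)
  then have "\<forall>\<kappa>\<in>conditions. holds \<kappa> \<alpha>" using \<alpha>(2) by (auto simp: prod_zero_iff)
  with \<alpha>(1) show ?thesis by blast
qed

end

section \<open>Squarefree factorizations and Euler's functions\<close>

lemma not_square_dvd_prod_primes: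
  fixes p :: "'a::idom"
  assumes S: "finite S" "\<And>x. x \<in> S \<Longrightarrow> prime_elem x" "\<And>x y. x \<in> S \<Longrightarrow> y \<in> S \<Longrightarrow> x dvd y \<Longrightarrow> x = y"
    and p: "p \<in> S"
  shows "\<not> p * p dvd \<Prod>S"
proof
  assume "p * p dvd \<Prod>S"
  also have "\<Prod>S = p * \<Prod>(S - {p})" using S(1) p by (rule prod.remove)
  finally have "p dvd \<Prod>(S - {p})" using S(2)[OF p] by (simp add: prime_elem_def)
  then have "\<exists>x\<in>S - {p}. p dvd x" using S(1) by (intro prime_elem_dvd_prod[OF _ S(2)[OF p]]) auto
  then show False using S(3) p by blast
qed

text \<open>Formulated with a set of prime representatives so as to serve integers and polynomials
  alike. A prime dividing two of the three factors would divide a product of distinct primes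
  twice.\<close>

lemma prime_divisors_of_squarefree_factorization:
  fixes a b c :: "'a::idom"
  assumes prime: "\<And>x. x \<in> \<P> \<Longrightarrow> prime_elem x" and eq: "\<And>x y. x \<in> \<P> \<Longrightarrow> y \<in> \<P> \<Longrightarrow> x dvd y \<Longrightarrow> x = y"
    and S: "finite S" "S \<subseteq> \<P>" and abc: "\<Prod>S = a * b * c"
  defines "D \<equiv> \<lambda>x. {p \<in> \<P>. p dvd x}"
  shows "S = D a \<union> D b \<union> D c" and "D a \<inter> D b = {}" and "D a \<inter> D c = {}" and "D b \<inter> D c = {}"
proof -
  have in_S: "p \<in> S" if p: "p \<in> \<P>" "p dvd \<Prod>S" for p
  proof -
    have "\<exists>x\<in>S. p dvd x" using p(2) by (rule prime_elem_dvd_prod[OF S(1) prime[OF p(1)]])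
    then show ?thesis using eq[OF p(1)] S(2) by blast
  qed
  show "S = D a \<union> D b \<union> D c"
  proof
    show "S \<subseteq> D a \<union> D b \<union> D c"
    proof
      fix p assume p: "p \<in> S"
      have "p dvd a * b * c" using dvd_prodI[OF S(1) p, of "\<lambda>x. x"] abc by simp
      then show "p \<in> D a \<union> D b \<union> D c"
        using prime p S(2) unfolding D_def by (auto simp: prime_elem_dvd_mult_iff)
    qed
    show "D a \<union> D b \<union> D c \<subseteq> S" using in_S unfolding D_def abc by auto
  qed
  have no: "\<not> (p dvd x \<and> p dvd y)" if p: "p \<in> \<P>" and xy: "x * y dvd \<Prod>S" for p x y
  proof
    assume xy': "p dvd x \<and> p dvd y"
    then have "p * p dvd \<Prod>S" using mult_dvd_mono[of p x p y] dvd_trans xy by metis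
    moreover have "p \<in> S" using in_S[OF p] xy xy' by (metis dvd_trans dvd_triv_left)
    ultimately show False
      using not_square_dvd_prod_primes[OF S(1)] prime eq S(2) by (metis subsetD)
  qed
  have "a * b dvd \<Prod>S" "a * c dvd \<Prod>S" "b * c dvd \<Prod>S"
    unfolding abc by (simp_all add: mult_dvd_mono mult.assoc)
  then show "D a \<inter> D b = {}" "D a \<inter> D c = {}" "D b \<inter> D c = {}"
    using no unfolding D_def by blast+
qed

text \<open>Induction on the set of primes. Reduced polynomials modulo \<open>M * Q\<close> are
  \<open>r + M * t\<close>, and avoiding the primes of \<open>B\<close> is a condition on
  \<open>r\<close> only. Those divisible by \<open>Q\<close> are \<open>Q\<close> times the
  solutions for \<open>M\<close>; removing them gives the factor
  \<open>CARD('f) ^ degree Q - 1\<close>.\<close>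

lemma card_reduced_coprime:
  fixes B :: "'f::finite_field poly set"
  assumes "finite B" "B \<subseteq> monic_irreducibles"
  shows "finite {a. a div \<Prod>B = 0 \<and> (\<forall>Q\<in>B. \<not> Q dvd a)}"
    and "real (card {a. a div \<Prod>B = 0 \<and> (\<forall>Q\<in>B. \<not> Q dvd a)}) = (\<Prod>Q\<in>B. real CARD('f) ^ degree Q - 1)"
proof -
  have fin: "finite {a. a div M = 0}" if M: "M \<noteq> 0" for M :: "'f poly"
  proof (rule finite_subset[OF _ finite_polys_degree_le[of "degree M"]])
    show "{a. a div M = 0} \<subseteq> {P. degree P \<le> degree M}" using M by (auto simp: div_poly_eq_0_iff)
  qed
  have nz: "\<Prod>B \<noteq> 0" if "finite B" "B \<subseteq> monic_irreducibles" for B :: "'f poly set"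
    using that monic_prod_monic_irreducibles[of B] by force
  show "finite {a. a div \<Prod>B = 0 \<and> (\<forall>Q\<in>B. \<not> Q dvd a)}"
    using fin[OF nz[OF assms]] by (rule finite_subset[rotated]) blast
  show "real (card {a. a div \<Prod>B = 0 \<and> (\<forall>Q\<in>B. \<not> Q dvd a)}) = (\<Prod>Q\<in>B. real CARD('f) ^ degree Q - 1)"
    using assms
  proof (induction B rule: finite_induct)
    case empty
    have "{a :: 'f poly. a div 1 = 0} = {0}" by simp
    then show ?case by simp
  next
    case (insert Q B)
    have Q: "Q \<in> monic_irreducibles" and B: "B \<subseteq> monic_irreducibles" using insert.prems by auto
    define M where "M = \<Prod>B"
    have M: "M \<noteq> 0" unfolding M_def using insert.hyps(1) B by (rule nz)
    have Q0: "Q \<noteq> 0" using Q by (rule monic_irreducible_nonzero)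
    define C where "C = {a. a div M = 0 \<and> (\<forall>Q\<in>B. \<not> Q dvd a)}"
    define R where "R = {t. t div Q = 0}"
    define C' where "C' = {a. a div (M * Q) = 0 \<and> (\<forall>Q\<in>B. \<not> Q dvd a)}"
    have finR: "finite R" unfolding R_def using Q0 by (rule fin)
    have cardR: "card R = CARD('f) ^ degree Q"
    proof -
      have "R = {t. degree t < degree Q}"
        using monic_irreducible_degree_pos[OF Q] Q0 by (auto simp: R_def div_poly_eq_0_iff)
      then show ?thesis using card_polys_degree_less[OF monic_irreducible_degree_pos[OF Q]] by simp
    qed
    have C_bij: "bij_betw (\<lambda>(r, t). r + M * t) (C \<times> R) C'"
    proof (rule bij_betwI[where g = "\<lambda>a. (a mod M, a div M)"])
      have dvdM: "Q' dvd M" if "Q' \<in> B" for Q' unfolding M_def using insert.hyps(1) that by (rule dvd_prodI[where f = "\<lambda>x. x"])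
      show "(\<lambda>(r, t). r + M * t) \<in> C \<times> R \<rightarrow> C'"
        using M dvdM by (auto simp: C_def R_def C'_def poly_div_mult_right dvd_add_left_iff)
      show "(\<lambda>a. (a mod M, a div M)) \<in> C' \<rightarrow> C \<times> R"
        using M dvdM by (auto simp: C_def R_def C'_def poly_div_mult_right dvd_mod_iff)
      show "(\<lambda>a. (a mod M, a div M)) (case x of (r, t) \<Rightarrow> r + M * t) = x" if "x \<in> C \<times> R" for x
      proof (cases x)
        case (Pair r t)
        then have "r div M = 0" using that by (simp add: C_def)
        moreover from this have "r mod M = r" by (metis add_0 div_mult_mod_eq mult_zero_left)
        ultimately show ?thesis using M by (simp add: Pair)
      qed
      show "(case (a mod M, a div M) of (r, t) \<Rightarrow> r + M * t) = a" for a by simp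
    qed
    have D_bij: "bij_betw ((*) Q) C {a \<in> C'. Q dvd a}"
    proof (rule bij_betwI[where g = "\<lambda>a. a div Q"])
      have "\<not> Q' dvd Q" if "Q' \<in> B" for Q'
        using monic_irreducible_dvd_imp_eq that B Q insert.hyps(2) by blast
      then have "Q' dvd Q * a \<longleftrightarrow> Q' dvd a" if "Q' \<in> B" for Q' a
        using prime_elem_dvd_mult_iff[OF monic_irreducible_prime] that B by blast
      moreover have "Q * a div (M * Q) = a div M" for a using Q0 by (simp add: mult.commute[of M])
      ultimately show "(*) Q \<in> C \<rightarrow> {a \<in> C'. Q dvd a}" "(\<lambda>a. a div Q) \<in> {a \<in> C'. Q dvd a} \<rightarrow> C"
        using Q0 by (auto simp: C_def C'_def elim!: dvdE)
    qed (use Q0 in auto)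
    have finC: "finite C" unfolding C_def using fin[OF M] by (rule finite_subset[rotated]) blast
    have "card C' = card C * CARD('f) ^ degree Q"
      using bij_betw_same_card[OF C_bij] by (simp add: card_cartesian_product cardR)
    moreover have finC': "finite C'" using bij_betw_finite[OF C_bij] finC finR by simp
    moreover have "card {a \<in> C'. Q dvd a} = card C" using bij_betw_same_card[OF D_bij] by simp
    moreover have "{a. a div \<Prod>(insert Q B) = 0 \<and> (\<forall>Q\<in>insert Q B. \<not> Q dvd a)} = C' - {a \<in> C'. Q dvd a}"
      using insert.hyps by (auto simp: C'_def M_def mult.commute)
    moreover have "card (C' - {a \<in> C'. Q dvd a}) + card {a \<in> C'. Q dvd a} = card C'"
      using finC' card_mono[OF finC', of "{a \<in> C'. Q dvd a}"] by (subst card_Diff_subset) auto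
    ultimately have "real (card {a. a div \<Prod>(insert Q B) = 0 \<and> (\<forall>Q\<in>insert Q B. \<not> Q dvd a)})
        = real (card C) * (real CARD('f) ^ degree Q - 1)"
      by (simp add: algebra_simps flip: of_nat_power of_nat_mult of_nat_add)
    then show ?case using insert B by (simp add: C_def M_def mult.commute)
  qed
qed

text \<open>By Bezout, a residue is a unit precisely when no prime factor of the modulus divides it,
  so the units are the elements counted by induction above.\<close>

lemma Theta_poly_eq:
  fixes B :: "'f::finite_field poly set"
  assumes B: "finite B" "B \<subseteq> monic_irreducibles"
  shows "Theta_poly (\<Prod>B) = (\<Prod>Q\<in>B. 1 - 1 / real CARD('f) ^ degree Q)"
proof -
  have nz: "\<Prod>B \<noteq> 0" using B monic_prod_monic_irreducibles[of B] by force
  have unit_iff: "(\<exists>b. (a * b) mod \<Prod>B = 1 mod \<Prod>B) \<longleftrightarrow> (\<forall>Q\<in>B. \<not> Q dvd a)" for a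
  proof safe
    fix b Q assume b: "(a * b) mod \<Prod>B = 1 mod \<Prod>B" and Q: "Q \<in> B" "Q dvd a"
    have "\<Prod>B dvd a * b - 1" using b by (simp add: mod_eq_dvd_iff)
    moreover have "Q dvd \<Prod>B" using B(1) Q(1) by (rule dvd_prodI[where f = "\<lambda>x. x"])
    ultimately have "Q dvd a * b - 1" by (metis dvd_trans)
    moreover have "Q dvd a * b" using Q(2) by simp
    ultimately have "Q dvd 1" by (metis dvd_diff_right_iff)
    then show False using Q(1) B(2) monic_irreducible_prime prime_elem_not_unit by blast
  next
    assume no: "\<forall>Q\<in>B. \<not> Q dvd a"
    have "\<not> Q dvd \<Prod>B" if Q: "Q \<in> monic_irreducibles" "Q dvd a" for Q
    proof
      assume "Q dvd \<Prod>B"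
      then have "\<exists>Q'\<in>B. Q dvd Q'" by (rule prime_elem_dvd_prod[OF B(1) monic_irreducible_prime[OF Q(1)]])
      then show False using monic_irreducible_dvd_imp_eq[OF Q(1)] B(2) no Q(2) by blast
    qed
    then obtain b c where "b * a + c * \<Prod>B = 1" using poly_bezout[OF nz] by metis
    then show "\<exists>b. (a * b) mod \<Prod>B = 1 mod \<Prod>B" by (metis mod_mult_self1 mult.commute)
  qed
  have "a mod \<Prod>B = a \<longleftrightarrow> a div \<Prod>B = 0" for a
    using nz by (metis add_cancel_left_left div_mult_mod_eq mult_eq_0_iff)
  then have "real (Phi_poly (\<Prod>B)) = (\<Prod>Q\<in>B. real CARD('f) ^ degree Q - 1)"
    using card_reduced_coprime(2)[OF B] by (simp add: Phi_poly_def unit_iff)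
  moreover have "degree (\<Prod>B) = sum degree B"
    using B monic_irreducible_nonzero by (intro degree_prod_eq_sum_degree) blast
  moreover have "real CARD('f) ^ sum degree B = (\<Prod>Q\<in>B. real CARD('f) ^ degree Q)" by (simp add: power_sum)
  ultimately show ?thesis
    by (simp add: Theta_poly_def diff_divide_distrib flip: prod_dividef)
qed

context sieve_setup
begin

lemma holds_all_conditions:
  assumes \<alpha>: "\<alpha> \<in> dom" and all: "\<And>\<kappa>. \<kappa> \<in> conditions \<Longrightarrow> holds \<kappa> \<alpha>"
  shows "normal_element q m \<alpha>" and "primitive_pair \<alpha> (Fract f1 f2)" and "field_trace q m (inverse \<alpha>) = a"
proof -
  show "field_trace q m (inverse \<alpha>) = a" using all[of Tr] by (simp add: conditions_def)
  show "normal_element q m \<alpha>"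
    using all[of "Free _"] by (intro normal_elementI) (simp add: conditions_def)
  have l: "l \<in> prime_factors (N - 1)" if "prime l" "l dvd CARD('k) - 1" for l
    using that N_gt_1 unfolding card_N in_prime_factors_iff by simp
  have "primitive_element \<alpha>"
    using all[of "Pow1 _"] l dom_nonzero[OF \<alpha>] by (intro primitive_elementI) (auto simp: conditions_def)
  moreover have "primitive_element (val \<alpha>)"
    using all[of "Pow2 _"] l dom_nonzero[OF \<alpha>] by (intro primitive_elementI) (auto simp: conditions_def)
  moreover have "reduced_form (Fract f1 f2) f1 f2" using red by (simp add: reduced_form_def)
  moreover have "poly f2 \<alpha> \<noteq> 0" using \<alpha> by (simp add: dom_def)
  ultimately show "primitive_pair \<alpha> (Fract f1 f2)" unfolding primitive_pair_def val_def by blast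
qed

end

lemma theta_nat_eq: "k > 0 \<Longrightarrow> theta_nat k = (\<Prod>p\<in>prime_factors k. 1 - 1 / real p)"
  by (simp add: theta_nat_def totient_formula2)

text \<open>The factorization is carried over to the integers, where the general statement for
  integral domains applies, and the prime factors are brought back along \<open>int\<close>.\<close>

lemma prime_factors_nat_rad_factorization:
  assumes "n > 0" and rad: "nat_rad n = k * P * L"
  shows "k > 0" "prime_factors n = prime_factors k \<union> prime_factors P \<union> prime_factors L"
    "prime_factors k \<inter> prime_factors P = {}" "prime_factors k \<inter> prime_factors L = {}"
    "prime_factors P \<inter> prime_factors L = {}"
proof -
  let ?S = "int ` prime_factors n" and ?\<P> = "{p :: int. prime p}"
  have "nat_rad n > 0" unfolding nat_rad_def by (intro prod_pos) (auto simp: in_prime_factors_iff prime_gt_0_nat)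
  then have pos: "k > 0" "P > 0" "L > 0" by (simp_all add: rad)
  then show "k > 0" by simp
  have "\<Prod>?S = int (nat_rad n)" by (simp add: nat_rad_def prod.reindex)
  then have eq: "\<Prod>?S = int k * int P * int L" by (simp add: rad)
  have primes: "prime_elem x" if "x \<in> ?\<P>" for x using that by (blast intro: prime_imp_prime_elem)
  have dvd_eq: "x = y" if "x \<in> ?\<P>" "y \<in> ?\<P>" "x dvd y" for x y using that primes_dvd_imp_eq by blast
  have S: "finite ?S" "?S \<subseteq> ?\<P>" by (auto simp: in_prime_factors_iff)
  have img: "{p \<in> ?\<P>. p dvd int x} = int ` prime_factors x" if "x > 0" for x
  proof
    show "{p \<in> ?\<P>. p dvd int x} \<subseteq> int ` prime_factors x"
    proof
      fix p assume p: "p \<in> {p \<in> ?\<P>. p dvd int x}"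
      then have "int (nat p) = p" using prime_ge_0_int by auto
      show "p \<in> int ` prime_factors x"
      proof (intro image_eqI[of _ _ "nat p"])
        have "prime p" "p dvd int x" using p by auto
        then have "prime (nat p)" "nat p dvd x" using \<open>int (nat p) = p\<close> by (metis prime_int_nat_transfer, metis int_dvd_int_iff)
        then show "nat p \<in> prime_factors x" using that by (simp add: in_prime_factors_iff)
      qed (metis \<open>int (nat p) = p\<close>)
    qed
  qed (use that in \<open>auto simp: in_prime_factors_iff\<close>)
  note D = prime_divisors_of_squarefree_factorization[OF primes dvd_eq S eq, unfolded img[OF pos(1)] img[OF pos(2)] img[OF pos(3)]]
  have inj: "inj int" by (rule inj_of_nat)
  show "prime_factors n = prime_factors k \<union> prime_factors P \<union> prime_factors L"
    using D(1) by (simp only: image_Un[symmetric] inj_image_eq_iff[OF inj])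
  show "prime_factors k \<inter> prime_factors P = {}" "prime_factors k \<inter> prime_factors L = {}" "prime_factors P \<inter> prime_factors L = {}"
    using D(2,3,4) by blast+
qed

text \<open>Besides splitting the set of factors, \<open>g\<close> must be recovered as the product
  of its own irreducible factors, since its Euler function is computed from such a product.\<close>

lemma monic_irreducible_factors_poly_rad_factorization:
  fixes F :: "'f::finite_field poly"
  assumes "F \<noteq> 0" and rad: "poly_rad F = g * G * H" and monic: "lead_coeff g = 1"
  shows "g = \<Prod>(monic_irreducible_factors g)"
    "monic_irreducible_factors F = monic_irreducible_factors g \<union> monic_irreducible_factors G \<union> monic_irreducible_factors H"
    "monic_irreducible_factors g \<inter> monic_irreducible_factors G = {}" "monic_irreducible_factors g \<inter> monic_irreducible_factors H = {}"
    "monic_irreducible_factors G \<inter> monic_irreducible_factors H = {}"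
proof -
  let ?F = "monic_irreducible_factors :: 'f poly \<Rightarrow> 'f poly set"
  have dvd_eq: "x = y" if "x \<in> monic_irreducibles" "y \<in> monic_irreducibles" "x dvd y" for x y :: "'f poly"
    using monic_irreducible_dvd_imp_eq that by blast
  have S: "finite (?F F)" "?F F \<subseteq> monic_irreducibles"
    using finite_monic_irreducible_factors[OF assms(1)] by (auto simp: monic_irreducible_factors_altdef)
  note D = prime_divisors_of_squarefree_factorization[OF monic_irreducible_prime dvd_eq S rad[unfolded poly_rad_def],
      folded monic_irreducible_factors_altdef]
  show un: "?F F = ?F g \<union> ?F G \<union> ?F H" by (rule D(1))
  show disj: "?F g \<inter> ?F G = {}" "?F g \<inter> ?F H = {}" "?F G \<inter> ?F H = {}"
    using D(2-4) by blast+
  have "poly_rad F \<noteq> 0" using monic_poly_rad[of F] by force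
  then have nz: "g \<noteq> 0" "G \<noteq> 0" "H \<noteq> 0" using rad by auto
  have dvd: "\<Prod>(?F P) dvd P" if "P \<noteq> 0" for P
    by (rule prod_monic_irreducibles_dvd[OF finite_monic_irreducible_factors[OF that]])
       (auto simp: monic_irreducible_factors_altdef)
  obtain a where a: "g = \<Prod>(?F g) * a" using dvd[OF nz(1)] by (elim dvdE)
  obtain b where b: "G * H = \<Prod>(?F G \<union> ?F H) * b"
  proof -
    have "\<Prod>(?F G \<union> ?F H) = \<Prod>(?F G) * \<Prod>(?F H)"
      using disj(3) nz finite_monic_irreducible_factors by (intro prod.union_disjoint) auto
    then have "\<Prod>(?F G \<union> ?F H) dvd G * H" using dvd[OF nz(2)] dvd[OF nz(3)] by (simp add: mult_dvd_mono)
    then show ?thesis using that by (elim dvdE)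
  qed
  have split: "\<Prod>(?F F) = \<Prod>(?F g) * \<Prod>(?F G \<union> ?F H)"
    unfolding un Un_assoc using disj nz finite_monic_irreducible_factors by (intro prod.union_disjoint) auto
  have "\<Prod>(?F F) = g * (G * H)" using rad by (simp add: poly_rad_def mult.assoc)
  also have "\<dots> = (\<Prod>(?F g) * a) * (\<Prod>(?F G \<union> ?F H) * b)" by (rule arg_cong2[where f = "(*)", OF a b])
  also have "\<dots> = \<Prod>(?F F) * (a * b)" unfolding split by (simp only: mult_ac)
  \<comment> \<open>The cofactors \<open>a\<close> and \<open>b\<close> have product 1, so
    \<open>a\<close> is constant, and monicity of \<open>g\<close> makes it 1.\<close>
  finally have "\<Prod>(?F F) = \<Prod>(?F F) * (a * b)" .
  moreover have "\<Prod>(?F F) \<noteq> 0" using \<open>poly_rad F \<noteq> 0\<close> by (simp add: poly_rad_def)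
  ultimately have "a * b = 1" by simp
  moreover from this have "a \<noteq> 0" "b \<noteq> 0" by auto
  ultimately have "degree a = 0" using degree_mult_eq[of a b] by simp
  then obtain c where c: "a = [:c:]" by (elim degree_eq_zeroE)
  have "lead_coeff (\<Prod>(?F g)) = 1"
    by (rule monic_prod_monic_irreducibles) (auto simp: monic_irreducible_factors_altdef)
  moreover have "lead_coeff g = lead_coeff (\<Prod>(?F g)) * lead_coeff a" using a lead_coeff_mult by metis
  ultimately have "a = 1" using monic c by (simp add: one_pCons)
  with a show "g = \<Prod>(?F g)" by simp
qed

theorem theorem4p2:
  fixes q m n :: nat
    and k P L :: nat
    and g G H :: "'f::finite_field poly"
    and r s t u :: nat
    and \<delta> \<epsilon>\<^sub>1 \<epsilon>\<^sub>2 :: real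
  assumes "primepow q" and "m \<ge> 3"
    and card_base: "CARD('f) = q"
    and card_ext: "CARD('k::finite_field) = q ^ m"
    and rad_nat: "nat_rad (q ^ m - 1) = k * P * L"
    and k_smallest: "\<forall>p \<in> prime_factors k. \<forall>p' \<in> prime_factors (P * L). p < p'"
    and L_largest: "\<forall>p \<in> prime_factors P. \<forall>l \<in> prime_factors L. p < l"
    and rad_poly: "poly_rad (monom 1 m - 1) = g * G * H"
    and monic: "lead_coeff g = 1" "lead_coeff G = 1" "lead_coeff H = 1"
    and g_least: "\<forall>h \<in> monic_irreducible_factors g. \<forall>h' \<in> monic_irreducible_factors (G * H).
                    degree h \<le> degree h'"
    and H_large: "\<forall>h \<in> monic_irreducible_factors G. \<forall>h' \<in> monic_irreducible_factors H.
                    degree h \<le> degree h'"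
    and r: "r = card (prime_factors P)"
    and t: "t = card (prime_factors L)"
    and s: "s = card (monic_irreducible_factors G)"
    and u: "u = card (monic_irreducible_factors H)"
    and \<delta>: "\<delta> = 1 - 2 * (\<Sum>p \<in> prime_factors P. 1 / real p)
                   - (\<Sum>h \<in> monic_irreducible_factors G. 1 / real q ^ degree h)"
    and \<epsilon>\<^sub>1: "\<epsilon>\<^sub>1 = (\<Sum>l \<in> prime_factors L. 1 / real l)"
    and \<epsilon>\<^sub>2: "\<epsilon>\<^sub>2 = (\<Sum>h \<in> monic_irreducible_factors H. 1 / real q ^ degree h)"
    and pos: "\<delta> * (theta_nat k)\<^sup>2 * Theta_poly g - (2 * \<epsilon>\<^sub>1 + \<epsilon>\<^sub>2) > 0"
    and bound: "real q powr (real m / 2 - 1) >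
       (real n + 2) *
         ((theta_nat k)\<^sup>2 * Theta_poly g * (real (W_nat k))\<^sup>2 * real (W_poly g)
              * (2 * real r + real s - 1 + 2 * \<delta>)
           + (real t - \<epsilon>\<^sub>1)
           + 2 / (real n + 2) * (real u - \<epsilon>\<^sub>2)
           + real n / (real n + 2) * (1 / real q powr (real m / 2))
               * (real t + real u - \<epsilon>\<^sub>1 - \<epsilon>\<^sub>2))
       / (\<delta> * (theta_nat k)\<^sup>2 * Theta_poly g - (2 * \<epsilon>\<^sub>1 + \<epsilon>\<^sub>2))"
  shows "(q, m) \<in> T_total TYPE('k) n"
proof -
  obtain p e0 where p: "prime p" "q = p ^ e0" using \<open>primepow q\<close> by (auto simp: primepow_def)
  have char: "CHAR('f) = p" "CHAR('k) = p"
  proof -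
    show "CHAR('f) = p" by (rule CHAR_eqI[where e = e0]) (simp_all only: card_base p)
    show "CHAR('k) = p" by (rule CHAR_eqI[where e = "e0 * m"]) (simp_all only: card_ext p power_mult)
  qed
  obtain \<iota> :: "'f \<Rightarrow> 'k" where "comm_ring_morphism \<iota>"
    using ex_finite_field_embedding[where ?'f = 'f and ?'k = 'k, of m] card_base card_ext char by (simp only:) blast
  \<comment> \<open>The type \<open>'f\<close> is embedded into the extension field, so that the
    factors of \<open>x ^ m - 1\<close> over it act as linearized polynomials there.\<close>
  then interpret field_extension \<iota> e0 q m
    by (intro field_extension.intro field_extension_axioms.intro) (simp_all add: card_base card_ext char p(2))
  have n: "q ^ m - 1 > 0" using N_gt_1 by simp
  note nat = prime_factors_nat_rad_factorization[OF n rad_nat]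
  note poly = monic_irreducible_factors_poly_rad_factorization[OF xm1_nonzero rad_poly[folded xm1_def] monic(1)]
  have g0: "g \<noteq> 0" using monic(1) by auto
  have B0: "finite (monic_irreducible_factors g)" "monic_irreducible_factors g \<subseteq> monic_irreducibles"
    using finite_monic_irreducible_factors[OF g0] by (auto simp: monic_irreducible_factors_altdef)
  define \<Theta> where "\<Theta> = (theta_nat k)\<^sup>2 * Theta_poly g"
  have \<Theta>: "\<Theta> = (\<Prod>l\<in>prime_factors k. 1 - 1 / real l)\<^sup>2 * (\<Prod>Q\<in>monic_irreducible_factors g. 1 - 1 / real q ^ degree Q)"
    using Theta_poly_eq[OF B0] unfolding \<Theta>_def theta_nat_eq[OF nat(1)] poly(1)[symmetric] card_base by simp
  define W where "W = (real (W_nat k))\<^sup>2 * real (W_poly g)"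
  have W: "W = (2 ^ card (prime_factors k))\<^sup>2 * 2 ^ card (monic_irreducible_factors g)"
    by (simp add: W_def W_nat_def W_poly_def)
  have D: "\<delta> * \<Theta> - (2 * \<epsilon>\<^sub>1 + \<epsilon>\<^sub>2) > 0" using pos by (simp add: \<Theta>_def mult.assoc)
  have q: "real q > 0" using q_gt_1 by simp
  have sqrt: "sqrt (real (q ^ m)) = real q powr (real m / 2)"
  proof -
    have "sqrt (real (q ^ m)) = (real q powr real m) powr (1 / 2)"
      using q by (simp add: powr_half_sqrt powr_realpow)
    then show ?thesis by (simp add: powr_powr)
  qed
  have bound': "sqrt (real (q ^ m)) / real q * (\<delta> * \<Theta> - (2 * \<epsilon>\<^sub>1 + \<epsilon>\<^sub>2)) >
      (real n + 2) * (\<Theta> * W * (2 * real (card (prime_factors P)) + real (card (monic_irreducible_factors G)) - 1 + 2 * \<delta>) + (real (card (prime_factors L)) - \<epsilon>\<^sub>1))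
      + 2 * (real (card (monic_irreducible_factors H)) - \<epsilon>\<^sub>2)
      + real n / sqrt (real (q ^ m)) * (real (card (prime_factors L)) + real (card (monic_irreducible_factors H)) - \<epsilon>\<^sub>1 - \<epsilon>\<^sub>2)"
  proof -
    \<comment> \<open>With \<open>c = n + 2\<close>, the fractions \<open>2 / (n + 2)\<close> and
      \<open>n / (n + 2)\<close> of the hypothesis become the coefficients 2 and \<open>n\<close> of
      the sieve inequality.\<close>
    have expand: "c * (A + B + 2 / c * C + x / c * (1 / S) * E) = c * (A + B) + 2 * C + x / S * E"
      if "c > 0" for c A B C x S E :: real
      using that by (simp add: distrib_left)
    have "real q powr (real m / 2 - 1) = sqrt (real (q ^ m)) / real q"
      unfolding sqrt using q by (simp add: powr_diff)
    then have "(real n + 2) * (\<Theta> * W * (2 * real r + real s - 1 + 2 * \<delta>) + (real t - \<epsilon>\<^sub>1)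
        + 2 / (real n + 2) * (real u - \<epsilon>\<^sub>2)
        + real n / (real n + 2) * (1 / sqrt (real (q ^ m))) * (real t + real u - \<epsilon>\<^sub>1 - \<epsilon>\<^sub>2))
      / (\<delta> * \<Theta> - (2 * \<epsilon>\<^sub>1 + \<epsilon>\<^sub>2)) < sqrt (real (q ^ m)) / real q"
      using bound by (simp only: \<Theta>_def W_def sqrt mult.assoc)
    then have "(real n + 2) * (\<Theta> * W * (2 * real r + real s - 1 + 2 * \<delta>) + (real t - \<epsilon>\<^sub>1))
        + 2 * (real u - \<epsilon>\<^sub>2) + real n / sqrt (real (q ^ m)) * (real t + real u - \<epsilon>\<^sub>1 - \<epsilon>\<^sub>2)
      < sqrt (real (q ^ m)) / real q * (\<delta> * \<Theta> - (2 * \<epsilon>\<^sub>1 + \<epsilon>\<^sub>2))"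
      by (subst (asm) pos_divide_less_eq[OF D], subst (asm) expand) simp_all
    then show ?thesis by (simp only: r t s u)
  qed
  have "(q, m) \<in> T_pair TYPE('k) n1 n2" if n12: "n1 + n2 = n" for n1 n2
    unfolding T_pair_def
  proof (intro CollectI case_prodI conjI ballI)
    fix F :: "'k poly fract" and a :: 'k
    assume F: "F \<in> S_set n1 n2" and a: "a \<in> base_field q"
    then obtain f1 f2 where f: "\<not> exceptional F" "reduced_form F f1 f2" "degree f1 \<le> n1" "degree f2 \<le> n2"
      unfolding S_set_def by blast
    then have F_eq: "F = Fract f1 f2" by (simp add: reduced_form_def)
    interpret sieve_setup \<iota> e0 q m f1 f2 n a
      using f a n12 by unfold_locales (auto simp: reduced_form_def)
    obtain \<alpha> where "\<alpha> \<in> dom" "\<And>\<kappa>. \<kappa> \<in> conditions \<Longrightarrow> holds \<kappa> \<alpha>"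
      using sieve[OF nat(2-5) poly(2-5) \<delta> \<epsilon>\<^sub>1 \<epsilon>\<^sub>2 \<Theta> W D bound'] by blast
    then show "\<exists>\<alpha>::'k. normal_element q m \<alpha> \<and> primitive_pair \<alpha> F \<and> field_trace q m (inverse \<alpha>) = a"
      unfolding F_eq using holds_all_conditions by blast
  qed (fact | simp add: card_ext)+
  then show ?thesis unfolding T_total_def by blast
qed

end
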